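(* Let $X=\mathbb R^d$, $d\ge2$, and let $Q,\eta$ be as in the context. Let $K_1,K_2$ be continuous linear operators in the real space $\mathscr H=L^2(X,m)$ which commute with every operator $(M_\psi f)(x)=\psi(x^1)f(x)$, $\psi:\mathbb R\to\mathbb R$ bounded measurable, and satisfy $K_2^*K_2=\mathbf 1+\eta K_1^*K_1$; extend them by linearity to $\mathscr H_{\mathbb C}$. Let $\mathbf A$ be the complex algebra generated by the operators $\mathfrak I^{(k)}_{\sharp_1,\dots,\sharp_k}(h_1,\dots,h_k,v^{(k)})$ on $\mathscr F^{JQ}_{\mathrm{fin}}(L^2(Z,m))$ defined in the context (a representation of the $Q$-CR algebra), and define $\tau(a):=(a\Omega,\Omega)_{\mathscr F^{JQ}(L^2(Z,m))}$, $a\in\mathbf A$. Then $\tau$ is a gauge-invariant quasi-free state on the $Q$-CR algebra $\mathbf A$. The state $\tau$ is completely determined by the self-adjoint positive operator $T:=K_1^*K_1$ in $\mathscr H_{\mathbb C}$ (that is, all functionals $\mathbf S^{(k,n)}$ depend on $K_1,K_2$ only through $T$) and satisfies, for any $g,h\in\mathscr H_{\mathbb C}$ and $v^{(2)}\in L^\infty(\mathbb R^2,\nu^{(2)}_{+,-})$, $$\mathbf S^{(1,1)}(g,h,v^{(2)})=\int_Xg(x)(Th)(x)v^{(2)}(x^1,x^1)\,m(dx),$$ or equivalently $$\mathbf S^{(1,1)}[g,h](s_1,s_2)=\chi_D(s_1,s_2)\int_{\mathbb R^{d-1}}g(s_1,x^2,\dots,x^d)(Th)(s_1,x^2,\dots,x^d)\,dx^2\cdots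 dx^d,$$ where $D=\{(s_1,s_2)\in\mathbb R^2: s_1=s_2\}$ and $\chi_D$ is its indicator function.
   Context: $m$ is the Lebesgue measure on $X=\mathbb R^d$, $d\ge2$; $x^i$ is the $i$-th coordinate of $x$; $\mathscr H=L^2(X,m)$ (real-valued), $\mathscr H_{\mathbb C}=L^2(X\to\mathbb C,m)$. $\Delta=\{(x,y)\in X^2: x^1=y^1\}$. $Q:X^2\to\mathbb C$ is a measurable function depending only on $(x^1,y^1)$ (we also write $Q(s,t)$, $s,t\in\mathbb R$), with $|Q(x,y)|=1$ and $Q(x,y)=\overline{Q(y,x)}$ off $\Delta$, and $Q(x,y)=\eta$ on $\Delta$, where $\eta\in\mathbb R$ is a constant. For $\pi\in S_n$, $Q_\pi(s_1,\dots,s_n)=\prod_{i<j,\ \pi(i)>\pi(j)}Q(s_i,s_j)$. Measures. For signs $\sharp_1,\dots,\sharp_k\in\{+,-\}$ let $\Pi(k,\sharp_1,\dots,\sharp_k)$ be the set of partitions $\theta$ of $\{1,\dots,k\}$ all of whose blocks have at most two elements and such that $\sharp_a\ne\sharp_b$ whenever $\{a,b\}$ is a two-element block. For a non-atomic measure $\mu$ on a space $Y$ and $\theta=\{\theta_1,\dots,\theta_l\}$ with $\min\theta_1<\dots<\min\theta_l$, let $\mu^{(k)}_\theta$ be the pushforward of $\mu^{\otimes l}$ under $Y^l\ni(y_1,\dots,y_l)\mapsto(z_1,\dots,z_k)\in Y^k$, $z_i=y_j$ for $i\in\theta_j$; put $\mu^{(k)}_{\sharp_1,\dots,\sharp_k}=\sum_{\theta\in\Pi(k,\sharp_1,\dots,\sharp_k)}\mu^{(k)}_\theta$.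 For $\mu=m$ this gives $m^{(k)}_{\sharp_1,\dots,\sharp_k}$; for $\mu$ the Lebesgue measure on $\mathbb R$ it gives $\nu^{(k)}_{\sharp_1,\dots,\sharp_k}$ on $\mathbb R^k$. The space $Z$ and the function $JQ$. $Z=X_1\sqcup X_2$ is the disjoint union of two copies $X_1,X_2$ of $X$; $m$ also denotes the measure on $Z$ whose restriction to each copy is $m$, so $L^2(Z\to\mathbb C,m)=\mathscr H_{\mathbb C}\oplus\mathscr H_{\mathbb C}$. $JQ:Z^2\to\mathbb C$ is $JQ(x,y)=Q(x,y)$ if $x,y$ lie in the same copy, and $JQ(x,y)=Q(y,x)$ if they lie in different copies (on the right, points of $Z$ are identified with the corresponding points of $X$). The $JQ$-Fock space and its operator-valued integrals. Write $R=JQ$, $Y=Z$. For $\pi\in S_n$ let $R_\pi(x_1,\dots,x_n)=\prod_{i<j,\ \pi(i)>\pi(j)}R(x_i,x_j)$ and $(P_nf)(x_1,\dots,x_n)=\frac1{n!}\sum_{\pi\in S_n}R_\pi(x_1,\dots,x_n)f(x_{\pi^{-1}(1)},\dots,x_{\pi^{-1}(n)})$; $P_n$ is the orthogonal projection of $L^2(Y^n\to\mathbb C,m^{\otimes n})$ onto the subspace $\mathscr H_n$ of $R$-symmetric functions, i.e. $f(x_1,\dots,x_n)=R(x_i,x_{i+1})f(x_1,\dots,x_{i+1},x_i,\dots,x_n)$ a.e. for all $i$; $\mathscr H_0=\mathbb C$, $P_0=\mathrm{id}$. $\mathscr F^{R}(L^2(Y,m))$ is the Hilbert space of sequences $(f^{(n)})_{n\ge0}$,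 $f^{(n)}\in\mathscr H_n$, with squared norm $\sum_n n!\|f^{(n)}\|^2$; $\Omega=(1,0,0,\dots)$; $\mathscr F^R_{\mathrm{fin}}(L^2(Y,m))$ is the subspace of finite sequences. For signs $\sharp_1,\dots,\sharp_k$, $g_1,\dots,g_k\in L^2(Y\to\mathbb C,m)$ and $\varkappa\in L^\infty(Y^k\to\mathbb C,m^{(k)}_{\sharp_1,\dots,\sharp_k})$, put $\varphi(y_1,\dots,y_k)=g_1(y_1)\cdots g_k(y_k)\varkappa(y_1,\dots,y_k)$ and define the operator $I^{(k)}_{\sharp_1,\dots,\sharp_k}(g_1,\dots,g_k,\varkappa)$ on $f\in\mathscr H_n$ as follows. Start with the word of variables $(t_1,\dots,t_n)$. For $j=k,k-1,\dots,1$ successively: if $\sharp_j=+$, put a new letter $y_j$ at the front of the current word; if $\sharp_j=-$, choose a letter $z$ of the current word, delete it, set $y_j:=z$, and record the factor $\prod_uR(z,u)$ over the letters $u$ preceding $z$ in the current word. A history $c$ is a complete sequence of such choices (none exists if a deletion from an empty word is required). The final word has length $n'$; $(I_cf)(x_1,\dots,x_{n'})$ is the integral, with respect to $m$ in each deleted letter, of $\varphi(y_1,\dots,y_k)f(t_1,\dots,t_n)$ times all recorded factors, where the letters of the final word are set equal to $x_1,\dots,x_{n'}$ in order. Then $I^{(k)}_{\sharp_1,\dots,\sharp_k}(g_1,\dots,g_k,\varkappa)f:=P_{n'}\sum_cI_cf$, extended linearly to $\mathscr F^R_{\mathrm{fin}}$. (For $\varkappa\equiv1$ this is the product of the operators $\int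 g_j\partial^{\sharp_j}$, where $\int g\,\partial^+=a^+(g)$, $a^+(g)f=P_{n+1}(g\otimes f)$, and $\int g\,\partial^-=a^-(\bar g)=(a^+(\bar g))^*$.) The operators $\mathfrak I^{(k)}$. $\mathscr K_1h=(K_1h,0)$, $\mathscr K_2h=(0,K_2h)$; $s(1,+)=-$, $s(2,+)=+$, $s(1,-)=+$, $s(2,-)=-$; $(\mathscr R^{(k)}_{i_1,\dots,i_k}v^{(k)})(x_1,\dots,x_k)=v^{(k)}(x_1^1,\dots,x_k^1)$ on $X_{i_1}\times\dots\times X_{i_k}$ and $0$ otherwise. For $h_1,\dots,h_k\in\mathscr H_{\mathbb C}$ and $v^{(k)}\in L^\infty(\mathbb R^k\to\mathbb C,\nu^{(k)}_{\sharp_1,\dots,\sharp_k})$, $$\mathfrak I^{(k)}_{\sharp_1,\dots,\sharp_k}(h_1,\dots,h_k,v^{(k)}):=\sum_{(i_1,\dots,i_k)\in\{1,2\}^k}I^{(k)}_{s(i_1,\sharp_1),\dots,s(i_k,\sharp_k)}(\mathscr K_{i_1}h_1,\dots,\mathscr K_{i_k}h_k,\mathscr R^{(k)}_{i_1,\dots,i_k}v^{(k)}).$$ States. A state on $\mathbf A$ is a linear functional with $\tau(\mathbf 1)=1$, $\tau(a^*a)\ge0$. Its $n$-point functions are $\mathbf S^{(k,n)}(h_1,\dots,h_{k+n},v^{(k+n)}):=\tau\big(\mathfrak I^{(k+n)}_{\sharp_1,\dots,\sharp_{k+n}}(h_1,\dots,h_{k+n},v^{(k+n)})\big)$ with $\sharp_1=\dots=\sharp_k=+$,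 $\sharp_{k+1}=\dots=\sharp_{k+n}=-$. The state $\tau$ is called gauge-invariant quasi-free if: (i) $\mathbf S^{(k,n)}\equiv0$ for $k\neq n$; (ii) for each $n$ and all $h_1,\dots,h_{2n}\in\mathscr H_{\mathbb C}$ there is a complex-valued measure $\mathbf S^{(n,n)}[h_1,\dots,h_{2n}]$ on $\mathbb R^{2n}$, absolutely continuous with respect to $\nu^{(2n)}_{\sharp_1,\dots,\sharp_{2n}}$ ($\sharp_1=\dots=\sharp_n=+$, $\sharp_{n+1}=\dots=\sharp_{2n}=-$), with $\mathbf S^{(n,n)}(h_1,\dots,h_{2n},v^{(2n)})=\int_{\mathbb R^{2n}}v^{(2n)}\,d\mathbf S^{(n,n)}[h_1,\dots,h_{2n}]$ for all $v^{(2n)}\in L^\infty(\mathbb R^{2n},\nu^{(2n)}_{\sharp_1,\dots,\sharp_{2n}})$; its density with respect to $\nu^{(2n)}_{\sharp_1,\dots,\sharp_{2n}}$ is written $\mathbf S^{(n,n)}[h_1,\dots,h_{2n}](s_1,\dots,s_{2n})$; (iii) for all $n$ and $g_1,\dots,g_n,h_1,\dots,h_n\in\mathscr H_{\mathbb C}$, $\nu^{(2n)}_{\sharp_1,\dots,\sharp_{2n}}$-a.e., $$\mathbf S^{(n,n)}[g_n,\dots,g_1,h_1,\dots,h_n](s_n,\dots,s_1,s_{n+1},\dots,s_{2n})=\sum_{\pi\in S_n}\Big(\prod_{i=1}^n\mathbf S^{(1,1)}[g_i,h_{\pi(i)}](s_i,s_{n+\pi(i)})\Big)Q_\pi(s_1,\dots,s_n).$$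 *)

theory Defs
  imports "HOL-Analysis.Analysis" "HOL-Combinatorics.Permutations" "HOL-Library.Disjoint_Sets"
begin

text \<open>
  Elements of L2 and L-infinity spaces are represented by functions; identities between
  them, and between operators acting on them, are stated almost everywhere.
  A tuple in a cartesian power is an extensional function on the index set
  \<open>{..<n}\<close>, so the \<open>i\<close>-th entry in one-based counting is the value at \<open>i - 1\<close>;
  lists are used for tuples of signs and of L2 functions.
\<close>

definition L2 :: "'x measure \<Rightarrow> ('x \<Rightarrow> 'b::{real_normed_field, second_countable_topology, banach}) set"
  where "L2 M = {f \<in> borel_measurable M. integrable M (\<lambda>x. (norm (f x))\<^sup>2)}"

definition Linf :: "'x measure \<Rightarrow> ('x \<Rightarrow> complex) set"
  where "Linf M = {v \<in> borel_measurable M. \<exists>C. AE x in M. norm (v x) \<le> C}"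

definition L2_operator ::
  "'x measure \<Rightarrow> (('x \<Rightarrow> 'b::{real_normed_field, second_countable_topology, banach}) \<Rightarrow> 'x \<Rightarrow> 'b) \<Rightarrow> bool"
  where "L2_operator M K \<longleftrightarrow>
    (\<forall>f\<in>L2 M. K f \<in> L2 M) \<and>
    (\<forall>f\<in>L2 M. \<forall>g\<in>L2 M. (AE x in M. f x = g x) \<longrightarrow> (AE x in M. K f x = K g x)) \<and>
    (\<forall>f\<in>L2 M. \<forall>g\<in>L2 M. AE x in M. K (\<lambda>y. f y + g y) x = K f x + K g x) \<and>
    (\<forall>c. \<forall>f\<in>L2 M. AE x in M. K (\<lambda>y. c * f y) x = c * K f x) \<and>
    (\<exists>C\<ge>0. \<forall>f\<in>L2 M. sqrt (LINT x|M. (norm (K f x))\<^sup>2) \<le> C * sqrt (LINT x|M. (norm (f x))\<^sup>2))"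

definition L2_adjoint ::
  "'x measure \<Rightarrow> (('x \<Rightarrow> real) \<Rightarrow> 'x \<Rightarrow> real) \<Rightarrow> (('x \<Rightarrow> real) \<Rightarrow> 'x \<Rightarrow> real) \<Rightarrow> bool"
  where "L2_adjoint M K K' \<longleftrightarrow> L2_operator M K' \<and>
    (\<forall>f\<in>L2 M. \<forall>g\<in>L2 M. (LINT x|M. K f x * g x) = (LINT x|M. f x * K' g x))"

definition L2_selfadjoint_positive :: "'x measure \<Rightarrow> (('x \<Rightarrow> complex) \<Rightarrow> 'x \<Rightarrow> complex) \<Rightarrow> bool"
  where "L2_selfadjoint_positive M T \<longleftrightarrow> L2_operator M T \<and>
    (\<forall>f\<in>L2 M. \<forall>g\<in>L2 M. (LINT x|M. T f x * cnj (g x)) = (LINT x|M. f x * cnj (T g x))) \<and>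
    (\<forall>f\<in>L2 M. (LINT x|M. T f x * cnj (f x)) \<in> \<real>\<^sub>\<ge>\<^sub>0)"

definition cext :: "(('x \<Rightarrow> real) \<Rightarrow> 'x \<Rightarrow> real) \<Rightarrow> ('x \<Rightarrow> complex) \<Rightarrow> 'x \<Rightarrow> complex"
  where "cext K h = (\<lambda>x. Complex (K (\<lambda>y. Re (h y)) x) (K (\<lambda>y. Im (h y)) x))"


subsection \<open>Measures attached to pair partitions\<close>

datatype sign = Plus | Minus

definition sign_partitions :: "sign list \<Rightarrow> nat set set set"
  where "sign_partitions ss = {\<theta>. partition_on {..<length ss} \<theta> \<and>
    (\<forall>B\<in>\<theta>. card B \<le> 2) \<and>
    (\<forall>a b. a \<noteq> b \<longrightarrow> {a, b} \<in> \<theta> \<longrightarrow> ss ! a \<noteq> ss ! b)}"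

text \<open>
  The factors of the product are indexed by the blocks themselves; numbering the blocks
  in the order of their minima would only rename the coordinates of the product.
\<close>

definition partition_measure :: "'x measure \<Rightarrow> nat \<Rightarrow> nat set set \<Rightarrow> (nat \<Rightarrow> 'x) measure"
  where "partition_measure M k \<theta> =
    distr (PiM \<theta> (\<lambda>_. M)) (PiM {..<k} (\<lambda>_. M))
      (\<lambda>y. \<lambda>i\<in>{..<k}. y (THE B. B \<in> \<theta> \<and> i \<in> B))"

definition sign_measure :: "'x measure \<Rightarrow> sign list \<Rightarrow> (nat \<Rightarrow> 'x) measure"
  where "sign_measure M ss =
    measure_of (space (PiM {..<length ss} (\<lambda>_. M))) (sets (PiM {..<length ss} (\<lambda>_. M)))
      (\<lambda>A. \<Sum>\<theta>\<in>sign_partitions ss. emeasure (partition_measure M (length ss) \<theta>) A)"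

abbreviation nu :: "sign list \<Rightarrow> (nat \<Rightarrow> real) measure"
  where "nu \<equiv> sign_measure lborel"


subsection \<open>Complex measures\<close>

definition complex_measure :: "'x measure \<Rightarrow> ('x set \<Rightarrow> complex) \<Rightarrow> bool"
  where "complex_measure N \<mu> \<longleftrightarrow> \<mu> {} = 0 \<and>
    (\<forall>A::nat \<Rightarrow> 'x set. range A \<subseteq> sets N \<longrightarrow> disjoint_family A \<longrightarrow>
      (\<lambda>i. \<mu> (A i)) sums \<mu> (\<Union>i. A i))"

definition cmeasure_abs_continuous :: "'x measure \<Rightarrow> ('x set \<Rightarrow> complex) \<Rightarrow> bool"
  where "cmeasure_abs_continuous N \<mu> \<longleftrightarrow> (\<forall>A\<in>null_sets N. \<mu> A = 0)"

text \<open>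
  The integral is taken along a decomposition of the complex measure into four finite
  measures; by additivity its value does not depend on the decomposition.
\<close>

definition has_cmeasure_integral ::
  "'x measure \<Rightarrow> ('x set \<Rightarrow> complex) \<Rightarrow> ('x \<Rightarrow> complex) \<Rightarrow> complex \<Rightarrow> bool"
  where "has_cmeasure_integral N \<mu> v I \<longleftrightarrow> (\<exists>P1 P2 P3 P4.
    (\<forall>P\<in>{P1, P2, P3, P4}. finite_measure P \<and> sets P = sets N \<and> integrable P v) \<and>
    (\<forall>A\<in>sets N. \<mu> A = Complex (measure P1 A - measure P2 A) (measure P3 A - measure P4 A)) \<and>
    I = (LINT x|P1. v x) - (LINT x|P2. v x) + \<i> * ((LINT x|P3. v x) - (LINT x|P4. v x)))"

definition cmeasure_density :: "'x measure \<Rightarrow> ('x set \<Rightarrow> complex) \<Rightarrow> ('x \<Rightarrow> complex) \<Rightarrow> bool"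
  where "cmeasure_density N \<mu> \<rho> \<longleftrightarrow> integrable N \<rho> \<and>
    (\<forall>A\<in>sets N. \<mu> A = (LINT x:A|N. \<rho> x))"


subsection \<open>The Fock space of symmetric functions\<close>

type_synonym 'y fock = "nat \<Rightarrow> (nat \<Rightarrow> 'y) \<Rightarrow> complex"
type_synonym 'y fock_op = "'y fock \<Rightarrow> 'y fock"

abbreviation power_measure :: "'y measure \<Rightarrow> nat \<Rightarrow> (nat \<Rightarrow> 'y) measure"
  where "power_measure M n \<equiv> PiM {..<n} (\<lambda>_. M)"

definition perm_phase :: "('y \<Rightarrow> 'y \<Rightarrow> complex) \<Rightarrow> nat \<Rightarrow> (nat \<Rightarrow> nat) \<Rightarrow> (nat \<Rightarrow> 'y) \<Rightarrow> complex"
  where "perm_phase R n \<pi> x = (\<Prod>(i, j)\<in>{(i, j). i < j \<and> j < n \<and> \<pi> i > \<pi> j}. R (x i) (x j))"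

definition sym_proj ::
  "('y \<Rightarrow> 'y \<Rightarrow> complex) \<Rightarrow> nat \<Rightarrow> ((nat \<Rightarrow> 'y) \<Rightarrow> complex) \<Rightarrow> (nat \<Rightarrow> 'y) \<Rightarrow> complex"
  where "sym_proj R n f x =
    (\<Sum>\<pi> | \<pi> permutes {..<n}. perm_phase R n \<pi> x * f (x \<circ> inv \<pi>)) / of_nat (fact n)"

definition sym_L2 ::
  "'y measure \<Rightarrow> ('y \<Rightarrow> 'y \<Rightarrow> complex) \<Rightarrow> nat \<Rightarrow> ((nat \<Rightarrow> 'y) \<Rightarrow> complex) set"
  where "sym_L2 M R n = {f \<in> L2 (power_measure M n). \<forall>i. Suc i < n \<longrightarrow>
    (AE x in power_measure M n.
      f x = R (x i) (x (Suc i)) * f (x(i := x (Suc i), Suc i := x i)))}"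

definition fock_eq :: "'y measure \<Rightarrow> 'y fock \<Rightarrow> 'y fock \<Rightarrow> bool"
  where "fock_eq M f g \<longleftrightarrow> (\<forall>n. AE x in power_measure M n. f n x = g n x)"

definition fock_fin :: "'y measure \<Rightarrow> ('y \<Rightarrow> 'y \<Rightarrow> complex) \<Rightarrow> 'y fock set"
  where "fock_fin M R = {f. (\<forall>n. f n \<in> sym_L2 M R n) \<and>
    (\<exists>N. \<forall>n\<ge>N. AE x in power_measure M n. f n x = 0)}"

definition fock_inner :: "'y measure \<Rightarrow> 'y fock \<Rightarrow> 'y fock \<Rightarrow> complex"
  where "fock_inner M f g = (\<Sum>n. of_nat (fact n) * (LINT x|power_measure M n. f n x * cnj (g n x)))"

definition vacuum :: "'y fock"
  where "vacuum = (\<lambda>n x. if n = 0 then 1 else 0)"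


subsection \<open>Operator-valued integrals\<close>

text \<open>
  \<open>Arg i\<close> stands for the variable \<open>t\<close> number \<open>i + 1\<close> of the function acted upon,
  \<open>New j\<close> for the letter created in the step treating the variable \<open>y\<close> number \<open>j + 1\<close>.
  A history is kept as the quadruple (current word, letter which \<open>y\<close> is set equal to,
  recorded pairs \<open>(z, u)\<close> for the factors \<open>R(z, u)\<close>, deleted letters).
\<close>

datatype letter = Arg nat | New nat

type_synonym history = "letter list \<times> (nat \<Rightarrow> letter) \<times> (letter \<times> letter) list \<times> letter list"

fun history_step :: "sign \<Rightarrow> nat \<Rightarrow> history \<Rightarrow> history list"
  where
    "history_step Plus j (w, a, F, D) = [(New j # w, a(j := New j), F, D)]"
  | "history_step Minus j (w, a, F, D) =
      map (\<lambda>p. (take p w @ drop (Suc p) w, a(j := w ! p),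
                map (\<lambda>u. (w ! p, u)) (take p w) @ F, w ! p # D)) [0..<length w]"

text \<open>The list of signs starts at position \<open>j\<close>; its last sign is treated first.\<close>

primrec histories_from :: "nat \<Rightarrow> nat \<Rightarrow> sign list \<Rightarrow> history list"
  where
    "histories_from n j [] = [(map Arg [0..<n], New, [], [])]"
  | "histories_from n j (s # ss) = concat (map (history_step s j) (histories_from n (Suc j) ss))"

definition histories :: "nat \<Rightarrow> sign list \<Rightarrow> history list"
  where "histories n ss = histories_from n 0 ss"

definition letter_value :: "letter list \<Rightarrow> letter list \<Rightarrow> (nat \<Rightarrow> 'y) \<Rightarrow> (letter \<Rightarrow> 'y) \<Rightarrow> letter \<Rightarrow> 'y"
  where "letter_value w D x z l = (if l \<in> set D then z l else x (LEAST i. i < length w \<and> w ! i = l))"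

fun history_integral ::
  "'y measure \<Rightarrow> ('y \<Rightarrow> 'y \<Rightarrow> complex) \<Rightarrow> nat \<Rightarrow> ((nat \<Rightarrow> 'y) \<Rightarrow> complex) \<Rightarrow>
    nat \<Rightarrow> ((nat \<Rightarrow> 'y) \<Rightarrow> complex) \<Rightarrow> history \<Rightarrow> (nat \<Rightarrow> 'y) \<Rightarrow> complex"
  where
    "history_integral M R k \<phi> n f (w, a, F, D) x =
      (LINT z|PiM (set D) (\<lambda>_. M).
        (let e = letter_value w D x z
         in \<phi> (\<lambda>j\<in>{..<k}. e (a j)) * f (\<lambda>i\<in>{..<n}. e (Arg i)) *
            (\<Prod>(l, u)\<leftarrow>F. R (e l) (e u))))"

text \<open>
  A history starting from a word of length \<open>n\<close> ends with a word of length \<open>n'\<close>, where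
  \<open>n\<close> plus the number of creations equals \<open>n'\<close> plus the number of deletions.
\<close>

definition op_integral ::
  "'y measure \<Rightarrow> ('y \<Rightarrow> 'y \<Rightarrow> complex) \<Rightarrow> sign list \<Rightarrow> ('y \<Rightarrow> complex) list \<Rightarrow>
    ((nat \<Rightarrow> 'y) \<Rightarrow> complex) \<Rightarrow> 'y fock_op"
  where "op_integral M R ss gs \<kappa> f n' x =
    (\<Sum>n | n + count_list ss Plus = n' + count_list ss Minus.
      sym_proj R n' (\<lambda>x'. \<Sum>c\<leftarrow>histories n ss.
        history_integral M R (length ss)
          (\<lambda>y. (\<Prod>j<length ss. (gs ! j) (y j)) * \<kappa> y) n (f n) c x') x)"


subsection \<open>Algebras of operators and states\<close>

definition fock_operator :: "'y measure \<Rightarrow> ('y \<Rightarrow> 'y \<Rightarrow> complex) \<Rightarrow> 'y fock_op \<Rightarrow> bool"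
  where "fock_operator M R a \<longleftrightarrow>
    (\<forall>f\<in>fock_fin M R. a f \<in> fock_fin M R) \<and>
    (\<forall>f\<in>fock_fin M R. \<forall>g\<in>fock_fin M R. fock_eq M f g \<longrightarrow> fock_eq M (a f) (a g)) \<and>
    (\<forall>f\<in>fock_fin M R. \<forall>g\<in>fock_fin M R.
      fock_eq M (a (\<lambda>n x. f n x + g n x)) (\<lambda>n x. a f n x + a g n x)) \<and>
    (\<forall>c. \<forall>f\<in>fock_fin M R. fock_eq M (a (\<lambda>n x. c * f n x)) (\<lambda>n x. c * a f n x))"

definition fock_adjoint ::
  "'y measure \<Rightarrow> ('y \<Rightarrow> 'y \<Rightarrow> complex) \<Rightarrow> 'y fock_op \<Rightarrow> 'y fock_op \<Rightarrow> bool"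
  where "fock_adjoint M R a b \<longleftrightarrow>
    (\<forall>f\<in>fock_fin M R. \<forall>g\<in>fock_fin M R. fock_inner M (a f) g = fock_inner M f (b g))"

inductive_set generated_algebra :: "'y fock_op set \<Rightarrow> 'y fock_op set" for G
  where
    gen: "a \<in> G \<Longrightarrow> a \<in> generated_algebra G"
  | one: "(\<lambda>f. f) \<in> generated_algebra G"
  | add: "a \<in> generated_algebra G \<Longrightarrow> b \<in> generated_algebra G \<Longrightarrow>
      (\<lambda>f n x. a f n x + b f n x) \<in> generated_algebra G"
  | scale: "a \<in> generated_algebra G \<Longrightarrow> (\<lambda>f n x. c * a f n x) \<in> generated_algebra G"
  | mult: "a \<in> generated_algebra G \<Longrightarrow> b \<in> generated_algebra G \<Longrightarrow>
      (\<lambda>f. a (b f)) \<in> generated_algebra G"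

text \<open>
  The first conjunct says that the functional depends only on the operator on the space of
  finite vectors; the second one that the involution of the algebra is defined.
\<close>

definition state_on ::
  "'y measure \<Rightarrow> ('y \<Rightarrow> 'y \<Rightarrow> complex) \<Rightarrow> 'y fock_op set \<Rightarrow> ('y fock_op \<Rightarrow> complex) \<Rightarrow> bool"
  where "state_on M R A \<tau> \<longleftrightarrow>
    (\<forall>a\<in>A. \<forall>b\<in>A. (\<forall>f\<in>fock_fin M R. fock_eq M (a f) (b f)) \<longrightarrow> \<tau> a = \<tau> b) \<and>
    (\<forall>a\<in>A. \<exists>b\<in>A. fock_adjoint M R a b) \<and>
    (\<forall>a\<in>A. \<forall>b\<in>A. \<tau> (\<lambda>f n x. a f n x + b f n x) = \<tau> a + \<tau> b) \<and>
    (\<forall>c. \<forall>a\<in>A. \<tau> (\<lambda>f n x. c * a f n x) = c * \<tau> a) \<and>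
    \<tau> (\<lambda>f. f) = 1 \<and>
    (\<forall>a\<in>A. \<forall>b\<in>A. fock_adjoint M R a b \<longrightarrow> \<tau> (\<lambda>f. b (a f)) \<in> \<real>\<^sub>\<ge>\<^sub>0)"

definition vacuum_state :: "'y measure \<Rightarrow> 'y fock_op \<Rightarrow> complex"
  where "vacuum_state M a = fock_inner M (a vacuum) vacuum"


subsection \<open>The doubled space and the representation\<close>

text \<open>
  The \<open>d\<close>-dimensional space is \<open>real \<times> (real ^ 'n)\<close> with \<open>d = 1 + CARD('n)\<close>, which is
  at least 2; the first coordinate of \<open>x\<close> is \<open>fst x\<close>.
\<close>

type_synonym 'n space = "real \<times> (real ^ 'n)"

datatype copy = Copy1 | Copy2

instance copy :: finite
proof
  show "finite (UNIV :: copy set)"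
    by (rule finite_subset[of _ "{Copy1, Copy2}"]) (use copy.exhaust in blast, simp)
qed

definition Z_measure :: "(copy \<times> 'n::finite space) measure"
  where "Z_measure = count_space UNIV \<Otimes>\<^sub>M lborel"

definition JQ ::
  "(real \<Rightarrow> real \<Rightarrow> complex) \<Rightarrow> copy \<times> 'n space \<Rightarrow> copy \<times> 'n space \<Rightarrow> complex"
  where "JQ Q p q =
    (if fst p = fst q then Q (fst (snd p)) (fst (snd q)) else Q (fst (snd q)) (fst (snd p)))"

fun rep_sign :: "copy \<Rightarrow> sign \<Rightarrow> sign"
  where
    "rep_sign Copy1 Plus = Minus"
  | "rep_sign Copy2 Plus = Plus"
  | "rep_sign Copy1 Minus = Plus"
  | "rep_sign Copy2 Minus = Minus"

definition rep_fun ::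
  "(('n space \<Rightarrow> real) \<Rightarrow> 'n space \<Rightarrow> real) \<Rightarrow> (('n space \<Rightarrow> real) \<Rightarrow> 'n space \<Rightarrow> real) \<Rightarrow>
    copy \<Rightarrow> ('n space \<Rightarrow> complex) \<Rightarrow> copy \<times> 'n space \<Rightarrow> complex"
  where "rep_fun K1 K2 i h p =
    (if fst p = i then cext (case i of Copy1 \<Rightarrow> K1 | Copy2 \<Rightarrow> K2) h (snd p) else 0)"

definition rep_kernel ::
  "copy list \<Rightarrow> ((nat \<Rightarrow> real) \<Rightarrow> complex) \<Rightarrow> (nat \<Rightarrow> copy \<times> 'n space) \<Rightarrow> complex"
  where "rep_kernel is v p =
    (if \<forall>j<length is. fst (p j) = is ! j then v (\<lambda>j\<in>{..<length is}. fst (snd (p j))) else 0)"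

definition rep_integral ::
  "(real \<Rightarrow> real \<Rightarrow> complex) \<Rightarrow>
    (('n::finite space \<Rightarrow> real) \<Rightarrow> 'n space \<Rightarrow> real) \<Rightarrow> (('n space \<Rightarrow> real) \<Rightarrow> 'n space \<Rightarrow> real) \<Rightarrow>
    sign list \<Rightarrow> ('n space \<Rightarrow> complex) list \<Rightarrow> ((nat \<Rightarrow> real) \<Rightarrow> complex) \<Rightarrow> (copy \<times> 'n space) fock_op"
  where "rep_integral Q K1 K2 ss hs v f n x =
    (\<Sum>is | length is = length ss.
      op_integral Z_measure (JQ Q) (map2 rep_sign is ss) (map2 (rep_fun K1 K2) is hs)
        (rep_kernel is v) f n x)"

definition rep_algebra ::
  "(real \<Rightarrow> real \<Rightarrow> complex) \<Rightarrow>
    (('n::finite space \<Rightarrow> real) \<Rightarrow> 'n space \<Rightarrow> real) \<Rightarrow> (('n space \<Rightarrow> real) \<Rightarrow> 'n space \<Rightarrow> real) \<Rightarrow>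
    (copy \<times> 'n space) fock_op set"
  where "rep_algebra Q K1 K2 = generated_algebra
    {rep_integral Q K1 K2 ss hs v | ss hs v.
      length hs = length ss \<and> set hs \<subseteq> L2 lborel \<and> v \<in> Linf (nu ss)}"

text \<open>\<open>K1'\<close> and \<open>K2'\<close> are the adjoints of \<open>K1\<close> and \<open>K2\<close>.\<close>

definition admissible_operators ::
  "real \<Rightarrow>
    (('n::finite space \<Rightarrow> real) \<Rightarrow> 'n space \<Rightarrow> real) \<Rightarrow> (('n space \<Rightarrow> real) \<Rightarrow> 'n space \<Rightarrow> real) \<Rightarrow>
    (('n space \<Rightarrow> real) \<Rightarrow> 'n space \<Rightarrow> real) \<Rightarrow> (('n space \<Rightarrow> real) \<Rightarrow> 'n space \<Rightarrow> real) \<Rightarrow> bool"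
  where "admissible_operators \<eta> K1 K1' K2 K2' \<longleftrightarrow>
    L2_operator lborel K1 \<and> L2_adjoint lborel K1 K1' \<and>
    L2_operator lborel K2 \<and> L2_adjoint lborel K2 K2' \<and>
    (\<forall>K\<in>{K1, K2}. \<forall>\<psi>::real \<Rightarrow> real. \<psi> \<in> borel_measurable borel \<longrightarrow> bounded (range \<psi>) \<longrightarrow>
      (\<forall>f\<in>L2 lborel. AE x in lborel. K (\<lambda>y. \<psi> (fst y) * f y) x = \<psi> (fst x) * K f x)) \<and>
    (\<forall>f\<in>L2 lborel. AE x in lborel. K2' (K2 f) x = f x + \<eta> * K1' (K1 f) x)"


subsection \<open>Gauge-invariant quasi-free states\<close>

definition npoint ::
  "('op \<Rightarrow> complex) \<Rightarrow> (sign list \<Rightarrow> ('x \<Rightarrow> complex) list \<Rightarrow> ((nat \<Rightarrow> real) \<Rightarrow> complex) \<Rightarrow> 'op) \<Rightarrow>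
    nat \<Rightarrow> nat \<Rightarrow> ('x \<Rightarrow> complex) list \<Rightarrow> ((nat \<Rightarrow> real) \<Rightarrow> complex) \<Rightarrow> complex"
  where "npoint \<tau> J k n hs v = \<tau> (J (replicate k Plus @ replicate n Minus) hs v)"

abbreviation nu2 :: "nat \<Rightarrow> (nat \<Rightarrow> real) measure"
  where "nu2 n \<equiv> nu (replicate n Plus @ replicate n Minus)"

definition npoint_measure ::
  "('op \<Rightarrow> complex) \<Rightarrow> (sign list \<Rightarrow> ('x \<Rightarrow> complex) list \<Rightarrow> ((nat \<Rightarrow> real) \<Rightarrow> complex) \<Rightarrow> 'op) \<Rightarrow>
    nat \<Rightarrow> ('x \<Rightarrow> complex) list \<Rightarrow> ((nat \<Rightarrow> real) set \<Rightarrow> complex) \<Rightarrow> bool"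
  where "npoint_measure \<tau> J n hs \<mu> \<longleftrightarrow>
    complex_measure (nu2 n) \<mu> \<and> cmeasure_abs_continuous (nu2 n) \<mu> \<and>
    (\<forall>v\<in>Linf (nu2 n). has_cmeasure_integral (nu2 n) \<mu> v (npoint \<tau> J n n hs v))"

definition npoint_density ::
  "('op \<Rightarrow> complex) \<Rightarrow> (sign list \<Rightarrow> ('x \<Rightarrow> complex) list \<Rightarrow> ((nat \<Rightarrow> real) \<Rightarrow> complex) \<Rightarrow> 'op) \<Rightarrow>
    nat \<Rightarrow> ('x \<Rightarrow> complex) list \<Rightarrow> ((nat \<Rightarrow> real) \<Rightarrow> complex) \<Rightarrow> bool"
  where "npoint_density \<tau> J n hs \<rho> \<longleftrightarrow>
    (\<exists>\<mu>. npoint_measure \<tau> J n hs \<mu> \<and> cmeasure_density (nu2 n) \<mu> \<rho>)"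

definition pair_point :: "'x \<Rightarrow> 'x \<Rightarrow> nat \<Rightarrow> 'x"
  where "pair_point s t = (\<lambda>i\<in>{..<2}. if i = 0 then s else t)"

definition gauge_invariant_quasi_free ::
  "(real \<Rightarrow> real \<Rightarrow> complex) \<Rightarrow> 'x measure \<Rightarrow> ('op \<Rightarrow> complex) \<Rightarrow>
    (sign list \<Rightarrow> ('x \<Rightarrow> complex) list \<Rightarrow> ((nat \<Rightarrow> real) \<Rightarrow> complex) \<Rightarrow> 'op) \<Rightarrow> bool"
  where "gauge_invariant_quasi_free Q M \<tau> J \<longleftrightarrow>
    (\<forall>k n hs v. k \<noteq> n \<longrightarrow> length hs = k + n \<longrightarrow> set hs \<subseteq> L2 M \<longrightarrow>
      v \<in> Linf (nu (replicate k Plus @ replicate n Minus)) \<longrightarrow> npoint \<tau> J k n hs v = 0) \<and>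
    (\<forall>n hs. length hs = 2 * n \<longrightarrow> set hs \<subseteq> L2 M \<longrightarrow>
      (\<exists>\<mu> \<rho>. npoint_measure \<tau> J n hs \<mu> \<and> cmeasure_density (nu2 n) \<mu> \<rho>)) \<and>
    (\<forall>n gs hs \<rho> \<sigma>. length gs = n \<longrightarrow> length hs = n \<longrightarrow> set gs \<subseteq> L2 M \<longrightarrow> set hs \<subseteq> L2 M \<longrightarrow>
      npoint_density \<tau> J n (rev gs @ hs) \<rho> \<longrightarrow>
      (\<forall>i<n. \<forall>j<n. npoint_density \<tau> J 1 [gs ! i, hs ! j] (\<sigma> i j)) \<longrightarrow>
      (AE s in nu2 n.
        \<rho> (\<lambda>i\<in>{..<2 * n}. if i < n then s (n - 1 - i) else s i) =
        (\<Sum>\<pi> | \<pi> permutes {..<n}.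
          (\<Prod>i<n. \<sigma> i (\<pi> i) (pair_point (s i) (s (n + \<pi> i)))) * perm_phase Q n \<pi> s)))"

end

theory Submission
  imports Defs
begin

text \<open>
  An operator-valued integral is a sum over histories, and a history is determined by the matching of
  every deletion with the letter it deletes. Integrated against a symmetric function, a history followed
  by a permutation of the final word becomes a matching diagram on a line of signs, in which every
  crossing of two arcs contributes one factor \<open>R\<close>; composing histories with permutations gives every
  diagram exactly once. Because \<open>R(y, x)\<close> is the conjugate of \<open>R(x, y)\<close>, reflecting the line
  turns the sum over diagrams into its conjugate, so that the integral with reversed arguments and flipped
  signs is the adjoint operator. This makes the vacuum functional a state.

  In an \<open>n\<close>-point function with \<open>k\<close> creations to the left of \<open>n\<close> annihilations, the copy \<open>X\<^sub>2\<close> would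
  annihilate the vacuum on one of the two sides, so only \<open>X\<^sub>1\<close>, where the signs are exchanged, contributes.
  All diagrams are then perfect matchings of the two groups, that is, permutations. Since \<open>K\<^sub>1\<close> commutes
  with functions of the first coordinate, integrating out the other coordinates replaces \<open>K\<^sub>1 g \<cdot> K\<^sub>1 h\<close> by the
  fibre integral of \<open>g \<cdot> T h\<close>. The permutations live on different diagonals of \<open>\<real>\<^sup>2\<^sup>n\<close>, which meet in
  null sets, and this identifies the density of the \<open>n\<close>-point function.
\<close>

section \<open>Product measures\<close>

text \<open>All functions are known only almost everywhere, yet a contraction evaluates the kernel
  on a diagonal, a Lebesgue null set. The evaluation makes sense because \<open>sign_measure\<close>
  charges the diagonals that pair opposite signs, and a contraction always joins a creation to an
  annihilation; so each kernel is essentially bounded along every contraction that occurs. Passing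
  from \<open>X\<close> to its first coordinate does not preserve measure; only null sets can be
  carried along it.

  Convergence rests on Cauchy-Schwarz: each deleted letter is seen by exactly one annihilation
  function, so these functions form a square-integrable factor in the deleted letters alone, while
  the creation functions and the argument form one in all letters.

  Adjoints are found inside scalar products, where the weight \<open>n!\<close> cancels the
  normalization of the symmetrizer and its permutations become further arcs. On the line the outer
  left block is read backwards: then the identity is a nested family of arcs and every inversion is
  a crossing.\<close>

lemma product_sigma_finite_const:
  "sigma_finite_measure M \<Longrightarrow> product_sigma_finite (\<lambda>_. M)"
  by (simp add: product_sigma_finite_def)

text \<open>The main map in view is the projection to the first coordinate, whose image of Lebesgue
  measure takes only the values zero and infinity. Hence the hypothesis is absolute continuity and
  not preservation of measure.\<close>

lemma AE_nonsingular:
  assumes "absolutely_continuous N (distr M N p)" "p \<in> M \<rightarrow>\<^sub>M N" "AE y in N. P y"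
  shows "AE x in M. P (p x)"
proof -
  from assms(3) obtain A where A: "A \<in> null_sets N" "{y \<in> space N. \<not> P y} \<subseteq> A"
    by (auto simp: eventually_ae_filter)
  have "A \<in> null_sets (distr M N p)"
    using assms(1) A(1) by (auto simp: absolutely_continuous_def)
  then have "p -` A \<inter> space M \<in> null_sets M"
    using assms(2) null_sets_distr_iff by blast
  moreover have "{x \<in> space M. \<not> P (p x)} \<subseteq> p -` A \<inter> space M"
    using A(2) measurable_space[OF assms(2)] by auto
  ultimately show ?thesis by (rule AE_I')
qed

text \<open>Fubini peels off one coordinate at a time: almost every section of a null set is null,
  nonsingularity of \<open>p\<close> turns almost every value \<open>p y\<close> into almost every
  \<open>y\<close>, and the section is handled by induction. Coordinates of \<open>L\<close> outside
  the image of \<open>q\<close> are spectators, so \<open>L\<close> varies in the induction.\<close>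

lemma nn_integral_PiM_pullback_eq_0:
  fixes M :: "'a measure" and N :: "'b measure"
  assumes M: "sigma_finite_measure M" and N: "sigma_finite_measure N"
    and p: "absolutely_continuous N (distr M N p)" and p_meas[measurable]: "p \<in> M \<rightarrow>\<^sub>M N"
    and fin: "finite I"
  shows "finite L \<Longrightarrow> inj_on q I \<Longrightarrow> q ` I \<subseteq> L \<Longrightarrow> A \<in> null_sets (PiM I (\<lambda>_. N)) \<Longrightarrow>
    (\<integral>\<^sup>+e. indicator A (\<lambda>i\<in>I. p (e (q i))) \<partial>PiM L (\<lambda>_. M)) = 0"
  using fin
proof (induction I arbitrary: L A)
  case empty
  have "A \<in> sets (PiM {} (\<lambda>_. N))" "emeasure (PiM {} (\<lambda>_. N)) A = 0"
    using empty by auto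
  then have "A = {}"
    by (auto simp: PiM_empty emeasure_count_space split: if_splits)
  then show ?case by simp
next
  case (insert i I)
  interpret M: product_sigma_finite "\<lambda>_. M" by (rule product_sigma_finite_const[OF M])
  interpret N: product_sigma_finite "\<lambda>_. N" by (rule product_sigma_finite_const[OF N])
  let ?l = "q i" and ?L = "L - {q i}"
  have L: "L = insert ?l ?L" "finite ?L" "?l \<notin> ?L" using insert.prems by auto
  have q: "inj_on q I" "q ` I \<subseteq> ?L" using insert by (auto simp: inj_on_def)
  have A[measurable]: "A \<in> sets (PiM (insert i I) (\<lambda>_. N))" using insert.prems by auto

  define g where "g e = (indicator A (\<lambda>j\<in>insert i I. p (e (q j))) :: ennreal)" for e
  have pe[measurable]: "(\<lambda>e. \<lambda>j\<in>insert i I. p (e (q j))) \<in> PiM L (\<lambda>_. M) \<rightarrow>\<^sub>M PiM (insert i I) (\<lambda>_. N)"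
    using insert.prems(3) by (intro measurable_restrict measurable_compose[OF _ p_meas]
      measurable_component_singleton) auto
  have g[measurable]: "g \<in> borel_measurable (PiM L (\<lambda>_. M))"
    unfolding g_def by measurable
  have "0 = (\<integral>\<^sup>+s. indicator A s \<partial>PiM (insert i I) (\<lambda>_. N))"
    using insert.prems(4) by auto
  also have "\<dots> = (\<integral>\<^sup>+t. \<integral>\<^sup>+s. indicator A (s(i := t)) \<partial>PiM I (\<lambda>_. N) \<partial>N)"
    using insert(1,2) by (intro N.product_nn_integral_insert_rev) auto
  finally have "AE t in N. (\<integral>\<^sup>+s. indicator A (s(i := t)) \<partial>PiM I (\<lambda>_. N)) = 0"
  proof (subst (asm) eq_commute, subst (asm) nn_integral_0_iff_AE)
    interpret I: sigma_finite_measure "PiM I (\<lambda>_. N)" by (rule N.sigma_finite[OF insert(1)])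
    show "(\<lambda>t. \<integral>\<^sup>+ s. indicator A (s(i := t)) \<partial>Pi\<^sub>M I (\<lambda>_. N)) \<in> borel_measurable N"
      by measurable
  qed auto
  then have AEp: "AE y in M. (\<integral>\<^sup>+s. indicator A (s(i := p y)) \<partial>PiM I (\<lambda>_. N)) = 0"
    by (rule AE_nonsingular[OF p p_meas])
  have "(\<integral>\<^sup>+e. g e \<partial>PiM L (\<lambda>_. M)) = (\<integral>\<^sup>+e. g e \<partial>PiM (insert ?l ?L) (\<lambda>_. M))"
    using L(1) by simp
  also have "\<dots> = (\<integral>\<^sup>+y. \<integral>\<^sup>+x. g (x(?l := y)) \<partial>PiM ?L (\<lambda>_. M) \<partial>M)"
    using L g by (intro M.product_nn_integral_insert_rev) auto
  also have "\<dots> = (\<integral>\<^sup>+y. 0 \<partial>M)"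
  proof (rule nn_integral_cong_AE)
    show "AE y in M. (\<integral>\<^sup>+x. g (x(?l := y)) \<partial>PiM ?L (\<lambda>_. M)) = 0"
      using AEp AE_space
    proof eventually_elim
      case (elim y)
      \<comment> \<open>\<open>B\<close> is the section of \<open>A\<close> at the value
        \<open>p y\<close>. It is null for the \<open>y\<close> at hand, and freezing the coordinate
        \<open>q i\<close> at \<open>y\<close> turns \<open>g\<close> into the pulled-back indicator
        of \<open>B\<close>.\<close>
      define B where "B = (\<lambda>s. s(i := p y)) -` A \<inter> space (PiM I (\<lambda>_. N))"
      have py: "p y \<in> space N" using elim(2) measurable_space[OF p_meas] by auto
      have upd[measurable]: "(\<lambda>s. s(i := p y)) \<in> PiM I (\<lambda>_. N) \<rightarrow>\<^sub>M PiM (insert i I) (\<lambda>_. N)"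
        using py by (intro measurable_fun_upd[where J=I]) auto
      have B[measurable]: "B \<in> sets (PiM I (\<lambda>_. N))" unfolding B_def by measurable
      have "emeasure (PiM I (\<lambda>_. N)) B = (\<integral>\<^sup>+s. indicator B s \<partial>PiM I (\<lambda>_. N))" by simp
      also have "\<dots> = (\<integral>\<^sup>+s. indicator A (s(i := p y)) \<partial>PiM I (\<lambda>_. N))"
        by (intro nn_integral_cong) (auto simp: B_def indicator_def)
      finally have "B \<in> null_sets (PiM I (\<lambda>_. N))" using elim(1) by auto
      from insert.IH[OF L(2) q this]
      have "(\<integral>\<^sup>+x. indicator B (\<lambda>j\<in>I. p (x (q j))) \<partial>PiM ?L (\<lambda>_. M)) = 0" .
      moreover have "g (x(?l := y)) = indicator B (\<lambda>j\<in>I. p (x (q j)))"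
        if x: "x \<in> space (PiM ?L (\<lambda>_. M))" for x
      proof -
        have "q j \<noteq> q i" if "j \<in> I" for j using that insert by (auto simp: inj_on_def)
        then have eq: "(\<lambda>j\<in>insert i I. p ((x(?l := y)) (q j))) = (\<lambda>j\<in>I. p (x (q j)))(i := p y)"
          using insert(2) by (auto simp: fun_eq_iff)
        have "x (q j) \<in> space M" if "j \<in> I" for j
          using x q that by (auto simp: space_PiM PiE_iff)
        then have "(\<lambda>j\<in>I. p (x (q j))) \<in> space (PiM I (\<lambda>_. N))"
          using measurable_space[OF p_meas] by (auto simp: space_PiM PiE_iff)
        then show ?thesis unfolding g_def eq by (simp add: B_def indicator_def)
      qed
      ultimately show ?case by (simp cong: nn_integral_cong)
    qed
  qed
  finally have "(\<integral>\<^sup>+e. g e \<partial>PiM L (\<lambda>_. M)) = 0" by simp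
  then show ?case unfolding g_def .
qed

text \<open>The form in which almost-everywhere statements travel. With \<open>p\<close> the
  identity it renames coordinates and adds idle ones; with \<open>p\<close> the first coordinate it
  lifts statements on real tuples to tuples in \<open>Z\<close>.\<close>

lemma AE_PiM_pullback:
  fixes M :: "'a measure" and N :: "'b measure"
  assumes M: "sigma_finite_measure M" and N: "sigma_finite_measure N"
    and p: "absolutely_continuous N (distr M N p)" and p_meas[measurable]: "p \<in> M \<rightarrow>\<^sub>M N"
    and fin: "finite L" "inj_on q I" "q ` I \<subseteq> L"
    and ae: "AE s in PiM I (\<lambda>_. N). P s"
  shows "AE e in PiM L (\<lambda>_. M). P (\<lambda>i\<in>I. p (e (q i)))"
proof -
  have finI: "finite I" using fin by (meson finite_imageD finite_subset)
  from ae obtain A where A: "A \<in> null_sets (PiM I (\<lambda>_. N))"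
      "{s \<in> space (PiM I (\<lambda>_. N)). \<not> P s} \<subseteq> A"
    by (auto simp: eventually_ae_filter)
  then have [measurable]: "A \<in> sets (PiM I (\<lambda>_. N))" by auto
  have pe[measurable]: "(\<lambda>e. \<lambda>j\<in>I. p (e (q j))) \<in> PiM L (\<lambda>_. M) \<rightarrow>\<^sub>M PiM I (\<lambda>_. N)"
    using fin by (intro measurable_restrict measurable_compose[OF _ p_meas]
      measurable_component_singleton) auto
  have "AE e in PiM L (\<lambda>_. M). (indicator A (\<lambda>i\<in>I. p (e (q i))) :: ennreal) = 0"
    using nn_integral_PiM_pullback_eq_0[OF M N p p_meas finI fin A(1)]
    by (subst nn_integral_0_iff_AE[symmetric]) auto
  then show ?thesis using AE_space
  proof eventually_elim
    case (elim e)
    then show ?case using A(2) measurable_space[OF pe elim(2)]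
      by (auto simp: indicator_def split: if_splits)
  qed
qed

lemma absolutely_continuous_id: "absolutely_continuous M (distr M M (\<lambda>x. x))"
  by (simp add: distr_id2 absolutely_continuous_def)

text \<open>Both measures agree on boxes, and a finite product of sigma-finite measures is
  determined by its values there.\<close>

lemma distr_PiM_reindex_bij:
  fixes M :: "'a measure" and q :: "'i \<Rightarrow> 'l"
  assumes M: "sigma_finite_measure M" and fin: "finite L" and q: "bij_betw q I L"
  shows "distr (PiM L (\<lambda>_. M)) (PiM I (\<lambda>_. M)) (\<lambda>e. \<lambda>i\<in>I. e (q i)) = PiM I (\<lambda>_. M)"
proof -
  interpret M: product_sigma_finite "\<lambda>_. M" by (rule product_sigma_finite_const[OF M])
  have finI: "finite I" using fin q by (simp add: bij_betw_finite)
  have qm: "(\<lambda>e. \<lambda>i\<in>I. e (q i)) \<in> PiM L (\<lambda>_. M) \<rightarrow>\<^sub>M PiM I (\<lambda>_. M)"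
    using q by (intro measurable_restrict measurable_component_singleton) (auto simp: bij_betw_def)
  show ?thesis
  proof (rule M.PiM_eqI[OF finI])
    fix A :: "'i \<Rightarrow> 'a set" assume A: "\<And>i. i \<in> I \<Longrightarrow> A i \<in> sets M"
    let ?r = "the_inv_into I q"
    have r: "?r l \<in> I" "q (?r l) = l" if "l \<in> L" for l
      using q that by (auto simp: bij_betw_def the_inv_into_into f_the_inv_into_f)
    have rq: "?r (q i) = i" if "i \<in> I" for i
      using q that by (auto simp: bij_betw_def the_inv_into_f_f)
    have sp: "A i \<subseteq> space M" if "i \<in> I" for i using A[OF that] by (rule sets.sets_into_space)
    have "(\<lambda>e. \<lambda>i\<in>I. e (q i)) -` Pi\<^sub>E I A \<inter> space (PiM L (\<lambda>_. M)) = Pi\<^sub>E L (\<lambda>l. A (?r l))"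
    proof (intro set_eqI iffI)
      fix e assume e: "e \<in> (\<lambda>e. \<lambda>i\<in>I. e (q i)) -` Pi\<^sub>E I A \<inter> space (PiM L (\<lambda>_. M))"
      have "e l \<in> A (?r l)" if "l \<in> L" for l
      proof -
        have "(\<lambda>i\<in>I. e (q i)) (?r l) \<in> A (?r l)" using e r(1)[OF that] by (auto simp: PiE_iff)
        then show ?thesis using r[OF that] by simp
      qed
      then show "e \<in> Pi\<^sub>E L (\<lambda>l. A (?r l))" using e by (auto simp: space_PiM PiE_iff)
    next
      fix e assume e: "e \<in> Pi\<^sub>E L (\<lambda>l. A (?r l))"
      have "e (q i) \<in> A i" if "i \<in> I" for i
      proof -
        have "q i \<in> L" using q that by (auto simp: bij_betw_def)
        then show ?thesis using e rq[OF that] by (auto simp: PiE_iff)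
      qed
      moreover have "e l \<in> space M" if "l \<in> L" for l
        using e that sp[OF r(1)[OF that]] by (auto simp: PiE_iff)
      ultimately show "e \<in> (\<lambda>e. \<lambda>i\<in>I. e (q i)) -` Pi\<^sub>E I A \<inter> space (PiM L (\<lambda>_. M))"
        using e by (auto simp: space_PiM PiE_iff)
    qed
    then have "emeasure (distr (PiM L (\<lambda>_. M)) (PiM I (\<lambda>_. M)) (\<lambda>e. \<lambda>i\<in>I. e (q i))) (Pi\<^sub>E I A)
        = emeasure (PiM L (\<lambda>_. M)) (Pi\<^sub>E L (\<lambda>l. A (?r l)))"
      using A finI by (subst emeasure_distr[OF qm]) auto
    also have "\<dots> = (\<Prod>l\<in>L. emeasure M (A (?r l)))"
      using A r by (intro M.emeasure_PiM[OF fin]) auto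
    also have "\<dots> = (\<Prod>i\<in>I. emeasure M (A i))"
      unfolding prod.reindex_bij_betw[OF q, symmetric] by (intro prod.cong) (auto simp: rq)
    finally show "emeasure (distr (PiM L (\<lambda>_. M)) (PiM I (\<lambda>_. M)) (\<lambda>e. \<lambda>i\<in>I. e (q i))) (Pi\<^sub>E I A)
       = (\<Prod>i\<in>I. emeasure M (A i))" .
  qed simp
qed

text \<open>Glues the values along a word \<open>w\<close> and the values on \<open>D\<close> into
  one tuple indexed by letters. \<open>LEAST\<close> finds the place of a letter in a word without
  repetitions. Unlike \<open>letter_value\<close> the result is extensional, hence a point of the
  product space over all letters.\<close>

definition join :: "'l list \<Rightarrow> 'l set \<Rightarrow> (nat \<Rightarrow> 'y) \<Rightarrow> ('l \<Rightarrow> 'y) \<Rightarrow> 'l \<Rightarrow> 'y"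
  where "join w D x z = (\<lambda>l\<in>set w \<union> D. if l \<in> D then z l else x (LEAST i. i < length w \<and> w ! i = l))"

lemma Least_index:
  assumes "distinct w" "p < length w"
  shows "(LEAST i. i < length w \<and> w ! i = w ! p) = p"
  using assms by (intro Least_equality) (auto simp: nth_eq_iff_index_eq)

lemma join_nth:
  assumes "distinct w" "set w \<inter> D = {}" "p < length w"
  shows "join w D x z (w ! p) = x p"
proof -
  have "w ! p \<in> set w" using assms by simp
  moreover from this have "w ! p \<notin> D" using assms(2) by blast
  ultimately show ?thesis using assms Least_index[OF assms(1,3)] by (auto simp: join_def)
qed

lemma join_deleted: "l \<in> D \<Longrightarrow> join w D x z l = z l"
  by (simp add: join_def)

lemma measurable_join:
  assumes "distinct w"
  shows "(\<lambda>(x, z). join w D x z) \<in> PiM {..<length w} (\<lambda>_. M) \<Otimes>\<^sub>M PiM D (\<lambda>_. M) \<rightarrow>\<^sub>M PiM (set w \<union> D) (\<lambda>_. M)"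
  unfolding join_def split_beta
proof (rule measurable_restrict)
  fix l assume l: "l \<in> set w \<union> D"
  let ?i = "LEAST i. i < length w \<and> w ! i = l"
  show "(\<lambda>p. if l \<in> D then snd p l else fst p ?i)
    \<in> PiM {..<length w} (\<lambda>_. M) \<Otimes>\<^sub>M PiM D (\<lambda>_. M) \<rightarrow>\<^sub>M M"
  proof (cases "l \<in> D")
    case False
    then obtain i where "i < length w" "w ! i = l" using l by (auto simp: in_set_conv_nth)
    then have "?i < length w \<and> w ! ?i = l" by (rule_tac LeastI[of "\<lambda>i. i < length w \<and> w ! i = l" i]) auto
    with False show ?thesis
      by (simp add: measurable_compose[OF measurable_fst measurable_component_singleton])
  qed (simp add: measurable_compose[OF measurable_snd measurable_component_singleton])
qed

text \<open>Checked on boxes: the preimage of a box is a product of two boxes, since the word has no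
  repetitions and shares no letter with \<open>D\<close>. The Fubini arguments for histories go
  through this identity.\<close>

lemma distr_join:
  fixes M :: "'a measure"
  assumes M: "sigma_finite_measure M" and w: "distinct w" "set w \<inter> D = {}" "finite D"
  shows "distr (PiM {..<length w} (\<lambda>_. M) \<Otimes>\<^sub>M PiM D (\<lambda>_. M)) (PiM (set w \<union> D) (\<lambda>_. M)) (\<lambda>(x, z). join w D x z)
    = PiM (set w \<union> D) (\<lambda>_. M)"
proof -
  interpret M: product_sigma_finite "\<lambda>_. M" by (rule product_sigma_finite_const[OF M])
  let ?P = "PiM {..<length w} (\<lambda>_. M) \<Otimes>\<^sub>M PiM D (\<lambda>_. M)"
  interpret D: sigma_finite_measure "PiM D (\<lambda>_. M)" by (rule M.sigma_finite[OF w(3)])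
  show ?thesis
  proof (rule M.PiM_eqI)
    fix A assume A: "\<And>i. i \<in> set w \<union> D \<Longrightarrow> A i \<in> sets M"
    have sp: "A i \<subseteq> space M" if "i \<in> set w \<union> D" for i using A[OF that] by (rule sets.sets_into_space)
    have sp1: "y \<in> space M" if "i < length w" "y \<in> A (w ! i)" for i y using sp[of "w ! i"] that by auto
    have sp2: "y \<in> space M" if "i \<in> D" "y \<in> A i" for i y using sp[of i] that by auto
    have "(\<lambda>(x, z). join w D x z) -` Pi\<^sub>E (set w \<union> D) A \<inter> space ?P =
      (Pi\<^sub>E {..<length w} (\<lambda>i. A (w ! i))) \<times> Pi\<^sub>E D A" (is "?A = ?B")
    proof (intro set_eqI, clarify)
      fix x z
      have "(\<forall>l\<in>set w \<union> D. join w D x z l \<in> A l) \<longleftrightarrow> (\<forall>i<length w. x i \<in> A (w ! i)) \<and> (\<forall>l\<in>D. z l \<in> A l)"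
      proof -
        have "join w D x z (w ! i) = x i" if "i < length w" for i by (rule join_nth[OF w(1,2) that])
        moreover have "join w D x z l = z l" if "l \<in> D" for l using that by (rule join_deleted)
        ultimately show ?thesis by (simp add: all_set_conv_all_nth ball_Un)
      qed
      moreover have "join w D x z \<in> extensional (set w \<union> D)" by (simp add: join_def)
      ultimately show "(x, z) \<in> ?A \<longleftrightarrow> (x, z) \<in> ?B"
        using sp1 sp2 by (auto simp: space_pair_measure space_PiM PiE_iff)
    qed
    then have "emeasure (distr ?P (PiM (set w \<union> D) (\<lambda>_. M)) (\<lambda>(x, z). join w D x z)) (Pi\<^sub>E (set w \<union> D) A)
       = emeasure ?P (Pi\<^sub>E {..<length w} (\<lambda>i. A (w ! i)) \<times> Pi\<^sub>E D A)"
      using A w by (subst emeasure_distr[OF measurable_join[OF w(1)]]) auto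
    also have "\<dots> = (\<Prod>i<length w. emeasure M (A (w ! i))) * (\<Prod>l\<in>D. emeasure M (A l))"
    proof -
      have "emeasure (PiM {..<length w} (\<lambda>_. M)) (Pi\<^sub>E {..<length w} (\<lambda>i. A (w ! i))) = (\<Prod>i<length w. emeasure M (A (w ! i)))"
        using A by (intro M.emeasure_PiM) auto
      moreover have "emeasure (PiM D (\<lambda>_. M)) (Pi\<^sub>E D A) = (\<Prod>l\<in>D. emeasure M (A l))"
        using A w by (intro M.emeasure_PiM) auto
      ultimately show ?thesis
        using A w by (subst D.emeasure_pair_measure_Times) auto
    qed
    also have "(\<Prod>i<length w. emeasure M (A (w ! i))) = (\<Prod>l\<in>set w. emeasure M (A l))"
      using bij_betw_nth[OF w(1) refl refl] by (rule prod.reindex_bij_betw)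
    finally show "emeasure (distr ?P (PiM (set w \<union> D) (\<lambda>_. M)) (\<lambda>(x, z). join w D x z)) (Pi\<^sub>E (set w \<union> D) A)
       = (\<Prod>i\<in>set w \<union> D. emeasure M (A i))"
      using w by (simp add: prod.union_disjoint)
  qed (use w in auto)
qed

lemma nn_integral_join:
  fixes M :: "'a measure"
  assumes M: "sigma_finite_measure M" and w: "distinct w" "set w \<inter> D = {}" "finite D"
    and g: "g \<in> borel_measurable (PiM (set w \<union> D) (\<lambda>_. M))"
  shows "(\<integral>\<^sup>+e. g e \<partial>PiM (set w \<union> D) (\<lambda>_. M)) =
    (\<integral>\<^sup>+x. \<integral>\<^sup>+z. g (join w D x z) \<partial>PiM D (\<lambda>_. M) \<partial>PiM {..<length w} (\<lambda>_. M))"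
proof -
  interpret M: product_sigma_finite "\<lambda>_. M" by (rule product_sigma_finite_const[OF M])
  interpret D: sigma_finite_measure "PiM D (\<lambda>_. M)" by (rule M.sigma_finite[OF w(3)])
  note mj = measurable_join[OF w(1), where M=M and D=D]
  have "(\<integral>\<^sup>+e. g e \<partial>PiM (set w \<union> D) (\<lambda>_. M)) =
    (\<integral>\<^sup>+p. g (case p of (x, z) \<Rightarrow> join w D x z) \<partial>(PiM {..<length w} (\<lambda>_. M) \<Otimes>\<^sub>M PiM D (\<lambda>_. M)))"
    by (subst distr_join[OF M w, symmetric]) (rule nn_integral_distr[OF mj], simp add: g)
  also have "\<dots> = (\<integral>\<^sup>+x. \<integral>\<^sup>+z. g (join w D x z) \<partial>PiM D (\<lambda>_. M) \<partial>PiM {..<length w} (\<lambda>_. M))"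
    using D.nn_integral_fst[OF measurable_compose[OF mj g], symmetric] by simp
  finally show ?thesis .
qed

lemma integral_join:
  fixes M :: "'a measure" and g :: "_ \<Rightarrow> 'b::{banach, second_countable_topology}"
  assumes M: "sigma_finite_measure M" and w: "distinct w" "set w \<inter> D = {}" "finite D"
    and g: "integrable (PiM (set w \<union> D) (\<lambda>_. M)) g"
  shows "(LINT e|PiM (set w \<union> D) (\<lambda>_. M). g e) =
    (LINT x|PiM {..<length w} (\<lambda>_. M). LINT z|PiM D (\<lambda>_. M). g (join w D x z))"
proof -
  interpret M: product_sigma_finite "\<lambda>_. M" by (rule product_sigma_finite_const[OF M])
  interpret D: sigma_finite_measure "PiM D (\<lambda>_. M)" by (rule M.sigma_finite[OF w(3)])
  interpret X: sigma_finite_measure "PiM {..<length w} (\<lambda>_. M)" by (rule M.sigma_finite) simp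
  interpret P: pair_sigma_finite "PiM {..<length w} (\<lambda>_. M)" "PiM D (\<lambda>_. M)" ..
  have gm: "g \<in> borel_measurable (PiM (set w \<union> D) (\<lambda>_. M))" using g by auto
  note mj = measurable_join[OF w(1), where M=M and D=D]
  have int: "integrable (PiM {..<length w} (\<lambda>_. M) \<Otimes>\<^sub>M PiM D (\<lambda>_. M)) (\<lambda>p. g (case p of (x, z) \<Rightarrow> join w D x z))"
    by (rule integrable_distr[OF mj]) (simp add: distr_join[OF M w] g)
  have "(LINT e|PiM (set w \<union> D) (\<lambda>_. M). g e) =
    (LINT p|(PiM {..<length w} (\<lambda>_. M) \<Otimes>\<^sub>M PiM D (\<lambda>_. M)). g (case p of (x, z) \<Rightarrow> join w D x z))"
    by (subst distr_join[OF M w, symmetric]) (rule integral_distr[OF mj gm])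
  also have "\<dots> = (LINT x|PiM {..<length w} (\<lambda>_. M). LINT z|PiM D (\<lambda>_. M). g (join w D x z))"
    using P.integral_fst'[OF int] by simp
  finally show ?thesis .
qed

lemma AE_join:
  fixes M :: "'a measure"
  assumes M: "sigma_finite_measure M" and w: "distinct w" "set w \<inter> D = {}" "finite D"
    and ae: "AE e in PiM (set w \<union> D) (\<lambda>_. M). P e"
  shows "AE x in PiM {..<length w} (\<lambda>_. M). AE z in PiM D (\<lambda>_. M). P (join w D x z)"
    and "AE p in PiM {..<length w} (\<lambda>_. M) \<Otimes>\<^sub>M PiM D (\<lambda>_. M). P (join w D (fst p) (snd p))"
proof -
  interpret M: product_sigma_finite "\<lambda>_. M" by (rule product_sigma_finite_const[OF M])
  interpret D: sigma_finite_measure "PiM D (\<lambda>_. M)" by (rule M.sigma_finite[OF w(3)])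
  interpret X: sigma_finite_measure "PiM {..<length w} (\<lambda>_. M)" by (rule M.sigma_finite) simp
  interpret P: pair_sigma_finite "PiM {..<length w} (\<lambda>_. M)" "PiM D (\<lambda>_. M)" ..
  have "AE p in PiM {..<length w} (\<lambda>_. M) \<Otimes>\<^sub>M PiM D (\<lambda>_. M). P (case p of (x, z) \<Rightarrow> join w D x z)"
    using ae by (intro AE_distrD[OF measurable_join[OF w(1)]]) (simp only: distr_join[OF M w])
  then show p: "AE p in PiM {..<length w} (\<lambda>_. M) \<Otimes>\<^sub>M PiM D (\<lambda>_. M). P (join w D (fst p) (snd p))"
    by (simp add: split_beta)
  show "AE x in PiM {..<length w} (\<lambda>_. M). AE z in PiM D (\<lambda>_. M). P (join w D x z)"
    using P.AE_pair[OF p] by simp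
qed

section \<open>Square-integrable functions\<close>

lemma L2_iff:
  "f \<in> L2 M \<longleftrightarrow> f \<in> borel_measurable M \<and> (\<integral>\<^sup>+x. (ennreal (norm (f x)))\<^sup>2 \<partial>M) < \<infinity>"
proof (cases "f \<in> borel_measurable M")
  case True
  then have "integrable M (\<lambda>x. (norm (f x))\<^sup>2) \<longleftrightarrow> (\<integral>\<^sup>+x. (ennreal (norm (f x)))\<^sup>2 \<partial>M) < \<infinity>"
    by (subst integrable_iff_bounded) (simp add: ennreal_power)
  with True show ?thesis by (simp add: L2_def)
qed (simp add: L2_def)

lemma L2_measurable: "f \<in> L2 M \<Longrightarrow> f \<in> borel_measurable M"
  by (simp add: L2_def)

lemma L2_integrable_mult:
  fixes f g :: "'a \<Rightarrow> 'b::{real_normed_field, second_countable_topology, banach}"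
  assumes "f \<in> L2 M" "g \<in> L2 M"
  shows "integrable M (\<lambda>x. f x * g x)"
proof (rule Bochner_Integration.integrable_bound)
  show "integrable M (\<lambda>x. (norm (f x))\<^sup>2 + (norm (g x))\<^sup>2)"
    using assms by (auto simp: L2_def)
  show "(\<lambda>x. f x * g x) \<in> borel_measurable M" using assms by (auto simp: L2_def)
  show "AE x in M. norm (f x * g x) \<le> norm ((norm (f x))\<^sup>2 + (norm (g x))\<^sup>2)"
  proof (rule AE_I2)
    fix x
    have "2 * norm (f x) * norm (g x) \<le> (norm (f x))\<^sup>2 + (norm (g x))\<^sup>2"
      by (rule sum_squares_bound)
    moreover have "0 \<le> norm (f x) * norm (g x)" by simp
    ultimately have "norm (f x) * norm (g x) \<le> (norm (f x))\<^sup>2 + (norm (g x))\<^sup>2" by linarith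
    then show "norm (f x * g x) \<le> norm ((norm (f x))\<^sup>2 + (norm (g x))\<^sup>2)"
      by (simp add: norm_mult)
  qed
qed

lemma L2_bound:
  fixes f :: "'a \<Rightarrow> 'b::{real_normed_field, second_countable_topology, banach}"
    and g :: "'a \<Rightarrow> 'c::{real_normed_field, second_countable_topology, banach}"
  assumes "f \<in> L2 M" "g \<in> borel_measurable M" "AE x in M. norm (g x) \<le> C * norm (f x)"
  shows "g \<in> L2 M"
  unfolding L2_def
proof (safe, fact)
  show "integrable M (\<lambda>x. (norm (g x))\<^sup>2)"
  proof (rule Bochner_Integration.integrable_bound)
    show "integrable M (\<lambda>x. C\<^sup>2 * (norm (f x))\<^sup>2)" using assms by (auto simp: L2_def)
    show "AE x in M. norm ((norm (g x))\<^sup>2) \<le> norm (C\<^sup>2 * (norm (f x))\<^sup>2)"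
      using assms(3)
    proof eventually_elim
      case (elim x)
      have "(norm (g x))\<^sup>2 \<le> (C * norm (f x))\<^sup>2" using elim by (intro power_mono) auto
      then show ?case by (simp add: power_mult_distrib)
    qed
  qed (use assms in measurable)
qed

lemma L2_mult_bounded:
  fixes f :: "'a \<Rightarrow> 'b::{real_normed_field, second_countable_topology, banach}"
  assumes "f \<in> L2 M" "c \<in> borel_measurable M" "\<And>x. norm (c x) \<le> C"
  shows "(\<lambda>x. c x * f x) \<in> L2 M"
  by (rule L2_bound[OF assms(1), of _ C])
    (use assms in \<open>auto simp: norm_mult L2_def intro!: mult_right_mono\<close>)

lemma L2_scale:
  fixes f :: "'a \<Rightarrow> 'b::{real_normed_field, second_countable_topology, banach}"
  shows "f \<in> L2 M \<Longrightarrow> (\<lambda>x. c * f x) \<in> L2 M"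
  by (rule L2_mult_bounded[where C="norm c"]) auto

lemma L2_add:
  fixes f g :: "'a \<Rightarrow> 'b::{real_normed_field, second_countable_topology, banach}"
  assumes "f \<in> L2 M" "g \<in> L2 M"
  shows "(\<lambda>x. f x + g x) \<in> L2 M"
  unfolding L2_def
proof safe
  show "(\<lambda>x. f x + g x) \<in> borel_measurable M" using assms by (auto simp: L2_def)
  show "integrable M (\<lambda>x. (norm (f x + g x))\<^sup>2)"
  proof (rule Bochner_Integration.integrable_bound)
    show "integrable M (\<lambda>x. 2 * (norm (f x))\<^sup>2 + 2 * (norm (g x))\<^sup>2)" using assms by (auto simp: L2_def)
    show "AE x in M. norm ((norm (f x + g x))\<^sup>2) \<le> norm (2 * (norm (f x))\<^sup>2 + 2 * (norm (g x))\<^sup>2)"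
    proof (rule AE_I2)
      fix x
      have "(norm (f x + g x))\<^sup>2 \<le> (norm (f x) + norm (g x))\<^sup>2"
        by (intro power_mono norm_triangle_ineq) auto
      also have "\<dots> \<le> 2 * (norm (f x))\<^sup>2 + 2 * (norm (g x))\<^sup>2"
        using sum_squares_bound[of "norm (f x)" "norm (g x)"] by (simp add: power2_sum)
      finally show "norm ((norm (f x + g x))\<^sup>2) \<le> norm (2 * (norm (f x))\<^sup>2 + 2 * (norm (g x))\<^sup>2)"
        by simp
    qed
  qed (use assms in \<open>auto simp: L2_def\<close>)
qed

lemma L2_zero: "(\<lambda>x. 0) \<in> L2 M"
  by (simp add: L2_def)

lemma L2_sum:
  fixes f :: "'i \<Rightarrow> 'a \<Rightarrow> 'b::{real_normed_field, second_countable_topology, banach}"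
  shows "(\<And>i. i \<in> I \<Longrightarrow> f i \<in> L2 M) \<Longrightarrow> (\<lambda>x. \<Sum>i\<in>I. f i x) \<in> L2 M"
  by (induction I rule: infinite_finite_induct) (auto intro!: L2_add L2_zero)

lemma L2_cnj: "f \<in> L2 M \<Longrightarrow> (\<lambda>x. cnj (f x)) \<in> L2 M"
  by (auto simp: L2_def intro: borel_measurable_continuous_onI[THEN measurable_compose[rotated]]
    continuous_on_cnj)

lemma nn_integral_mult_finite:
  assumes [measurable]: "u \<in> borel_measurable M" "h \<in> borel_measurable M"
    and "(\<integral>\<^sup>+x. (u x)\<^sup>2 \<partial>M) < \<infinity>" "(\<integral>\<^sup>+x. (h x)\<^sup>2 \<partial>M) < \<infinity>"
  shows "(\<integral>\<^sup>+x. u x * h x \<partial>M) < \<infinity>"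
proof -
  have "(\<integral>\<^sup>+x. u x * h x \<partial>M)\<^sup>2 \<le> (\<integral>\<^sup>+x. (u x)\<^sup>2 \<partial>M) * (\<integral>\<^sup>+x. (h x)\<^sup>2 \<partial>M)"
    by (rule Cauchy_Schwarz_nn_integral) auto
  also have "\<dots> < \<infinity>" using assms(3,4) by (simp add: ennreal_mult_less_top)
  finally show ?thesis
    by (metis ennreal_top_mult infinity_ennreal_def less_irrefl power2_eq_square top.not_eq_extremum top_neq_ennreal zero_neq_numeral ennreal_top_eq_mult_iff not_gr_zero)
qed

text \<open>Cauchy-Schwarz in the fibre variable. The bound splits unevenly, a factor
  \<open>B\<close> of the fibre variable alone and a factor \<open>E\<close> of both variables,
  because a deleted letter may also occur among the arguments of the operator. The square of the
  fibre integral is at most the squared norm of \<open>B\<close> times the fibre integral of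
  \<open>E\<close> squared. The third claim keeps the absolute value inside, as a later use of
  Fubini against an L2 function requires.\<close>

lemma fibre_integral_L2:
  fixes G :: "'a \<times> 'b \<Rightarrow> complex" and B :: "'b \<Rightarrow> ennreal" and E :: "'a \<times> 'b \<Rightarrow> ennreal"
  assumes M1: "sigma_finite_measure M1" and M2: "sigma_finite_measure M2"
    and G[measurable]: "G \<in> borel_measurable (M1 \<Otimes>\<^sub>M M2)"
    and B[measurable]: "B \<in> borel_measurable M2" and E[measurable]: "E \<in> borel_measurable (M1 \<Otimes>\<^sub>M M2)"
    and bound: "AE p in M1 \<Otimes>\<^sub>M M2. ennreal (norm (G p)) \<le> B (snd p) * E p"
    and finB: "(\<integral>\<^sup>+z. (B z)\<^sup>2 \<partial>M2) < \<infinity>" and finE: "(\<integral>\<^sup>+p. (E p)\<^sup>2 \<partial>(M1 \<Otimes>\<^sub>M M2)) < \<infinity>"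
  shows "AE x in M1. integrable M2 (\<lambda>z. G (x, z))"
    and "(\<lambda>x. LINT z|M2. G (x, z)) \<in> L2 M1"
    and "(\<integral>\<^sup>+x. (\<integral>\<^sup>+z. ennreal (norm (G (x, z))) \<partial>M2)\<^sup>2 \<partial>M1) < \<infinity>"
proof -
  interpret M1: sigma_finite_measure M1 by fact
  interpret M2: sigma_finite_measure M2 by fact
  interpret P: pair_sigma_finite M1 M2 ..
  define h where "h x = (\<integral>\<^sup>+z. ennreal (norm (G (x, z))) \<partial>M2)" for x
  have h[measurable]: "h \<in> borel_measurable M1" unfolding h_def by measurable
  have "AE x in M1. AE z in M2. ennreal (norm (G (x, z))) \<le> B z * E (x, z)"
    using P.AE_pair[OF bound] by simp
  then have "AE x in M1. (h x)\<^sup>2 \<le> (\<integral>\<^sup>+z. (B z)\<^sup>2 \<partial>M2) * (\<integral>\<^sup>+z. (E (x, z))\<^sup>2 \<partial>M2)"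
    using AE_space
  proof eventually_elim
    case (elim x)
    have [measurable]: "(\<lambda>z. E (x, z)) \<in> borel_measurable M2"
      using elim(2) by measurable
    have "h x \<le> (\<integral>\<^sup>+z. B z * E (x, z) \<partial>M2)"
      unfolding h_def using elim(1) by (intro nn_integral_mono_AE) auto
    then have "(h x)\<^sup>2 \<le> (\<integral>\<^sup>+z. B z * E (x, z) \<partial>M2)\<^sup>2" by (intro power_mono) auto
    also have "\<dots> \<le> (\<integral>\<^sup>+z. (B z)\<^sup>2 \<partial>M2) * (\<integral>\<^sup>+z. (E (x, z))\<^sup>2 \<partial>M2)"
      by (rule Cauchy_Schwarz_nn_integral) auto
    finally show ?case .
  qed
  then have "(\<integral>\<^sup>+x. (h x)\<^sup>2 \<partial>M1) \<le> (\<integral>\<^sup>+x. (\<integral>\<^sup>+z. (B z)\<^sup>2 \<partial>M2) * (\<integral>\<^sup>+z. (E (x, z))\<^sup>2 \<partial>M2) \<partial>M1)"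
    by (rule nn_integral_mono_AE)
  also have "\<dots> = (\<integral>\<^sup>+z. (B z)\<^sup>2 \<partial>M2) * (\<integral>\<^sup>+x. (\<integral>\<^sup>+z. (E (x, z))\<^sup>2 \<partial>M2) \<partial>M1)"
    by (rule nn_integral_cmult) measurable
  also have "(\<integral>\<^sup>+x. (\<integral>\<^sup>+z. (E (x, z))\<^sup>2 \<partial>M2) \<partial>M1) = (\<integral>\<^sup>+p. (E p)\<^sup>2 \<partial>(M1 \<Otimes>\<^sub>M M2))"
    by (rule M2.nn_integral_fst) measurable
  finally have fin: "(\<integral>\<^sup>+x. (h x)\<^sup>2 \<partial>M1) < \<infinity>"
    using finB finE by (elim le_less_trans) (simp add: ennreal_mult_less_top)
  then show "(\<integral>\<^sup>+x. (\<integral>\<^sup>+z. ennreal (norm (G (x, z))) \<partial>M2)\<^sup>2 \<partial>M1) < \<infinity>"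
    unfolding h_def .
  have "AE x in M1. (h x)\<^sup>2 \<noteq> \<infinity>" using fin by (intro nn_integral_PInf_AE) auto
  then have hf: "AE x in M1. h x < \<infinity>"
    by eventually_elim (auto simp: power2_eq_square ennreal_mult_eq_top_iff less_top)
  show int: "AE x in M1. integrable M2 (\<lambda>z. G (x, z))"
    using hf AE_space
    by eventually_elim (auto simp: integrable_iff_bounded h_def)
  show "(\<lambda>x. LINT z|M2. G (x, z)) \<in> L2 M1"
    unfolding L2_iff
  proof
    show "(\<lambda>x. LINT z|M2. G (x, z)) \<in> borel_measurable M1"
      by (rule M2.borel_measurable_lebesgue_integral) simp
    have "(\<integral>\<^sup>+x. (ennreal (norm (LINT z|M2. G (x, z))))\<^sup>2 \<partial>M1) \<le> (\<integral>\<^sup>+x. (h x)\<^sup>2 \<partial>M1)"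
      using int by (intro nn_integral_mono_AE, eventually_elim)
        (auto simp: h_def intro!: power_mono integral_norm_bound_ennreal)
    then show "(\<integral>\<^sup>+x. (ennreal (norm (LINT z|M2. G (x, z))))\<^sup>2 \<partial>M1) < \<infinity>"
      using fin by (rule le_less_trans)
  qed
qed

section \<open>Measures of pair partitions\<close>

lemma finite_sign_partitions: "finite (sign_partitions ss)"
proof (rule finite_subset)
  show "sign_partitions ss \<subseteq> Pow (Pow {..<length ss})"
    by (auto simp: sign_partitions_def partition_on_def)
qed simp

abbreviation "block \<theta> i \<equiv> (THE B. B \<in> \<theta> \<and> i \<in> B)"

lemma block_eq:
  assumes "partition_on A \<theta>" "B \<in> \<theta>" "i \<in> B"
  shows "block \<theta> i = B"
  using assms by (intro the_equality) (auto simp: partition_on_def disjoint_def)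

lemma block_in:
  assumes "partition_on A \<theta>" "i \<in> A"
  shows "block \<theta> i \<in> \<theta>" "i \<in> block \<theta> i"
proof -
  obtain B where "B \<in> \<theta>" "i \<in> B" using assms by (auto simp: partition_on_def)
  then show "block \<theta> i \<in> \<theta>" "i \<in> block \<theta> i" using block_eq[OF assms(1)] by auto
qed

lemma measurable_partition_map:
  assumes "partition_on {..<k} \<theta>"
  shows "(\<lambda>y. \<lambda>i\<in>{..<k}. y (block \<theta> i)) \<in> PiM \<theta> (\<lambda>_. M) \<rightarrow>\<^sub>M PiM {..<k} (\<lambda>_. M)"
  using block_in[OF assms] by (intro measurable_restrict measurable_component_singleton) auto

lemma space_sign_measure: "space (sign_measure M ss) = space (PiM {..<length ss} (\<lambda>_. M))"
  unfolding sign_measure_def by (rule space_measure_of) (rule sets.space_closed)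

lemma sets_sign_measure [measurable_cong]:
  "sets (sign_measure M ss) = sets (PiM {..<length ss} (\<lambda>_. M))"
  unfolding sign_measure_def by (rule sets.sets_measure_of_eq)

lemma sets_partition_measure: "sets (partition_measure M k \<theta>) = sets (PiM {..<k} (\<lambda>_. M))"
  by (simp add: partition_measure_def)

text \<open>\<open>measure_of\<close> returns the prescribed set function only after countable
  additivity has been checked; for a finite sum of measures this is an exchange of sums.\<close>

lemma emeasure_sign_measure:
  assumes "A \<in> sets (PiM {..<length ss} (\<lambda>_. M))"
  shows "emeasure (sign_measure M ss) A =
    (\<Sum>\<theta>\<in>sign_partitions ss. emeasure (partition_measure M (length ss) \<theta>) A)"
  unfolding sign_measure_def
proof (rule emeasure_measure_of_sigma)
  show "sigma_algebra (space (PiM {..<length ss} (\<lambda>_. M))) (sets (PiM {..<length ss} (\<lambda>_. M)))"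
    by (rule sets.sigma_algebra_axioms)
  show "positive (sets (PiM {..<length ss} (\<lambda>_. M)))
    (\<lambda>A. \<Sum>\<theta>\<in>sign_partitions ss. emeasure (partition_measure M (length ss) \<theta>) A)"
    by (simp add: positive_def)
  show "countably_additive (sets (PiM {..<length ss} (\<lambda>_. M)))
    (\<lambda>A. \<Sum>\<theta>\<in>sign_partitions ss. emeasure (partition_measure M (length ss) \<theta>) A)"
  proof (rule countably_additiveI)
    fix A :: "nat \<Rightarrow> (nat \<Rightarrow> 'a) set"
    assume A: "range A \<subseteq> sets (PiM {..<length ss} (\<lambda>_. M))" "disjoint_family A"
    have "(\<Sum>i. \<Sum>\<theta>\<in>sign_partitions ss. emeasure (partition_measure M (length ss) \<theta>) (A i)) =
      (\<Sum>\<theta>\<in>sign_partitions ss. \<Sum>i. emeasure (partition_measure M (length ss) \<theta>) (A i))"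
      by (rule suminf_sum) auto
    also have "\<dots> = (\<Sum>\<theta>\<in>sign_partitions ss. emeasure (partition_measure M (length ss) \<theta>) (\<Union>i. A i))"
      using A by (intro sum.cong suminf_emeasure) (auto simp: sets_partition_measure)
    finally show "(\<Sum>i. \<Sum>\<theta>\<in>sign_partitions ss. emeasure (partition_measure M (length ss) \<theta>) (A i)) =
      (\<Sum>\<theta>\<in>sign_partitions ss. emeasure (partition_measure M (length ss) \<theta>) (\<Union>i. A i))" .
  qed
qed (fact assms)

lemma partition_on_sign_partitions: "\<theta> \<in> sign_partitions ss \<Longrightarrow> partition_on {..<length ss} \<theta>"
  by (simp add: sign_partitions_def)

text \<open>A null set of a sum of measures is null for every summand, so a statement for
  \<open>sign_measure\<close> may be used on each diagonal separately.\<close>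

lemma AE_sign_measureD:
  assumes \<theta>: "\<theta> \<in> sign_partitions ss" and ae: "AE s in sign_measure M ss. P s"
  shows "AE y in PiM \<theta> (\<lambda>_. M). P (\<lambda>i\<in>{..<length ss}. y (block \<theta> i))"
proof (rule AE_distrD[OF measurable_partition_map[OF partition_on_sign_partitions[OF \<theta>]]])
  from ae obtain A where A: "A \<in> null_sets (sign_measure M ss)"
      "{s \<in> space (sign_measure M ss). \<not> P s} \<subseteq> A"
    by (auto simp: eventually_ae_filter)
  then have As: "A \<in> sets (PiM {..<length ss} (\<lambda>_. M))" by (auto simp: sets_sign_measure null_sets_def)
  have "emeasure (partition_measure M (length ss) \<theta>) A = 0"
    using A(1) \<theta> emeasure_sign_measure[OF As] finite_sign_partitions by (auto simp: null_sets_def)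
  then have "A \<in> null_sets (partition_measure M (length ss) \<theta>)"
    using As by (auto simp: null_sets_def sets_partition_measure)
  moreover have "{s \<in> space (partition_measure M (length ss) \<theta>). \<not> P s} \<subseteq> A"
    using A(2) by (auto simp: space_sign_measure partition_measure_def)
  ultimately show "AE s in distr (PiM \<theta> (\<lambda>_. M)) (PiM {..<length ss} (\<lambda>_. M))
      (\<lambda>y. \<lambda>i\<in>{..<length ss}. y (block \<theta> i)). P s"
    unfolding partition_measure_def[symmetric] by (rule AE_I')
qed

text \<open>The statement is tested on the parametrization of each diagonal. Measurability of the
  set lets nullity pass from the parameter space to the image measure.\<close>

lemma AE_sign_measureI:
  assumes meas: "{s \<in> space (PiM {..<length ss} (\<lambda>_. M)). P s} \<in> sets (PiM {..<length ss} (\<lambda>_. M))"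
    and ae: "\<And>\<theta>. \<theta> \<in> sign_partitions ss \<Longrightarrow>
      AE y in PiM \<theta> (\<lambda>_. M). P (\<lambda>i\<in>{..<length ss}. y (block \<theta> i))"
  shows "AE s in sign_measure M ss. P s"
proof (rule AE_I')
  let ?A = "{s \<in> space (PiM {..<length ss} (\<lambda>_. M)). \<not> P s}"
  have A: "?A = space (PiM {..<length ss} (\<lambda>_. M)) - {s \<in> space (PiM {..<length ss} (\<lambda>_. M)). P s}"
    by auto
  then have As: "?A \<in> sets (PiM {..<length ss} (\<lambda>_. M))" using meas by simp
  have "emeasure (partition_measure M (length ss) \<theta>) ?A = 0" if "\<theta> \<in> sign_partitions ss" for \<theta>
  proof -
    have "AE s in partition_measure M (length ss) \<theta>. P s"
      unfolding partition_measure_def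
      using ae[OF that] meas
      by (subst AE_distr_iff[OF measurable_partition_map[OF partition_on_sign_partitions[OF that]]]) auto
    then show ?thesis
      using As by (subst (asm) AE_iff_measurable[of ?A]) (auto simp: sets_partition_measure partition_measure_def)
  qed
  then show "?A \<in> null_sets (sign_measure M ss)"
    using emeasure_sign_measure[OF As] As by (simp add: null_sets_def sets_sign_measure)
qed (simp add: space_sign_measure)

text \<open>The fibres of \<open>a\<close> have at most two elements, since there are only two signs.\<close>

lemma AE_sign_measure_pullback:
  assumes M: "sigma_finite_measure M" and N: "sigma_finite_measure N"
    and p: "absolutely_continuous N (distr M N p)" "p \<in> M \<rightarrow>\<^sub>M N"
    and L: "finite L" "a ` {..<length ss} \<subseteq> L"
    and fib: "\<And>i j. i < length ss \<Longrightarrow> j < length ss \<Longrightarrow> i \<noteq> j \<Longrightarrow> a i = a j \<Longrightarrow> ss ! i \<noteq> ss ! j"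
    and ae: "AE s in sign_measure N ss. P s"
  shows "AE e in PiM L (\<lambda>_. M). P (\<lambda>i\<in>{..<length ss}. p (e (a i)))"
proof -
  define k where "k = length ss"
  define F where "F l = {j. j < k \<and> a j = l}" for l
  \<comment> \<open>Grouping the positions that share a letter gives an admissible partition.
    \<open>P\<close> is then known on its diagonal, which has one free coordinate per letter in the
    image of \<open>a\<close>.\<close>
  define \<theta> where "\<theta> = F ` a ` {..<k}"
  have part: "partition_on {..<k} \<theta>"
    by (auto simp: partition_on_def disjoint_def \<theta>_def F_def)
  have card: "card B \<le> 2" if "B \<in> \<theta>" for B
  proof -
    obtain l where l: "B = F l" using \<open>B \<in> \<theta>\<close> unfolding \<theta>_def by blast
    have "inj_on ((!) ss) B"
    proof (rule inj_onI, rule ccontr)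
      fix i j assume "i \<in> B" "j \<in> B" "ss ! i = ss ! j" "i \<noteq> j"
      then show False using fib[of i j] by (simp add: l F_def k_def)
    qed
    moreover have "(!) ss ` B \<subseteq> {Plus, Minus}" using sign.exhaust by auto
    ultimately have "card B \<le> card {Plus, Minus}" by (rule card_inj_on_le) simp
    then show ?thesis by simp
  qed
  have "\<theta> \<in> sign_partitions ss"
  proof -
    have "ss ! i \<noteq> ss ! j" if "i \<noteq> j" "{i, j} \<in> \<theta>" for i j
    proof -
      obtain l where "{i, j} = F l" using \<open>{i, j} \<in> \<theta>\<close> unfolding \<theta>_def by blast
      then have "i \<in> F l" "j \<in> F l" by auto
      then show ?thesis using fib[of i j] \<open>i \<noteq> j\<close> by (simp add: F_def k_def)
    qed
    with part card show ?thesis by (simp add: sign_partitions_def k_def)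
  qed
  from AE_sign_measureD[OF this ae]
  have ae\<theta>: "AE y in PiM \<theta> (\<lambda>_. N). P (\<lambda>i\<in>{..<k}. y (block \<theta> i))" by (simp add: k_def)
  define q where "q B = a (SOME i. i \<in> B)" for B
  have q: "q (F l) = l" if "l \<in> a ` {..<k}" for l
  proof -
    have "(SOME i. i \<in> F l) \<in> F l" using that by (rule_tac someI_ex) (auto simp: F_def)
    then show ?thesis by (simp add: q_def F_def)
  qed
  have "inj_on q \<theta>"
  proof (rule inj_onI)
    fix B C assume "B \<in> \<theta>" "C \<in> \<theta>" and eq: "q B = q C"
    then obtain l m where "l \<in> a ` {..<k}" "B = F l" "m \<in> a ` {..<k}" "C = F m"
      unfolding \<theta>_def by blast
    then show "B = C" using eq q[of l] q[of m] by simp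
  qed
  moreover have "q ` \<theta> \<subseteq> L"
  proof (rule image_subsetI)
    fix B assume "B \<in> \<theta>"
    then obtain l where "l \<in> a ` {..<k}" "B = F l" unfolding \<theta>_def by blast
    then show "q B \<in> L" using q[of l] L(2) by (auto simp: k_def)
  qed
  ultimately have q\<theta>: "inj_on q \<theta>" "q ` \<theta> \<subseteq> L" by auto
  from AE_PiM_pullback[OF M N p L(1) q\<theta> ae\<theta>]
  have "AE e in PiM L (\<lambda>_. M). P (\<lambda>i\<in>{..<k}. (\<lambda>B\<in>\<theta>. p (e (q B))) (block \<theta> i))" .
  moreover have "(\<lambda>i\<in>{..<k}. (\<lambda>B\<in>\<theta>. p (e (q B))) (block \<theta> i)) = (\<lambda>i\<in>{..<k}. p (e (a i)))" for e
  proof (rule restrict_ext)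
    fix i assume i: "i \<in> {..<k}"
    have "F (a i) \<in> \<theta>" "i \<in> F (a i)" using i by (auto simp: \<theta>_def F_def)
    then show "(\<lambda>B\<in>\<theta>. p (e (q B))) (block \<theta> i) = p (e (a i))"
      using block_eq[OF part] q[of "a i"] i by simp
  qed
  ultimately show ?thesis by (simp add: k_def)
qed

section \<open>Histories as pairings of letters\<close>

text \<open>
  The letters that can occur in a history, in the order in which they would stand in the word
  if nothing were deleted; \<open>letter_rank\<close> is increasing along this order.
\<close>

definition minus_set :: "nat \<Rightarrow> sign list \<Rightarrow> nat set"
  where "minus_set j ss = {i. j \<le> i \<and> i < j + length ss \<and> ss ! (i - j) = Minus}"

definition plus_set :: "nat \<Rightarrow> sign list \<Rightarrow> nat set"
  where "plus_set j ss = {i. j \<le> i \<and> i < j + length ss \<and> ss ! (i - j) = Plus}"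

fun letters :: "nat \<Rightarrow> nat \<Rightarrow> sign list \<Rightarrow> letter list"
  where
    "letters n j [] = map Arg [0..<n]"
  | "letters n j (Plus # ss) = New j # letters n (Suc j) ss"
  | "letters n j (Minus # ss) = letters n (Suc j) ss"

fun letter_rank :: "nat \<Rightarrow> letter \<Rightarrow> nat"
  where
    "letter_rank m (New i) = i"
  | "letter_rank m (Arg q) = m + q"

text \<open>This is the final word of a history, since deletions leave the order of the remaining
  letters unchanged.\<close>

definition survivors :: "nat \<Rightarrow> nat \<Rightarrow> sign list \<Rightarrow> (nat \<Rightarrow> letter) \<Rightarrow> letter list"
  where "survivors n j ss a = filter (\<lambda>l. l \<notin> a ` minus_set j ss) (letters n j ss)"

text \<open>The letters that precede \<open>a i\<close> in the word at the time when \<open>a i\<close> is deleted.\<close>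

definition passed :: "nat \<Rightarrow> nat \<Rightarrow> sign list \<Rightarrow> nat \<Rightarrow> (nat \<Rightarrow> letter) \<Rightarrow> nat \<Rightarrow> letter set"
  where "passed n j ss m a i = {u \<in> set (letters n j ss). i < letter_rank m u \<and>
    letter_rank m u < letter_rank m (a i) \<and> u \<notin> a ` {i'\<in>minus_set j ss. i < i'}}"

text \<open>Signs are treated from right to left and new letters go to the front, so a letter
  present when position \<open>i\<close> acts has rank above \<open>i\<close>; besides injectivity
  this is the only constraint. Outside the annihilations \<open>a\<close> is fixed to
  \<open>New\<close>, so that one history corresponds to one function and each creation carries its
  own letter.\<close>

definition pairings :: "nat \<Rightarrow> nat \<Rightarrow> sign list \<Rightarrow> nat \<Rightarrow> (nat \<Rightarrow> letter) set"
  where "pairings n j ss m = {a. (\<forall>i. i \<notin> minus_set j ss \<longrightarrow> a i = New i) \<and> inj_on a (minus_set j ss) \<and>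
    (\<forall>i\<in>minus_set j ss. a i \<in> set (letters n j ss) \<and> i < letter_rank m (a i))}"

lemma finite_minus_set [simp]: "finite (minus_set j ss)" and finite_plus_set [simp]: "finite (plus_set j ss)"
  by (auto simp: minus_set_def plus_set_def)

lemma minus_set_Nil [simp]: "minus_set j [] = {}" and plus_set_Nil [simp]: "plus_set j [] = {}"
  by (auto simp: minus_set_def plus_set_def)

lemma minus_set_Cons:
  "minus_set j (s # ss) = (if s = Minus then {j} else {}) \<union> minus_set (Suc j) ss"
  by (auto simp: minus_set_def nth_Cons' Suc_le_eq less_Suc_eq_le split: if_splits)

lemma plus_set_Cons:
  "plus_set j (s # ss) = (if s = Plus then {j} else {}) \<union> plus_set (Suc j) ss"
  by (auto simp: plus_set_def nth_Cons' Suc_le_eq less_Suc_eq_le split: if_splits)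

lemma minus_set_ge: "i \<in> minus_set j ss \<Longrightarrow> j \<le> i"
  and plus_set_ge: "i \<in> plus_set j ss \<Longrightarrow> j \<le> i"
  and plus_set_less: "i \<in> plus_set j ss \<Longrightarrow> i < j + length ss"
  and minus_set_less: "i \<in> minus_set j ss \<Longrightarrow> i < j + length ss"
  by (auto simp: minus_set_def plus_set_def)

lemma set_letters: "set (letters n j ss) = New ` plus_set j ss \<union> Arg ` {..<n}"
  by (induction n j ss rule: letters.induct) (auto simp: plus_set_Cons)

text \<open>Ranks of \<open>Arg\<close> letters start at \<open>m\<close>; the assumption on
  \<open>m\<close> places them behind every created letter.\<close>

lemma sorted_letters:
  "j + length ss \<le> m \<Longrightarrow> sorted_wrt (\<lambda>l u. letter_rank m l < letter_rank m u) (letters n j ss)"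
proof (induction n j ss rule: letters.induct)
  case (1 n j)
  then show ?case by (simp add: sorted_wrt_iff_nth_less)
next
  case (2 n j ss)
  then show ?case by (auto simp: set_letters dest!: plus_set_ge)
qed simp

lemma distinct_letters: "distinct (letters n j ss)"
proof -
  have "sorted_wrt (\<lambda>l u. letter_rank (j + length ss) l < letter_rank (j + length ss) u) (letters n j ss)"
    by (rule sorted_letters) simp
  then show ?thesis
    unfolding sorted_wrt_iff_nth_less distinct_conv_nth
    by (metis less_irrefl linorder_neqE_nat)
qed

lemma rank_letters_ge:
  "j + length ss \<le> m \<Longrightarrow> l \<in> set (letters n j ss) \<Longrightarrow> j \<le> letter_rank m l"
  by (auto simp: set_letters dest: plus_set_ge)

lemma inj_on_letter_rank: "j + length ss \<le> m \<Longrightarrow> inj_on (letter_rank m) (set (letters n j ss))"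
  by (auto simp: set_letters inj_on_def dest: plus_set_less)

text \<open>Replaces the position in the current word, which changes during a history, by a
  comparison of ranks, which does not.\<close>

lemma take_sorted_wrt:
  assumes "sorted_wrt (\<lambda>l u. (r l :: nat) < r u) w" "p < length w"
  shows "set (take p w) = {u \<in> set w. r u < r (w ! p)}"
proof -
  have "r (w ! i) < r (w ! p) \<longleftrightarrow> i < p" if "i < length w" for i
    using sorted_wrt_nth_less[OF assms(1)] that assms(2)
    by (metis linorder_neqE_nat order_less_asym order_less_irrefl)
  note * = this
  show ?thesis
  proof (intro set_eqI iffI)
    fix u assume "u \<in> set (take p w)"
    then obtain i where "i < p" "u = w ! i" using assms(2) by (auto simp: in_set_conv_nth)
    then show "u \<in> {u \<in> set w. r u < r (w ! p)}" using *[of i] assms(2) by simp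
  next
    fix u assume "u \<in> {u \<in> set w. r u < r (w ! p)}"
    then obtain i where "i < length w" "u = w ! i" "r u < r (w ! p)" by (auto simp: in_set_conv_nth)
    then show "u \<in> set (take p w)" using *[of i] assms(2) by (auto simp: in_set_conv_nth)
  qed
qed

text \<open>A creation at \<open>j\<close> adds the letter \<open>New j\<close>, but no annihilation
  in \<open>ss\<close> can take it: those stand to the right of \<open>j\<close> and reach only
  letters further right.\<close>

lemma pairings_Plus:
  assumes "Suc j + length ss \<le> m"
  shows "pairings n j (Plus # ss) m = pairings n (Suc j) ss m"
proof -
  have "New j \<noteq> a i" if "i < letter_rank m (a i)" "i \<in> minus_set (Suc j) ss" for a i
  proof
    assume "New j = a i"
    then have "i < letter_rank m (New j)" using that by simp
    then show False using minus_set_ge[OF that(2)] by simp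
  qed
  then show ?thesis by (fastforce simp: pairings_def minus_set_Cons)
qed

text \<open>The choices made determine everything else: \<open>a\<close> alone fixes the final word,
  the deleted letters and the recorded factors. The list \<open>F\<close> enters only through
  products with an arbitrary weight \<open>g\<close>, because its order records the course of the
  history while the factors commute.\<close>

lemma history_invariant:
  assumes "(w, a, F, D) \<in> set (histories_from n j ss)" "j + length ss \<le> m"
  shows "a \<in> pairings n j ss m \<and> w = survivors n j ss a \<and> set D = a ` minus_set j ss \<and>
    (\<forall>g::letter \<times> letter \<Rightarrow> complex. prod_list (map g F) =
      (\<Prod>i\<in>minus_set j ss. \<Prod>u\<in>passed n j ss m a i. g (a i, u)))"
  using assms
proof (induction ss arbitrary: j w a F D)
  case Nil
  then show ?case by (auto simp: pairings_def survivors_def)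
next
  case (Cons s ss)
  obtain w0 a0 F0 D0 where c0: "(w0, a0, F0, D0) \<in> set (histories_from n (Suc j) ss)"
    and step: "(w, a, F, D) \<in> set (history_step s j (w0, a0, F0, D0))"
    using Cons.prems(1) by auto
  have m: "Suc j + length ss \<le> m" using Cons.prems by simp
  have IH1: "a0 \<in> pairings n (Suc j) ss m" and IH2: "w0 = survivors n (Suc j) ss a0"
    and IH3: "set D0 = a0 ` minus_set (Suc j) ss"
    and IH4: "prod_list (map g F0) =
      (\<Prod>i\<in>minus_set (Suc j) ss. \<Prod>u\<in>passed n (Suc j) ss m a0 i. g (a0 i, u))"
    for g :: "letter \<times> letter \<Rightarrow> complex"
    using Cons.IH[OF c0 m] by auto
  have jm: "j \<notin> minus_set (Suc j) ss" by (auto dest: minus_set_ge)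
  have a0j: "a0 j = New j" using IH1 jm by (auto simp: pairings_def)
  show ?case
  proof (cases s)
    case Plus
    with step have c: "w = New j # w0" "a = a0" "F = F0" "D = D0"
      using a0j by (auto simp: fun_upd_idem)
    have "New j \<notin> a0 ` minus_set (Suc j) ss"
    proof
      assume "New j \<in> a0 ` minus_set (Suc j) ss"
      then obtain i where i: "i \<in> minus_set (Suc j) ss" "a0 i = New j" by auto
      then have "i < letter_rank m (New j)" using IH1 unfolding pairings_def by fastforce
      then show False using minus_set_ge[OF i(1)] by simp
    qed
    then have "w = survivors n j (s # ss) a"
      using IH2 c Plus by (simp add: survivors_def minus_set_Cons)
    moreover have "passed n j (s # ss) m a0 i = passed n (Suc j) ss m a0 i" if "i \<in> minus_set (Suc j) ss" for i
      using that Plus by (auto simp: passed_def minus_set_Cons dest: minus_set_ge)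
    ultimately show ?thesis
      using IH1 IH3 IH4 c Plus pairings_Plus[OF m] by (simp add: minus_set_Cons)
  next
    case Minus
    with step obtain p where p: "p < length w0" and c: "w = take p w0 @ drop (Suc p) w0"
      "a = a0(j := w0 ! p)" "F = map (\<lambda>u. (w0 ! p, u)) (take p w0) @ F0" "D = w0 ! p # D0"
      by auto
    have dist: "distinct w0" unfolding IH2 survivors_def using distinct_letters by simp
    have srt: "sorted_wrt (\<lambda>l u. letter_rank m l < letter_rank m u) w0"
      unfolding IH2 survivors_def using sorted_letters[OF m] by (rule sorted_wrt_filter)
    have w0p: "w0 ! p \<in> set (letters n (Suc j) ss)" "w0 ! p \<notin> a0 ` minus_set (Suc j) ss"
      using nth_mem[OF p] unfolding IH2 survivors_def by auto
    have img: "a ` minus_set (Suc j) ss = a0 ` minus_set (Suc j) ss"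
      unfolding c(2) by (rule image_cong) (auto dest: minus_set_ge)
    have img2: "a ` minus_set j (s # ss) = insert (w0 ! p) (a0 ` minus_set (Suc j) ss)"
      using Minus img c by (auto simp: minus_set_Cons)
    have aeq: "a i = a0 i" if "i \<in> minus_set (Suc j) ss" for i using that jm c by auto
    have "inj_on a (minus_set (Suc j) ss)"
      using IH1 aeq by (auto simp: pairings_def inj_on_def)
    then have "inj_on a (minus_set j (s # ss))"
      using Minus w0p(2) img jm c(2) by (auto simp: minus_set_Cons)
    moreover have "a i \<in> set (letters n j (s # ss)) \<and> i < letter_rank m (a i)" if "i \<in> minus_set j (s # ss)" for i
    proof (cases "i = j")
      case True
      then show ?thesis using w0p(1) rank_letters_ge[OF m w0p(1)] c(2) Minus by auto
    next
      case False
      then have "i \<in> minus_set (Suc j) ss" using that Minus by (auto simp: minus_set_Cons)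
      then show ?thesis using IH1 aeq Minus by (auto simp: pairings_def)
    qed
    moreover have "a i = New i" if "i \<notin> minus_set j (s # ss)" for i
      using that IH1 c(2) Minus by (auto simp: pairings_def minus_set_Cons)
    ultimately have 1: "a \<in> pairings n j (s # ss) m" by (auto simp: pairings_def)
    have "w = filter (\<lambda>l. l \<noteq> w0 ! p) w0"
    proof -
      have w0: "w0 = take p w0 @ w0 ! p # drop (Suc p) w0" using p by (rule id_take_nth_drop)
      then have "distinct (take p w0 @ w0 ! p # drop (Suc p) w0)" using dist by metis
      then have "\<forall>x\<in>set (take p w0). x \<noteq> w0 ! p" "\<forall>x\<in>set (drop (Suc p) w0). x \<noteq> w0 ! p" by auto
      then have "filter (\<lambda>l. l \<noteq> w0 ! p) (take p w0 @ w0 ! p # drop (Suc p) w0) = w"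
        unfolding c(1) by (simp add: filter_id_conv)
      then show ?thesis using w0 by metis
    qed
    then have 2: "w = survivors n j (s # ss) a"
      unfolding IH2 survivors_def img2 using Minus by (simp add: conj_commute)
    have 3: "set D = a ` minus_set j (s # ss)"
      unfolding c(4) img2 using IH3 by simp
    have 4: "prod_list (map g F) = (\<Prod>i\<in>minus_set j (s # ss). \<Prod>u\<in>passed n j (s # ss) m a i. g (a i, u))"
      for g :: "letter \<times> letter \<Rightarrow> complex"
    proof -
      \<comment> \<open>When \<open>j\<close> acts, all annihilations of \<open>ss\<close> have
        already acted, so the current word lists the letters not yet taken, in the order of
        rank.\<close>
      have A: "set (take p w0) = passed n j (s # ss) m a j"
      proof -
        have "{i' \<in> minus_set j (s # ss). j < i'} = minus_set (Suc j) ss"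
          using Minus by (auto simp: minus_set_Cons dest: minus_set_ge)
        then have "passed n j (s # ss) m a j = {u \<in> set (letters n (Suc j) ss). j < letter_rank m u \<and>
            letter_rank m u < letter_rank m (w0 ! p) \<and> u \<notin> a0 ` minus_set (Suc j) ss}"
          using c(2) Minus img by (simp add: passed_def)
        also have "\<dots> = {u \<in> set w0. letter_rank m u < letter_rank m (w0 ! p)}"
          unfolding IH2 survivors_def using rank_letters_ge[OF m] by (auto simp: Suc_le_eq)
        finally show ?thesis using take_sorted_wrt[OF srt p] by simp
      qed
      \<comment> \<open>Factors recorded before stay as they are, because \<open>passed\<close> at
        \<open>i\<close> depends only on annihilations to the right of \<open>i\<close>.\<close>
      have B: "passed n j (s # ss) m a i = passed n (Suc j) ss m a0 i" if "i \<in> minus_set (Suc j) ss" for i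
      proof -
        have "a ` {i' \<in> minus_set j (s # ss). i < i'} = a0 ` {i' \<in> minus_set (Suc j) ss. i < i'}"
          using that aeq Minus by (intro image_cong) (auto simp: minus_set_Cons dest: minus_set_ge)
        then show ?thesis using that aeq Minus by (simp add: passed_def)
      qed
      have "prod_list (map g F) = prod_list (map (\<lambda>u. g (w0 ! p, u)) (take p w0)) * prod_list (map g F0)"
        by (simp add: c(3) comp_def)
      also have "prod_list (map (\<lambda>u. g (w0 ! p, u)) (take p w0)) = (\<Prod>u\<in>passed n j (s # ss) m a j. g (a j, u))"
        unfolding A[symmetric] using dist c(2) by (simp add: prod.distinct_set_conv_list[symmetric])
      also have "prod_list (map g F0) = (\<Prod>i\<in>minus_set (Suc j) ss. \<Prod>u\<in>passed n j (s # ss) m a i. g (a i, u))"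
        unfolding IH4 by (intro prod.cong refl) (simp_all add: B aeq)
      finally show ?thesis using jm Minus by (simp add: minus_set_Cons)
    qed
    from 1 2 3 4 show ?thesis by blast
  qed
qed

lemma finite_letters_fun: "finite (pairings n j ss m)"
proof (rule finite_subset)
  let ?f = "\<lambda>b i. if i \<in> minus_set j ss then b i else New i"
  show "pairings n j ss m \<subseteq> ?f ` (minus_set j ss \<rightarrow>\<^sub>E set (letters n j ss))"
  proof
    fix a assume a: "a \<in> pairings n j ss m"
    then have "a = ?f (restrict a (minus_set j ss))" by (auto simp: pairings_def fun_eq_iff)
    moreover have "restrict a (minus_set j ss) \<in> minus_set j ss \<rightarrow>\<^sub>E set (letters n j ss)"
      using a by (auto simp: pairings_def)
    ultimately show "a \<in> ?f ` (minus_set j ss \<rightarrow>\<^sub>E set (letters n j ss))" by blast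
  qed
qed (auto intro!: finite_imageI finite_PiE)

text \<open>Histories correspond one to one to pairings. The bijection is stated as an equality of
  sums, so that the induction can keep a list on one side and a set on the other. At an
  annihilation, choosing a position in the word amounts to choosing a surviving letter.\<close>

lemma sum_list_histories:
  fixes g :: "(nat \<Rightarrow> letter) \<Rightarrow> complex"
  assumes "j + length ss \<le> m"
  shows "(\<Sum>c\<leftarrow>histories_from n j ss. g (fst (snd c))) = (\<Sum>a\<in>pairings n j ss m. g a)"
  using assms
proof (induction ss arbitrary: j g)
  case Nil
  have "pairings n j [] m = {New}" by (auto simp: pairings_def)
  then show ?case by simp
next
  case (Cons s ss)
  have m: "Suc j + length ss \<le> m" using Cons.prems by simp
  have jm: "j \<notin> minus_set (Suc j) ss" by (auto dest: minus_set_ge)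
  have flat: "(\<Sum>c\<leftarrow>concat (map f cs). h c) = (\<Sum>c\<leftarrow>cs. \<Sum>d\<leftarrow>f c. h d)"
    for f :: "history \<Rightarrow> history list" and cs and h :: "history \<Rightarrow> complex"
    by (induction cs) auto
  define alive where "alive a = set (survivors n (Suc j) ss a)" for a
  show ?case
  proof (cases s)
    case Plus
    have "(\<Sum>c\<leftarrow>histories_from n j (s # ss). g (fst (snd c))) = (\<Sum>c\<leftarrow>histories_from n (Suc j) ss. g (fst (snd c)))"
    proof -
      have "(\<Sum>d\<leftarrow>history_step s j c. g (fst (snd d))) = g (fst (snd c))"
        if "c \<in> set (histories_from n (Suc j) ss)" for c
      proof -
        obtain w a F D where c: "c = (w, a, F, D)" by (cases c)
        have "a \<in> pairings n (Suc j) ss m" using history_invariant[OF _ m] that c by blast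
        then have "a j = New j" using jm by (auto simp: pairings_def)
        then show ?thesis using Plus c by (simp add: fun_upd_idem)
      qed
      then show ?thesis by (simp add: flat cong: map_cong)
    qed
    then show ?thesis using Cons.IH[OF m] Plus pairings_Plus[OF m] by simp
  next
    case Minus
    have "(\<Sum>c\<leftarrow>histories_from n j (s # ss). g (fst (snd c))) =
      (\<Sum>c\<leftarrow>histories_from n (Suc j) ss. \<Sum>l\<in>alive (fst (snd c)). g ((fst (snd c))(j := l)))"
    proof -
      have "(\<Sum>d\<leftarrow>history_step s j c. g (fst (snd d))) = (\<Sum>l\<in>alive (fst (snd c)). g ((fst (snd c))(j := l)))"
        if "c \<in> set (histories_from n (Suc j) ss)" for c
      proof -
        obtain w a F D where c: "c = (w, a, F, D)" by (cases c)
        have w: "w = survivors n (Suc j) ss a" using history_invariant[OF _ m] that c by blast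
        then have "distinct w" unfolding survivors_def using distinct_letters by simp
        have "(\<Sum>d\<leftarrow>history_step s j c. g (fst (snd d))) = (\<Sum>p\<leftarrow>[0..<length w]. g (a(j := w ! p)))"
          using Minus by (simp add: c comp_def)
        also have "\<dots> = (\<Sum>p<length w. g (a(j := w ! p)))"
          by (simp add: sum_list_distinct_conv_sum_set atLeast0LessThan)
        also have "\<dots> = (\<Sum>l\<in>set w. g (a(j := l)))"
          using bij_betw_nth[OF \<open>distinct w\<close> refl refl] by (rule sum.reindex_bij_betw)
        finally show ?thesis by (simp add: c alive_def w)
      qed
      then show ?thesis by (simp add: flat cong: map_cong)
    qed
    also have "\<dots> = (\<Sum>a\<in>pairings n (Suc j) ss m. \<Sum>l\<in>alive a. g (a(j := l)))"
      using Cons.IH[OF m, of "\<lambda>a. \<Sum>l\<in>alive a. g (a(j := l))"] by simp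
    also have "\<dots> = (\<Sum>(a, l)\<in>Sigma (pairings n (Suc j) ss m) alive. g (a(j := l)))"
      by (rule sum.Sigma) (auto simp: alive_def finite_letters_fun)
    also have "\<dots> = (\<Sum>b\<in>pairings n j (s # ss) m. g b)"
    \<comment> \<open>A pairing for the longer list is a pairing for the shorter one together with
      the letter taken by \<open>j\<close>. Resetting the value at \<open>j\<close> to
      \<open>New j\<close> restores the normal form outside the annihilations.\<close>
    proof (rule sum.reindex_bij_witness[where j="\<lambda>(a, l). a(j := l)" and i="\<lambda>b. (b(j := New j), b j)"])
      fix b assume b: "b \<in> pairings n j (s # ss) m"
      then have b': "b j \<in> set (letters n (Suc j) ss)" "b i \<in> set (letters n (Suc j) ss)" "inj_on b (minus_set (Suc j) ss)"
        "i < letter_rank m (b i)" "b j \<notin> b ` minus_set (Suc j) ss" if "i \<in> minus_set (Suc j) ss" for i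
        using that Minus jm by (auto simp: pairings_def minus_set_Cons)
      have bj: "b j \<in> set (letters n (Suc j) ss)" "b j \<notin> b ` minus_set (Suc j) ss" "inj_on b (minus_set (Suc j) ss)"
        using b Minus jm by (auto simp: pairings_def minus_set_Cons)
      have eq: "(b(j := New j)) ` minus_set (Suc j) ss = b ` minus_set (Suc j) ss"
        by (rule image_cong) (auto dest: minus_set_ge)
      have "inj_on (b(j := New j)) (minus_set (Suc j) ss)"
        using bj(3) by (rule inj_on_cong[THEN iffD1, rotated]) (auto dest: minus_set_ge)
      then have "b(j := New j) \<in> pairings n (Suc j) ss m"
        using b Minus jm by (auto simp: pairings_def minus_set_Cons)
      moreover have "b j \<in> alive (b(j := New j))"
        using bj unfolding alive_def survivors_def eq by simp
      ultimately show "(b(j := New j), b j) \<in> Sigma (pairings n (Suc j) ss m) alive" by simp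
    next
      fix c assume "c \<in> Sigma (pairings n (Suc j) ss m) alive"
      then obtain a l where c: "c = (a, l)" and a: "a \<in> pairings n (Suc j) ss m" and l: "l \<in> alive a" by auto
      have l': "l \<in> set (letters n (Suc j) ss)" "l \<notin> a ` minus_set (Suc j) ss"
        using l by (auto simp: alive_def survivors_def)
      have eq: "(a(j := l)) ` minus_set (Suc j) ss = a ` minus_set (Suc j) ss"
        by (rule image_cong) (auto dest: minus_set_ge)
      have "inj_on a (minus_set (Suc j) ss)" using a by (simp add: pairings_def)
      then have "inj_on (a(j := l)) (minus_set (Suc j) ss)"
        by (rule inj_on_cong[THEN iffD1, rotated]) (auto dest: minus_set_ge)
      then have "inj_on (a(j := l)) (minus_set j (s # ss))"
        using l'(2) eq jm Minus by (auto simp: minus_set_Cons)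
      moreover have "j < letter_rank m l" using rank_letters_ge[OF m l'(1)] by simp
      ultimately show "(case c of (a, l) \<Rightarrow> a(j := l)) \<in> pairings n j (s # ss) m"
        using a l' Minus by (auto simp: c pairings_def minus_set_Cons)
      have "a j = New j" using a jm by (auto simp: pairings_def)
      then show "((case c of (a, l) \<Rightarrow> a(j := l))(j := New j), (case c of (a, l) \<Rightarrow> a(j := l)) j) = c"
        by (simp add: c fun_upd_idem)
    qed auto
    finally show ?thesis .
  qed
qed

section \<open>Symmetrization\<close>

lemma measurable_compose_permutes:
  assumes "\<sigma> permutes {..<n}"
  shows "(\<lambda>x. x \<circ> \<sigma>) \<in> power_measure M n \<rightarrow>\<^sub>M power_measure M n"
proof (rule measurable_cong[THEN iffD2])
  show "x \<circ> \<sigma> = (\<lambda>i\<in>{..<n}. x (\<sigma> i))" if "x \<in> space (power_measure M n)" for x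
    using that permutes_not_in[OF assms] by (auto simp: fun_eq_iff space_PiM PiE_iff extensional_def)
  show "(\<lambda>x. \<lambda>i\<in>{..<n}. x (\<sigma> i)) \<in> power_measure M n \<rightarrow>\<^sub>M power_measure M n"
    using permutes_in_image[OF assms] by (intro measurable_restrict measurable_component_singleton) auto
qed

lemma distr_compose_permutes:
  assumes M: "sigma_finite_measure M" and \<sigma>: "\<sigma> permutes {..<n}"
  shows "distr (power_measure M n) (power_measure M n) (\<lambda>x. x \<circ> \<sigma>) = power_measure M n"
proof -
  have "distr (power_measure M n) (power_measure M n) (\<lambda>x. x \<circ> \<sigma>) =
    distr (power_measure M n) (power_measure M n) (\<lambda>x. \<lambda>i\<in>{..<n}. x (\<sigma> i))"
    using permutes_not_in[OF \<sigma>]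
    by (intro distr_cong) (auto simp: fun_eq_iff space_PiM PiE_iff extensional_def)
  also have "\<dots> = power_measure M n"
    by (rule distr_PiM_reindex_bij[OF M _ permutes_imp_bij[OF \<sigma>]]) simp
  finally show ?thesis .
qed

lemma AE_compose_permutes:
  assumes "sigma_finite_measure M" "\<sigma> permutes {..<n}" "AE x in power_measure M n. P x"
  shows "AE x in power_measure M n. P (x \<circ> \<sigma>)"
  using assms by (intro AE_distrD[OF measurable_compose_permutes[OF assms(2)]])
    (simp only: distr_compose_permutes)

lemma L2_compose_permutes:
  assumes "sigma_finite_measure M" and \<sigma>: "\<sigma> permutes {..<n}" and f: "f \<in> L2 (power_measure M n)"
  shows "(\<lambda>x. f (x \<circ> \<sigma>)) \<in> L2 (power_measure M n)"
proof -
  have "f \<in> L2 (distr (power_measure M n) (power_measure M n) (\<lambda>x. x \<circ> \<sigma>))"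
    using f by (simp only: distr_compose_permutes[OF assms(1,2)])
  then show ?thesis
    unfolding L2_def
    by (auto intro: measurable_compose[OF measurable_compose_permutes[OF \<sigma>]]
      integrable_distr[OF measurable_compose_permutes[OF \<sigma>]])
qed

lemma integral_compose_permutes:
  fixes f :: "_ \<Rightarrow> 'b::{banach, second_countable_topology}"
  assumes "sigma_finite_measure M" and \<sigma>: "\<sigma> permutes {..<n}" and f: "f \<in> borel_measurable (power_measure M n)"
  shows "(LINT x|power_measure M n. f (x \<circ> \<sigma>)) = (LINT x|power_measure M n. f x)"
  by (subst (2) distr_compose_permutes[OF assms(1,2), symmetric])
    (rule integral_distr[OF measurable_compose_permutes[OF \<sigma>] f, symmetric])

text \<open>An adjacent swap preserves the order of every pair of positions except
  \<open>(i, i + 1)\<close>, so conjugation with it matches all other inversions of the two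
  permutations. The exceptional pair is an inversion for exactly one of them, which supplies or
  cancels exactly one factor.\<close>

lemma perm_phase_transpose:
  fixes n i :: nat
  defines "\<tau> \<equiv> Transposition.transpose i (Suc i)"
  assumes i: "Suc i < n" and \<pi>: "\<pi> permutes {..<n}"
    and unit: "R (x i) (x (Suc i)) * R (x (Suc i)) (x i) = 1"
  shows "R (x i) (x (Suc i)) * perm_phase R n (\<pi> \<circ> \<tau>) (x \<circ> \<tau>) = perm_phase R n \<pi> x"
proof -
  define A where "A = {(a, b). a < b \<and> b < n \<and> \<pi> a > \<pi> b}"
  define B where "B = {(a, b). a < b \<and> b < n \<and> (\<pi> \<circ> \<tau>) a > (\<pi> \<circ> \<tau>) b}"
  have fin: "finite A" "finite B"
    by (rule finite_subset[of _ "{..<n} \<times> {..<n}"], auto simp: A_def B_def)+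
  have \<tau>: "\<tau> i = Suc i" "\<tau> (Suc i) = i" "\<And>a. a \<noteq> i \<Longrightarrow> a \<noteq> Suc i \<Longrightarrow> \<tau> a = a"
    by (simp_all add: \<tau>_def)
  have \<tau>\<tau>: "\<tau> (\<tau> a) = a" for a by (simp add: \<tau>_def)
  have \<tau>n: "\<tau> a < n \<longleftrightarrow> a < n" for a using i \<tau> by (cases "a = i"; cases "a = Suc i") auto
  have mono: "\<tau> a < \<tau> b" if "a < b" "(a, b) \<noteq> (i, Suc i)" for a b
    using that \<tau> by (cases "a = i"; cases "a = Suc i"; cases "b = i"; cases "b = Suc i") auto
  have ne: "(\<tau> a, \<tau> b) \<noteq> (i, Suc i)" if "a < b" for a b
    using that \<tau>\<tau>[of a] \<tau>\<tau>[of b] \<tau> by (metis Suc_n_not_le_n less_imp_le prod.inject)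
  have "(\<Prod>(a, b)\<in>B - {(i, Suc i)}. R (x (\<tau> a)) (x (\<tau> b))) = (\<Prod>(a, b)\<in>A - {(i, Suc i)}. R (x a) (x b))"
  proof (rule prod.reindex_bij_witness[where i="\<lambda>(a, b). (\<tau> a, \<tau> b)" and j="\<lambda>(a, b). (\<tau> a, \<tau> b)"])
    fix p assume "p \<in> B - {(i, Suc i)}"
    then obtain a b where p: "p = (a, b)" "a < b" "b < n" "\<pi> (\<tau> a) > \<pi> (\<tau> b)" "(a, b) \<noteq> (i, Suc i)"
      by (auto simp: B_def)
    then show "(case p of (a, b) \<Rightarrow> (\<tau> a, \<tau> b)) \<in> A - {(i, Suc i)}"
      using mono[of a b] ne[of a b] by (auto simp: A_def \<tau>n)
  next
    fix p assume "p \<in> A - {(i, Suc i)}"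
    then obtain a b where p: "p = (a, b)" "a < b" "b < n" "\<pi> a > \<pi> b" "(a, b) \<noteq> (i, Suc i)"
      by (auto simp: A_def)
    then show "(case p of (a, b) \<Rightarrow> (\<tau> a, \<tau> b)) \<in> B - {(i, Suc i)}"
      using mono[of a b] ne[of a b] by (auto simp: B_def \<tau>n \<tau>\<tau>)
  qed (auto simp: \<tau>\<tau>)
  then have eq: "(\<Prod>(a, b)\<in>B - {(i, Suc i)}. R ((x \<circ> \<tau>) a) ((x \<circ> \<tau>) b)) = (\<Prod>(a, b)\<in>A - {(i, Suc i)}. R (x a) (x b))"
    by simp
  have inj: "\<pi> i \<noteq> \<pi> (Suc i)" using permutes_inj[OF \<pi>] by (metis inj_eq n_not_Suc_n)
  show ?thesis
  proof (cases "\<pi> i > \<pi> (Suc i)")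
    case True
    then have "(i, Suc i) \<in> A" "(i, Suc i) \<notin> B" using i by (auto simp: A_def B_def \<tau>)
    then show ?thesis
      using eq fin unfolding perm_phase_def A_def[symmetric] B_def[symmetric]
      by (simp add: prod.remove[of A "(i, Suc i)"])
  next
    case False
    then have "(i, Suc i) \<notin> A" "(i, Suc i) \<in> B" using i inj by (auto simp: A_def B_def \<tau>)
    then show ?thesis
      using eq fin unit unfolding perm_phase_def A_def[symmetric] B_def[symmetric]
      by (simp add: prod.remove[of B "(i, Suc i)"] \<tau> mult.assoc[symmetric])
  qed
qed

text \<open>Reindexing the sum by \<open>\<pi> \<circ> \<tau>\<close> reduces the symmetry to the
  behaviour of one phase under a single swap; the relation \<open>unit\<close> enters only at the
  pair being swapped.\<close>

lemma sym_proj_transpose: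
  assumes i: "Suc i < n" and unit: "R (x i) (x (Suc i)) * R (x (Suc i)) (x i) = 1"
  shows "sym_proj R n f x = R (x i) (x (Suc i)) * sym_proj R n f (x(i := x (Suc i), Suc i := x i))"
proof -
  define \<tau> where "\<tau> = Transposition.transpose i (Suc i)"
  have \<tau>: "\<tau> permutes {..<n}" unfolding \<tau>_def using i by (intro permutes_swap_id) auto
  have \<tau>\<tau>: "\<tau> \<circ> \<tau> = id" by (simp add: \<tau>_def)
  have x: "x(i := x (Suc i), Suc i := x i) = x \<circ> \<tau>"
    by (auto simp: fun_eq_iff \<tau>_def transpose_def)
  have "R (x i) (x (Suc i)) * (\<Sum>\<pi> | \<pi> permutes {..<n}. perm_phase R n \<pi> (x \<circ> \<tau>) * f (x \<circ> \<tau> \<circ> inv \<pi>)) =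
    (\<Sum>\<pi> | \<pi> permutes {..<n}. R (x i) (x (Suc i)) * (perm_phase R n (\<pi> \<circ> \<tau>) (x \<circ> \<tau>) * f (x \<circ> \<tau> \<circ> inv (\<pi> \<circ> \<tau>))))"
    unfolding sum_distrib_left
    by (rule sum.reindex_bij_witness[where i="\<lambda>\<pi>. \<pi> \<circ> \<tau>" and j="\<lambda>\<pi>. \<pi> \<circ> \<tau>"])
      (auto simp: comp_assoc \<tau>\<tau> permutes_compose[OF \<tau>])
  also have "\<dots> = (\<Sum>\<pi> | \<pi> permutes {..<n}. perm_phase R n \<pi> x * f (x \<circ> inv \<pi>))"
  proof (rule sum.cong[OF refl], clarify)
    fix \<pi> assume \<pi>: "\<pi> permutes {..<n}"
    have "inv (\<pi> \<circ> \<tau>) = \<tau> \<circ> inv \<pi>"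
      using permutes_bij[OF \<pi>] permutes_bij[OF \<tau>] \<tau>\<tau> by (simp add: o_inv_distrib inv_unique_comp)
    then have "x \<circ> \<tau> \<circ> inv (\<pi> \<circ> \<tau>) = x \<circ> (\<tau> \<circ> \<tau>) \<circ> inv \<pi>" by (simp add: comp_assoc)
    then show "R (x i) (x (Suc i)) * (perm_phase R n (\<pi> \<circ> \<tau>) (x \<circ> \<tau>) * f (x \<circ> \<tau> \<circ> inv (\<pi> \<circ> \<tau>))) =
      perm_phase R n \<pi> x * f (x \<circ> inv \<pi>)"
      using perm_phase_transpose[OF i \<pi>, of R x, OF unit] by (simp add: \<tau>\<tau> \<tau>_def[symmetric] mult.assoc[symmetric])
  qed
  finally show ?thesis unfolding sym_proj_def x by simp
qed

lemma sym_proj_add: "sym_proj R n (\<lambda>x. f x + g x) x = sym_proj R n f x + sym_proj R n g x"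
  by (simp add: sym_proj_def distrib_left sum.distrib add_divide_distrib)

lemma sym_proj_scale: "sym_proj R n (\<lambda>x. c * f x) x = c * sym_proj R n f x"
  by (simp add: sym_proj_def sum_distrib_left mult_ac)

lemma sym_proj_cong_AE:
  assumes M: "sigma_finite_measure M" and ae: "AE x in power_measure M n. f x = g x"
  shows "AE x in power_measure M n. sym_proj R n f x = sym_proj R n g x"
proof -
  have "AE x in power_measure M n. \<forall>\<pi>\<in>{\<pi>. \<pi> permutes {..<n}}. f (x \<circ> inv \<pi>) = g (x \<circ> inv \<pi>)"
    by (intro AE_finite_allI finite_permutations)
      (auto intro: AE_compose_permutes[OF M permutes_inv ae])
  then show ?thesis by eventually_elim (simp add: sym_proj_def)
qed

text \<open>What the Fock space argument takes from \<open>JQ\<close>: it is measurable, bounded and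
  hermitian, and exchanging two neighbours twice is trivial. The last property may fail where two
  first coordinates coincide and the value is \<open>\<eta>\<close>, hence the almost-everywhere
  form; since \<open>\<eta>\<close> may exceed 1 in absolute value, a bound \<open>C\<close>
  replaces unimodularity.\<close>

locale fock_setup =
  fixes M :: "'y measure" and R :: "'y \<Rightarrow> 'y \<Rightarrow> complex" and C :: real
  assumes sf: "sigma_finite_measure M"
    and R_meas: "(\<lambda>(x, y). R x y) \<in> borel_measurable (M \<Otimes>\<^sub>M M)"
    and R_bound: "norm (R x y) \<le> C" and C_ge: "1 \<le> C"
    and R_herm: "R x y = cnj (R y x)"
    and R_unit: "Suc i < n \<Longrightarrow> AE x in power_measure M n. R (x i) (x (Suc i)) * R (x (Suc i)) (x i) = 1"
begin

lemma R_measurable: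
  assumes "u \<in> N \<rightarrow>\<^sub>M M" "v \<in> N \<rightarrow>\<^sub>M M"
  shows "(\<lambda>x. R (u x) (v x)) \<in> borel_measurable N"
  using measurable_compose[OF measurable_Pair[OF assms] R_meas] by simp

lemma norm_prod_R_le: "finite A \<Longrightarrow> norm (\<Prod>p\<in>A. R (u p) (v p)) \<le> C ^ card A"
  by (simp add: prod_norm[symmetric] prod_mono R_bound order_trans[OF prod_mono, of A _ "\<lambda>_. C"])

lemma perm_phase_measurable: "perm_phase R n \<pi> \<in> borel_measurable (power_measure M n)"
  unfolding perm_phase_def case_prod_beta
  by (intro borel_measurable_prod R_measurable measurable_component_singleton) auto

lemma perm_phase_bound: "norm (perm_phase R n \<pi> x) \<le> C ^ card {(i, j). i < j \<and> j < n \<and> \<pi> i > \<pi> j}"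
  unfolding perm_phase_def case_prod_beta
  by (rule norm_prod_R_le, rule finite_subset[of _ "{..<n} \<times> {..<n}"]) auto

lemma L2_perm_term:
  assumes "\<pi> permutes {..<n}" "f \<in> L2 (power_measure M n)"
  shows "(\<lambda>x. perm_phase R n \<pi> x * f (x \<circ> inv \<pi>)) \<in> L2 (power_measure M n)"
  by (rule L2_mult_bounded[OF L2_compose_permutes[OF sf permutes_inv[OF assms(1)] assms(2)]
    perm_phase_measurable perm_phase_bound])

lemma sym_proj_L2:
  assumes "f \<in> L2 (power_measure M n)"
  shows "sym_proj R n f \<in> L2 (power_measure M n)"
proof -
  have "(\<lambda>x. (1 / of_nat (fact n)) * (\<Sum>\<pi> | \<pi> permutes {..<n}. perm_phase R n \<pi> x * f (x \<circ> inv \<pi>)))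
    \<in> L2 (power_measure M n)"
    using assms by (intro L2_scale L2_sum L2_perm_term) auto
  then show ?thesis by (simp add: sym_proj_def[abs_def])
qed

lemma sym_proj_sym_L2:
  assumes "f \<in> L2 (power_measure M n)"
  shows "sym_proj R n f \<in> sym_L2 M R n"
  unfolding sym_L2_def
proof (safe intro!: sym_proj_L2[OF assms])
  fix i assume i: "Suc i < n"
  show "AE x in power_measure M n. sym_proj R n f x =
      R (x i) (x (Suc i)) * sym_proj R n f (x(i := x (Suc i), Suc i := x i))"
    using R_unit[OF i] by eventually_elim (rule sym_proj_transpose[OF i])
qed

lemma sym_L2_add:
  assumes "f \<in> sym_L2 M R n" "g \<in> sym_L2 M R n"
  shows "(\<lambda>x. f x + g x) \<in> sym_L2 M R n"
  unfolding sym_L2_def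
proof (safe)
  show "(\<lambda>x. f x + g x) \<in> L2 (power_measure M n)" using assms by (auto simp: sym_L2_def intro: L2_add)
  fix i assume i: "Suc i < n"
  have "AE x in power_measure M n. f x = R (x i) (x (Suc i)) * f (x(i := x (Suc i), Suc i := x i))"
    "AE x in power_measure M n. g x = R (x i) (x (Suc i)) * g (x(i := x (Suc i), Suc i := x i))"
    using assms i by (auto simp: sym_L2_def)
  then show "AE x in power_measure M n. f x + g x = R (x i) (x (Suc i)) *
    (f (x(i := x (Suc i), Suc i := x i)) + g (x(i := x (Suc i), Suc i := x i)))"
    by eventually_elim (metis distrib_left)
qed

lemma sym_L2_scale:
  assumes "f \<in> sym_L2 M R n"
  shows "(\<lambda>x. c * f x) \<in> sym_L2 M R n"
  unfolding sym_L2_def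
proof (safe)
  show "(\<lambda>x. c * f x) \<in> L2 (power_measure M n)" using assms by (auto simp: sym_L2_def intro: L2_scale)
  fix i assume i: "Suc i < n"
  have "AE x in power_measure M n. f x = R (x i) (x (Suc i)) * f (x(i := x (Suc i), Suc i := x i))"
    using assms i by (auto simp: sym_L2_def)
  then show "AE x in power_measure M n. c * f x = R (x i) (x (Suc i)) *
    (c * f (x(i := x (Suc i), Suc i := x i)))"
    by eventually_elim (metis mult.left_commute)
qed

lemma sym_L2_0: "(\<lambda>x. 0) \<in> sym_L2 M R n"
  by (auto simp: sym_L2_def L2_zero)

end

section \<open>Counting and sharing of letters in a pairing\<close>

lemma count_list_Plus: "count_list ss Plus = card (plus_set j ss)"
proof (induction ss arbitrary: j)
  case (Cons s ss)
  have "j \<notin> plus_set (Suc j) ss" by (auto dest: plus_set_ge)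
  then show ?case using Cons[of "Suc j"] by (cases s) (auto simp: plus_set_Cons)
qed simp

lemma count_list_Minus: "count_list ss Minus = card (minus_set j ss)"
proof (induction ss arbitrary: j)
  case (Cons s ss)
  have "j \<notin> minus_set (Suc j) ss" by (auto dest: minus_set_ge)
  then show ?case using Cons[of "Suc j"] by (cases s) (auto simp: minus_set_Cons)
qed simp

lemma plus_minus_disjoint: "plus_set j ss \<inter> minus_set j ss = {}"
  and plus_minus_Un: "plus_set 0 ss \<union> minus_set 0 ss = {..<length ss}"
proof -
  have "s = Plus \<or> s = Minus" for s by (cases s) auto
  then show "plus_set 0 ss \<union> minus_set 0 ss = {..<length ss}" by (auto simp: plus_set_def minus_set_def)
qed (auto simp: plus_set_def minus_set_def)

abbreviation "pairs n ss \<equiv> pairings n 0 ss (length ss)"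
abbreviation "minuses ss \<equiv> minus_set 0 ss"
abbreviation "pluses ss \<equiv> plus_set 0 ss"
abbreviation "alphabet n ss \<equiv> set (letters n 0 ss)"
abbreviation "surv n ss a \<equiv> survivors n 0 ss a"

lemma distinct_survivors: "distinct (survivors n j ss a)"
  by (simp add: survivors_def distinct_letters)

lemma survivors_disjoint: "set (survivors n j ss a) \<inter> a ` minus_set j ss = {}"
  by (auto simp: survivors_def)

lemma pairingsD:
  assumes "a \<in> pairings n j ss m"
  shows "i \<notin> minus_set j ss \<Longrightarrow> a i = New i" "inj_on a (minus_set j ss)"
    "i \<in> minus_set j ss \<Longrightarrow> a i \<in> set (letters n j ss)" "i \<in> minus_set j ss \<Longrightarrow> i < letter_rank m (a i)"
  using assms by (auto simp: pairings_def)

lemma survivors_Un: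
  assumes "a \<in> pairings n j ss m"
  shows "set (survivors n j ss a) \<union> a ` minus_set j ss = set (letters n j ss)"
  using assms by (auto simp: survivors_def pairings_def)

text \<open>The letters are counted twice: as survivors and deleted letters, and as created letters
  and arguments.\<close>

lemma length_survivors:
  assumes a: "a \<in> pairings n j ss m"
  shows "n + count_list ss Plus = length (survivors n j ss a) + count_list ss Minus"
proof -
  have "length (survivors n j ss a) + card (minus_set j ss) = card (set (survivors n j ss a)) + card (a ` minus_set j ss)"
    using pairingsD(2)[OF a] by (simp add: distinct_card distinct_survivors card_image)
  also have "\<dots> = card (set (letters n j ss))"
    unfolding survivors_Un[OF a, symmetric] by (rule card_Un_disjoint[symmetric]) (auto simp: survivors_def)
  also have "\<dots> = card (plus_set j ss) + n"
    unfolding set_letters by (subst card_Un_disjoint) (auto simp: card_image inj_on_def)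
  finally show ?thesis by (simp add: count_list_Plus[of ss j] count_list_Minus[of ss j])
qed

lemma pairing_in_alphabet:
  assumes "a \<in> pairs n ss" "j < length ss"
  shows "a j \<in> alphabet n ss"
proof (cases "j \<in> minuses ss")
  case False
  then have "j \<in> pluses ss" using plus_minus_Un[of ss] assms(2) by auto
  then show ?thesis using pairingsD(1)[OF assms(1) False] by (simp add: set_letters)
qed (rule pairingsD(3)[OF assms(1)])

text \<open>Two annihilations never take the same letter and two creations never make the same one.
  This is precisely the condition under which a kernel in \<open>Linf\<close> of
  \<open>sign_measure\<close> is bounded along the pairing.\<close>

lemma pairing_fibres:
  assumes a: "a \<in> pairs n ss" and "i < length ss" "j < length ss" "i \<noteq> j" "a i = a j"
  shows "ss ! i \<noteq> ss ! j"
proof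
  assume eq: "ss ! i = ss ! j"
  show False
  proof (cases "i \<in> minuses ss")
    case True
    then have "j \<in> minuses ss" using eq assms by (simp add: minus_set_def)
    then show False using True pairingsD(2)[OF a] assms by (auto simp: inj_on_def)
  next
    case False
    then have "j \<notin> minuses ss" using eq assms by (simp add: minus_set_def)
    then show False using False pairingsD(1)[OF a] assms by auto
  qed
qed

lemma borel_measurable_power2_ennreal:
  "f \<in> borel_measurable N \<Longrightarrow> (\<lambda>x. (f x :: ennreal)\<^sup>2) \<in> borel_measurable N"
  by measurable

lemma AE_PiM_coordinate:
  assumes M: "sigma_finite_measure M" and L: "finite L" "l \<in> L" and ae: "AE y in M. P y"
  shows "AE e in PiM L (\<lambda>_. M). P (e l)"
proof -
  interpret M: product_sigma_finite "\<lambda>_. M" by (rule product_sigma_finite_const[OF M])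
  have "distr (PiM {0::nat} (\<lambda>_. M)) M (\<lambda>s. s 0) = M" by (rule M.distr_singleton)
  with ae have "AE y in distr (PiM {0::nat} (\<lambda>_. M)) M (\<lambda>s. s 0). P y" by metis
  then have "AE s in PiM {0::nat} (\<lambda>_. M). P (s 0)"
    by (rule AE_distrD[rotated]) (rule measurable_component_singleton, simp)
  from AE_PiM_pullback[OF M M absolutely_continuous_id measurable_ident_sets[OF refl] L(1), of "\<lambda>_. l", OF _ _ this]
  show ?thesis using L by simp
qed

section \<open>The integral attached to a single pairing\<close>

context fock_setup
begin

interpretation P: product_sigma_finite "\<lambda>_. M"
  by (rule product_sigma_finite_const[OF sf])

definition phase :: "nat \<Rightarrow> sign list \<Rightarrow> (nat \<Rightarrow> letter) \<Rightarrow> (letter \<Rightarrow> 'y) \<Rightarrow> complex"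
  where "phase n ss a e = (\<Prod>i\<in>minuses ss. \<Prod>u\<in>passed n 0 ss (length ss) a i. R (e (a i)) (e u))"

definition integrand ::
  "nat \<Rightarrow> sign list \<Rightarrow> ((nat \<Rightarrow> 'y) \<Rightarrow> complex) \<Rightarrow> ((nat \<Rightarrow> 'y) \<Rightarrow> complex) \<Rightarrow> (nat \<Rightarrow> letter) \<Rightarrow> (letter \<Rightarrow> 'y) \<Rightarrow> complex"
  where "integrand n ss \<phi> f a e =
    \<phi> (\<lambda>j\<in>{..<length ss}. e (a j)) * f (\<lambda>i\<in>{..<n}. e (Arg i)) * phase n ss a e"

definition pair_integral ::
  "nat \<Rightarrow> sign list \<Rightarrow> ((nat \<Rightarrow> 'y) \<Rightarrow> complex) \<Rightarrow> ((nat \<Rightarrow> 'y) \<Rightarrow> complex) \<Rightarrow> (nat \<Rightarrow> letter) \<Rightarrow> (nat \<Rightarrow> 'y) \<Rightarrow> complex"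
  where "pair_integral n ss \<phi> f a x =
    (LINT z|PiM (a ` minuses ss) (\<lambda>_. M). integrand n ss \<phi> f a (join (surv n ss a) (a ` minuses ss) x z))"

lemma passed_subset: "passed n j ss m a i \<subseteq> set (letters n j ss)"
  by (auto simp: passed_def)

lemma finite_passed: "finite (passed n j ss m a i)"
  by (rule finite_subset[OF passed_subset]) simp

text \<open>Allows \<open>letter_value\<close>, which assigns a value to every letter whatsoever, to
  be replaced by the extensional \<open>join\<close>.\<close>

lemma integrand_cong:
  assumes a: "a \<in> pairs n ss" and eq: "\<And>l. l \<in> alphabet n ss \<Longrightarrow> e l = e' l"
  shows "integrand n ss \<phi> f a e = integrand n ss \<phi> f a e'"
proof -
  have 1: "(\<lambda>j\<in>{..<length ss}. e (a j)) = (\<lambda>j\<in>{..<length ss}. e' (a j))"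
    using pairing_in_alphabet[OF a] eq by (auto intro!: restrict_ext)
  have 2: "(\<lambda>i\<in>{..<n}. e (Arg i)) = (\<lambda>i\<in>{..<n}. e' (Arg i))"
    using eq by (auto intro!: restrict_ext simp: set_letters)
  have 3: "phase n ss a e = phase n ss a e'"
    unfolding phase_def
  proof (intro prod.cong refl)
    fix i u assume "i \<in> minuses ss" "u \<in> passed n 0 ss (length ss) a i"
    then show "R (e (a i)) (e u) = R (e' (a i)) (e' u)"
      using eq[OF pairingsD(3)[OF a]] eq[of u] passed_subset[of n 0 ss "length ss" a i] by auto
  qed
  show ?thesis unfolding integrand_def 1 2 3 ..
qed

lemma history_integral_eq:
  assumes c: "(w, a, F, D) \<in> set (histories n ss)"
  shows "history_integral M R (length ss) \<phi> n f (w, a, F, D) x = pair_integral n ss \<phi> f a x"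
proof -
  from history_invariant[of w a F D n 0 ss "length ss"] c
  have a: "a \<in> pairs n ss" and w: "w = surv n ss a" and D: "set D = a ` minuses ss"
    and F: "\<And>g::letter \<times> letter \<Rightarrow> complex. prod_list (map g F) =
      (\<Prod>i\<in>minuses ss. \<Prod>u\<in>passed n 0 ss (length ss) a i. g (a i, u))"
    by (auto simp: histories_def)
  have "history_integral M R (length ss) \<phi> n f (w, a, F, D) x =
    (LINT z|PiM (set D) (\<lambda>_. M). integrand n ss \<phi> f a (letter_value w D x z))"
    using F[of "\<lambda>(l, u). R (letter_value w D x z l) (letter_value w D x z u)" for z]
    by (simp add: integrand_def phase_def Let_def)
  also have "\<dots> = pair_integral n ss \<phi> f a x"
    unfolding pair_integral_def D
  proof (intro Bochner_Integration.integral_cong refl integrand_cong[OF a])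
    fix z l assume "l \<in> alphabet n ss"
    then show "letter_value w D x z l = join (surv n ss a) (a ` minuses ss) x z l"
      using survivors_Un[OF a] by (auto simp: letter_value_def join_def D w)
  qed
  finally show ?thesis .
qed

lemma sum_history_integral:
  "(\<Sum>c\<leftarrow>histories n ss. history_integral M R (length ss) \<phi> n f c x) =
    (\<Sum>a\<in>pairs n ss. pair_integral n ss \<phi> f a x)"
proof -
  have "(\<Sum>c\<leftarrow>histories n ss. history_integral M R (length ss) \<phi> n f c x) =
    (\<Sum>c\<leftarrow>histories n ss. pair_integral n ss \<phi> f (fst (snd c)) x)"
  proof (rule arg_cong[where f=sum_list], rule map_cong[OF refl])
    fix c assume "c \<in> set (histories n ss)"
    moreover obtain w a F D where "c = (w, a, F, D)" by (cases c)
    ultimately show "history_integral M R (length ss) \<phi> n f c x = pair_integral n ss \<phi> f (fst (snd c)) x"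
      by (simp only: history_integral_eq fst_conv snd_conv)
  qed
  also have "\<dots> = (\<Sum>a\<in>pairs n ss. pair_integral n ss \<phi> f a x)"
    unfolding histories_def by (rule sum_list_histories) simp
  finally show ?thesis .
qed

definition kernel_fun :: "('y \<Rightarrow> complex) list \<Rightarrow> ((nat \<Rightarrow> 'y) \<Rightarrow> complex) \<Rightarrow> nat \<Rightarrow> (nat \<Rightarrow> 'y) \<Rightarrow> complex"
  where "kernel_fun gs \<kappa> k y = (\<Prod>j<k. (gs ! j) (y j)) * \<kappa> y"

lemma op_integral_eq:
  "op_integral M R ss gs \<kappa> f n' x = (\<Sum>n | n + count_list ss Plus = n' + count_list ss Minus.
    sym_proj R n' (\<lambda>x. \<Sum>a\<in>pairs n ss. pair_integral n ss (kernel_fun gs \<kappa> (length ss)) (f n) a x) x)"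
  by (simp add: op_integral_def sum_history_integral kernel_fun_def[abs_def])

lemma phase_measurable:
  assumes a: "a \<in> pairs n ss"
  shows "phase n ss a \<in> borel_measurable (PiM (alphabet n ss) (\<lambda>_. M))"
  unfolding phase_def[abs_def]
proof (intro borel_measurable_prod R_measurable measurable_component_singleton)
  show "a i \<in> alphabet n ss" if "i \<in> minuses ss" for i using pairingsD(3)[OF a that] .
  show "u \<in> alphabet n ss" if "u \<in> passed n 0 ss (length ss) a i" for i u
    using that passed_subset by blast
qed

lemma phase_bound: "\<exists>B\<ge>0. \<forall>e. norm (phase n ss a e) \<le> B"
proof (intro exI conjI allI)
  fix e
  have "norm (phase n ss a e) = (\<Prod>i\<in>minuses ss. norm (\<Prod>u\<in>passed n 0 ss (length ss) a i. R (e (a i)) (e u)))"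
    by (simp add: phase_def prod_norm)
  also have "\<dots> \<le> (\<Prod>i\<in>minuses ss. C ^ card (passed n 0 ss (length ss) a i))"
    by (intro prod_mono conjI norm_prod_R_le finite_passed) auto
  finally show "norm (phase n ss a e) \<le> (\<Prod>i\<in>minuses ss. C ^ card (passed n 0 ss (length ss) a i))" .
qed (use C_ge in \<open>auto intro: prod_nonneg\<close>)

lemma pairing_map_measurable:
  assumes a: "a \<in> pairs n ss"
  shows "(\<lambda>e. \<lambda>j\<in>{..<length ss}. e (a j)) \<in> PiM (alphabet n ss) (\<lambda>_. M) \<rightarrow>\<^sub>M power_measure M (length ss)"
  using pairing_in_alphabet[OF a] by (intro measurable_restrict measurable_component_singleton) auto

lemma Arg_map_measurable:
  "(\<lambda>e. \<lambda>i\<in>{..<n}. e (Arg i)) \<in> PiM (alphabet n ss) (\<lambda>_. M) \<rightarrow>\<^sub>M power_measure M n"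
  by (intro measurable_restrict measurable_component_singleton) (auto simp: set_letters)

lemma AE_Arg:
  assumes "AE x in power_measure M n. P x"
  shows "AE e in PiM (alphabet n ss) (\<lambda>_. M). P (\<lambda>i\<in>{..<n}. e (Arg i))"
  by (rule AE_PiM_pullback[OF sf sf absolutely_continuous_id measurable_ident_sets[OF refl] _ _ _ assms])
    (auto simp: set_letters inj_on_def)

lemma AE_pairing:
  assumes a: "a \<in> pairs n ss" and ae: "AE y in sign_measure M ss. P y"
  shows "AE e in PiM (alphabet n ss) (\<lambda>_. M). P (\<lambda>j\<in>{..<length ss}. e (a j))"
  by (rule AE_sign_measure_pullback[OF sf sf absolutely_continuous_id measurable_ident_sets[OF refl] _ _ pairing_fibres[OF a] ae])
    (use pairing_in_alphabet[OF a] in auto)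

definition good_kernel :: "sign list \<Rightarrow> ('y \<Rightarrow> complex) list \<Rightarrow> ((nat \<Rightarrow> 'y) \<Rightarrow> complex) \<Rightarrow> bool"
  where "good_kernel ss gs \<kappa> \<longleftrightarrow> (\<forall>j<length ss. gs ! j \<in> L2 M) \<and> \<kappa> \<in> Linf (sign_measure M ss)"

lemma kernel_fun_measurable:
  assumes "good_kernel ss gs \<kappa>"
  shows "kernel_fun gs \<kappa> (length ss) \<in> borel_measurable (power_measure M (length ss))"
proof -
  have "\<kappa> \<in> borel_measurable (power_measure M (length ss))"
    using assms measurable_cong_sets[OF sets_sign_measure refl] by (auto simp: good_kernel_def Linf_def)
  moreover have "(\<lambda>y. \<Prod>j<length ss. (gs ! j) (y j)) \<in> borel_measurable (power_measure M (length ss))"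
    using assms by (intro borel_measurable_prod measurable_compose[OF measurable_component_singleton])
      (auto simp: good_kernel_def L2_def)
  ultimately show ?thesis unfolding kernel_fun_def[abs_def] by (rule borel_measurable_times[rotated])
qed

lemma integrand_measurable:
  assumes "a \<in> pairs n ss" "\<phi> \<in> borel_measurable (power_measure M (length ss))" "f \<in> borel_measurable (power_measure M n)"
  shows "integrand n ss \<phi> f a \<in> borel_measurable (PiM (alphabet n ss) (\<lambda>_. M))"
  unfolding integrand_def[abs_def]
  by (intro borel_measurable_times phase_measurable assms(1)
    measurable_compose[OF pairing_map_measurable[OF assms(1)] assms(2)]
    measurable_compose[OF Arg_map_measurable assms(3)])

text \<open>The kernel is essentially bounded along the pairing and the phase is bounded everywhere,
  so the one-variable functions and \<open>f\<close> remain. They are grouped as the fibre estimate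
  requires: annihilation functions see deleted letters only, while created letters and arguments may
  or may not survive.\<close>

lemma integrand_bound:
  assumes a: "a \<in> pairs n ss" and good: "good_kernel ss gs \<kappa>"
  obtains K where "0 \<le> K" "AE e in PiM (alphabet n ss) (\<lambda>_. M).
      norm (integrand n ss (kernel_fun gs \<kappa> (length ss)) f a e) \<le>
      (K * (\<Prod>j\<in>minuses ss. norm ((gs ! j) (e (a j))))) *
      ((\<Prod>j\<in>pluses ss. norm ((gs ! j) (e (New j)))) * norm (f (\<lambda>i\<in>{..<n}. e (Arg i))))"
proof -
  obtain C1 where C1: "AE y in sign_measure M ss. norm (\<kappa> y) \<le> C1"
    using good by (auto simp: good_kernel_def Linf_def)
  obtain B where B: "0 \<le> B" "\<And>e. norm (phase n ss a e) \<le> B"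
    using phase_bound[of n ss a] by auto
  \<comment> \<open>The absolute value keeps the constant nonnegative whatever essential bound
    \<open>C1\<close> was obtained.\<close>
  have "AE e in PiM (alphabet n ss) (\<lambda>_. M).
      norm (integrand n ss (kernel_fun gs \<kappa> (length ss)) f a e) \<le>
      ((\<bar>C1\<bar> * B) * (\<Prod>j\<in>minuses ss. norm ((gs ! j) (e (a j))))) *
      ((\<Prod>j\<in>pluses ss. norm ((gs ! j) (e (New j)))) * norm (f (\<lambda>i\<in>{..<n}. e (Arg i))))"
    using AE_pairing[OF a C1]
  proof eventually_elim
    case (elim e)
    let ?m = "\<Prod>j\<in>minuses ss. norm ((gs ! j) (e (a j)))"
    let ?p = "\<Prod>j\<in>pluses ss. norm ((gs ! j) (e (New j)))"
    let ?f = "norm (f (\<lambda>i\<in>{..<n}. e (Arg i)))"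
    have "(\<Prod>j<length ss. norm ((gs ! j) (e (a j)))) = (\<Prod>j\<in>pluses ss. norm ((gs ! j) (e (a j)))) * ?m"
      unfolding plus_minus_Un[symmetric] by (rule prod.union_disjoint) (auto simp: plus_minus_disjoint)
    also have "(\<Prod>j\<in>pluses ss. norm ((gs ! j) (e (a j)))) = ?p"
    proof (intro prod.cong refl)
      fix j assume "j \<in> pluses ss"
      then have "j \<notin> minuses ss" using plus_minus_disjoint[of 0 ss] by auto
      then show "norm ((gs ! j) (e (a j))) = norm ((gs ! j) (e (New j)))" using pairingsD(1)[OF a] by simp
    qed
    finally have pm: "(\<Prod>j<length ss. norm ((gs ! j) (e (a j)))) = ?p * ?m" .
    have "norm (integrand n ss (kernel_fun gs \<kappa> (length ss)) f a e) =
      (?p * ?m * ?f) * (norm (\<kappa> (\<lambda>j\<in>{..<length ss}. e (a j))) * norm (phase n ss a e))"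
      unfolding integrand_def kernel_fun_def norm_mult prod_norm[symmetric] pm[symmetric] by simp
    also have "\<dots> \<le> (?p * ?m * ?f) * (\<bar>C1\<bar> * B)"
      using elim B by (intro mult_left_mono mult_mono) (auto intro!: mult_nonneg_nonneg prod_nonneg)
    finally show ?case by (simp add: mult_ac)
  qed
  moreover have "0 \<le> \<bar>C1\<bar> * B" using B by simp
  ultimately show ?thesis using that by blast
qed

text \<open>Injectivity of \<open>q\<close> gives every function its own variable, so the squared
  norms multiply.\<close>

lemma L2_product:
  assumes J: "finite J" and h: "\<And>j. j \<in> J \<Longrightarrow> g j \<in> L2 M" and q: "inj_on q J"
  shows "(\<integral>\<^sup>+z. (\<Prod>j\<in>J. ennreal (norm (g j (z (q j)) :: complex)))\<^sup>2 \<partial>PiM (q ` J) (\<lambda>_. M)) < \<infinity>"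
proof -
  have inv: "the_inv_into J q (q j) = j" if "j \<in> J" for j using the_inv_into_f_f[OF q that] .
  have "(\<integral>\<^sup>+z. (\<Prod>j\<in>J. ennreal (norm (g j (z (q j)))))\<^sup>2 \<partial>PiM (q ` J) (\<lambda>_. M)) =
    (\<integral>\<^sup>+z. (\<Prod>l\<in>q ` J. (ennreal (norm (g (the_inv_into J q l) (z l))))\<^sup>2) \<partial>PiM (q ` J) (\<lambda>_. M))"
    by (simp add: prod.reindex[OF q] inv prod_power_distrib)
  also have "\<dots> = (\<Prod>l\<in>q ` J. \<integral>\<^sup>+y. (ennreal (norm (g (the_inv_into J q l) y)))\<^sup>2 \<partial>M)"
  proof (intro P.product_nn_integral_prod)
    fix l assume "l \<in> q ` J"
    then have "g (the_inv_into J q l) \<in> borel_measurable M" using h inv by (auto intro: L2_measurable)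
    then show "(\<lambda>y. (ennreal (norm (g (the_inv_into J q l) y)))\<^sup>2) \<in> borel_measurable M" by measurable
  qed (use J in simp)
  also have "\<dots> < \<infinity>"
    using J h inv by (auto simp: less_top[symmetric] ennreal_prod_eq_top L2_iff)
  finally show ?thesis .
qed

text \<open>\<open>B\<close> collects the annihilation functions, one per deleted letter, and
  \<open>E\<close> the creation functions and \<open>f\<close>. Over the whole alphabet created
  letters and arguments are separate variables, so \<open>E\<close> has finite norm no matter which
  of them are deleted.\<close>

lemma pair_integral_L2:
  assumes a: "a \<in> pairs n ss" and good: "good_kernel ss gs \<kappa>" and f: "f \<in> L2 (power_measure M n)"
  defines "N \<equiv> power_measure M (length (surv n ss a))"
  defines "G \<equiv> \<lambda>x z. integrand n ss (kernel_fun gs \<kappa> (length ss)) f a (join (surv n ss a) (a ` minuses ss) x z)"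
  shows "AE x in N. integrable (PiM (a ` minuses ss) (\<lambda>_. M)) (G x)"
    and "pair_integral n ss (kernel_fun gs \<kappa> (length ss)) f a \<in> L2 N"
    and "(\<integral>\<^sup>+x. (\<integral>\<^sup>+z. ennreal (norm (G x z)) \<partial>PiM (a ` minuses ss) (\<lambda>_. M))\<^sup>2 \<partial>N) < \<infinity>"
proof -
  let ?w = "surv n ss a" and ?D = "a ` minuses ss"
  let ?DM = "PiM ?D (\<lambda>_. M)"
  note j = distinct_survivors[of n 0 ss a] survivors_disjoint[of n 0 ss a]
  have finD: "finite ?D" by simp
  note U = survivors_Un[OF a]
  note mj = measurable_join[OF j(1), where M=M and D="?D", unfolded U]
  obtain K where K: "0 \<le> K" and bd: "AE e in PiM (alphabet n ss) (\<lambda>_. M).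
      norm (integrand n ss (kernel_fun gs \<kappa> (length ss)) f a e) \<le>
      (K * (\<Prod>j\<in>minuses ss. norm ((gs ! j) (e (a j))))) *
      ((\<Prod>j\<in>pluses ss. norm ((gs ! j) (e (New j)))) * norm (f (\<lambda>i\<in>{..<n}. e (Arg i))))"
    by (rule integrand_bound[OF a good])
  have gs: "gs ! j \<in> L2 M" if "j < length ss" for j using good that by (simp add: good_kernel_def)
  have ml: "j < length ss" if "j \<in> minuses ss" for j using that by (simp add: minus_set_def)
  have pl: "j < length ss" if "j \<in> pluses ss" for j using that by (simp add: plus_set_def)
  define B where "B z = ennreal K * (\<Prod>j\<in>minuses ss. ennreal (norm ((gs ! j) (z (a j)))))" for z
  define E' where "E' e = (\<Prod>j\<in>pluses ss. ennreal (norm ((gs ! j) (e (New j))))) *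
    ennreal (norm (f (\<lambda>i\<in>{..<n}. e (Arg i))))" for e
  define E where "E p = E' (case p of (x, z) \<Rightarrow> join ?w ?D x z)" for p
  have B[measurable]: "B \<in> borel_measurable ?DM"
    unfolding B_def[abs_def] using gs[OF ml]
    by (intro borel_measurable_times_ennreal borel_measurable_const borel_measurable_prod_ennreal measurable_compose[OF _ measurable_ennreal]
      measurable_compose[OF _ borel_measurable_norm] measurable_compose[OF measurable_component_singleton])
      (auto simp: L2_def)
  have E'm[measurable]: "E' \<in> borel_measurable (PiM (alphabet n ss) (\<lambda>_. M))"
    unfolding E'_def[abs_def] using gs[OF pl] f
    by (intro borel_measurable_times_ennreal borel_measurable_const borel_measurable_prod_ennreal measurable_compose[OF _ measurable_ennreal]
      measurable_compose[OF _ borel_measurable_norm] measurable_compose[OF measurable_component_singleton]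
      measurable_compose[OF Arg_map_measurable])
      (auto simp: L2_def set_letters)
  have E[measurable]: "E \<in> borel_measurable (N \<Otimes>\<^sub>M ?DM)"
    unfolding E_def[abs_def] N_def by (rule measurable_compose[OF mj E'm])
  have Gm: "(\<lambda>p. case p of (x, z) \<Rightarrow> G x z) \<in> borel_measurable (N \<Otimes>\<^sub>M ?DM)"
    using measurable_compose[OF mj integrand_measurable[OF a kernel_fun_measurable[OF good] L2_measurable[OF f]]]
    unfolding G_def N_def by (simp add: case_prod_beta)
  have bound: "AE p in N \<Otimes>\<^sub>M ?DM. ennreal (norm (case p of (x, z) \<Rightarrow> G x z)) \<le> B (snd p) * E p"
    unfolding N_def
  proof (rule AE_mp[OF AE_join(2)[OF sf j finD, unfolded U, OF bd]], intro AE_I2 impI)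
    fix p :: "(nat \<Rightarrow> 'y) \<times> (letter \<Rightarrow> 'y)"
    let ?e = "join ?w ?D (fst p) (snd p)"
    assume h: "norm (integrand n ss (kernel_fun gs \<kappa> (length ss)) f a ?e) \<le>
      (K * (\<Prod>j\<in>minuses ss. norm ((gs ! j) (?e (a j))))) *
      ((\<Prod>j\<in>pluses ss. norm ((gs ! j) (?e (New j)))) * norm (f (\<lambda>i\<in>{..<n}. ?e (Arg i))))"
    have "(\<Prod>j\<in>minuses ss. norm ((gs ! j) (?e (a j)))) = (\<Prod>j\<in>minuses ss. norm ((gs ! j) (snd p (a j))))"
      by (intro prod.cong refl) (simp add: join_deleted)
    then have "ennreal (norm (case p of (x, z) \<Rightarrow> G x z)) \<le> ennreal ((K * (\<Prod>j\<in>minuses ss. norm ((gs ! j) (snd p (a j))))) *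
      ((\<Prod>j\<in>pluses ss. norm ((gs ! j) (?e (New j)))) * norm (f (\<lambda>i\<in>{..<n}. ?e (Arg i)))))"
      using h by (simp add: G_def case_prod_beta ennreal_leI)
    also have "\<dots> = B (snd p) * E p"
      using K by (simp add: B_def E_def E'_def case_prod_beta ennreal_mult prod_nonneg prod_ennreal[symmetric])
    finally show "ennreal (norm (case p of (x, z) \<Rightarrow> G x z)) \<le> B (snd p) * E p" .
  qed
  have finB: "(\<integral>\<^sup>+z. (B z)\<^sup>2 \<partial>?DM) < \<infinity>"
  proof -
    have "(\<integral>\<^sup>+z. (B z)\<^sup>2 \<partial>?DM) = (ennreal K)\<^sup>2 * (\<integral>\<^sup>+z. (\<Prod>j\<in>minuses ss. ennreal (norm ((gs ! j) (z (a j)))))\<^sup>2 \<partial>?DM)"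
      unfolding B_def power_mult_distrib using gs[OF ml]
      by (intro nn_integral_cmult borel_measurable_power2_ennreal borel_measurable_prod_ennreal measurable_compose[OF _ measurable_ennreal]
        measurable_compose[OF _ borel_measurable_norm] measurable_compose[OF measurable_component_singleton])
        (auto simp: L2_def)
    also have "\<dots> < \<infinity>"
      using L2_product[of "minuses ss" "\<lambda>j. gs ! j" a, OF _ _ pairingsD(2)[OF a]] gs[OF ml] K
      by (simp add: ennreal_mult_less_top ennreal_power)
    finally show ?thesis .
  qed
  \<comment> \<open>The alphabet is split a second time, now into arguments and created letters
    instead of survivors and deleted letters; in this splitting the integrand factorizes.\<close>
  have finE: "(\<integral>\<^sup>+p. (E p)\<^sup>2 \<partial>(N \<Otimes>\<^sub>M ?DM)) < \<infinity>"
  proof -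
    have "(\<integral>\<^sup>+p. (E p)\<^sup>2 \<partial>(N \<Otimes>\<^sub>M ?DM)) = (\<integral>\<^sup>+e. (E' e)\<^sup>2 \<partial>PiM (alphabet n ss) (\<lambda>_. M))"
      unfolding E_def N_def
      by (subst distr_join[OF sf j finD, unfolded U, symmetric]) (rule nn_integral_distr[OF mj, symmetric], simp)
    also have "\<dots> = (\<integral>\<^sup>+e. (E' e)\<^sup>2 \<partial>PiM (set (map Arg [0..<n]) \<union> New ` pluses ss) (\<lambda>_. M))"
      by (simp add: set_letters Un_commute atLeast0LessThan)
    also have "\<dots> = (\<integral>\<^sup>+x. \<integral>\<^sup>+z. (E' (join (map Arg [0..<n]) (New ` pluses ss) x z))\<^sup>2 \<partial>PiM (New ` pluses ss) (\<lambda>_. M) \<partial>power_measure M n)"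
    proof (subst nn_integral_join[OF sf])
      show "(\<lambda>e. (E' e)\<^sup>2) \<in> borel_measurable (PiM (set (map Arg [0..<n]) \<union> New ` pluses ss) (\<lambda>_. M))"
        using E'm by (simp add: set_letters Un_commute atLeast0LessThan)
    qed (auto simp: distinct_map inj_on_def)
    also have "\<dots> = (\<integral>\<^sup>+x. \<integral>\<^sup>+z. (ennreal (norm (f x)))\<^sup>2 * (\<Prod>j\<in>pluses ss. ennreal (norm ((gs ! j) (z (New j)))))\<^sup>2 \<partial>PiM (New ` pluses ss) (\<lambda>_. M) \<partial>power_measure M n)"
    proof (intro nn_integral_cong)
      fix x z assume x: "x \<in> space (power_measure M n)"
      have "join (map Arg [0..<n]) (New ` pluses ss) x z (map Arg [0..<n] ! i) = x i" if "i < n" for i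
        using that by (intro join_nth) (auto simp: distinct_map inj_on_def)
      then have "(\<lambda>i\<in>{..<n}. join (map Arg [0..<n]) (New ` pluses ss) x z (Arg i)) = x"
        using x by (auto simp: fun_eq_iff space_PiM PiE_iff extensional_def)
      then show "(E' (join (map Arg [0..<n]) (New ` pluses ss) x z))\<^sup>2 =
        (ennreal (norm (f x)))\<^sup>2 * (\<Prod>j\<in>pluses ss. ennreal (norm ((gs ! j) (z (New j)))))\<^sup>2"
        by (simp add: E'_def join_deleted power_mult_distrib mult.commute)
    qed
    also have "\<dots> = (\<integral>\<^sup>+x. (ennreal (norm (f x)))\<^sup>2 *
      (\<integral>\<^sup>+z. (\<Prod>j\<in>pluses ss. ennreal (norm ((gs ! j) (z (New j)))))\<^sup>2 \<partial>PiM (New ` pluses ss) (\<lambda>_. M)) \<partial>power_measure M n)"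
      using gs[OF pl]
      by (intro nn_integral_cong nn_integral_cmult borel_measurable_power2_ennreal borel_measurable_prod_ennreal measurable_compose[OF _ measurable_ennreal]
        measurable_compose[OF _ borel_measurable_norm] measurable_compose[OF measurable_component_singleton])
        (auto simp: L2_def)
    also have "\<dots> = (\<integral>\<^sup>+x. (ennreal (norm (f x)))\<^sup>2 \<partial>power_measure M n) *
      (\<integral>\<^sup>+z. (\<Prod>j\<in>pluses ss. ennreal (norm ((gs ! j) (z (New j)))))\<^sup>2 \<partial>PiM (New ` pluses ss) (\<lambda>_. M))"
      using f by (intro nn_integral_multc) (auto simp: L2_def)
    also have "\<dots> < \<infinity>"
      using L2_product[of "pluses ss" "\<lambda>j. gs ! j" New] gs[OF pl] f
      by (simp add: ennreal_mult_less_top L2_iff inj_on_def)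
    finally show ?thesis .
  qed
  have sfN: "sigma_finite_measure N" "sigma_finite_measure ?DM"
    unfolding N_def by (rule P.sigma_finite, simp)+
  note * = fibre_integral_L2[OF sfN Gm B E bound finB finE]
  show "AE x in N. integrable ?DM (G x)" using *(1) by simp
  show "pair_integral n ss (kernel_fun gs \<kappa> (length ss)) f a \<in> L2 N"
    using *(2) by (simp add: pair_integral_def[abs_def] G_def)
  show "(\<integral>\<^sup>+x. (\<integral>\<^sup>+z. ennreal (norm (G x z)) \<partial>?DM)\<^sup>2 \<partial>N) < \<infinity>" using *(3) by simp
qed

end

lemma fock_finD:
  assumes "f \<in> fock_fin M R"
  shows "f n \<in> sym_L2 M R n" "f n \<in> L2 (power_measure M n)" "f n \<in> borel_measurable (power_measure M n)"
  using assms by (auto simp: fock_fin_def sym_L2_def L2_def)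

section \<open>Operator-valued integrals as operators on finite vectors\<close>

context fock_setup
begin

interpretation P: product_sigma_finite "\<lambda>_. M"
  by (rule product_sigma_finite_const[OF sf])

text \<open>The two kernels are compared along the pairing: agreement almost everywhere on the full
  power would say nothing about the diagonal on which the pairing evaluates them.\<close>

lemma pair_integral_cong_AE:
  assumes a: "a \<in> pairs n ss"
    and \<phi>: "\<phi> \<in> borel_measurable (power_measure M (length ss))" "\<phi>' \<in> borel_measurable (power_measure M (length ss))"
    and f: "f \<in> borel_measurable (power_measure M n)" "f' \<in> borel_measurable (power_measure M n)"
    and ae\<phi>: "AE e in PiM (alphabet n ss) (\<lambda>_. M). \<phi> (\<lambda>j\<in>{..<length ss}. e (a j)) = \<phi>' (\<lambda>j\<in>{..<length ss}. e (a j))"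
    and aef: "AE x in power_measure M n. f x = f' x"
  shows "AE x in power_measure M (length (surv n ss a)). pair_integral n ss \<phi> f a x = pair_integral n ss \<phi>' f' a x"
proof -
  let ?w = "surv n ss a" and ?D = "a ` minuses ss"
  note j = distinct_survivors[of n 0 ss a] survivors_disjoint[of n 0 ss a]
  have finD: "finite ?D" by simp
  note U = survivors_Un[OF a]
  note mj = measurable_join[OF j(1), where M=M and D="?D", unfolded U]
  have "AE e in PiM (alphabet n ss) (\<lambda>_. M). integrand n ss \<phi> f a e = integrand n ss \<phi>' f' a e"
    using ae\<phi> AE_Arg[OF aef] by eventually_elim (simp add: integrand_def)
  from AE_join(1)[OF sf j finD, unfolded U, OF this] AE_space
  show ?thesis
  proof eventually_elim
    case (elim x)
    have m: "(\<lambda>z. integrand n ss \<psi> h a (join ?w ?D x z)) \<in> borel_measurable (PiM ?D (\<lambda>_. M))"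
      if "\<psi> \<in> borel_measurable (power_measure M (length ss))" "h \<in> borel_measurable (power_measure M n)" for \<psi> h
      using measurable_compose[OF measurable_Pair1'[OF elim(2)] measurable_compose[OF mj integrand_measurable[OF a that]]]
      by simp
    show ?case unfolding pair_integral_def
      by (rule integral_cong_AE[OF m[OF \<phi>(1) f(1)] m[OF \<phi>(2) f(2)] elim(1)])
  qed
qed

lemma kernel_fun_cong_AE:
  assumes a: "a \<in> pairs n ss"
    and ae: "\<And>j. j < length ss \<Longrightarrow> AE y in M. (gs ! j) y = (gs' ! j) y"
  shows "AE e in PiM (alphabet n ss) (\<lambda>_. M). kernel_fun gs \<kappa> (length ss) (\<lambda>j\<in>{..<length ss}. e (a j)) =
    kernel_fun gs' \<kappa> (length ss) (\<lambda>j\<in>{..<length ss}. e (a j))"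
proof -
  have "AE e in PiM (alphabet n ss) (\<lambda>_. M). \<forall>j\<in>{..<length ss}. (gs ! j) (e (a j)) = (gs' ! j) (e (a j))"
    using pairing_in_alphabet[OF a] ae
    by (intro AE_finite_allI AE_PiM_coordinate[OF sf, where P="\<lambda>y. (gs ! j) y = (gs' ! j) y" for j]) auto
  then show ?thesis by eventually_elim (simp add: kernel_fun_def)
qed

lemma pair_integral_add:
  assumes a: "a \<in> pairs n ss" and good: "good_kernel ss gs \<kappa>"
    and f: "f \<in> L2 (power_measure M n)" "g \<in> L2 (power_measure M n)"
  shows "AE x in power_measure M (length (surv n ss a)).
    pair_integral n ss (kernel_fun gs \<kappa> (length ss)) (\<lambda>x. f x + g x) a x =
    pair_integral n ss (kernel_fun gs \<kappa> (length ss)) f a x + pair_integral n ss (kernel_fun gs \<kappa> (length ss)) g a x"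
  using pair_integral_L2(1)[OF a good f(1)] pair_integral_L2(1)[OF a good f(2)]
  by eventually_elim (simp add: pair_integral_def integrand_def distrib_left distrib_right)

lemma pair_integral_scale:
  "pair_integral n ss \<phi> (\<lambda>x. c * f x) a x = c * pair_integral n ss \<phi> f a x"
proof -
  have "integrand n ss \<phi> (\<lambda>x. c * f x) a e = c * integrand n ss \<phi> f a e" for e
    by (simp add: integrand_def)
  then show ?thesis by (simp add: pair_integral_def)
qed

text \<open>The matrix entry from \<open>n\<close> to \<open>n'\<close> particles. Given
  \<open>n'\<close>, at most one \<open>n\<close> is \<open>linked\<close>, so the sum in
  \<open>op_integral\<close> has at most one term.\<close>

definition op_term ::
  "sign list \<Rightarrow> ('y \<Rightarrow> complex) list \<Rightarrow> ((nat \<Rightarrow> 'y) \<Rightarrow> complex) \<Rightarrow> nat \<Rightarrow> ((nat \<Rightarrow> 'y) \<Rightarrow> complex) \<Rightarrow> nat \<Rightarrow> (nat \<Rightarrow> 'y) \<Rightarrow> complex"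
  where "op_term ss gs \<kappa> n f n' x =
    sym_proj R n' (\<lambda>x. \<Sum>a\<in>pairs n ss. pair_integral n ss (kernel_fun gs \<kappa> (length ss)) f a x) x"

abbreviation linked :: "sign list \<Rightarrow> nat \<Rightarrow> nat \<Rightarrow> bool"
  where "linked ss n n' \<equiv> n + count_list ss Plus = n' + count_list ss Minus"

lemma op_integral_terms:
  "op_integral M R ss gs \<kappa> f n' x = (\<Sum>n | linked ss n n'. op_term ss gs \<kappa> n (f n) n' x)"
  by (simp add: op_integral_eq op_term_def)

lemma finite_linked: "finite {n. linked ss n n'}" "finite {n'. linked ss n n'}"
  by (rule finite_subset[of _ "{..n' + count_list ss Minus}"], auto)
    (rule finite_subset[of _ "{..n + count_list ss Plus}"], auto)

lemma length_surv:
  "a \<in> pairs n ss \<Longrightarrow> linked ss n n' \<Longrightarrow> length (surv n ss a) = n'"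
  using length_survivors[of a n 0 ss "length ss"] by simp

lemma pair_integral_sum_L2:
  assumes "good_kernel ss gs \<kappa>" "f \<in> L2 (power_measure M n)" "linked ss n n'"
  shows "(\<lambda>x. \<Sum>a\<in>pairs n ss. pair_integral n ss (kernel_fun gs \<kappa> (length ss)) f a x) \<in> L2 (power_measure M n')"
  using pair_integral_L2(2)[OF _ assms(1,2)] length_surv[OF _ assms(3)] by (intro L2_sum) auto

lemma op_term_sym_L2:
  assumes "good_kernel ss gs \<kappa>" "f \<in> L2 (power_measure M n)" "linked ss n n'"
  shows "op_term ss gs \<kappa> n f n' \<in> sym_L2 M R n'"
  using sym_proj_sym_L2[OF pair_integral_sum_L2[OF assms]] by (simp add: op_term_def[abs_def])

lemma op_term_cong_AE:
  assumes good: "good_kernel ss gs \<kappa>" "good_kernel ss gs' \<kappa>"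
    and ae: "\<And>j. j < length ss \<Longrightarrow> AE y in M. (gs ! j) y = (gs' ! j) y"
    and f: "f \<in> borel_measurable (power_measure M n)" "f' \<in> borel_measurable (power_measure M n)"
    and aef: "AE x in power_measure M n. f x = f' x"
    and linked: "linked ss n n'"
  shows "AE x in power_measure M n'. op_term ss gs \<kappa> n f n' x = op_term ss gs' \<kappa> n f' n' x"
  unfolding op_term_def
proof (rule sym_proj_cong_AE[OF sf])
  have "AE x in power_measure M n'. \<forall>a\<in>pairs n ss. pair_integral n ss (kernel_fun gs \<kappa> (length ss)) f a x =
    pair_integral n ss (kernel_fun gs' \<kappa> (length ss)) f' a x"
  proof (intro AE_finite_allI finite_letters_fun)
    fix a assume a: "a \<in> pairs n ss"
    show "AE x in power_measure M n'. pair_integral n ss (kernel_fun gs \<kappa> (length ss)) f a x =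
      pair_integral n ss (kernel_fun gs' \<kappa> (length ss)) f' a x"
      using pair_integral_cong_AE[OF a kernel_fun_measurable[OF good(1)] kernel_fun_measurable[OF good(2)] f
          kernel_fun_cong_AE[OF a ae] aef] unfolding length_surv[OF a linked] .
  qed
  then show "AE x in power_measure M n'. (\<Sum>a\<in>pairs n ss. pair_integral n ss (kernel_fun gs \<kappa> (length ss)) f a x) =
    (\<Sum>a\<in>pairs n ss. pair_integral n ss (kernel_fun gs' \<kappa> (length ss)) f' a x)"
    by eventually_elim simp
qed

lemma op_term_scale: "op_term ss gs \<kappa> n (\<lambda>x. c * f x) n' x = c * op_term ss gs \<kappa> n f n' x"
  by (simp add: op_term_def pair_integral_scale sum_distrib_left[symmetric] sym_proj_scale)

lemma op_term_add:
  assumes good: "good_kernel ss gs \<kappa>"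
    and f: "f \<in> L2 (power_measure M n)" "g \<in> L2 (power_measure M n)" and linked: "linked ss n n'"
  shows "AE x in power_measure M n'. op_term ss gs \<kappa> n (\<lambda>x. f x + g x) n' x =
    op_term ss gs \<kappa> n f n' x + op_term ss gs \<kappa> n g n' x"
  unfolding op_term_def sym_proj_add[symmetric]
proof (rule sym_proj_cong_AE[OF sf])
  have "AE x in power_measure M n'. \<forall>a\<in>pairs n ss. pair_integral n ss (kernel_fun gs \<kappa> (length ss)) (\<lambda>x. f x + g x) a x =
    pair_integral n ss (kernel_fun gs \<kappa> (length ss)) f a x + pair_integral n ss (kernel_fun gs \<kappa> (length ss)) g a x"
    using pair_integral_add[OF _ good f] length_surv[OF _ linked]
    by (intro AE_finite_allI finite_letters_fun) auto
  then show "AE x in power_measure M n'. (\<Sum>a\<in>pairs n ss. pair_integral n ss (kernel_fun gs \<kappa> (length ss)) (\<lambda>x. f x + g x) a x) =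
    (\<Sum>a\<in>pairs n ss. pair_integral n ss (kernel_fun gs \<kappa> (length ss)) f a x) +
    (\<Sum>a\<in>pairs n ss. pair_integral n ss (kernel_fun gs \<kappa> (length ss)) g a x)"
    by eventually_elim (simp add: sum.distrib)
qed

lemma sym_L2_sum: "(\<And>i. i \<in> I \<Longrightarrow> f i \<in> sym_L2 M R n) \<Longrightarrow> (\<lambda>x. \<Sum>i\<in>I. f i x) \<in> sym_L2 M R n"
  by (induction I rule: infinite_finite_induct) (auto intro!: sym_L2_add sym_L2_0)

lemma AE_sum_cong:
  assumes "finite I" "\<And>i. i \<in> I \<Longrightarrow> AE x in N. f i x = g i x"
  shows "AE x in N. (\<Sum>i\<in>I. f i x) = (\<Sum>i\<in>I. g i x)"
proof -
  have "AE x in N. \<forall>i\<in>I. f i x = g i x" using assms by (intro AE_finite_allI) auto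
  then show ?thesis by eventually_elim simp
qed

lemma op_integral_cong_AE:
  assumes good: "good_kernel ss gs \<kappa>" "good_kernel ss gs' \<kappa>"
    and ae: "\<And>j. j < length ss \<Longrightarrow> AE y in M. (gs ! j) y = (gs' ! j) y"
    and f: "f \<in> fock_fin M R" "f' \<in> fock_fin M R" and eq: "fock_eq M f f'"
  shows "fock_eq M (op_integral M R ss gs \<kappa> f) (op_integral M R ss gs' \<kappa> f')"
  unfolding fock_eq_def op_integral_terms
proof
  fix n'
  show "AE x in power_measure M n'. (\<Sum>n | linked ss n n'. op_term ss gs \<kappa> n (f n) n' x) =
    (\<Sum>n | linked ss n n'. op_term ss gs' \<kappa> n (f' n) n' x)"
    using eq f unfolding fock_eq_def
    by (intro AE_sum_cong finite_linked op_term_cong_AE[OF good ae]) (auto intro: fock_finD)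
qed

lemma op_integral_fock_operator:
  assumes good: "good_kernel ss gs \<kappa>"
  shows "fock_operator M R (op_integral M R ss gs \<kappa>)"
  unfolding fock_operator_def
proof (intro conjI ballI allI impI)
  let ?A = "op_integral M R ss gs \<kappa>"
  show "?A f \<in> fock_fin M R" if f: "f \<in> fock_fin M R" for f
    unfolding fock_fin_def
  proof (safe)
    fix n' show "?A f n' \<in> sym_L2 M R n'"
      unfolding op_integral_terms[abs_def] using fock_finD(2)[OF f]
      by (intro sym_L2_sum op_term_sym_L2[OF good]) auto
  next
    obtain N where N: "\<And>n. n \<ge> N \<Longrightarrow> AE x in power_measure M n. f n x = 0"
      using f by (auto simp: fock_fin_def)
    show "\<exists>N. \<forall>n'\<ge>N. AE x in power_measure M n'. ?A f n' x = 0"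
    proof (intro exI allI impI)
      \<comment> \<open>Every creation raises the particle number by one, so the cut-off moves up by
        at most the number of creations.\<close>
      fix n' assume n': "N + count_list ss Plus \<le> n'"
      have "AE x in power_measure M n'. op_term ss gs \<kappa> n (f n) n' x = 0 * op_term ss gs \<kappa> n (f n) n' x"
        if "linked ss n n'" for n
      proof -
        have "n \<ge> N" using that n' by linarith
        from op_term_cong_AE[OF good good AE_I2[OF refl] fock_finD(3)[OF f] borel_measurable_const N[OF this] that]
        show ?thesis using op_term_scale[of ss gs \<kappa> n 0 "f n"] by simp
      qed
      then have "AE x in power_measure M n'. (\<Sum>n | linked ss n n'. op_term ss gs \<kappa> n (f n) n' x) = (\<Sum>n | linked ss n n'. 0)"
        by (intro AE_sum_cong finite_linked) auto
      then show "AE x in power_measure M n'. ?A f n' x = 0" by (simp add: op_integral_terms)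
    qed
  qed
  show "fock_eq M (?A f) (?A g)" if "f \<in> fock_fin M R" "g \<in> fock_fin M R" "fock_eq M f g" for f g
    using that by (intro op_integral_cong_AE[OF good good]) auto
  show "fock_eq M (?A (\<lambda>n x. f n x + g n x)) (\<lambda>n x. ?A f n x + ?A g n x)"
    if "f \<in> fock_fin M R" "g \<in> fock_fin M R" for f g
    unfolding fock_eq_def op_integral_terms sum.distrib[symmetric]
    using fock_finD(2)[OF that(1)] fock_finD(2)[OF that(2)]
    by (intro allI AE_sum_cong finite_linked op_term_add[OF good]) auto
  show "fock_eq M (?A (\<lambda>n x. c * f n x)) (\<lambda>n x. c * ?A f n x)" if "f \<in> fock_fin M R" for f c
    by (simp add: fock_eq_def op_integral_terms op_term_scale sum_distrib_left)
qed

end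

section \<open>Matching diagrams and adjoints\<close>

text \<open>
  Matching diagrams on a line of signs: every minus \<open>i\<close> is joined to a plus \<open>m i > i\<close>. Each pair of
  crossing arcs contributes one factor \<open>R\<close>.
\<close>

definition line_diagrams :: "sign list \<Rightarrow> (nat \<Rightarrow> nat) set"
  where "line_diagrams SS = {m. (\<forall>i. i \<notin> minuses SS \<longrightarrow> m i = i) \<and> bij_betw m (minuses SS) (pluses SS) \<and>
    (\<forall>i\<in>minuses SS. i < m i)}"

definition crossings :: "sign list \<Rightarrow> (nat \<Rightarrow> nat) \<Rightarrow> nat \<Rightarrow> nat set"
  where "crossings SS m i = {i'\<in>minuses SS. i' < i \<and> i < m i' \<and> m i' < m i}"

definition line_phase :: "('y \<Rightarrow> 'y \<Rightarrow> complex) \<Rightarrow> sign list \<Rightarrow> (nat \<Rightarrow> nat) \<Rightarrow> (nat \<Rightarrow> 'y) \<Rightarrow> complex"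
  where "line_phase R SS m e = (\<Prod>i\<in>minuses SS. \<Prod>i'\<in>crossings SS m i. R (e (m i)) (e (m i')))"

text \<open>Only plus positions carry integration variables. \<open>m\<close> fixes them and sends a
  minus to its partner, so that composing with \<open>m\<close> fills the whole line.\<close>

definition line_integral ::
  "'y measure \<Rightarrow> ('y \<Rightarrow> 'y \<Rightarrow> complex) \<Rightarrow> sign list \<Rightarrow> ((nat \<Rightarrow> 'y) \<Rightarrow> complex) \<Rightarrow> (nat \<Rightarrow> nat) \<Rightarrow> complex"
  where "line_integral M R SS \<Phi> m =
    (LINT e|PiM (pluses SS) (\<lambda>_. M). \<Phi> (\<lambda>i\<in>{..<length SS}. e (m i)) * line_phase R SS m e)"

section \<open>Reflection of a line of signs and of its diagrams\<close>

primrec flip :: "sign \<Rightarrow> sign"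
  where "flip Plus = Minus" | "flip Minus = Plus"

lemma flip_flip [simp]: "flip (flip s) = s"
  by (cases s) auto

lemma flip_eq [simp]: "flip s = Plus \<longleftrightarrow> s = Minus" "flip s = Minus \<longleftrightarrow> s = Plus"
  by (cases s; simp)+

abbreviation "flip_rev ss \<equiv> rev (map flip ss)"

lemma flip_rev_flip_rev: "flip_rev (flip_rev ss) = ss"
  by (simp add: rev_map comp_def)

lemma nth_flip_rev: "i < length ss \<Longrightarrow> flip_rev ss ! i = flip (ss ! (length ss - Suc i))"
  by (simp add: rev_nth)

lemma minuses_flip_rev:
  "i \<in> minuses (flip_rev ss) \<longleftrightarrow> i < length ss \<and> length ss - Suc i \<in> pluses ss"
  by (auto simp: minus_set_def plus_set_def nth_flip_rev)

lemma pluses_flip_rev: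
  "i \<in> pluses (flip_rev ss) \<longleftrightarrow> i < length ss \<and> length ss - Suc i \<in> minuses ss"
  by (auto simp: minus_set_def plus_set_def nth_flip_rev)

lemma minuses_less: "i \<in> minuses ss \<Longrightarrow> i < length ss"
  and pluses_less: "i \<in> pluses ss \<Longrightarrow> i < length ss"
  by (auto simp: minus_set_def plus_set_def)

lemma line_diagramsD:
  assumes "m \<in> line_diagrams SS"
  shows "i \<notin> minuses SS \<Longrightarrow> m i = i" "bij_betw m (minuses SS) (pluses SS)" "i \<in> minuses SS \<Longrightarrow> i < m i"
    "inj_on m (minuses SS)" "i \<in> minuses SS \<Longrightarrow> m i \<in> pluses SS"
  using assms by (auto simp: line_diagrams_def bij_betw_def)

lemma line_diagrams_idem:
  assumes "m \<in> line_diagrams SS" "i \<in> minuses SS"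
  shows "m (m i) = m i"
proof (rule line_diagramsD(1)[OF assms(1)])
  show "m i \<notin> minuses SS" using line_diagramsD(5)[OF assms] plus_minus_disjoint[of 0 SS] by auto
qed

text \<open>The arc from \<open>i\<close> to \<open>m i\<close> becomes the arc from the reflection
  of \<open>m i\<close> to the reflection of \<open>i\<close>; flipping the signs makes its left end
  a minus again. The inverse of \<open>m\<close> appears because the definition starts from the left
  end of the reflected arc.\<close>

definition mirror :: "sign list \<Rightarrow> (nat \<Rightarrow> nat) \<Rightarrow> nat \<Rightarrow> nat"
  where "mirror SS m i = (if i \<in> minuses (flip_rev SS)
    then length SS - Suc (the_inv_into (minuses SS) m (length SS - Suc i)) else i)"

context
  fixes SS :: "sign list" and m :: "nat \<Rightarrow> nat"
  assumes m: "m \<in> line_diagrams SS"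
begin

lemma mirror_arc:
  assumes "i \<in> minuses SS"
  shows "length SS - Suc (m i) \<in> minuses (flip_rev SS)"
    "mirror SS m (length SS - Suc (m i)) = length SS - Suc i"
proof -
  have p: "m i \<in> pluses SS" and l: "m i < length SS"
    using line_diagramsD(5)[OF m assms] pluses_less by auto
  then have eq: "length SS - Suc (length SS - Suc (m i)) = m i" by simp
  show *: "length SS - Suc (m i) \<in> minuses (flip_rev SS)"
    unfolding minuses_flip_rev eq using p l by simp
  have "the_inv_into (minuses SS) m (m i) = i"
    by (rule the_inv_into_f_f[OF line_diagramsD(4)[OF m] assms])
  with * show "mirror SS m (length SS - Suc (m i)) = length SS - Suc i"
    unfolding mirror_def eq by simp
qed

lemma mirror_arcE:
  assumes "i \<in> minuses (flip_rev SS)"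
  obtains j where "j \<in> minuses SS" "i = length SS - Suc (m j)" "mirror SS m i = length SS - Suc j"
proof -
  have i: "i < length SS" "length SS - Suc i \<in> pluses SS" using assms by (auto simp: minuses_flip_rev)
  then obtain j where j: "j \<in> minuses SS" "m j = length SS - Suc i"
    using line_diagramsD(2)[OF m] unfolding bij_betw_def by (metis imageE)
  then have "i = length SS - Suc (m j)" using i by simp
  with j that mirror_arc[OF j(1)] show ?thesis by simp
qed

lemma mirror_in_line_diagrams: "mirror SS m \<in> line_diagrams (flip_rev SS)"
  unfolding line_diagrams_def
proof (safe)
  fix i assume "i \<notin> minuses (flip_rev SS)"
  then show "mirror SS m i = i" by (simp add: mirror_def)
next
  fix i assume "i \<in> minuses (flip_rev SS)"
  then obtain j where j: "j \<in> minuses SS" "i = length SS - Suc (m j)" "mirror SS m i = length SS - Suc j"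
    by (rule mirror_arcE)
  show "i < mirror SS m i"
    using line_diagramsD(3,5)[OF m j(1)] j pluses_less[of "m j" SS] by simp
next
  show "bij_betw (mirror SS m) (minuses (flip_rev SS)) (pluses (flip_rev SS))"
    unfolding bij_betw_def
  proof (intro conjI inj_onI set_eqI iffI)
    fix i i' assume i: "i \<in> minuses (flip_rev SS)" "i' \<in> minuses (flip_rev SS)" and eq: "mirror SS m i = mirror SS m i'"
    obtain j where j: "j \<in> minuses SS" "i = length SS - Suc (m j)" "mirror SS m i = length SS - Suc j"
      using i(1) by (rule mirror_arcE)
    obtain j' where j': "j' \<in> minuses SS" "i' = length SS - Suc (m j')" "mirror SS m i' = length SS - Suc j'"
      using i(2) by (rule mirror_arcE)
    have "j = j'" using j j' eq minuses_less[of j SS] minuses_less[of j' SS] by simp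
    then show "i = i'" using j j' by simp
  next
    fix p assume "p \<in> mirror SS m ` minuses (flip_rev SS)"
    then obtain i where i: "i \<in> minuses (flip_rev SS)" "p = mirror SS m i" by auto
    obtain j where j: "j \<in> minuses SS" "i = length SS - Suc (m j)" "mirror SS m i = length SS - Suc j"
      using i(1) by (rule mirror_arcE)
    then show "p \<in> pluses (flip_rev SS)"
      using i minuses_less[OF j(1)] by (simp add: pluses_flip_rev)
  next
    fix p assume "p \<in> pluses (flip_rev SS)"
    then have p: "p < length SS" "length SS - Suc p \<in> minuses SS" by (auto simp: pluses_flip_rev)
    then have "mirror SS m (length SS - Suc (m (length SS - Suc p))) = p"
      using mirror_arc(2)[OF p(2)] by simp
    then show "p \<in> mirror SS m ` minuses (flip_rev SS)"
      using mirror_arc(1)[OF p(2)] by (metis imageI)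
  qed
qed

end

lemma mirror_mirror:
  assumes m: "m \<in> line_diagrams SS"
  shows "mirror (flip_rev SS) (mirror SS m) = m"
proof
  fix i
  show "mirror (flip_rev SS) (mirror SS m) i = m i"
  proof (cases "i \<in> minuses SS")
    case True
    note a = mirror_arc[OF m True]
    have l: "i < length SS" "m i < length SS"
      using True minuses_less line_diagramsD(5)[OF m True] pluses_less by auto
    show ?thesis
      using mirror_arc(2)[OF mirror_in_line_diagrams[OF m] a(1)] a(2) l by simp
  next
    case False
    then show ?thesis using line_diagramsD(1)[OF m False]
      by (simp add: mirror_def flip_rev_flip_rev[simplified])
  qed
qed

text \<open>Reflection preserves crossings but exchanges which of two crossing arcs ends further
  right. Every factor therefore reappears with its two arguments exchanged, which is its
  conjugate.\<close>

lemma line_phase_mirror: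
  assumes m: "m \<in> line_diagrams SS" and herm: "\<And>x y. R x y = cnj (R y x)"
    and e': "\<And>i. i < length SS \<Longrightarrow> e' (mirror SS m i) = e (m (length SS - Suc i))"
  shows "line_phase R (flip_rev SS) (mirror SS m) e' = cnj (line_phase R SS m e)"
proof -
  let ?S = "flip_rev SS" and ?m = "mirror SS m" and ?r = "\<lambda>i. length SS - Suc (m i)"
  have fin: "finite (crossings S k i)" for S k i
    by (rule finite_subset[of _ "minuses S"]) (auto simp: crossings_def)
  have lt: "i < length SS" "m i < length SS" "i < m i" if "i \<in> minuses SS" for i
    using that minuses_less line_diagramsD(3,5)[OF m that] pluses_less by auto
  have "line_phase R ?S ?m e' = (\<Prod>(i, i')\<in>Sigma (minuses ?S) (crossings ?S ?m). R (e' (?m i)) (e' (?m i')))"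
    unfolding line_phase_def by (rule prod.Sigma) (auto simp: fin)
  also have "\<dots> = (\<Prod>(j, j')\<in>Sigma (minuses SS) (crossings SS m). cnj (R (e (m j)) (e (m j'))))"
  \<comment> \<open>The reflected crossing lists the two arcs in the opposite order, hence the swap
    of components in both witnesses.\<close>
  proof (rule prod.reindex_bij_witness[where j="\<lambda>(i, i'). (length SS - Suc (?m i'), length SS - Suc (?m i))"
        and i="\<lambda>(j, j'). (?r j', ?r j)"])
    fix p assume "p \<in> Sigma (minuses ?S) (crossings ?S ?m)"
    then obtain i i' where p: "p = (i, i')" "i \<in> minuses ?S" "i' \<in> minuses ?S" "i' < i" "i < ?m i'" "?m i' < ?m i"
      by (auto simp: crossings_def)
    obtain j where j: "j \<in> minuses SS" "i = ?r j" "?m i = length SS - Suc j"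
      using p(2) by (rule mirror_arcE[OF m])
    obtain j' where j': "j' \<in> minuses SS" "i' = ?r j'" "?m i' = length SS - Suc j'"
      using p(3) by (rule mirror_arcE[OF m])
    note l = lt[OF j(1)] lt[OF j'(1)]
    have eq: "length SS - Suc (?m i) = j" "length SS - Suc (?m i') = j'" using j j' l by auto
    show "(\<lambda>(j, j'). (?r j', ?r j)) ((\<lambda>(i, i'). (length SS - Suc (?m i'), length SS - Suc (?m i))) p) = p"
      by (simp only: p(1) prod.case eq j(2)[symmetric] j'(2)[symmetric])
    show "(\<lambda>(i, i'). (length SS - Suc (?m i'), length SS - Suc (?m i))) p \<in> Sigma (minuses SS) (crossings SS m)"
    proof -
      have "m j < m j'" using p(4) l unfolding j(2) j'(2) by arith
      moreover have "j' < m j" using p(5) l unfolding j(2) j'(3) by arith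
      moreover have "j < j'" using p(6) l unfolding j(3) j'(3) by arith
      ultimately show ?thesis using j(1) j'(1) by (simp add: p(1) eq crossings_def)
    qed
    have "e' (?m i) = e (m j)" "e' (?m i') = e (m j')"
      using e'[of i] e'[of i'] j j' l line_diagrams_idem[OF m j(1)] line_diagrams_idem[OF m j'(1)] by auto
    then show "(case (\<lambda>(i, i'). (length SS - Suc (?m i'), length SS - Suc (?m i))) p of (j, j') \<Rightarrow> cnj (R (e (m j)) (e (m j')))) =
      (case p of (i, i') \<Rightarrow> R (e' (?m i)) (e' (?m i')))"
      using herm[of "e (m j)" "e (m j')"] by (simp only: p(1) prod.case eq)
  next
    fix q assume "q \<in> Sigma (minuses SS) (crossings SS m)"
    then obtain j j' where q: "q = (j, j')" "j \<in> minuses SS" "j' \<in> minuses SS" "j' < j" "j < m j'" "m j' < m j"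
      by (auto simp: crossings_def)
    note l = lt[OF q(2)] lt[OF q(3)]
    show "(\<lambda>(i, i'). (length SS - Suc (?m i'), length SS - Suc (?m i))) ((\<lambda>(j, j'). (?r j', ?r j)) q) = q"
      using l mirror_arc(2)[OF m q(2)] mirror_arc(2)[OF m q(3)] by (simp add: q(1))
    show "(\<lambda>(j, j'). (?r j', ?r j)) q \<in> Sigma (minuses ?S) (crossings ?S ?m)"
      using l q(4-6) mirror_arc[OF m q(2)] mirror_arc[OF m q(3)] by (auto simp: q(1) crossings_def)
  qed
  also have "\<dots> = cnj (line_phase R SS m e)"
    unfolding line_phase_def by (subst prod.Sigma[symmetric]) (auto simp: fin)
  finally show ?thesis .
qed

text \<open>The integration variables sit at the right ends of the arcs, and reflection turns left
  ends into right ends. \<open>T\<close> renames the variables accordingly; after that the two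
  integrands are conjugate pointwise.\<close>

lemma line_integral_mirror:
  assumes M: "sigma_finite_measure M" and m: "m \<in> line_diagrams SS" and herm: "\<And>x y. R x y = cnj (R y x)"
    and R: "(\<lambda>(x, y). R x y) \<in> borel_measurable (M \<Otimes>\<^sub>M M)"
    and \<Phi>: "\<Phi>' \<in> borel_measurable (power_measure M (length SS))"
    and eq: "\<And>y. \<Phi>' (\<lambda>i\<in>{..<length SS}. y (length SS - Suc i)) = cnj (\<Phi> (\<lambda>i\<in>{..<length SS}. y i))"
  shows "line_integral M R (flip_rev SS) \<Phi>' (mirror SS m) = cnj (line_integral M R SS \<Phi> m)"
proof -
  let ?S = "flip_rev SS" and ?m = "mirror SS m"
  let ?q = "\<lambda>l. m (length SS - Suc l)"
  have m': "?m \<in> line_diagrams ?S" by (rule mirror_in_line_diagrams[OF m])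
  have q: "bij_betw ?q (pluses ?S) (pluses SS)"
  proof -
    have "bij_betw (\<lambda>l. length SS - Suc l) (pluses ?S) (minuses SS)"
    proof (rule bij_betw_byWitness[where f'="\<lambda>l. length SS - Suc l"])
      have "l < length SS \<and> length SS - Suc l < length SS \<and> length SS - Suc (length SS - Suc l) = l" if "l \<in> minuses SS" for l
        using minuses_less[OF that] by simp
      then show "\<forall>l\<in>minuses SS. length SS - Suc (length SS - Suc l) = l"
        "(\<lambda>l. length SS - Suc l) ` minuses SS \<subseteq> pluses ?S"
        by (auto simp: pluses_flip_rev)
    qed (auto simp: pluses_flip_rev)
    from bij_betw_trans[OF this line_diagramsD(2)[OF m]] show ?thesis by (simp add: comp_def)
  qed
  define T where "T e = (\<lambda>l\<in>pluses ?S. e (?q l))" for e :: "nat \<Rightarrow> 'a"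
  have Tm: "T \<in> PiM (pluses SS) (\<lambda>_. M) \<rightarrow>\<^sub>M PiM (pluses ?S) (\<lambda>_. M)"
    unfolding T_def[abs_def] using q
    by (intro measurable_restrict measurable_component_singleton) (auto simp: bij_betw_def)
  have Td: "distr (PiM (pluses SS) (\<lambda>_. M)) (PiM (pluses ?S) (\<lambda>_. M)) T = PiM (pluses ?S) (\<lambda>_. M)"
    unfolding T_def[abs_def] by (rule distr_PiM_reindex_bij[OF M _ q]) simp
  have Teq: "T e (?m i) = e (m (length SS - Suc i))" if i: "i < length SS" for e i
  proof (cases "i \<in> minuses ?S")
    case True
    then obtain j where j: "j \<in> minuses SS" "i = length SS - Suc (m j)" "?m i = length SS - Suc j"
      by (rule mirror_arcE[OF m])
    have l: "j < length SS" "m j < length SS" "m (m j) = m j"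
      using j(1) minuses_less line_diagramsD(5)[OF m j(1)] pluses_less line_diagrams_idem[OF m j(1)]
      by auto
    moreover have "length SS - Suc j < length SS" using l(1) by arith
    ultimately show ?thesis using j by (simp add: T_def pluses_flip_rev)
  next
    case False
    then have "i \<in> pluses ?S" using i plus_minus_Un[of ?S] by auto
    then show ?thesis using line_diagramsD(1)[OF m' False] by (simp add: T_def)
  qed
  have mmeas: "(\<lambda>e. \<Phi>' (\<lambda>i\<in>{..<length ?S}. e (?m i)) * line_phase R ?S ?m e) \<in> borel_measurable (PiM (pluses ?S) (\<lambda>_. M))"
  proof (intro borel_measurable_times)
    have mi: "?m i \<in> pluses ?S" if "i < length SS" for i
      using that line_diagramsD(1,5)[OF m', of i] plus_minus_Un[of ?S] by (cases "i \<in> minuses ?S") auto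
    have "(\<lambda>e. \<lambda>i\<in>{..<length SS}. e (?m i)) \<in> PiM (pluses ?S) (\<lambda>_. M) \<rightarrow>\<^sub>M power_measure M (length SS)"
      using mi by (intro measurable_restrict measurable_component_singleton) auto
    from measurable_compose[OF this \<Phi>]
    show "(\<lambda>e. \<Phi>' (\<lambda>i\<in>{..<length ?S}. e (?m i))) \<in> borel_measurable (PiM (pluses ?S) (\<lambda>_. M))"
      by simp
    show "line_phase R ?S ?m \<in> borel_measurable (PiM (pluses ?S) (\<lambda>_. M))"
      unfolding line_phase_def[abs_def]
    proof (intro borel_measurable_prod)
      fix i i' assume "i \<in> minuses ?S" "i' \<in> crossings ?S ?m i"
      then have "?m i \<in> pluses ?S" "?m i' \<in> pluses ?S" using line_diagramsD(5)[OF m'] by (auto simp: crossings_def)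
      then have "(\<lambda>e. (e (?m i), e (?m i'))) \<in> PiM (pluses ?S) (\<lambda>_. M) \<rightarrow>\<^sub>M M \<Otimes>\<^sub>M M"
        by (intro measurable_Pair measurable_component_singleton)
      from measurable_compose[OF this R] show "(\<lambda>e. R (e (?m i)) (e (?m i'))) \<in> borel_measurable (PiM (pluses ?S) (\<lambda>_. M))"
        by simp
    qed
  qed
  have "line_integral M R ?S \<Phi>' ?m =
    (LINT e|PiM (pluses SS) (\<lambda>_. M). \<Phi>' (\<lambda>i\<in>{..<length ?S}. T e (?m i)) * line_phase R ?S ?m (T e))"
    unfolding line_integral_def by (subst Td[symmetric]) (rule integral_distr[OF Tm mmeas])
  also have "\<dots> = (LINT e|PiM (pluses SS) (\<lambda>_. M). cnj (\<Phi> (\<lambda>i\<in>{..<length SS}. e (m i)) * line_phase R SS m e))"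
  proof (intro Bochner_Integration.integral_cong refl)
    fix e
    have "(\<lambda>i\<in>{..<length ?S}. T e (?m i)) = (\<lambda>i\<in>{..<length SS}. (\<lambda>j. e (m j)) (length SS - Suc i))"
      using Teq by (auto intro!: restrict_ext)
    then have 1: "\<Phi>' (\<lambda>i\<in>{..<length ?S}. T e (?m i)) = cnj (\<Phi> (\<lambda>i\<in>{..<length SS}. e (m i)))"
      using eq[of "\<lambda>j. e (m j)"] by simp
    have 2: "line_phase R ?S ?m (T e) = cnj (line_phase R SS m e)"
      by (rule line_phase_mirror[OF m herm]) (rule Teq)
    show "\<Phi>' (\<lambda>i\<in>{..<length ?S}. T e (?m i)) * line_phase R ?S ?m (T e) =
      cnj (\<Phi> (\<lambda>i\<in>{..<length SS}. e (m i)) * line_phase R SS m e)"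
      unfolding 1 2 by simp
  qed
  also have "\<dots> = cnj (line_integral M R SS \<Phi> m)"
    unfolding line_integral_def by (rule Bochner_Integration.integral_cnj)
  finally show ?thesis .
qed

lemma sum_line_integral_mirror:
  assumes "sigma_finite_measure M" and "\<And>x y. R x y = cnj (R y x)"
    and "(\<lambda>(x, y). R x y) \<in> borel_measurable (M \<Otimes>\<^sub>M M)"
    and "\<Phi>' \<in> borel_measurable (power_measure M (length SS))"
    and "\<And>y. \<Phi>' (\<lambda>i\<in>{..<length SS}. y (length SS - Suc i)) = cnj (\<Phi> (\<lambda>i\<in>{..<length SS}. y i))"
  shows "(\<Sum>m\<in>line_diagrams (flip_rev SS). line_integral M R (flip_rev SS) \<Phi>' m) =
    cnj (\<Sum>m\<in>line_diagrams SS. line_integral M R SS \<Phi> m)"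
  unfolding cnj_sum
proof (rule sum.reindex_bij_witness[where i="mirror SS" and j="mirror (flip_rev SS)"])
  fix m assume m: "m \<in> line_diagrams (flip_rev SS)"
  show 1: "mirror SS (mirror (flip_rev SS) m) = m"
    using mirror_mirror[OF m] by (simp only: flip_rev_flip_rev)
  show 2: "mirror (flip_rev SS) m \<in> line_diagrams SS"
    using mirror_in_line_diagrams[OF m] by (simp only: flip_rev_flip_rev)
  show "cnj (line_integral M R SS \<Phi> (mirror (flip_rev SS) m)) = line_integral M R (flip_rev SS) \<Phi>' m"
    using line_integral_mirror[OF assms(1) 2 assms(2-5)] 1 by simp
qed (auto simp: mirror_mirror mirror_in_line_diagrams)

section \<open>Lines of signs that represent a scalar product\<close>

abbreviation "extended n' ss n \<equiv> replicate n' Minus @ ss @ replicate n Plus"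

lemma minuses_extended:
  "i \<in> minuses (extended n' ss n) \<longleftrightarrow> i < n' \<or> (n' \<le> i \<and> i - n' \<in> minuses ss)"
  by (auto simp: minus_set_def nth_append)

lemma pluses_extended:
  "i \<in> pluses (extended n' ss n) \<longleftrightarrow>
    (n' \<le> i \<and> i - n' \<in> pluses ss) \<or> (n' + length ss \<le> i \<and> i < n' + length ss + n)"
  by (auto simp: plus_set_def nth_append)

text \<open>The first \<open>n'\<close> positions carry the arguments of \<open>F\<close> in reverse
  order. Reflecting the line therefore puts them at the right end in natural order, where those of
  \<open>f\<close> stood.\<close>

definition line_fun ::
  "nat \<Rightarrow> nat \<Rightarrow> nat \<Rightarrow> ((nat \<Rightarrow> 'y) \<Rightarrow> complex) \<Rightarrow> ((nat \<Rightarrow> 'y) \<Rightarrow> complex) \<Rightarrow> ((nat \<Rightarrow> 'y) \<Rightarrow> complex) \<Rightarrow> (nat \<Rightarrow> 'y) \<Rightarrow> complex"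
  where "line_fun n' k n \<phi> f F y = cnj (F (\<lambda>p\<in>{..<n'}. y (n' - Suc p))) * \<phi> (\<lambda>j\<in>{..<k}. y (n' + j)) *
    f (\<lambda>q\<in>{..<n}. y (n' + k + q))"

context
  fixes n n' :: nat and ss :: "sign list"
  assumes linked: "n + count_list ss Plus = n' + count_list ss Minus"
begin

definition line_pos :: "letter \<Rightarrow> nat"
  where "line_pos l = n' + letter_rank (length ss) l"

text \<open>The letter at place \<open>\<pi> p\<close> of the final word is joined to the minus that
  carries the argument \<open>p\<close> of \<open>F\<close>, where \<open>n' - Suc i\<close> undoes
  the reversal of that block. An inner annihilation is joined to the letter it deletes, and a
  creation to itself.\<close>

definition diagram_of :: "(nat \<Rightarrow> nat) \<Rightarrow> (nat \<Rightarrow> letter) \<Rightarrow> nat \<Rightarrow> nat"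
  where "diagram_of \<pi> a i = (if i < n' then line_pos (surv n ss a ! \<pi> (n' - Suc i))
    else if i < n' + length ss then line_pos (a (i - n')) else i)"

lemma bij_line_pos: "bij_betw line_pos (alphabet n ss) (pluses (extended n' ss n))"
  unfolding bij_betw_def
proof
  have "inj_on (letter_rank (length ss)) (alphabet n ss)" by (rule inj_on_letter_rank) simp
  then show "inj_on line_pos (alphabet n ss)" by (auto simp: inj_on_def line_pos_def)
  have "line_pos ` alphabet n ss = (\<lambda>i. n' + i) ` (pluses ss \<union> (\<lambda>q. length ss + q) ` {..<n})"
    by (force simp: set_letters line_pos_def)
  also have "\<dots> = pluses (extended n' ss n)"
  proof (intro set_eqI iffI)
    fix i assume "i \<in> pluses (extended n' ss n)"
    then consider "n' \<le> i" "i - n' \<in> pluses ss" | "n' + length ss \<le> i" "i < n' + length ss + n"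
      by (auto simp: pluses_extended)
    then show "i \<in> (\<lambda>i. n' + i) ` (pluses ss \<union> (\<lambda>q. length ss + q) ` {..<n})"
    proof cases
      case 1 then show ?thesis by (intro image_eqI[of _ _ "i - n'"]) auto
    next
      case 2
      then have "i - n' = length ss + (i - n' - length ss)" "i - n' - length ss < n" by auto
      then have "i - n' \<in> (\<lambda>q. length ss + q) ` {..<n}" by blast
      then show ?thesis using 2 by (intro image_eqI[of _ _ "i - n'"]) auto
    qed
  qed (auto simp: pluses_extended)
  finally show "line_pos ` alphabet n ss = pluses (extended n' ss n)" .
qed

lemma line_pos_eq: "l \<in> alphabet n ss \<Longrightarrow> u \<in> alphabet n ss \<Longrightarrow> line_pos l = line_pos u \<Longrightarrow> l = u"
  using bij_line_pos by (auto simp: bij_betw_def inj_on_def)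

lemma length_surv': "a \<in> pairs n ss \<Longrightarrow> length (surv n ss a) = n'"
  using length_survivors[of a n 0 ss "length ss"] linked by simp

context
  fixes a \<pi>
  assumes a: "a \<in> pairs n ss" and \<pi>: "\<pi> permutes {..<n'}"
begin

lemma surv_alphabet: "p < n' \<Longrightarrow> surv n ss a ! \<pi> p \<in> set (surv n ss a)" "p < n' \<Longrightarrow> surv n ss a ! \<pi> p \<in> alphabet n ss"
proof -
  assume "p < n'"
  then have "\<pi> p < length (surv n ss a)" using permutes_in_image[OF \<pi>, of p] length_surv'[OF a] by simp
  then show "surv n ss a ! \<pi> p \<in> set (surv n ss a)" by simp
  then show "surv n ss a ! \<pi> p \<in> alphabet n ss" using survivors_Un[OF a] by auto
qed

lemma diagram_of_simps:
  "p < n' \<Longrightarrow> diagram_of \<pi> a (n' - Suc p) = line_pos (surv n ss a ! \<pi> p)"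
  "j < length ss \<Longrightarrow> diagram_of \<pi> a (n' + j) = line_pos (a j)"
  "diagram_of \<pi> a (n' + length ss + q) = line_pos (Arg q)"
  by (auto simp: diagram_of_def line_pos_def)

lemma surv_not_deleted: "p < n' \<Longrightarrow> surv n ss a ! \<pi> p \<notin> a ` minuses ss"
  using surv_alphabet(1) survivors_disjoint[of n 0 ss a] by auto

lemma surv_inj: "p < n' \<Longrightarrow> q < n' \<Longrightarrow> surv n ss a ! \<pi> p = surv n ss a ! \<pi> q \<Longrightarrow> p = q"
  using permutes_in_image[OF \<pi>] permutes_inj[OF \<pi>] length_surv'[OF a] distinct_survivors[of n 0 ss a]
  by (metis injD lessThan_iff nth_eq_iff_index_eq)

lemma minuses_extended_cases:
  assumes "i \<in> minuses (extended n' ss n)"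
  obtains p where "p < n'" "i = n' - Suc p" | j where "j \<in> minuses ss" "i = n' + j"
proof -
  from assms consider "i < n'" | "n' \<le> i" "i - n' \<in> minuses ss" by (auto simp: minuses_extended)
  then show ?thesis
  proof cases
    case 1 then show ?thesis using that(1)[of "n' - Suc i"] by simp
  next
    case 2 then show ?thesis using that(2)[of "i - n'"] by simp
  qed
qed

text \<open>Every plus is met exactly once because the survivors and the deleted letters split the
  alphabet.\<close>

lemma diagram_of_in: "diagram_of \<pi> a \<in> line_diagrams (extended n' ss n)"
  unfolding line_diagrams_def
proof (intro CollectI conjI allI impI ballI)
  fix i assume i: "i \<notin> minuses (extended n' ss n)"
  then have "n' \<le> i" "i - n' \<notin> minuses ss" by (auto simp: minuses_extended)
  then show "diagram_of \<pi> a i = i"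
    using pairingsD(1)[OF a, of "i - n'"] by (auto simp: diagram_of_def line_pos_def)
next
  fix i assume "i \<in> minuses (extended n' ss n)"
  then show "i < diagram_of \<pi> a i"
  proof (cases rule: minuses_extended_cases)
    case (1 p) then show ?thesis using diagram_of_simps(1)[of p] by (simp add: line_pos_def)
  next
    case (2 j) then show ?thesis using diagram_of_simps(2)[of j] pairingsD(4)[OF a, of j] minuses_less[of j ss]
      by (simp add: line_pos_def)
  qed
next
  have al: "a j \<in> alphabet n ss" if "j \<in> minuses ss" for j using pairingsD(3)[OF a that] .
  show "bij_betw (diagram_of \<pi> a) (minuses (extended n' ss n)) (pluses (extended n' ss n))"
    unfolding bij_betw_def
  proof
    show "inj_on (diagram_of \<pi> a) (minuses (extended n' ss n))"
    proof (rule inj_onI)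
      fix i i' assume i: "i \<in> minuses (extended n' ss n)" "i' \<in> minuses (extended n' ss n)"
        and eq: "diagram_of \<pi> a i = diagram_of \<pi> a i'"
      show "i = i'" using i(1)
      proof (cases rule: minuses_extended_cases)
        case (1 p)
        show ?thesis using i(2)
        proof (cases rule: minuses_extended_cases)
          case (1 q)
          then have "surv n ss a ! \<pi> p = surv n ss a ! \<pi> q"
            using eq \<open>p < n'\<close> \<open>i = n' - Suc p\<close> diagram_of_simps(1) surv_alphabet by (auto intro: line_pos_eq)
          then show ?thesis using surv_inj 1 \<open>p < n'\<close> \<open>i = n' - Suc p\<close> by auto
        next
          case (2 j)
          then have "surv n ss a ! \<pi> p = a j"
            using eq \<open>p < n'\<close> \<open>i = n' - Suc p\<close> diagram_of_simps(1,2) surv_alphabet al minuses_less[of j ss]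
            by (auto intro!: line_pos_eq)
          then show ?thesis using surv_not_deleted[OF \<open>p < n'\<close>] 2 by auto
        qed
      next
        case (2 j)
        show ?thesis using i(2)
        proof (cases rule: minuses_extended_cases)
          case (1 p)
          then have "surv n ss a ! \<pi> p = a j"
            using eq 1 2 diagram_of_simps(1,2) surv_alphabet al minuses_less[of j ss]
            by (auto intro!: line_pos_eq)
          then show ?thesis using surv_not_deleted[OF \<open>p < n'\<close>] 2 by auto
        next
          case (2 j')
          then have "a j = a j'"
            using eq \<open>j \<in> minuses ss\<close> \<open>i = n' + j\<close> diagram_of_simps(2) al minuses_less[of j ss] minuses_less[of j' ss]
            by (auto intro!: line_pos_eq)
          then show ?thesis using pairingsD(2)[OF a] 2 \<open>j \<in> minuses ss\<close> \<open>i = n' + j\<close> by (auto simp: inj_on_def)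
        qed
      qed
    qed
    have "diagram_of \<pi> a ` minuses (extended n' ss n) = line_pos ` alphabet n ss"
    proof (intro set_eqI iffI)
      fix l assume "l \<in> diagram_of \<pi> a ` minuses (extended n' ss n)"
      then obtain i where i: "i \<in> minuses (extended n' ss n)" "l = diagram_of \<pi> a i" by auto
      show "l \<in> line_pos ` alphabet n ss" using i(1)
        by (cases rule: minuses_extended_cases)
          (use i(2) diagram_of_simps(1,2) surv_alphabet al minuses_less[of _ ss] in auto)
    next
      fix l assume "l \<in> line_pos ` alphabet n ss"
      then obtain u where u: "u \<in> alphabet n ss" "l = line_pos u" by auto
      then consider "u \<in> set (surv n ss a)" | "u \<in> a ` minuses ss" using survivors_Un[OF a] by auto
      then show "l \<in> diagram_of \<pi> a ` minuses (extended n' ss n)"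
      proof cases
        case 1
        then obtain p where p: "p < n'" "u = surv n ss a ! p" using length_surv'[OF a] by (auto simp: in_set_conv_nth)
        then obtain q where q: "q < n'" "p = \<pi> q"
          using permutes_image[OF \<pi>] by (metis imageE lessThan_iff)
        then have "l = diagram_of \<pi> a (n' - Suc q)" using diagram_of_simps(1)[OF q(1)] u p by simp
        moreover have "n' - Suc q \<in> minuses (extended n' ss n)" using q by (simp add: minuses_extended)
        ultimately show ?thesis by blast
      next
        case 2
        then obtain j where j: "j \<in> minuses ss" "u = a j" by auto
        then have "l = diagram_of \<pi> a (n' + j)" using diagram_of_simps(2) u minuses_less[of j ss] by simp
        moreover have "n' + j \<in> minuses (extended n' ss n)" using j by (simp add: minuses_extended)
        ultimately show ?thesis by blast
      qed
    qed
    then show "diagram_of \<pi> a ` minuses (extended n' ss n) = pluses (extended n' ss n)"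
      using bij_line_pos by (simp add: bij_betw_def)
  qed
qed

text \<open>The final word is ordered by rank, so comparing the right ends of two outer arcs is
  comparing two values of \<open>\<pi>\<close>.\<close>

lemma rank_nth_less:
  assumes "p < n'" "q < n'"
  shows "line_pos (surv n ss a ! \<pi> q) < line_pos (surv n ss a ! \<pi> p) \<longleftrightarrow> \<pi> q < \<pi> p"
proof -
  have srt: "sorted_wrt (\<lambda>l u. letter_rank (length ss) l < letter_rank (length ss) u) (surv n ss a)"
    unfolding survivors_def by (rule sorted_wrt_filter, rule sorted_letters) simp
  have l: "\<pi> p < length (surv n ss a)" "\<pi> q < length (surv n ss a)"
    using assms permutes_in_image[OF \<pi>] length_surv'[OF a] by auto
  show ?thesis
    using sorted_wrt_nth_less[OF srt, of "\<pi> q" "\<pi> p"] sorted_wrt_nth_less[OF srt, of "\<pi> p" "\<pi> q"] l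
    by (cases "\<pi> q" "\<pi> p" rule: linorder_cases) (auto simp: line_pos_def)
qed

text \<open>An arc counted here starts to the left of \<open>n' + j\<close> and ends between the two
  ends of the arc of \<open>j\<close>. Starting to the left means that its letter is not taken by an
  annihilation right of \<open>j\<close>, hence is still in the word when \<open>j\<close> acts;
  ending between means that it stands before \<open>a j\<close>. These are the letters that
  \<open>a j\<close> is moved past.\<close>

lemma crossings_deleted:
  assumes j: "j \<in> minuses ss"
  shows "bij_betw (diagram_of \<pi> a) (crossings (extended n' ss n) (diagram_of \<pi> a) (n' + j))
    (line_pos ` passed n 0 ss (length ss) a j)"
proof -
  let ?m = "diagram_of \<pi> a" and ?S = "extended n' ss n"
  note m = diagram_of_in
  have jl: "j < length ss" using minuses_less[OF j] .
  have mj: "?m (n' + j) = line_pos (a j)" using diagram_of_simps(2)[OF jl] .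
  have "inj_on ?m (crossings ?S ?m (n' + j))"
    by (rule inj_on_subset[OF line_diagramsD(4)[OF m]]) (auto simp: crossings_def)
  moreover have "?m ` crossings ?S ?m (n' + j) = line_pos ` passed n 0 ss (length ss) a j"
  proof (intro set_eqI iffI)
    fix l assume "l \<in> ?m ` crossings ?S ?m (n' + j)"
    then obtain i' where i': "i' \<in> minuses ?S" "i' < n' + j" "n' + j < ?m i'" "?m i' < line_pos (a j)" "l = ?m i'"
      by (auto simp: crossings_def mj)
    obtain u where u: "u \<in> alphabet n ss" "?m i' = line_pos u"
      using line_diagramsD(5)[OF m i'(1)] bij_line_pos by (auto simp: bij_betw_def)
    have "u \<notin> a ` {j'\<in>minuses ss. j < j'}"
    proof
      assume "u \<in> a ` {j'\<in>minuses ss. j < j'}"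
      then obtain j' where j': "j' \<in> minuses ss" "j < j'" "u = a j'" by auto
      then have "?m (n' + j') = ?m i'" using u diagram_of_simps(2)[of j'] minuses_less[of j' ss] by simp
      moreover have "n' + j' \<in> minuses ?S" using j' by (simp add: minuses_extended)
      ultimately have "n' + j' = i'" using line_diagramsD(4)[OF m] i'(1) by (meson inj_onD)
      then show False using i'(2) j'(2) by simp
    qed
    then have "u \<in> passed n 0 ss (length ss) a j"
      using u i' by (auto simp: passed_def line_pos_def)
    then show "l \<in> line_pos ` passed n 0 ss (length ss) a j" using u i' by auto
  next
    fix l assume "l \<in> line_pos ` passed n 0 ss (length ss) a j"
    then obtain u where u: "u \<in> alphabet n ss" "j < letter_rank (length ss) u"
      "letter_rank (length ss) u < letter_rank (length ss) (a j)" "u \<notin> a ` {j'\<in>minuses ss. j < j'}" "l = line_pos u"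
      by (auto simp: passed_def)
    have "line_pos u \<in> pluses ?S" using u(1) bij_line_pos by (auto simp: bij_betw_def)
    then obtain i' where i': "i' \<in> minuses ?S" "?m i' = line_pos u"
      using line_diagramsD(2)[OF m] unfolding bij_betw_def by (metis imageE)
    have "i' < n' + j" using i'(1)
    proof (cases rule: minuses_extended_cases)
      case (2 j')
      then have "a j' = u"
        using i'(2) diagram_of_simps(2)[of j'] minuses_less[of j' ss] pairingsD(3)[OF a, of j'] u(1)
        by (auto intro: line_pos_eq)
      then have "\<not> j < j'" "j' \<noteq> j" using u(3,4) 2 by auto
      then show ?thesis using 2 by simp
    qed simp
    then show "l \<in> ?m ` crossings ?S ?m (n' + j)"
      using i' u by (auto simp: crossings_def mj line_pos_def intro!: image_eqI[of _ _ i'])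
  qed
  ultimately show ?thesis by (simp add: bij_betw_def)
qed

text \<open>A crossing is booked at the arc that starts further right. An outer arc is thus charged
  only for crossings with outer arcs, which are the inversions of \<open>\<pi>\<close>, and an inner
  arc is charged for the factors recorded at its deletion.\<close>

lemma line_phase_diagram_of:
  fixes R :: "'y \<Rightarrow> 'y \<Rightarrow> complex"
  shows "line_phase R (extended n' ss n) (diagram_of \<pi> a) e =
    perm_phase R n' \<pi> (\<lambda>p. e (line_pos (surv n ss a ! \<pi> p))) *
    (\<Prod>j\<in>minuses ss. \<Prod>u\<in>passed n 0 ss (length ss) a j. R (e (line_pos (a j))) (e (line_pos u)))"
proof -
  let ?m = "diagram_of \<pi> a" and ?S = "extended n' ss n"
  let ?g = "\<lambda>i. \<Prod>i'\<in>crossings ?S ?m i. R (e (?m i)) (e (?m i'))"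
  let ?w = "\<lambda>p. surv n ss a ! \<pi> p"
  have S: "minuses ?S = (\<lambda>p. n' - Suc p) ` {..<n'} \<union> (\<lambda>j. n' + j) ` minuses ss"
  proof (intro set_eqI iffI)
    fix i assume "i \<in> minuses ?S"
    then show "i \<in> (\<lambda>p. n' - Suc p) ` {..<n'} \<union> (\<lambda>j. n' + j) ` minuses ss"
      by (cases rule: minuses_extended_cases) auto
  qed (auto simp: minuses_extended)
  have "line_phase R ?S ?m e = (\<Prod>i\<in>(\<lambda>p. n' - Suc p) ` {..<n'}. ?g i) * (\<Prod>i\<in>(\<lambda>j. n' + j) ` minuses ss. ?g i)"
    unfolding line_phase_def S by (rule prod.union_disjoint) auto
  also have "(\<Prod>i\<in>(\<lambda>j. n' + j) ` minuses ss. ?g i) =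
    (\<Prod>j\<in>minuses ss. \<Prod>u\<in>passed n 0 ss (length ss) a j. R (e (line_pos (a j))) (e (line_pos u)))"
  proof (subst prod.reindex)
    show "prod (?g \<circ> (\<lambda>j. n' + j)) (minuses ss) =
      (\<Prod>j\<in>minuses ss. \<Prod>u\<in>passed n 0 ss (length ss) a j. R (e (line_pos (a j))) (e (line_pos u)))"
    proof (rule prod.cong[OF refl])
      fix j assume j: "j \<in> minuses ss"
      have mj: "?m (n' + j) = line_pos (a j)" using diagram_of_simps(2)[OF minuses_less[OF j]] .
      have inj: "inj_on line_pos (passed n 0 ss (length ss) a j)"
        by (rule inj_on_subset[of _ "alphabet n ss"]) (use bij_line_pos in \<open>auto simp: bij_betw_def passed_def\<close>)
      have "(?g \<circ> (\<lambda>j. n' + j)) j = (\<Prod>i'\<in>crossings ?S ?m (n' + j). R (e (line_pos (a j))) (e (?m i')))"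
        by (simp add: mj)
      also have "\<dots> = (\<Prod>l\<in>line_pos ` passed n 0 ss (length ss) a j. R (e (line_pos (a j))) (e l))"
        by (rule prod.reindex_bij_betw[OF crossings_deleted[OF j]])
      also have "\<dots> = (\<Prod>u\<in>passed n 0 ss (length ss) a j. R (e (line_pos (a j))) (e (line_pos u)))"
        by (simp add: prod.reindex[OF inj])
      finally show "(?g \<circ> (\<lambda>j. n' + j)) j = \<dots>" .
    qed
  qed (simp add: inj_on_def)
  also have "(\<Prod>i\<in>(\<lambda>p. n' - Suc p) ` {..<n'}. ?g i) = perm_phase R n' \<pi> (\<lambda>p. e (line_pos (?w p)))"
  proof (subst prod.reindex)
    have "prod (?g \<circ> (\<lambda>p. n' - Suc p)) {..<n'} =
      (\<Prod>p<n'. \<Prod>q\<in>{q. p < q \<and> q < n' \<and> \<pi> q < \<pi> p}. R (e (line_pos (?w p))) (e (line_pos (?w q))))"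
    proof (rule prod.cong[OF refl])
      fix p assume p: "p \<in> {..<n'}"
      then have mp: "?m (n' - Suc p) = line_pos (?w p)" using diagram_of_simps(1) by simp
      have "(?g \<circ> (\<lambda>p. n' - Suc p)) p = (\<Prod>i'\<in>crossings ?S ?m (n' - Suc p). R (e (line_pos (?w p))) (e (?m i')))"
        by (simp add: mp)
      also have "\<dots> = (\<Prod>q\<in>{q. p < q \<and> q < n' \<and> \<pi> q < \<pi> p}. R (e (line_pos (?w p))) (e (line_pos (?w q))))"
      \<comment> \<open>On the reversed block, starting further left means having a larger index:
        \<open>i < n' - Suc p\<close> with \<open>i = n' - Suc q\<close> says
        \<open>p < q\<close>.\<close>
      proof (rule prod.reindex_bij_witness[where i="\<lambda>q. n' - Suc q" and j="\<lambda>i. n' - Suc i"])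
        fix i assume i: "i \<in> crossings ?S ?m (n' - Suc p)"
        then have i': "i < n' - Suc p" "?m i < line_pos (?w p)" by (auto simp: crossings_def mp)
        then have q: "n' - Suc i < n'" "i = n' - Suc (n' - Suc i)" "p < n' - Suc i" by auto
        have mi: "?m i = line_pos (?w (n' - Suc i))" using diagram_of_simps(1)[OF q(1)] q(2) by simp
        show "n' - Suc (n' - Suc i) = i" using q by simp
        show "n' - Suc i \<in> {q. p < q \<and> q < n' \<and> \<pi> q < \<pi> p}"
          using q i'(2) rank_nth_less[of p "n' - Suc i"] p mi by auto
        show "R (e (line_pos (?w p))) (e (line_pos (?w (n' - Suc i)))) = R (e (line_pos (?w p))) (e (?m i))"
          by (simp add: mi)
      next
        fix q assume q: "q \<in> {q. p < q \<and> q < n' \<and> \<pi> q < \<pi> p}"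
        then have q': "p < q" "q < n'" "\<pi> q < \<pi> p" by auto
        show "n' - Suc (n' - Suc q) = q" using q' by simp
        have "n' - Suc q \<in> minuses ?S" using q' by (simp add: minuses_extended)
        moreover have "n' - Suc p < ?m (n' - Suc q)"
          using diagram_of_simps(1)[OF q'(2)] p by (auto simp: line_pos_def)
        moreover have "n' - Suc q < n' - Suc p" using q' by arith
        ultimately show "n' - Suc q \<in> crossings ?S ?m (n' - Suc p)"
          using q' rank_nth_less[of p q] p diagram_of_simps(1)[OF q'(2)] by (simp add: crossings_def mp)
      qed
      finally show "(?g \<circ> (\<lambda>p. n' - Suc p)) p = \<dots>" .
    qed
    also have "\<dots> = (\<Prod>(p, q)\<in>Sigma {..<n'} (\<lambda>p. {q. p < q \<and> q < n' \<and> \<pi> q < \<pi> p}). R (e (line_pos (?w p))) (e (line_pos (?w q))))"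
      by (rule prod.Sigma) auto
    also have "\<dots> = perm_phase R n' \<pi> (\<lambda>p. e (line_pos (?w p)))"
      unfolding perm_phase_def by (rule prod.cong) auto
    finally show "prod (?g \<circ> (\<lambda>p. n' - Suc p)) {..<n'} = perm_phase R n' \<pi> (\<lambda>p. e (line_pos (?w p)))" .
  qed (auto simp: inj_on_def)
  finally show ?thesis .
qed

end

text \<open>A diagram determines \<open>a\<close> through the arcs of its inner minuses. The
  remaining letters form the final word, and the arcs of the outer minuses list them in some order,
  which is \<open>\<pi>\<close>.\<close>

lemma bij_diagram_of:
  "bij_betw (\<lambda>(\<pi>, a). diagram_of \<pi> a) ({\<pi>. \<pi> permutes {..<n'}} \<times> pairs n ss) (line_diagrams (extended n' ss n))"
  unfolding bij_betw_def
proof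
  show "inj_on (\<lambda>(\<pi>, a). diagram_of \<pi> a) ({\<pi>. \<pi> permutes {..<n'}} \<times> pairs n ss)"
  proof (rule inj_onI, clarify)
    fix \<pi> a \<pi>' a' assume \<pi>: "\<pi> permutes {..<n'}" "\<pi>' permutes {..<n'}" and a: "a \<in> pairs n ss" "a' \<in> pairs n ss"
      and eq: "diagram_of \<pi> a = diagram_of \<pi>' a'"
    have aa: "a = a'"
    proof
      fix j show "a j = a' j"
      proof (cases "j < length ss")
        case True
        then have "line_pos (a j) = line_pos (a' j)"
          using diagram_of_simps(2)[OF a(1) \<pi>(1) True] diagram_of_simps(2)[OF a(2) \<pi>(2) True] eq by simp
        then show ?thesis using pairing_in_alphabet[OF a(1) True] pairing_in_alphabet[OF a(2) True] by (rule line_pos_eq[rotated 2])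
      next
        case False
        then have "j \<notin> minuses ss" using minuses_less by blast
        then show ?thesis using pairingsD(1)[OF a(1)] pairingsD(1)[OF a(2)] by simp
      qed
    qed
    have "\<pi> p = \<pi>' p" for p
    proof (cases "p < n'")
      case True
      have "line_pos (surv n ss a ! \<pi> p) = line_pos (surv n ss a ! \<pi>' p)"
        using diagram_of_simps(1)[OF a(1) \<pi>(1) True] diagram_of_simps(1)[OF a(2) \<pi>(2) True] eq aa by simp
      then have "surv n ss a ! \<pi> p = surv n ss a ! \<pi>' p"
        using surv_alphabet(2)[OF a(1) \<pi>(1) True] surv_alphabet(2)[OF a(1) \<pi>(2) True] by (rule line_pos_eq[rotated 2])
      then show ?thesis
        using permutes_in_image[OF \<pi>(1), of p] permutes_in_image[OF \<pi>(2), of p] True length_surv'[OF a(1)]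
          distinct_survivors[of n 0 ss a] by (simp add: nth_eq_iff_index_eq)
    next
      case False
      then show ?thesis using permutes_not_in[OF \<pi>(1)] permutes_not_in[OF \<pi>(2)] by simp
    qed
    then show "\<pi> = \<pi>' \<and> a = a'" using aa by auto
  qed
  show "(\<lambda>(\<pi>, a). diagram_of \<pi> a) ` ({\<pi>. \<pi> permutes {..<n'}} \<times> pairs n ss) = line_diagrams (extended n' ss n)"
  proof (intro set_eqI iffI)
    fix m assume m: "m \<in> line_diagrams (extended n' ss n)"
    let ?S = "extended n' ss n"
    let ?d = "the_inv_into (alphabet n ss) line_pos"
    have d: "?d l \<in> alphabet n ss" "line_pos (?d l) = l" if "l \<in> pluses ?S" for l
      using bij_line_pos that by (auto simp: bij_betw_def the_inv_into_into f_the_inv_into_f)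
    have Sj: "n' + j \<in> minuses ?S" if "j \<in> minuses ss" for j using that by (simp add: minuses_extended)
    have Sp: "i \<in> minuses ?S" if "i < n'" for i using that by (simp add: minuses_extended)
    define a where "a j = (if j \<in> minuses ss then ?d (m (n' + j)) else New j)" for j
    have pos_a: "line_pos (a j) = m (n' + j)" "a j \<in> alphabet n ss" if "j \<in> minuses ss" for j
      using that d line_diagramsD(5)[OF m Sj[OF that]] by (auto simp: a_def)
    have "inj_on a (minuses ss)"
    proof (rule inj_onI)
      fix j j' assume "j \<in> minuses ss" "j' \<in> minuses ss" "a j = a j'"
      then have "m (n' + j) = m (n' + j')" using pos_a(1) by metis
      then show "j = j'" using line_diagramsD(4)[OF m] Sj \<open>j \<in> minuses ss\<close> \<open>j' \<in> minuses ss\<close> by (auto dest: inj_onD)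
    qed
    moreover have "j < letter_rank (length ss) (a j)" if "j \<in> minuses ss" for j
      using line_diagramsD(3)[OF m Sj[OF that]] pos_a(1)[OF that] by (simp add: line_pos_def)
    ultimately have a: "a \<in> pairs n ss" using pos_a(2) by (auto simp: pairings_def a_def)
    let ?w = "surv n ss a"
    define h where "h p = ?d (m (n' - Suc p))" for p
    have h: "line_pos (h p) = m (n' - Suc p)" "h p \<in> alphabet n ss" if "p < n'" for p
      using that d line_diagramsD(5)[OF m Sp[of "n' - Suc p"]] by (auto simp: h_def)
    have hw: "h p \<in> set ?w" if p: "p < n'" for p
    proof -
      have "h p \<notin> a ` minuses ss"
      proof
        assume "h p \<in> a ` minuses ss"
        then obtain j where j: "j \<in> minuses ss" "h p = a j" by auto
        then have "m (n' - Suc p) = m (n' + j)" using h(1)[OF p] pos_a(1)[OF j(1)] by simp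
        then have "n' - Suc p = n' + j"
          using line_diagramsD(4)[OF m] Sj[OF j(1)] Sp[of "n' - Suc p"] p by (auto dest: inj_onD)
        then show False using p by simp
      qed
      then show ?thesis using h(2)[OF p] by (simp add: survivors_def)
    qed
    have lw: "length ?w = n'" by (rule length_surv'[OF a])
    have h_inj: "inj_on h {..<n'}"
    proof (rule inj_onI)
      fix p q assume p: "p \<in> {..<n'}" "q \<in> {..<n'}" "h p = h q"
      then have "m (n' - Suc p) = m (n' - Suc q)" using h(1)[of p] h(1)[of q] by simp
      then have "n' - Suc p = n' - Suc q"
        using line_diagramsD(4)[OF m] Sp[of "n' - Suc p"] Sp[of "n' - Suc q"] p by (auto dest: inj_onD)
      then show "p = q" using p by auto
    qed
    \<comment> \<open>\<open>h p\<close> is the letter met by the outer arc number \<open>p\<close>,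
      and \<open>\<pi> p\<close> is its place in the final word.\<close>
    define \<pi> where "\<pi> p = (if p < n' then THE i. i < n' \<and> ?w ! i = h p else p)" for p
    have \<pi>: "\<pi> p < n' \<and> ?w ! \<pi> p = h p" if p: "p < n'" for p
    proof -
      obtain i where i: "i < n'" "?w ! i = h p" using hw[OF p] lw by (auto simp: in_set_conv_nth)
      then have "(THE i. i < n' \<and> ?w ! i = h p) = i"
        using lw distinct_survivors[of n 0 ss a] by (intro the_equality) (auto, metis nth_eq_iff_index_eq)
      then show ?thesis using i p by (simp add: \<pi>_def)
    qed
    have "inj_on \<pi> {..<n'}"
      using \<pi> h_inj by (metis inj_on_def lessThan_iff)
    moreover from this have "\<pi> ` {..<n'} = {..<n'}"
      using \<pi> by (intro endo_inj_surj) auto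
    ultimately have perm: "\<pi> permutes {..<n'}"
      by (intro bij_imp_permutes) (auto simp: bij_betw_def \<pi>_def)
    have "diagram_of \<pi> a = m"
    proof
      fix i
      consider "i < n'" | j where "i = n' + j" "j < length ss" | "n' + length ss \<le> i"
        by (metis add_diff_inverse_nat linorder_not_less nat_add_left_cancel_less)
      then show "diagram_of \<pi> a i = m i"
      proof cases
        case 1
        then show ?thesis using \<pi>[of "n' - Suc i"] h(1)[of "n' - Suc i"] by (simp add: diagram_of_def)
      next
        case 2
        show ?thesis
        proof (cases "j \<in> minuses ss")
          case True
          then show ?thesis using 2 pos_a(1) by (simp add: diagram_of_def)
        next
          case False
          then have "n' + j \<notin> minuses ?S" by (simp add: minuses_extended)
          then show ?thesis using 2 False line_diagramsD(1)[OF m] by (simp add: diagram_of_def a_def line_pos_def)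
        qed
      next
        case 3
        then have "i \<notin> minuses ?S" using minuses_less[of "i - n'" ss] by (auto simp: minuses_extended)
        then show ?thesis using 3 line_diagramsD(1)[OF m] by (simp add: diagram_of_def)
      qed
    qed
    then show "m \<in> (\<lambda>(\<pi>, a). diagram_of \<pi> a) ` ({\<pi>. \<pi> permutes {..<n'}} \<times> pairs n ss)"
      using perm a by force
  qed (auto intro: diagram_of_in)
qed

end

lemma perm_phase_cong:
  "(\<And>i. i < n \<Longrightarrow> x i = y i) \<Longrightarrow> perm_phase R n \<pi> x = perm_phase R n \<pi> y"
  unfolding perm_phase_def by (intro prod.cong) auto

section \<open>Scalar products as sums over diagrams\<close>

context fock_setup
begin

interpretation P: product_sigma_finite "\<lambda>_. M"
  by (rule product_sigma_finite_const[OF sf])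

lemma line_pos_integral:
  assumes linked: "linked ss n n'" and g: "g \<in> borel_measurable (PiM (alphabet n ss) (\<lambda>_. M))"
  shows "(LINT e|PiM (alphabet n ss) (\<lambda>_. M). g e :: complex) =
    (LINT e|PiM (pluses (extended n' ss n)) (\<lambda>_. M). g (\<lambda>l\<in>alphabet n ss. e (line_pos n' ss l)))"
proof -
  note q = bij_line_pos[OF linked]
  have m: "(\<lambda>e. \<lambda>l\<in>alphabet n ss. e (line_pos n' ss l)) \<in>
      PiM (pluses (extended n' ss n)) (\<lambda>_. M) \<rightarrow>\<^sub>M PiM (alphabet n ss) (\<lambda>_. M)"
    using q by (intro measurable_restrict measurable_component_singleton) (auto simp: bij_betw_def)
  show ?thesis
    by (subst distr_PiM_reindex_bij[OF sf _ q, symmetric], simp) (rule integral_distr[OF m g])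
qed

text \<open>After the substitution \<open>x = y \<circ> \<pi>\<close> the argument \<open>p\<close>
  of \<open>F\<close> is the letter at place \<open>\<pi> p\<close> of the final word. The integral
  over the word and the inner one over the deleted letters then combine into a single integral over
  the alphabet, and naming letters by their positions turns it into a line integral.\<close>

lemma history_diagram:
  assumes linked: "linked ss n n'" and good: "good_kernel ss gs \<kappa>"
    and f: "f \<in> L2 (power_measure M n)" and F: "F \<in> L2 (power_measure M n')"
    and a: "a \<in> pairs n ss" and \<pi>: "\<pi> permutes {..<n'}"
  shows "(LINT x|power_measure M n'. perm_phase R n' \<pi> x *
      pair_integral n ss (kernel_fun gs \<kappa> (length ss)) f a (x \<circ> inv \<pi>) * cnj (F x)) =
    line_integral M R (extended n' ss n) (line_fun n' (length ss) n (kernel_fun gs \<kappa> (length ss)) f F)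
      (diagram_of n n' ss \<pi> a)"
proof -
  let ?\<phi> = "kernel_fun gs \<kappa> (length ss)" and ?w = "surv n ss a" and ?D = "a ` minuses ss"
  let ?N = "power_measure M n'" and ?DM = "PiM ?D (\<lambda>_. M)" and ?PI = "pair_integral n ss ?\<phi> f a"
  note lw = length_surv'[OF linked a]
  note j = distinct_survivors[of n 0 ss a] survivors_disjoint[of n 0 ss a]
  have finD: "finite ?D" by simp
  note U = survivors_Un[OF a]
  note mj = measurable_join[OF j(1), where M=M and D="?D", unfolded U lw]
  have wa: "?w ! \<pi> p \<in> alphabet n ss" if "p < n'" for p by (rule surv_alphabet(2)[OF linked a \<pi> that])
  have \<pi>n: "\<pi> p < n'" if "p < n'" for p using permutes_in_image[OF \<pi>] that by auto
  define xw where "xw e = (\<lambda>p\<in>{..<n'}. e (?w ! \<pi> p))" for e :: "letter \<Rightarrow> 'y"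
  have xwm: "xw \<in> PiM (alphabet n ss) (\<lambda>_. M) \<rightarrow>\<^sub>M ?N"
    unfolding xw_def[abs_def] using wa by (intro measurable_restrict measurable_component_singleton) auto
  \<comment> \<open>The full integrand as a function on the alphabet, before it is split into word
    and deleted letters; \<open>xw\<close> reads off the permuted word.\<close>
  define g where "g e = perm_phase R n' \<pi> (xw e) * integrand n ss ?\<phi> f a e * cnj (F (xw e))" for e
  have im: "integrand n ss ?\<phi> f a \<in> borel_measurable (PiM (alphabet n ss) (\<lambda>_. M))"
    by (rule integrand_measurable[OF a kernel_fun_measurable[OF good] L2_measurable[OF f]])
  have gm: "g \<in> borel_measurable (PiM (alphabet n ss) (\<lambda>_. M))"
    unfolding g_def[abs_def]
    by (intro borel_measurable_times im measurable_compose[OF xwm perm_phase_measurable]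
      measurable_compose[OF xwm L2_measurable[OF L2_cnj[OF F]]])
  have xj: "xw (join ?w ?D y z) = y \<circ> \<pi>" if y: "y \<in> space ?N" for y z
  proof
    fix p show "xw (join ?w ?D y z) p = (y \<circ> \<pi>) p"
    proof (cases "p < n'")
      case True
      then show ?thesis using join_nth[OF j, of "\<pi> p"] \<pi>n[OF True] by (simp add: xw_def lw)
    next
      case False
      then show ?thesis using y permutes_not_in[OF \<pi>] by (simp add: xw_def space_PiM PiE_def extensional_def)
    qed
  qed
  obtain C' where C': "0 \<le> C'" "\<And>x. norm (perm_phase R n' \<pi> x) \<le> C'"
  proof
    show "norm (perm_phase R n' \<pi> x) \<le> C ^ card {(i, j). i < j \<and> j < n' \<and> \<pi> i > \<pi> j}" for x
      by (rule perm_phase_bound)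
  qed (use C_ge in simp)
  \<comment> \<open>Merging the two integrals needs absolute convergence. The absolute fibre
    integral \<open>h\<close> is square integrable by the third claim of
    \<open>pair_integral_L2\<close>, and so is \<open>F\<close> after the permutation.\<close>
  define h where "h y = (\<integral>\<^sup>+z. ennreal (norm (integrand n ss ?\<phi> f a (join ?w ?D y z))) \<partial>?DM)" for y
  have sfD: "sigma_finite_measure ?DM" by (rule P.sigma_finite) simp
  have jm: "(\<lambda>p. norm (integrand n ss ?\<phi> f a (join ?w ?D (fst p) (snd p)))) \<in> borel_measurable (?N \<Otimes>\<^sub>M ?DM)"
    using measurable_compose[OF mj im] by (simp add: case_prod_beta)
  have hm: "h \<in> borel_measurable ?N"
  proof -
    interpret D: sigma_finite_measure ?DM by (rule sfD)
    have "(\<lambda>y. \<integral>\<^sup>+z. (\<lambda>p. ennreal (norm (integrand n ss ?\<phi> f a (join ?w ?D (fst p) (snd p))))) (y, z) \<partial>?DM) \<in> borel_measurable ?N"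
      using jm by (intro D.borel_measurable_nn_integral_fst) simp
    then show ?thesis by (simp add: h_def[abs_def])
  qed
  have Fm: "(\<lambda>y. F (y \<circ> \<pi>)) \<in> L2 ?N" by (rule L2_compose_permutes[OF sf \<pi> F])
  have "(\<integral>\<^sup>+e. ennreal (norm (g e)) \<partial>PiM (alphabet n ss) (\<lambda>_. M)) =
    (\<integral>\<^sup>+y. \<integral>\<^sup>+z. ennreal (norm (g (join ?w ?D y z))) \<partial>?DM \<partial>?N)"
    using nn_integral_join[OF sf j finD, of "\<lambda>e. ennreal (norm (g e))"] gm unfolding U lw by simp
  also have "\<dots> \<le> (\<integral>\<^sup>+y. ennreal C' * (ennreal (norm (F (y \<circ> \<pi>))) * h y) \<partial>?N)"
  proof (rule nn_integral_mono)
    fix y assume y: "y \<in> space ?N"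
    have [measurable]: "(\<lambda>z. norm (integrand n ss ?\<phi> f a (join ?w ?D y z))) \<in> borel_measurable ?DM"
      using measurable_compose[OF measurable_Pair1'[OF y] jm] by simp
    have "(\<integral>\<^sup>+z. ennreal (norm (g (join ?w ?D y z))) \<partial>?DM) \<le>
      (\<integral>\<^sup>+z. ennreal (C' * norm (F (y \<circ> \<pi>))) * ennreal (norm (integrand n ss ?\<phi> f a (join ?w ?D y z))) \<partial>?DM)"
    proof (rule nn_integral_mono)
      fix z
      have "norm (g (join ?w ?D y z)) = norm (perm_phase R n' \<pi> (y \<circ> \<pi>)) * (norm (F (y \<circ> \<pi>)) * norm (integrand n ss ?\<phi> f a (join ?w ?D y z)))"
        by (simp add: g_def xj[OF y] norm_mult)
      also have "\<dots> \<le> C' * (norm (F (y \<circ> \<pi>)) * norm (integrand n ss ?\<phi> f a (join ?w ?D y z)))"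
        using C'(2) by (intro mult_right_mono) auto
      finally show "ennreal (norm (g (join ?w ?D y z))) \<le> ennreal (C' * norm (F (y \<circ> \<pi>))) * ennreal (norm (integrand n ss ?\<phi> f a (join ?w ?D y z)))"
        using C'(1) by (simp add: ennreal_mult[symmetric] mult.assoc ennreal_leI)
    qed
    also have "\<dots> = ennreal C' * (ennreal (norm (F (y \<circ> \<pi>))) * h y)"
      using C'(1) by (simp add: h_def nn_integral_cmult ennreal_mult mult.assoc)
    finally show "(\<integral>\<^sup>+z. ennreal (norm (g (join ?w ?D y z))) \<partial>?DM) \<le> ennreal C' * (ennreal (norm (F (y \<circ> \<pi>))) * h y)" .
  qed
  also have "\<dots> = ennreal C' * (\<integral>\<^sup>+y. ennreal (norm (F (y \<circ> \<pi>))) * h y \<partial>?N)"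
    using hm Fm by (intro nn_integral_cmult) (auto simp: L2_def)
  also have "\<dots> < \<infinity>"
  proof -
    have "(\<integral>\<^sup>+y. ennreal (norm (F (y \<circ> \<pi>))) * h y \<partial>?N) < \<infinity>"
      using hm Fm pair_integral_L2(3)[OF a good f] unfolding lw h_def[symmetric]
      by (intro nn_integral_mult_finite) (auto simp: L2_iff)
    then show ?thesis by (simp add: ennreal_mult_less_top)
  qed
  finally have gint: "integrable (PiM (alphabet n ss) (\<lambda>_. M)) g"
    using gm by (simp add: integrable_iff_bounded)
  have meas: "(\<lambda>x. perm_phase R n' \<pi> x * ?PI (x \<circ> inv \<pi>) * cnj (F x)) \<in> borel_measurable ?N"
  proof -
    have "?PI \<in> L2 ?N" using pair_integral_L2(2)[OF a good f] unfolding lw .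
    from borel_measurable_times[OF L2_measurable[OF L2_perm_term[OF \<pi> this]] L2_measurable[OF L2_cnj[OF F]]]
    show ?thesis .
  qed
  have "(LINT x|?N. perm_phase R n' \<pi> x * ?PI (x \<circ> inv \<pi>) * cnj (F x)) =
    (LINT y|?N. perm_phase R n' \<pi> (y \<circ> \<pi>) * ?PI (y \<circ> \<pi> \<circ> inv \<pi>) * cnj (F (y \<circ> \<pi>)))"
    using integral_compose_permutes[OF sf \<pi> meas] by simp
  also have "\<dots> = (LINT y|?N. LINT z|?DM. g (join ?w ?D y z))"
  proof (intro Bochner_Integration.integral_cong refl)
    fix y assume y: "y \<in> space ?N"
    have "y \<circ> \<pi> \<circ> inv \<pi> = y" using permutes_inv_o(1)[OF \<pi>] by (simp add: comp_assoc)
    then show "perm_phase R n' \<pi> (y \<circ> \<pi>) * ?PI (y \<circ> \<pi> \<circ> inv \<pi>) * cnj (F (y \<circ> \<pi>)) = (LINT z|?DM. g (join ?w ?D y z))"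
      by (simp add: g_def xj[OF y] pair_integral_def)
  qed
  also have "\<dots> = (LINT e|PiM (alphabet n ss) (\<lambda>_. M). g e)"
    using integral_join[OF sf j finD, of g] gint unfolding U lw by simp
  also have "\<dots> = (LINT e|PiM (pluses (extended n' ss n)) (\<lambda>_. M). g (\<lambda>l\<in>alphabet n ss. e (line_pos n' ss l)))"
    by (rule line_pos_integral[OF linked gm])
  also have "\<dots> = line_integral M R (extended n' ss n) (line_fun n' (length ss) n ?\<phi> f F) (diagram_of n n' ss \<pi> a)"
    unfolding line_integral_def
  proof (intro Bochner_Integration.integral_cong refl)
    fix e :: "nat \<Rightarrow> 'y"
    let ?e = "\<lambda>l\<in>alphabet n ss. e (line_pos n' ss l)"
    let ?y = "\<lambda>i\<in>{..<length (extended n' ss n)}. e (diagram_of n n' ss \<pi> a i)"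
    note ds = diagram_of_simps[OF linked a \<pi>]
    have y1: "?y (n' - Suc p) = ?e (?w ! \<pi> p)" if "p < n'" for p
    proof -
      have "n' - Suc p < length (extended n' ss n)" using that by simp
      then show ?thesis using ds(1)[OF that] wa[OF that] by simp
    qed
    have y2: "?y (n' + i) = ?e (a i)" if "i < length ss" for i
      using ds(2)[OF that] pairing_in_alphabet[OF a that] that by simp
    have y3: "?y (n' + length ss + q) = ?e (Arg q)" if "q < n" for q
      using ds(3)[of q] that by (simp add: set_letters)
    have 1: "(\<lambda>p\<in>{..<n'}. ?y (n' - Suc p)) = xw ?e"
      unfolding xw_def by (rule restrict_ext, rule y1) simp
    have 2: "(\<lambda>j\<in>{..<length ss}. ?y (n' + j)) = (\<lambda>j\<in>{..<length ss}. ?e (a j))"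
      by (rule restrict_ext, rule y2) simp
    have 3: "(\<lambda>q\<in>{..<n}. ?y (n' + length ss + q)) = (\<lambda>q\<in>{..<n}. ?e (Arg q))"
      by (rule restrict_ext, rule y3) simp
    have 4: "line_phase R (extended n' ss n) (diagram_of n n' ss \<pi> a) e =
      perm_phase R n' \<pi> (xw ?e) * phase n ss a ?e"
    proof -
      have "perm_phase R n' \<pi> (xw ?e) = perm_phase R n' \<pi> (\<lambda>p. e (line_pos n' ss (?w ! \<pi> p)))"
        using wa by (intro perm_phase_cong) (simp add: xw_def)
      moreover have "phase n ss a ?e = (\<Prod>j\<in>minuses ss. \<Prod>u\<in>passed n 0 ss (length ss) a j.
          R (e (line_pos n' ss (a j))) (e (line_pos n' ss u)))"
        unfolding phase_def
      proof (intro prod.cong refl)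
        fix j u assume "j \<in> minuses ss" "u \<in> passed n 0 ss (length ss) a j"
        then show "R (?e (a j)) (?e u) = R (e (line_pos n' ss (a j))) (e (line_pos n' ss u))"
          using pairingsD(3)[OF a] passed_subset[of n 0 ss "length ss" a j] by auto
      qed
      ultimately show ?thesis using line_phase_diagram_of[OF linked a \<pi>, of R e] by simp
    qed
    show "g ?e = line_fun n' (length ss) n ?\<phi> f F ?y * line_phase R (extended n' ss n) (diagram_of n n' ss \<pi> a) e"
      unfolding g_def line_fun_def 1 2 3 4 integrand_def by simp
  qed
  finally show ?thesis .
qed

text \<open>The weight \<open>fact n'\<close> cancels the normalization of the symmetrizer, so what
  remains is a sum without coefficients over permutations and pairings, that is, over
  diagrams.\<close>

lemma op_term_inner:
  assumes linked: "linked ss n n'" and good: "good_kernel ss gs \<kappa>"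
    and f: "f \<in> L2 (power_measure M n)" and F: "F \<in> L2 (power_measure M n')"
  shows "of_nat (fact n') * (LINT x|power_measure M n'. op_term ss gs \<kappa> n f n' x * cnj (F x)) =
    (\<Sum>m\<in>line_diagrams (extended n' ss n). line_integral M R (extended n' ss n)
      (line_fun n' (length ss) n (kernel_fun gs \<kappa> (length ss)) f F) m)"
proof -
  let ?PI = "pair_integral n ss (kernel_fun gs \<kappa> (length ss)) f"
  let ?N = "power_measure M n'"
  let ?T = "\<lambda>\<pi> a x. perm_phase R n' \<pi> x * ?PI a (x \<circ> inv \<pi>) * cnj (F x)"
  have int: "integrable ?N (?T \<pi> a)" if "\<pi> permutes {..<n'}" "a \<in> pairs n ss" for \<pi> a
    using pair_integral_L2(2)[OF that(2) good f] length_surv'[OF linked that(2)]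
    by (intro L2_integrable_mult L2_perm_term L2_cnj F that) simp
  have eq: "of_nat (fact n') * (op_term ss gs \<kappa> n f n' x * cnj (F x)) = (\<Sum>\<pi> | \<pi> permutes {..<n'}. \<Sum>a\<in>pairs n ss. ?T \<pi> a x)" for x
  proof -
    have "of_nat (fact n') * (op_term ss gs \<kappa> n f n' x * cnj (F x)) =
      (\<Sum>\<pi> | \<pi> permutes {..<n'}. perm_phase R n' \<pi> x * (\<Sum>a\<in>pairs n ss. ?PI a (x \<circ> inv \<pi>))) * cnj (F x)"
      by (simp add: op_term_def sym_proj_def)
    also have "\<dots> = (\<Sum>\<pi> | \<pi> permutes {..<n'}. \<Sum>a\<in>pairs n ss. ?T \<pi> a x)"
      by (simp add: sum_distrib_left sum_distrib_right)
    finally show ?thesis .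
  qed
  have "of_nat (fact n') * (LINT x|?N. op_term ss gs \<kappa> n f n' x * cnj (F x)) =
    (LINT x|?N. (\<Sum>\<pi> | \<pi> permutes {..<n'}. \<Sum>a\<in>pairs n ss. ?T \<pi> a x))"
    by (subst integral_mult_right_zero[symmetric]) (simp only: eq)
  also have "\<dots> = (\<Sum>\<pi> | \<pi> permutes {..<n'}. \<Sum>a\<in>pairs n ss. LINT x|?N. ?T \<pi> a x)"
    using int by (simp add: Bochner_Integration.integral_sum integrable_sum)
  also have "\<dots> = (\<Sum>(\<pi>, a)\<in>{\<pi>. \<pi> permutes {..<n'}} \<times> pairs n ss. LINT x|?N. ?T \<pi> a x)"
    by (rule sum.cartesian_product)
  also have "\<dots> = (\<Sum>p\<in>{\<pi>. \<pi> permutes {..<n'}} \<times> pairs n ss. line_integral M R (extended n' ss n)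
      (line_fun n' (length ss) n (kernel_fun gs \<kappa> (length ss)) f F) (case p of (\<pi>, a) \<Rightarrow> diagram_of n n' ss \<pi> a))"
    using history_diagram[OF linked good f F] by (intro sum.cong refl) auto
  also have "\<dots> = (\<Sum>m\<in>line_diagrams (extended n' ss n). line_integral M R (extended n' ss n)
      (line_fun n' (length ss) n (kernel_fun gs \<kappa> (length ss)) f F) m)"
    by (rule sum.reindex_bij_betw[OF bij_diagram_of[OF linked]])
  finally show ?thesis .
qed

text \<open>Reversing and flipping the line built from \<open>F\<close>, \<open>ss\<close> and
  \<open>f\<close> gives the line built from \<open>f\<close>, the reversed and flipped signs and
  \<open>F\<close>. The functions and kernels have to be conjugate and reversed pointwise because
  the diagrams are compared integrand by integrand.\<close>

lemma op_term_adjoint: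
  assumes linked: "linked ss n n'" and good: "good_kernel ss gs \<kappa>" "good_kernel (flip_rev ss) gs' \<kappa>'"
    and f: "f \<in> L2 (power_measure M n)" and F: "F \<in> L2 (power_measure M n')"
    and gs': "\<And>j. j < length ss \<Longrightarrow> gs' ! j = (\<lambda>y. cnj ((gs ! (length ss - Suc j)) y))"
    and \<kappa>': "\<And>y. \<kappa>' y = cnj (\<kappa> (\<lambda>j\<in>{..<length ss}. y (length ss - Suc j)))"
  shows "of_nat (fact n') * (LINT x|power_measure M n'. op_term ss gs \<kappa> n f n' x * cnj (F x)) =
    of_nat (fact n) * (LINT x|power_measure M n. f x * cnj (op_term (flip_rev ss) gs' \<kappa>' n' F n x))"
proof -
  let ?k = "length ss" and ?SS = "extended n' ss n"
  let ?\<phi> = "kernel_fun gs \<kappa> (length ss)" and ?\<phi>' = "kernel_fun gs' \<kappa>' (length ss)"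
  have cl: "count_list (flip_rev ss) Plus = count_list ss Minus" "count_list (flip_rev ss) Minus = count_list ss Plus"
    by (induction ss) (auto simp: count_list_append)
  then have linked': "linked (flip_rev ss) n' n" using linked by simp
  have SS: "flip_rev ?SS = extended n (flip_rev ss) n'" by simp
  have len: "length ?SS = n' + ?k + n" by simp
  have \<phi>': "?\<phi>' (\<lambda>j\<in>{..<?k}. y j) = cnj (?\<phi> (\<lambda>j\<in>{..<?k}. y (?k - Suc j)))" for y
  proof -
    have "(\<Prod>j<?k. (gs' ! j) (y j)) = (\<Prod>j<?k. cnj ((gs ! (?k - Suc j)) (y j)))"
      using gs' by (intro prod.cong) auto
    also have "\<dots> = (\<Prod>j<?k. cnj ((gs ! j) (y (?k - Suc j))))"
      by (subst prod.nat_diff_reindex[symmetric]) (auto intro!: prod.cong)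
    finally have "(\<Prod>j<?k. (gs' ! j) (y j)) = cnj (\<Prod>j<?k. (gs ! j) (y (?k - Suc j)))" by simp
    moreover have "(\<lambda>j\<in>{..<?k}. (\<lambda>j\<in>{..<?k}. y j) (?k - Suc j)) = (\<lambda>j\<in>{..<?k}. y (?k - Suc j))"
      by (rule restrict_ext) auto
    ultimately show ?thesis by (simp add: kernel_fun_def \<kappa>')
  qed
  have lm: "line_fun n ?k n' ?\<phi>' F f \<in> borel_measurable (power_measure M (length ?SS))"
    unfolding line_fun_def[abs_def]
  proof (intro borel_measurable_times)
    have "(\<lambda>y. \<lambda>p\<in>{..<n}. y (n - Suc p)) \<in> power_measure M (length ?SS) \<rightarrow>\<^sub>M power_measure M n"
      by (intro measurable_restrict measurable_component_singleton) auto
    from measurable_compose[OF this L2_measurable[OF L2_cnj[OF f]]]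
    show "(\<lambda>y. cnj (f (\<lambda>p\<in>{..<n}. y (n - Suc p)))) \<in> borel_measurable (power_measure M (length ?SS))" .
    have "(\<lambda>y. \<lambda>j\<in>{..<?k}. y (n + j)) \<in> power_measure M (length ?SS) \<rightarrow>\<^sub>M power_measure M ?k"
      by (intro measurable_restrict measurable_component_singleton) auto
    from measurable_compose[OF this] kernel_fun_measurable[OF good(2)]
    show "(\<lambda>y. ?\<phi>' (\<lambda>j\<in>{..<?k}. y (n + j))) \<in> borel_measurable (power_measure M (length ?SS))" by simp
    have "(\<lambda>y. \<lambda>q\<in>{..<n'}. y (n + ?k + q)) \<in> power_measure M (length ?SS) \<rightarrow>\<^sub>M power_measure M n'"
      by (intro measurable_restrict measurable_component_singleton) auto
    from measurable_compose[OF this L2_measurable[OF F]]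
    show "(\<lambda>y. F (\<lambda>q\<in>{..<n'}. y (n + ?k + q))) \<in> borel_measurable (power_measure M (length ?SS))" .
  qed
  have rev: "line_fun n ?k n' ?\<phi>' F f (\<lambda>i\<in>{..<length ?SS}. y (length ?SS - Suc i)) =
      cnj (line_fun n' ?k n ?\<phi> f F (\<lambda>i\<in>{..<length ?SS}. y i))" for y
  proof -
    let ?z = "\<lambda>i\<in>{..<length ?SS}. y (length ?SS - Suc i)" and ?y = "\<lambda>i\<in>{..<length ?SS}. y i"
    have 1: "(\<lambda>p\<in>{..<n}. ?z (n - Suc p)) = (\<lambda>q\<in>{..<n}. ?y (n' + ?k + q))"
      by (rule restrict_ext) (auto simp: len intro!: arg_cong[where f=y])
    have 2: "(\<lambda>j\<in>{..<?k}. ?z (n + j)) = (\<lambda>j\<in>{..<?k}. (\<lambda>j. ?y (n' + (?k - Suc j))) j)"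
      by (rule restrict_ext) (auto simp: len intro!: arg_cong[where f=y])
    have 4: "(\<lambda>j\<in>{..<?k}. ?y (n' + (?k - Suc (?k - Suc j)))) = (\<lambda>j\<in>{..<?k}. ?y (n' + j))"
      by (rule restrict_ext) auto
    have 3: "(\<lambda>q\<in>{..<n'}. ?z (n + ?k + q)) = (\<lambda>p\<in>{..<n'}. ?y (n' - Suc p))"
      by (rule restrict_ext) (auto simp: len intro!: arg_cong[where f=y])
    show ?thesis unfolding line_fun_def 1 2 3 \<phi>' 4 by simp
  qed
  have "of_nat (fact n) * (LINT x|power_measure M n. op_term (flip_rev ss) gs' \<kappa>' n' F n x * cnj (f x)) =
    (\<Sum>m\<in>line_diagrams (flip_rev ?SS). line_integral M R (flip_rev ?SS) (line_fun n ?k n' ?\<phi>' F f) m)"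
    using op_term_inner[OF linked' good(2) F f] by simp
  also have "\<dots> = cnj (\<Sum>m\<in>line_diagrams ?SS. line_integral M R ?SS (line_fun n' ?k n ?\<phi> f F) m)"
    by (rule sum_line_integral_mirror[OF sf R_herm R_meas lm rev])
  also have "\<dots> = cnj (of_nat (fact n') * (LINT x|power_measure M n'. op_term ss gs \<kappa> n f n' x * cnj (F x)))"
    using op_term_inner[OF linked good(1) f F] by simp
  finally have "cnj (of_nat (fact n) * (LINT x|power_measure M n. op_term (flip_rev ss) gs' \<kappa>' n' F n x * cnj (f x))) =
    of_nat (fact n') * (LINT x|power_measure M n'. op_term ss gs \<kappa> n f n' x * cnj (F x))"
    by (metis complex_cnj_cnj)
  then show ?thesis
    by (simp add: Bochner_Integration.integral_cnj[symmetric] mult.commute del: Bochner_Integration.integral_cnj)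
qed

end

section \<open>The vacuum state\<close>

text \<open>Reduces the infinite series in \<open>fock_inner\<close> to a finite sum as soon as one
  of the two vectors is finite, so that linearity and conjugation need no summability
  argument.\<close>

lemma fock_inner_cut:
  assumes "\<And>n. n \<ge> N \<Longrightarrow> (LINT x|power_measure M n. f n x * cnj (g n x)) = 0"
  shows "fock_inner M f g = (\<Sum>n<N. of_nat (fact n) * (LINT x|power_measure M n. f n x * cnj (g n x)))"
  unfolding fock_inner_def by (rule suminf_finite) (use assms in auto)

lemma integral_AE_0: "AE x in N. f x = (0 :: complex) \<Longrightarrow> (LINT x|N. f x) = 0"
  by (rule integral_eq_zero_AE)

lemma fock_inner_cut_left:
  assumes "\<forall>n\<ge>N. AE x in power_measure M n. f n x = 0"
  shows "fock_inner M f g = (\<Sum>n<N. of_nat (fact n) * (LINT x|power_measure M n. f n x * cnj (g n x)))"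
proof (rule fock_inner_cut, rule integral_AE_0)
  fix n assume "N \<le> n"
  with assms have "AE x in power_measure M n. f n x = 0" by blast
  then show "AE x in power_measure M n. f n x * cnj (g n x) = 0" by eventually_elim simp
qed

lemma fock_inner_cut_right:
  assumes "\<forall>n\<ge>N. AE x in power_measure M n. g n x = 0"
  shows "fock_inner M f g = (\<Sum>n<N. of_nat (fact n) * (LINT x|power_measure M n. f n x * cnj (g n x)))"
proof (rule fock_inner_cut, rule integral_AE_0)
  fix n assume "N \<le> n"
  with assms have "AE x in power_measure M n. g n x = 0" by blast
  then show "AE x in power_measure M n. f n x * cnj (g n x) = 0" by eventually_elim simp
qed

lemma fock_finE:
  assumes "f \<in> fock_fin M R"
  obtains N where "\<forall>n\<ge>N. AE x in power_measure M n. f n x = 0"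
  using assms by (auto simp: fock_fin_def)

lemma fock_inner_integrable:
  assumes "f \<in> fock_fin M R" "g \<in> fock_fin M R"
  shows "integrable (power_measure M n) (\<lambda>x. f n x * cnj (g n x))"
  by (intro L2_integrable_mult L2_cnj fock_finD(2)[OF assms(1)] fock_finD(2)[OF assms(2)])

lemma fock_inner_cong:
  assumes f: "f \<in> fock_fin M R" "f' \<in> fock_fin M R" "fock_eq M f f'"
    and g: "g \<in> fock_fin M R" "g' \<in> fock_fin M R" "fock_eq M g g'"
  shows "fock_inner M f g = fock_inner M f' g'"
proof -
  have "(LINT x|power_measure M n. f n x * cnj (g n x)) = (LINT x|power_measure M n. f' n x * cnj (g' n x))" for n
  proof (rule integral_cong_AE)
    have "AE x in power_measure M n. f n x = f' n x" "AE x in power_measure M n. g n x = g' n x"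
      using f g by (auto simp: fock_eq_def)
    then show "AE x in power_measure M n. f n x * cnj (g n x) = f' n x * cnj (g' n x)"
      by eventually_elim simp
  qed (use fock_inner_integrable[OF f(1) g(1)] fock_inner_integrable[OF f(2) g(2)] in auto)
  then show ?thesis by (simp add: fock_inner_def)
qed

lemma fock_inner_cnj: "f \<in> fock_fin M R \<Longrightarrow> fock_inner M g f = cnj (fock_inner M f g)"
proof (elim fock_finE)
  fix N assume N: "\<forall>n\<ge>N. AE x in power_measure M n. f n x = 0"
  show ?thesis
    unfolding fock_inner_cut_left[OF N] fock_inner_cut_right[OF N]
    by (simp add: Bochner_Integration.integral_cnj[symmetric] mult.commute del: Bochner_Integration.integral_cnj)
qed

lemma fock_inner_add:
  assumes "f \<in> fock_fin M R" "f' \<in> fock_fin M R" "g \<in> fock_fin M R"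
  shows "fock_inner M (\<lambda>n x. f n x + f' n x) g = fock_inner M f g + fock_inner M f' g"
  using assms(3)
proof (elim fock_finE)
  fix N assume N: "\<forall>n\<ge>N. AE x in power_measure M n. g n x = 0"
  have "(LINT x|power_measure M n. (f n x + f' n x) * cnj (g n x)) =
    (LINT x|power_measure M n. f n x * cnj (g n x)) + (LINT x|power_measure M n. f' n x * cnj (g n x))" for n
    using Bochner_Integration.integral_add[OF fock_inner_integrable[OF assms(1,3)] fock_inner_integrable[OF assms(2,3)]]
    by (simp add: distrib_right)
  then show ?thesis
    unfolding fock_inner_cut_right[OF N] by (simp add: distrib_left sum.distrib)
qed

lemma fock_inner_scale:
  assumes "g \<in> fock_fin M R"
  shows "fock_inner M (\<lambda>n x. c * f n x) g = c * fock_inner M f g"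
  using assms
proof (elim fock_finE)
  fix N assume N: "\<forall>n\<ge>N. AE x in power_measure M n. g n x = 0"
  show ?thesis
    unfolding fock_inner_cut_right[OF N] by (simp add: sum_distrib_left mult_ac)
qed

lemma fock_inner_add_right:
  assumes "f \<in> fock_fin M R" "g \<in> fock_fin M R" "g' \<in> fock_fin M R"
  shows "fock_inner M f (\<lambda>n x. g n x + g' n x) = fock_inner M f g + fock_inner M f g'"
  using fock_inner_add[OF assms(2,3,1)] fock_inner_cnj[OF assms(1)] by (metis complex_cnj_add complex_cnj_cnj)

lemma fock_inner_scale_right:
  assumes "f \<in> fock_fin M R"
  shows "fock_inner M f (\<lambda>n x. c * g n x) = cnj c * fock_inner M f g"
  using fock_inner_scale[OF assms, of c g] fock_inner_cnj[OF assms] by (metis complex_cnj_mult complex_cnj_cnj)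

lemma fock_inner_self_nonneg:
  assumes "f \<in> fock_fin M R"
  shows "fock_inner M f f \<in> \<real>\<^sub>\<ge>\<^sub>0"
  using assms
proof (elim fock_finE)
  fix N assume N: "\<forall>n\<ge>N. AE x in power_measure M n. f n x = 0"
  have "fock_inner M f f = (\<Sum>n<N. of_real (fact n * (LINT x|power_measure M n. (norm (f n x))\<^sup>2)))"
    unfolding fock_inner_cut_right[OF N]
  proof (rule sum.cong[OF refl])
    fix n
    have "(LINT x|power_measure M n. f n x * cnj (f n x)) = (LINT x|power_measure M n. complex_of_real ((norm (f n x))\<^sup>2))"
      by (simp only: complex_norm_square)
    then show "of_nat (fact n) * (LINT x|power_measure M n. f n x * cnj (f n x)) =
      complex_of_real (fact n * (LINT x|power_measure M n. (norm (f n x))\<^sup>2))"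
      by (simp only: integral_complex_of_real of_real_mult of_real_of_nat_eq of_nat_fact of_real_fact)
  qed
  also have "\<dots> = of_real (\<Sum>n<N. fact n * (LINT x|power_measure M n. (norm (f n x))\<^sup>2))" by simp
  also have "\<dots> \<in> \<real>\<^sub>\<ge>\<^sub>0" by (subst nonneg_Reals_of_real_iff) (auto intro!: sum_nonneg)
  finally show ?thesis .
qed

lemma fock_eq_refl: "fock_eq M f f"
  by (simp add: fock_eq_def)

lemma fock_eq_trans:
  assumes "fock_eq M f g" "fock_eq M g h"
  shows "fock_eq M f h"
  unfolding fock_eq_def
proof
  fix n
  have "AE x in power_measure M n. f n x = g n x" "AE x in power_measure M n. g n x = h n x"
    using assms by (simp_all add: fock_eq_def)
  then show "AE x in power_measure M n. f n x = h n x" by eventually_elim simp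
qed

lemma fock_eq_add:
  assumes "fock_eq M f f'" "fock_eq M g g'"
  shows "fock_eq M (\<lambda>n x. f n x + g n x) (\<lambda>n x. f' n x + g' n x)"
  unfolding fock_eq_def
proof
  fix n
  have "AE x in power_measure M n. f n x = f' n x" "AE x in power_measure M n. g n x = g' n x"
    using assms by (simp_all add: fock_eq_def)
  then show "AE x in power_measure M n. f n x + g n x = f' n x + g' n x" by eventually_elim simp
qed

lemma fock_eq_scale:
  assumes "fock_eq M f f'"
  shows "fock_eq M (\<lambda>n x. c * f n x) (\<lambda>n x. c * f' n x)"
  unfolding fock_eq_def
proof
  fix n
  have "AE x in power_measure M n. f n x = f' n x" using assms by (simp add: fock_eq_def)
  then show "AE x in power_measure M n. c * f n x = c * f' n x" by eventually_elim simp
qed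

lemma fock_operatorD:
  assumes "fock_operator M R a"
  shows "f \<in> fock_fin M R \<Longrightarrow> a f \<in> fock_fin M R"
    "f \<in> fock_fin M R \<Longrightarrow> g \<in> fock_fin M R \<Longrightarrow> fock_eq M f g \<Longrightarrow> fock_eq M (a f) (a g)"
    "f \<in> fock_fin M R \<Longrightarrow> g \<in> fock_fin M R \<Longrightarrow> fock_eq M (a (\<lambda>n x. f n x + g n x)) (\<lambda>n x. a f n x + a g n x)"
    "f \<in> fock_fin M R \<Longrightarrow> fock_eq M (a (\<lambda>n x. c * f n x)) (\<lambda>n x. c * a f n x)"
  using assms by (auto simp: fock_operator_def)

section \<open>Finite vectors, the generated algebra and its involution\<close>

context fock_setup
begin

lemma fock_fin_add:
  assumes "f \<in> fock_fin M R" "g \<in> fock_fin M R"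
  shows "(\<lambda>n x. f n x + g n x) \<in> fock_fin M R"
proof -
  obtain N where N: "\<forall>n\<ge>N. AE x in power_measure M n. f n x = 0" using assms(1) by (rule fock_finE)
  obtain N' where N': "\<forall>n\<ge>N'. AE x in power_measure M n. g n x = 0" using assms(2) by (rule fock_finE)
  have "AE x in power_measure M n. f n x + g n x = 0" if "n \<ge> max N N'" for n
    proof -
    have "AE x in power_measure M n. f n x = 0" "AE x in power_measure M n. g n x = 0"
      using N N' that by auto
    then show ?thesis by eventually_elim simp
  qed
  then show ?thesis using assms unfolding fock_fin_def by (blast intro: sym_L2_add)
qed

lemma fock_fin_scale:
  assumes "f \<in> fock_fin M R"
  shows "(\<lambda>n x. c * f n x) \<in> fock_fin M R"
proof -
  obtain N where N: "\<forall>n\<ge>N. AE x in power_measure M n. f n x = 0" using assms(1) by (rule fock_finE)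
  have "AE x in power_measure M n. c * f n x = 0" if "n \<ge> N" for n
  proof -
    have "AE x in power_measure M n. f n x = 0" using N that by auto
    then show ?thesis by eventually_elim simp
  qed
  then show ?thesis using assms unfolding fock_fin_def by (blast intro: sym_L2_scale)
qed

lemma vacuum_fock_fin: "vacuum \<in> fock_fin M R"
proof -
  have "vacuum n \<in> sym_L2 M R n" for n
  proof (cases n)
    case 0
    have "integrable (power_measure M 0) (\<lambda>x. (norm (vacuum 0 x))\<^sup>2)"
      by (simp add: vacuum_def PiM_empty integrable_count_space)
    then show ?thesis using 0 by (simp add: sym_L2_def L2_def vacuum_def)
  next
    case (Suc m)
    then have "vacuum n = (\<lambda>x::nat \<Rightarrow> 'y. 0)" by (auto simp: vacuum_def)
    then show ?thesis by (simp add: sym_L2_0)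
  qed
  moreover have "\<forall>n\<ge>1. AE x in power_measure M n. vacuum n x = 0" by (simp add: vacuum_def)
  ultimately show ?thesis unfolding fock_fin_def by blast
qed

text \<open>Only the component without particles meets the vacuum, and the empty product is a point
  mass at the everywhere undefined function. Linearity of the functional thereby becomes an identity
  between values at one point.\<close>

lemma vacuum_state_eq: "vacuum_state M a = a vacuum 0 (\<lambda>_. undefined)"
proof -
  have "vacuum_state M a = (\<Sum>n<1. of_nat (fact n) * (LINT x|power_measure M n. a vacuum n x * cnj (vacuum n x)))"
    unfolding vacuum_state_def by (rule fock_inner_cut_right) (simp add: vacuum_def)
  also have "\<dots> = a vacuum 0 (\<lambda>_. undefined)"
    by (simp add: vacuum_def PiM_empty lebesgue_integral_count_space_finite)
  finally show ?thesis .
qed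

lemma fock_operator_add:
  assumes a: "fock_operator M R a" and b: "fock_operator M R b"
  shows "fock_operator M R (\<lambda>f n x. a f n x + b f n x)"
  unfolding fock_operator_def
proof (intro conjI ballI allI impI)
  note aD = fock_operatorD[OF a] and bD = fock_operatorD[OF b]
  show "(\<lambda>n x. a f n x + b f n x) \<in> fock_fin M R" if "f \<in> fock_fin M R" for f
    using that aD bD by (intro fock_fin_add) auto
  show "fock_eq M (\<lambda>n x. a f n x + b f n x) (\<lambda>n x. a g n x + b g n x)"
    if "f \<in> fock_fin M R" "g \<in> fock_fin M R" "fock_eq M f g" for f g
    using that aD bD by (intro fock_eq_add) auto
  show "fock_eq M (\<lambda>n x. a (\<lambda>n x. f n x + g n x) n x + b (\<lambda>n x. f n x + g n x) n x)
      (\<lambda>n x. a f n x + b f n x + (a g n x + b g n x))"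
    if "f \<in> fock_fin M R" "g \<in> fock_fin M R" for f g
    using fock_eq_add[OF aD(3)[OF that] bD(3)[OF that]] by (simp add: add_ac)
  show "fock_eq M (\<lambda>n x. a (\<lambda>n x. c * f n x) n x + b (\<lambda>n x. c * f n x) n x) (\<lambda>n x. c * (a f n x + b f n x))"
    if "f \<in> fock_fin M R" for c f
    using fock_eq_add[OF aD(4)[OF that] bD(4)[OF that]] by (simp add: distrib_left)
qed

lemma fock_operator_scale:
  assumes a: "fock_operator M R a"
  shows "fock_operator M R (\<lambda>f n x. c * a f n x)"
  unfolding fock_operator_def
proof (intro conjI ballI allI impI)
  note aD = fock_operatorD[OF a]
  show "(\<lambda>n x. c * a f n x) \<in> fock_fin M R" if "f \<in> fock_fin M R" for f
    using that aD by (intro fock_fin_scale) auto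
  show "fock_eq M (\<lambda>n x. c * a f n x) (\<lambda>n x. c * a g n x)"
    if "f \<in> fock_fin M R" "g \<in> fock_fin M R" "fock_eq M f g" for f g
    using that aD by (intro fock_eq_scale) auto
  show "fock_eq M (\<lambda>n x. c * a (\<lambda>n x. f n x + g n x) n x) (\<lambda>n x. c * a f n x + c * a g n x)"
    if "f \<in> fock_fin M R" "g \<in> fock_fin M R" for f g
    using fock_eq_scale[OF aD(3)[OF that], of c] by (simp add: distrib_left)
  show "fock_eq M (\<lambda>n x. c * a (\<lambda>n x. d * f n x) n x) (\<lambda>n x. d * (c * a f n x))"
    if "f \<in> fock_fin M R" for d f
    using fock_eq_scale[OF aD(4)[OF that, of d], of c] by (simp only: mult.left_commute[of c d])
qed

lemma fock_operator_id: "fock_operator M R (\<lambda>f. f)"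
  by (simp add: fock_operator_def fock_eq_refl)

lemma fock_operator_0: "fock_operator M R (\<lambda>f n x. 0)"
  using fock_operator_scale[OF fock_operator_id, of 0] by simp

lemma fock_operator_mult:
  assumes a: "fock_operator M R a" and b: "fock_operator M R b"
  shows "fock_operator M R (\<lambda>f. a (b f))"
  unfolding fock_operator_def
proof (intro conjI ballI allI impI)
  note aD = fock_operatorD[OF a] and bD = fock_operatorD[OF b]
  show "a (b f) \<in> fock_fin M R" if "f \<in> fock_fin M R" for f using that aD bD by auto
  show "fock_eq M (a (b f)) (a (b g))"
    if "f \<in> fock_fin M R" "g \<in> fock_fin M R" "fock_eq M f g" for f g using that aD bD by auto
  show "fock_eq M (a (b (\<lambda>n x. f n x + g n x))) (\<lambda>n x. a (b f) n x + a (b g) n x)"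
    if "f \<in> fock_fin M R" "g \<in> fock_fin M R" for f g
    using that by (intro fock_eq_trans[OF aD(2)[OF _ _ bD(3)] aD(3)] bD(1) fock_fin_add)
  show "fock_eq M (a (b (\<lambda>n x. c * f n x))) (\<lambda>n x. c * a (b f) n x)"
    if "f \<in> fock_fin M R" for c f
    using that by (intro fock_eq_trans[OF aD(2)[OF _ _ bD(4)] aD(4)] bD(1) fock_fin_scale)
qed

lemma generated_algebra_fock_operator:
  assumes "a \<in> generated_algebra G" and G: "\<And>a. a \<in> G \<Longrightarrow> fock_operator M R a"
  shows "fock_operator M R a"
  using assms(1)
  by induction (auto intro: G fock_operator_add fock_operator_scale fock_operator_id fock_operator_mult)

lemma fock_adjoint_add:
  assumes a: "fock_operator M R a" "fock_operator M R a'" and b: "fock_operator M R b" "fock_operator M R b'"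
    and ab: "fock_adjoint M R a a'" "fock_adjoint M R b b'"
  shows "fock_adjoint M R (\<lambda>f n x. a f n x + b f n x) (\<lambda>f n x. a' f n x + b' f n x)"
  unfolding fock_adjoint_def
proof (intro ballI)
  fix f g assume f: "f \<in> fock_fin M R" and g: "g \<in> fock_fin M R"
  have "fock_inner M (\<lambda>n x. a f n x + b f n x) g = fock_inner M (a f) g + fock_inner M (b f) g"
    using fock_operatorD(1)[OF a(1) f] fock_operatorD(1)[OF b(1) f] g by (rule fock_inner_add)
  also have "\<dots> = fock_inner M f (a' g) + fock_inner M f (b' g)"
    using ab f g by (simp add: fock_adjoint_def)
  also have "\<dots> = fock_inner M f (\<lambda>n x. a' g n x + b' g n x)"
    using f fock_operatorD(1)[OF a(2) g] fock_operatorD(1)[OF b(2) g] by (rule fock_inner_add_right[symmetric])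
  finally show "fock_inner M (\<lambda>n x. a f n x + b f n x) g = fock_inner M f (\<lambda>n x. a' g n x + b' g n x)" .
qed

lemma fock_adjoint_scale:
  assumes "fock_adjoint M R a b"
  shows "fock_adjoint M R (\<lambda>f n x. c * a f n x) (\<lambda>f n x. cnj c * b f n x)"
  using assms unfolding fock_adjoint_def by (simp add: fock_inner_scale fock_inner_scale_right)

text \<open>The involution is inherited from the generators. In the case of a product the adjoints
  change order, and the inner operator must keep finite vectors finite for the second adjoint
  relation to apply.\<close>

lemma generated_algebra_adjoint:
  assumes "a \<in> generated_algebra G" and G: "\<And>a. a \<in> G \<Longrightarrow> fock_operator M R a"
    and adj: "\<And>a. a \<in> G \<Longrightarrow> \<exists>b\<in>G. fock_adjoint M R a b"
  shows "\<exists>b\<in>generated_algebra G. fock_adjoint M R a b"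
  using assms(1)
proof induction
  case (gen a)
  then show ?case using adj by (blast intro: generated_algebra.gen)
next
  case one
  have "fock_adjoint M R (\<lambda>f. f) (\<lambda>f. f)" by (simp add: fock_adjoint_def)
  then show ?case by (blast intro: generated_algebra.one)
next
  case (add a b)
  then obtain a' b' where a': "a' \<in> generated_algebra G" "fock_adjoint M R a a'"
    and b': "b' \<in> generated_algebra G" "fock_adjoint M R b b'" by blast
  have "fock_adjoint M R (\<lambda>f n x. a f n x + b f n x) (\<lambda>f n x. a' f n x + b' f n x)"
    using a' b' add.hyps by (intro fock_adjoint_add generated_algebra_fock_operator[OF _ G])
  then show ?case using generated_algebra.add[OF a'(1) b'(1)] by blast
next
  case (scale a c)
  then obtain a' where a': "a' \<in> generated_algebra G" "fock_adjoint M R a a'" by blast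
  show ?case using fock_adjoint_scale[OF a'(2), of c] generated_algebra.scale[OF a'(1), of "cnj c"] by blast
next
  case (mult a b)
  then obtain a' b' where a': "a' \<in> generated_algebra G" "fock_adjoint M R a a'"
    and b': "b' \<in> generated_algebra G" "fock_adjoint M R b b'" by blast
  have "fock_adjoint M R (\<lambda>f. a (b f)) (\<lambda>f. b' (a' f))"
    using a'(2) b'(2) fock_operatorD(1)[OF generated_algebra_fock_operator[OF mult.hyps(2) G]]
      fock_operatorD(1)[OF generated_algebra_fock_operator[OF a'(1) G]]
    by (simp add: fock_adjoint_def)
  then show ?case using generated_algebra.mult[OF b'(1) a'(1)] by blast
qed

text \<open>Positivity holds because the value at \<open>b a\<close>, with \<open>b\<close> adjoint
  to \<open>a\<close>, is the squared norm of \<open>a vacuum\<close>. The adjoint relation removes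
  \<open>b\<close> from the second argument of the scalar product, hence the two conjugations in
  that step.\<close>

lemma vacuum_state_on:
  assumes G: "\<And>a. a \<in> G \<Longrightarrow> fock_operator M R a"
    and adj: "\<And>a. a \<in> G \<Longrightarrow> \<exists>b\<in>G. fock_adjoint M R a b"
  shows "state_on M R (generated_algebra G) (vacuum_state M)"
  unfolding state_on_def
proof (intro conjI ballI allI impI)
  note op = generated_algebra_fock_operator[OF _ G]
  note v = vacuum_fock_fin
  show "vacuum_state M a = vacuum_state M b"
    if "a \<in> generated_algebra G" "b \<in> generated_algebra G" "\<forall>f\<in>fock_fin M R. fock_eq M (a f) (b f)" for a b
    unfolding vacuum_state_def
    using that(3) v
    by (intro fock_inner_cong[OF fock_operatorD(1)[OF op[OF that(1)] v] fock_operatorD(1)[OF op[OF that(2)] v] _ v v] fock_eq_refl) auto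
  show "\<exists>b\<in>generated_algebra G. fock_adjoint M R a b" if "a \<in> generated_algebra G" for a
    using generated_algebra_adjoint[OF that G adj] .
  show "vacuum_state M (\<lambda>f n x. a f n x + b f n x) = vacuum_state M a + vacuum_state M b" for a b
    by (simp add: vacuum_state_eq)
  show "vacuum_state M (\<lambda>f n x. c * a f n x) = c * vacuum_state M a" for c a
    by (simp add: vacuum_state_eq)
  show "vacuum_state M (\<lambda>f. f) = 1"
    by (simp add: vacuum_state_eq) (simp add: vacuum_def)
  show "vacuum_state M (\<lambda>f. b (a f)) \<in> \<real>\<^sub>\<ge>\<^sub>0"
    if "a \<in> generated_algebra G" "b \<in> generated_algebra G" "fock_adjoint M R a b" for a b
  proof -
    have av: "a vacuum \<in> fock_fin M R" using fock_operatorD(1)[OF op[OF that(1)] v] .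
    have "vacuum_state M (\<lambda>f. b (a f)) = cnj (fock_inner M vacuum (b (a vacuum)))"
      unfolding vacuum_state_def by (rule fock_inner_cnj[OF v])
    also have "fock_inner M vacuum (b (a vacuum)) = fock_inner M (a vacuum) (a vacuum)"
      using that(3) v av by (simp add: fock_adjoint_def)
    also have "cnj \<dots> = fock_inner M (a vacuum) (a vacuum)" by (rule fock_inner_cnj[OF av, symmetric])
    finally show ?thesis using fock_inner_self_nonneg[OF av] by simp
  qed
qed

text \<open>Both sides are the same double sum of transition amplitudes \<open>t n n'\<close>,
  grouped once by the final and once by the initial particle number.\<close>

lemma op_integral_adjoint:
  assumes good: "good_kernel ss gs \<kappa>" "good_kernel (flip_rev ss) gs' \<kappa>'"
    and gs': "\<And>j. j < length ss \<Longrightarrow> gs' ! j = (\<lambda>y. cnj ((gs ! (length ss - Suc j)) y))"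
    and \<kappa>': "\<And>y. \<kappa>' y = cnj (\<kappa> (\<lambda>j\<in>{..<length ss}. y (length ss - Suc j)))"
  shows "fock_adjoint M R (op_integral M R ss gs \<kappa>) (op_integral M R (flip_rev ss) gs' \<kappa>')"
  unfolding fock_adjoint_def
proof (intro ballI)
  fix f g assume f: "f \<in> fock_fin M R" and g: "g \<in> fock_fin M R"
  obtain N1 where N1: "\<forall>n\<ge>N1. AE x in power_measure M n. f n x = 0" using f by (rule fock_finE)
  obtain N2 where N2: "\<forall>n\<ge>N2. AE x in power_measure M n. g n x = 0" using g by (rule fock_finE)
  define N where "N = max N1 N2"
  have fN: "\<forall>n\<ge>N. AE x in power_measure M n. f n x = 0" using N1 by (simp add: N_def)
  have gN: "\<forall>n\<ge>N. AE x in power_measure M n. g n x = 0" using N2 by (simp add: N_def)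
  have cl: "count_list (flip_rev ss) Plus = count_list ss Minus" "count_list (flip_rev ss) Minus = count_list ss Plus"
    by (induction ss) (auto simp: count_list_append)
  have linked': "linked (flip_rev ss) n' n \<longleftrightarrow> linked ss n n'" for n n' using cl by auto
  define t where "t n n' = of_nat (fact n') * (LINT x|power_measure M n'. op_term ss gs \<kappa> n (f n) n' x * cnj (g n' x))" for n n'
  have t': "t n n' = of_nat (fact n) * (LINT x|power_measure M n. f n x * cnj (op_term (flip_rev ss) gs' \<kappa>' n' (g n') n x))"
    if "linked ss n n'" for n n'
    unfolding t_def by (rule op_term_adjoint[OF that good fock_finD(2)[OF f] fock_finD(2)[OF g] gs' \<kappa>'])
  \<comment> \<open>Beyond the common cut-off the amplitude vanishes: in the index of
    \<open>f\<close> by its adjoint form, in the index of \<open>g\<close> by its direct form. The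
    two sums may then be exchanged as finite sums.\<close>
  have t0: "t n n' = 0" if "linked ss n n'" "n \<ge> N" for n n'
    unfolding t'[OF that(1)] using fN[rule_format, OF that(2)]
    by (subst integral_AE_0) (auto elim: eventually_mono)
  have t0': "t n n' = 0" if "n' \<ge> N" for n n'
    unfolding t_def using gN[rule_format, OF that]
    by (subst integral_AE_0) (auto elim: eventually_mono)
  have L: "of_nat (fact n') * (LINT x|power_measure M n'. op_integral M R ss gs \<kappa> f n' x * cnj (g n' x)) =
    (\<Sum>n | linked ss n n'. t n n')" for n'
  proof -
    have "(LINT x|power_measure M n'. op_integral M R ss gs \<kappa> f n' x * cnj (g n' x)) =
      (\<Sum>n | linked ss n n'. LINT x|power_measure M n'. op_term ss gs \<kappa> n (f n) n' x * cnj (g n' x))"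
      unfolding op_integral_terms sum_distrib_right
      using op_term_sym_L2[OF good(1) fock_finD(2)[OF f]] fock_finD(2)[OF g]
      by (intro Bochner_Integration.integral_sum L2_integrable_mult L2_cnj) (auto simp: sym_L2_def)
    then show ?thesis by (simp add: t_def sum_distrib_left)
  qed
  have Rr: "of_nat (fact n) * (LINT x|power_measure M n. f n x * cnj (op_integral M R (flip_rev ss) gs' \<kappa>' g n x)) =
    (\<Sum>n' | linked ss n n'. t n n')" for n
  proof -
    have "(LINT x|power_measure M n. f n x * cnj (op_integral M R (flip_rev ss) gs' \<kappa>' g n x)) =
      (\<Sum>n' | linked (flip_rev ss) n' n. LINT x|power_measure M n. f n x * cnj (op_term (flip_rev ss) gs' \<kappa>' n' (g n') n x))"
      unfolding op_integral_terms cnj_sum sum_distrib_left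
      using op_term_sym_L2[OF good(2) fock_finD(2)[OF g]] fock_finD(2)[OF f]
      by (intro Bochner_Integration.integral_sum L2_integrable_mult L2_cnj) (auto simp: sym_L2_def)
    then show ?thesis unfolding linked' by (simp add: t' sum_distrib_left)
  qed
  have "fock_inner M (op_integral M R ss gs \<kappa> f) g = (\<Sum>n'<N. \<Sum>n | linked ss n n'. t n n')"
    by (simp only: fock_inner_cut_right[OF gN] L)
  also have "\<dots> = (\<Sum>n'<N. \<Sum>n<N. if linked ss n n' then t n n' else 0)"
  proof (rule sum.cong[OF refl])
    fix n'
    have "(\<Sum>n<N. if linked ss n n' then t n n' else 0) = (\<Sum>n\<in>{..<N} \<inter> {n. linked ss n n'}. t n n')"
      by (simp add: sum.inter_restrict)
    also have "\<dots> = (\<Sum>n | linked ss n n'. t n n')"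
      by (rule sum.mono_neutral_left[OF finite_linked(1)]) (auto, metis t0 not_le)
    finally show "(\<Sum>n | linked ss n n'. t n n') = (\<Sum>n<N. if linked ss n n' then t n n' else 0)" by simp
  qed
  also have "\<dots> = (\<Sum>n<N. \<Sum>n'<N. if linked ss n n' then t n n' else 0)" by (rule sum.swap)
  also have "\<dots> = (\<Sum>n<N. \<Sum>n' | linked ss n n'. t n n')"
  proof (rule sum.cong[OF refl])
    fix n
    have "(\<Sum>n'<N. if linked ss n n' then t n n' else 0) = (\<Sum>n'\<in>{..<N} \<inter> {n'. linked ss n n'}. t n n')"
      by (simp add: sum.inter_restrict)
    also have "\<dots> = (\<Sum>n' | linked ss n n'. t n n')"
      by (rule sum.mono_neutral_left[OF finite_linked(2)]) (auto, metis t0' not_le)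
    finally show "(\<Sum>n'<N. if linked ss n n' then t n n' else 0) = (\<Sum>n' | linked ss n n'. t n n')" .
  qed
  also have "\<dots> = fock_inner M f (op_integral M R (flip_rev ss) gs' \<kappa>' g)"
    by (simp only: fock_inner_cut_left[OF fN] Rr)
  finally show "fock_inner M (op_integral M R ss gs \<kappa> f) g = fock_inner M f (op_integral M R (flip_rev ss) gs' \<kappa>' g)" .
qed

end

text \<open>Serves to reverse the arguments, to reorder half of them and to pick out two of them. A
  block of an admissible partition identifies two chosen positions only if their signs in
  \<open>ss\<close> differ, hence also in \<open>ss'\<close>, so null sets are pulled back to null
  sets. The proof works with a measurable null set \<open>A\<close> in place of \<open>P\<close>,
  which need not be measurable.\<close>

lemma AE_sign_measure_reindex:
  assumes N: "sigma_finite_measure N"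
    and \<tau>: "\<And>i. i < length ss' \<Longrightarrow> \<tau> i < length ss" "inj_on \<tau> {..<length ss'}"
    and signs: "\<And>i j. i < length ss' \<Longrightarrow> j < length ss' \<Longrightarrow> ss ! \<tau> i \<noteq> ss ! \<tau> j \<Longrightarrow> ss' ! i \<noteq> ss' ! j"
    and ae: "AE s in sign_measure N ss'. P s"
  shows "AE s in sign_measure N ss. P (\<lambda>i\<in>{..<length ss'}. s (\<tau> i))"
proof -
  from ae obtain A where A: "A \<in> null_sets (sign_measure N ss')"
      "{s \<in> space (sign_measure N ss'). \<not> P s} \<subseteq> A"
    by (auto simp: eventually_ae_filter)
  have As: "A \<in> sets (power_measure N (length ss'))" using A(1) by (auto simp: null_sets_def sets_sign_measure)
  have m: "(\<lambda>s. \<lambda>i\<in>{..<length ss'}. s (\<tau> i)) \<in> power_measure N (length ss) \<rightarrow>\<^sub>M power_measure N (length ss')"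
    using \<tau>(1) by (intro measurable_restrict measurable_component_singleton) auto
  have ae': "AE s in sign_measure N ss'. s \<notin> A" using A(1) by (rule AE_not_in)
  have "AE s in sign_measure N ss. (\<lambda>i\<in>{..<length ss'}. s (\<tau> i)) \<notin> A"
  proof (rule AE_sign_measureI)
    have "{s \<in> space (power_measure N (length ss)). (\<lambda>i\<in>{..<length ss'}. s (\<tau> i)) \<notin> A} =
      (\<lambda>s. \<lambda>i\<in>{..<length ss'}. s (\<tau> i)) -` (space (power_measure N (length ss')) - A) \<inter> space (power_measure N (length ss))"
      using measurable_space[OF m] by auto
    also have "\<dots> \<in> sets (power_measure N (length ss))"
      using As by (intro measurable_sets[OF m]) auto
    finally show "{s \<in> space (power_measure N (length ss)). (\<lambda>i\<in>{..<length ss'}. s (\<tau> i)) \<notin> A} \<in> sets (power_measure N (length ss))" .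
  next
    fix \<theta> assume \<theta>: "\<theta> \<in> sign_partitions ss"
    note part = partition_on_sign_partitions[OF \<theta>]
    have fin: "finite \<theta>" using finite_elements[OF _ part] by simp
    have "AE y in PiM \<theta> (\<lambda>_. N). (\<lambda>i\<in>{..<length ss'}. y (block \<theta> (\<tau> i))) \<notin> A"
    proof (rule AE_sign_measure_pullback[OF N N absolutely_continuous_id measurable_ident_sets[OF refl] fin _ _ ae'])
      show "(\<lambda>i. block \<theta> (\<tau> i)) ` {..<length ss'} \<subseteq> \<theta>"
        using block_in(1)[OF part] \<tau>(1) by auto
      fix i j assume ij: "i < length ss'" "j < length ss'" "i \<noteq> j" "block \<theta> (\<tau> i) = block \<theta> (\<tau> j)"
      have ne: "\<tau> i \<noteq> \<tau> j" using \<tau>(2) ij by (auto dest: inj_onD)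
      have B: "block \<theta> (\<tau> i) \<in> \<theta>" "{\<tau> i, \<tau> j} \<subseteq> block \<theta> (\<tau> i)"
        using block_in[OF part, of "\<tau> i"] block_in[OF part, of "\<tau> j"] \<tau>(1) ij by auto
      then have "card (block \<theta> (\<tau> i)) \<le> 2" using \<theta> by (auto simp: sign_partitions_def)
      moreover have "block \<theta> (\<tau> i) \<subseteq> {..<length ss}" using B(1) part by (auto simp: partition_on_def)
      then have "finite (block \<theta> (\<tau> i))" by (rule finite_subset) simp
      ultimately have "{\<tau> i, \<tau> j} = block \<theta> (\<tau> i)"
        using ne B(2) by (intro card_seteq) auto
      then have "{\<tau> i, \<tau> j} \<in> \<theta>" using B(1) by simp
      then have "ss ! \<tau> i \<noteq> ss ! \<tau> j" using \<theta> ne by (auto simp: sign_partitions_def)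
      then show "ss' ! i \<noteq> ss' ! j" using signs ij by blast
    qed
    moreover have "(\<lambda>i\<in>{..<length ss'}. (\<lambda>i\<in>{..<length ss}. y (block \<theta> i)) (\<tau> i)) = (\<lambda>i\<in>{..<length ss'}. y (block \<theta> (\<tau> i)))" for y :: "nat set \<Rightarrow> 'a"
      using \<tau>(1) by (auto intro!: restrict_ext)
    ultimately show "AE y in PiM \<theta> (\<lambda>_. N). (\<lambda>i\<in>{..<length ss'}. (\<lambda>i\<in>{..<length ss}. y (block \<theta> i)) (\<tau> i)) \<notin> A"
      by simp
  qed
  then show ?thesis using AE_space
  proof eventually_elim
    case (elim s)
    then have "(\<lambda>i\<in>{..<length ss'}. s (\<tau> i)) \<in> space (sign_measure N ss')"
      using measurable_space[OF m] by (simp add: space_sign_measure)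
    then show ?case using A(2) elim(1) by auto
  qed
qed

section \<open>The doubled space\<close>

lemma sigma_finite_Z: "sigma_finite_measure (Z_measure :: (copy \<times> 'n::finite space) measure)"
  unfolding Z_measure_def
  by (rule sigma_finite_pair_measure) (auto simp: sigma_finite_measure_count_space_finite lborel.sigma_finite_measure_axioms)

lemma space_Z [simp]: "space Z_measure = UNIV"
  by (simp add: Z_measure_def space_pair_measure)

lemma snd_Z [measurable]: "snd \<in> (Z_measure :: (copy \<times> 'n::finite space) measure) \<rightarrow>\<^sub>M lborel"
  unfolding Z_measure_def by measurable

lemma fst_Z [measurable]: "fst \<in> (Z_measure :: (copy \<times> 'n::finite space) measure) \<rightarrow>\<^sub>M count_space UNIV"
  unfolding Z_measure_def by measurable

lemma first_coordinate_Z [measurable]: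
  "(\<lambda>p. fst (snd p)) \<in> (Z_measure :: (copy \<times> 'n::finite space) measure) \<rightarrow>\<^sub>M lborel"
proof -
  have "fst \<in> (lborel :: 'n space measure) \<rightarrow>\<^sub>M lborel"
    unfolding lborel_prod[symmetric] by (rule measurable_fst)
  from measurable_compose[OF snd_Z this] show ?thesis .
qed

text \<open>The set lying over a null set \<open>A\<close> is a product with a factor of infinite
  measure; it is null because zero times infinity is zero in the extended reals.\<close>

lemma first_coordinate_nonsingular:
  "absolutely_continuous lborel (distr (Z_measure :: (copy \<times> 'n::finite space) measure) lborel (\<lambda>p. fst (snd p)))"
  unfolding absolutely_continuous_def
proof
  fix A :: "real set" assume A: "A \<in> null_sets lborel"
  then have As: "A \<in> sets lborel" by auto
  have "(\<lambda>p. fst (snd p)) -` A \<inter> space (Z_measure :: (copy \<times> 'n space) measure) = UNIV \<times> (A \<times> UNIV)"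
    by auto
  moreover have AU: "A \<times> UNIV \<in> sets (lborel :: 'n space measure)"
    unfolding lborel_prod[symmetric] using As by (intro pair_measureI) auto
  moreover have "emeasure (Z_measure :: (copy \<times> 'n space) measure) (UNIV \<times> (A \<times> UNIV)) =
    emeasure (count_space UNIV) (UNIV :: copy set) * emeasure (lborel \<Otimes>\<^sub>M lborel) (A \<times> (UNIV :: (real ^ 'n) set))"
    unfolding Z_measure_def lborel_prod
    using AU by (intro sigma_finite_measure.emeasure_pair_measure_Times lborel.sigma_finite_measure_axioms) auto
  moreover have "emeasure (lborel \<Otimes>\<^sub>M lborel) (A \<times> (UNIV :: (real ^ 'n) set)) = emeasure lborel A * emeasure lborel (UNIV :: (real ^ 'n) set)"
    using As by (intro sigma_finite_measure.emeasure_pair_measure_Times lborel.sigma_finite_measure_axioms) auto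
  ultimately have "emeasure (distr (Z_measure :: (copy \<times> 'n space) measure) lborel (\<lambda>p. fst (snd p))) A = 0"
    using A by (subst emeasure_distr[OF first_coordinate_Z As]) (auto simp: null_sets_def)
  then show "A \<in> null_sets (distr (Z_measure :: (copy \<times> 'n space) measure) lborel (\<lambda>p. fst (snd p)))"
    using As by (auto simp: null_sets_def)
qed

text \<open>The sections of the diagonal of the plane are single points. Two distinct coordinates of
  any product reduce to this case by pulling back along the index set \<open>{0, 1}\<close>.\<close>

lemma AE_lborel_distinct: "AE s in PiM {0, 1 :: nat} (\<lambda>_. lborel :: real measure). s 0 \<noteq> s 1"
proof -
  interpret product_sigma_finite "\<lambda>_. lborel :: real measure"
    by (rule product_sigma_finite_const) (rule lborel.sigma_finite_measure_axioms)
  interpret pair_sigma_finite "lborel :: real measure" "lborel :: real measure" ..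
  have m: "(\<lambda>p. indicator {p. fst p = snd p} p :: ennreal) \<in> borel_measurable (lborel \<Otimes>\<^sub>M (lborel :: real measure))"
    by measurable
  have "(\<integral>\<^sup>+s. indicator {p. fst p = snd p} (s 0, s 1) \<partial>PiM {0, 1 :: nat} (\<lambda>_. lborel :: real measure)) =
    (\<integral>\<^sup>+p. indicator {p. fst p = snd p} (fst p, snd p) \<partial>(lborel \<Otimes>\<^sub>M (lborel :: real measure)))"
    using m by (intro product_nn_integral_pair[where f="\<lambda>x y. indicator {p. fst p = snd p} (x, y)"]) (auto simp: case_prod_beta)
  also have "\<dots> = (\<integral>\<^sup>+p. indicator {p. fst p = snd p} p \<partial>(lborel \<Otimes>\<^sub>M (lborel :: real measure)))"
    by (simp add: indicator_def)
  also have "\<dots> = (\<integral>\<^sup>+x. \<integral>\<^sup>+y. indicator {p. fst p = snd p} (x, y) \<partial>lborel \<partial>(lborel :: real measure))"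
    by (rule lborel.nn_integral_fst[OF m, symmetric])
  also have "\<dots> = (\<integral>\<^sup>+x. \<integral>\<^sup>+y. indicator {x} y \<partial>lborel \<partial>(lborel :: real measure))"
    by (intro nn_integral_cong) (auto simp: indicator_def)
  also have "\<dots> = 0" by simp
  finally have z: "(\<integral>\<^sup>+s. indicator {p. fst p = snd p} (s 0, s 1) \<partial>PiM {0, 1 :: nat} (\<lambda>_. lborel :: real measure)) = 0" .
  have "(\<lambda>s. (s 0, s 1)) \<in> PiM {0, 1 :: nat} (\<lambda>_. lborel :: real measure) \<rightarrow>\<^sub>M lborel \<Otimes>\<^sub>M lborel"
    by (intro measurable_Pair measurable_component_singleton) auto
  from measurable_compose[OF this m] z show ?thesis
    by (subst (asm) nn_integral_0_iff_AE) (auto simp: indicator_def elim!: eventually_mono)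
qed

section \<open>The kernel on the doubled space\<close>

locale qcr =
  fixes Q :: "real \<Rightarrow> real \<Rightarrow> complex" and \<eta> :: real
  assumes Q_meas: "(\<lambda>(s, t). Q s t) \<in> borel_measurable borel"
    and Q_norm: "\<And>s t. s \<noteq> t \<Longrightarrow> norm (Q s t) = 1"
    and Q_herm: "\<And>s t. s \<noteq> t \<Longrightarrow> Q s t = cnj (Q t s)"
    and Q_diag: "\<And>s. Q s s = complex_of_real \<eta>"
begin

lemma Q_herm': "Q s t = cnj (Q t s)"
  by (cases "s = t") (simp add: Q_diag, rule Q_herm)

lemma Q_bound: "norm (Q s t) \<le> max 1 \<bar>\<eta>\<bar>"
  by (cases "s = t") (simp_all add: Q_diag Q_norm)

lemma Q_measurable [measurable (raw)]:
  assumes "u \<in> borel_measurable N" "v \<in> borel_measurable N"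
  shows "(\<lambda>x. Q (u x) (v x)) \<in> borel_measurable N"
proof -
  have "(\<lambda>x. (u x, v x)) \<in> N \<rightarrow>\<^sub>M borel" using measurable_Pair[OF assms] by (simp add: borel_prod)
  from measurable_compose[OF this Q_meas] show ?thesis by simp
qed

lemma JQ_herm: "JQ Q p q = cnj (JQ Q q p)"
  by (simp add: JQ_def Q_herm'[symmetric])

lemma JQ_bound: "norm (JQ Q p q) \<le> max 1 \<bar>\<eta>\<bar>"
  by (simp add: JQ_def Q_bound del: max_less_iff_conj)

lemma JQ_unit:
  assumes "fst (snd p) \<noteq> fst (snd q)"
  shows "JQ Q p q * JQ Q q p = 1"
proof -
  have "JQ Q p q * JQ Q q p = JQ Q p q * cnj (JQ Q p q)" by (subst JQ_herm[of q p]) (rule refl)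
  also have "\<dots> = of_real ((norm (JQ Q p q))\<^sup>2)" by (rule complex_norm_square[symmetric])
  also have "norm (JQ Q p q) = 1" using assms by (simp add: JQ_def Q_norm)
  finally show ?thesis by simp
qed

lemma JQ_meas: "(\<lambda>(p, q). JQ Q p q) \<in> borel_measurable (Z_measure \<Otimes>\<^sub>M (Z_measure :: (copy \<times> 'n::finite space) measure))"
proof -
  let ?ZZ = "Z_measure \<Otimes>\<^sub>M (Z_measure :: (copy \<times> 'n space) measure)"
  have f: "(\<lambda>x. fst (fst x)) \<in> ?ZZ \<rightarrow>\<^sub>M count_space UNIV" "(\<lambda>x. fst (snd x)) \<in> ?ZZ \<rightarrow>\<^sub>M count_space UNIV"
    by (rule measurable_compose[OF measurable_fst fst_Z], rule measurable_compose[OF measurable_snd fst_Z])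
  have c: "(\<lambda>x. fst (snd (fst x))) \<in> borel_measurable ?ZZ" "(\<lambda>x. fst (snd (snd x))) \<in> borel_measurable ?ZZ"
    using measurable_compose[OF measurable_fst first_coordinate_Z] measurable_compose[OF measurable_snd first_coordinate_Z]
    by auto
  \<comment> \<open>Lying in the same copy is a finite union of measurable events, one for each
    copy.\<close>
  have "{x \<in> space ?ZZ. fst (fst x) = fst (snd x)} =
    (\<Union>c. (\<lambda>x. fst (fst x)) -` {c} \<inter> space ?ZZ \<inter> ((\<lambda>x. fst (snd x)) -` {c} \<inter> space ?ZZ))"
    by auto
  also have "\<dots> \<in> sets ?ZZ"
    by (intro sets.finite_UN finite_class.finite_UNIV sets.Int measurable_sets[OF f(1)] measurable_sets[OF f(2)]) auto
  finally have "(\<lambda>x. if fst (fst x) = fst (snd x) then Q (fst (snd (fst x))) (fst (snd (snd x)))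
      else Q (fst (snd (snd x))) (fst (snd (fst x)))) \<in> borel_measurable ?ZZ"
    using c by (intro measurable_If Q_measurable) auto
  then show ?thesis unfolding JQ_def case_prod_beta .
qed

text \<open>Where first coordinates differ, \<open>Q\<close> is unimodular and hermitian, and two
  coordinates of a tuple differ almost everywhere. On the diagonal \<open>\<eta>\<close> is real, so
  hermiticity persists there, and \<open>max 1 \<bar>\<eta>\<bar>\<close> bounds the values in both
  cases.\<close>

lemma fock_setup_JQ: "fock_setup (Z_measure :: (copy \<times> 'n::finite space) measure) (JQ Q) (max 1 \<bar>\<eta>\<bar>)"
proof (rule fock_setup.intro)
  show "sigma_finite_measure (Z_measure :: (copy \<times> 'n space) measure)" by (rule sigma_finite_Z)
  show "(\<lambda>(p, q). JQ Q p q) \<in> borel_measurable (Z_measure \<Otimes>\<^sub>M (Z_measure :: (copy \<times> 'n space) measure))" by (rule JQ_meas)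
  show "JQ Q p q = cnj (JQ Q q p)" for p q :: "copy \<times> 'n space" by (rule JQ_herm)
  show "norm (JQ Q p q) \<le> max 1 \<bar>\<eta>\<bar>" for p q :: "copy \<times> 'n space" by (rule JQ_bound)
  show "AE x in power_measure (Z_measure :: (copy \<times> 'n space) measure) n. JQ Q (x i) (x (Suc i)) * JQ Q (x (Suc i)) (x i) = 1"
    if i: "Suc i < n" for i n
  proof -
    have "AE x in power_measure (Z_measure :: (copy \<times> 'n space) measure) n.
      (\<lambda>j\<in>{0, 1 :: nat}. fst (snd (x (i + j)))) 0 \<noteq> (\<lambda>j\<in>{0, 1 :: nat}. fst (snd (x (i + j)))) 1"
      using i by (intro AE_PiM_pullback[OF sigma_finite_Z lborel.sigma_finite_measure_axioms first_coordinate_nonsingular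
            first_coordinate_Z _ _ _ AE_lborel_distinct]) auto
    then show ?thesis by eventually_elim (simp add: JQ_unit)
  qed
qed simp

end

section \<open>Complexified operators and functions on the doubled space\<close>

lemma L2_Re: "h \<in> L2 M \<Longrightarrow> (\<lambda>y. Re (h y)) \<in> L2 M"
  and L2_Im: "h \<in> L2 M \<Longrightarrow> (\<lambda>y. Im (h y)) \<in> L2 M"
  by (auto intro!: L2_bound[where f=h and C=1] abs_Re_le_cmod abs_Im_le_cmod dest: L2_measurable)

lemma L2_of_real: "f \<in> L2 M \<Longrightarrow> (\<lambda>y. complex_of_real (f y)) \<in> L2 M"
  by (auto intro!: L2_bound[where f=f and C=1] dest: L2_measurable)

lemma L2_operatorD:
  assumes "L2_operator M K"
  shows "f \<in> L2 M \<Longrightarrow> K f \<in> L2 M"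
    "f \<in> L2 M \<Longrightarrow> g \<in> L2 M \<Longrightarrow> AE x in M. f x = g x \<Longrightarrow> AE x in M. K f x = K g x"
    "f \<in> L2 M \<Longrightarrow> g \<in> L2 M \<Longrightarrow> AE x in M. K (\<lambda>y. f y + g y) x = K f x + K g x"
    "f \<in> L2 M \<Longrightarrow> AE x in M. K (\<lambda>y. c * f y) x = c * K f x"
  using assms by (auto simp: L2_operator_def)

lemma cext_eq: "cext K h x = of_real (K (\<lambda>y. Re (h y)) x) + \<i> * of_real (K (\<lambda>y. Im (h y)) x)"
  by (simp add: cext_def complex_eq_iff)

lemma cext_L2:
  assumes "L2_operator M K" "h \<in> L2 M"
  shows "cext K h \<in> L2 M"
  unfolding cext_eq[abs_def]
  by (intro L2_add L2_scale L2_of_real L2_operatorD(1)[OF assms(1)] L2_Re L2_Im assms(2))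

text \<open>A real operator commutes with conjugation, here up to null sets because \<open>K\<close>
  is homogeneous only almost everywhere.\<close>

lemma cext_cnj:
  assumes "L2_operator M K" "h \<in> L2 M"
  shows "AE x in M. cext K (\<lambda>y. cnj (h y)) x = cnj (cext K h x)"
  using L2_operatorD(4)[OF assms(1) L2_Im[OF assms(2)], of "- 1"]
  by eventually_elim (simp add: cext_def complex_eq_iff)

lemma nn_integral_Z:
  fixes g :: "copy \<times> 'n::finite space \<Rightarrow> ennreal"
  assumes g: "g \<in> borel_measurable Z_measure"
  shows "(\<integral>\<^sup>+p. g p \<partial>Z_measure) = (\<integral>\<^sup>+x. g (Copy1, x) \<partial>lborel) + (\<integral>\<^sup>+x. g (Copy2, x) \<partial>lborel)"
proof -
  have U: "UNIV = {Copy1, Copy2}" using copy.exhaust by auto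
  have "(\<integral>\<^sup>+p. g p \<partial>Z_measure) = (\<integral>\<^sup>+c. \<integral>\<^sup>+x. g (c, x) \<partial>lborel \<partial>count_space UNIV)"
    unfolding Z_measure_def using g by (intro lborel.nn_integral_fst[symmetric]) (simp add: Z_measure_def)
  also have "\<dots> = (\<integral>\<^sup>+x. g (Copy1, x) \<partial>lborel) + (\<integral>\<^sup>+x. g (Copy2, x) \<partial>lborel)"
    unfolding U by (subst nn_integral_count_space_finite) auto
  finally show ?thesis .
qed

lemma copy_fun_measurable:
  fixes f :: "'n::finite space \<Rightarrow> complex"
  assumes "f \<in> borel_measurable lborel"
  shows "(\<lambda>p. if fst p = i then f (snd p) else 0) \<in> borel_measurable Z_measure"
proof (rule measurable_If)
  show "(\<lambda>p. f (snd p)) \<in> borel_measurable Z_measure" by (rule measurable_compose[OF snd_Z assms])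
  have "{p \<in> space (Z_measure :: (copy \<times> 'n space) measure). fst p = i} = fst -` {i} \<inter> space Z_measure" by auto
  also have "\<dots> \<in> sets Z_measure" by (rule measurable_sets[OF fst_Z]) simp
  finally show "{p \<in> space (Z_measure :: (copy \<times> 'n space) measure). fst p = i} \<in> sets Z_measure" .
qed simp

lemma copy_fun_L2:
  fixes f :: "'n::finite space \<Rightarrow> complex"
  assumes "f \<in> L2 lborel"
  shows "(\<lambda>p. if fst p = i then f (snd p) else 0) \<in> L2 Z_measure"
  unfolding L2_iff
proof
  show m: "(\<lambda>p. if fst p = i then f (snd p) else 0) \<in> borel_measurable Z_measure"
    by (rule copy_fun_measurable[OF L2_measurable[OF assms]])
  then have m2: "(\<lambda>p. (ennreal (norm (if fst p = i then f (snd p) else 0)))\<^sup>2) \<in> borel_measurable Z_measure"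
    by measurable
  show "(\<integral>\<^sup>+p. (ennreal (norm (if fst p = i then f (snd p) else 0)))\<^sup>2 \<partial>Z_measure) < \<infinity>"
    unfolding nn_integral_Z[OF m2] using assms by (cases i) (auto simp: L2_iff)
qed

lemma AE_Z:
  fixes P :: "copy \<times> 'n::finite space \<Rightarrow> bool"
  assumes "\<And>c. AE x in lborel. P (c, x)" and [measurable]: "{p \<in> space Z_measure. P p} \<in> sets Z_measure"
  shows "AE p in Z_measure. P p"
proof -
  have m: "(\<lambda>p. indicator {p. \<not> P p} p :: ennreal) \<in> borel_measurable Z_measure"
    by measurable
  have "(\<integral>\<^sup>+x. indicator {p. \<not> P p} (c, x) \<partial>(lborel :: 'n space measure)) = 0" for c
  proof -
    have "(\<integral>\<^sup>+x. indicator {p. \<not> P p} (c, x) \<partial>(lborel :: 'n space measure)) = (\<integral>\<^sup>+x. 0 \<partial>(lborel :: 'n space measure))"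
      by (rule nn_integral_cong_AE) (use assms(1)[of c] in eventually_elim, simp)
    then show ?thesis by simp
  qed
  then have "(\<integral>\<^sup>+p. indicator {p. \<not> P p} p \<partial>Z_measure) = 0"
    unfolding nn_integral_Z[OF m] by simp
  then show ?thesis
    by (subst (asm) nn_integral_0_iff_AE[OF m]) (auto simp: indicator_def elim!: eventually_mono split: if_splits)
qed

lemma finite_copy_lists: "finite {is :: copy list. length is = k}"
  using finite_lists_length_eq[of "UNIV :: copy set" k] by simp

lemma rep_sign_flip: "rep_sign c (flip s) = flip (rep_sign c s)"
  by (cases c; cases s) auto

lemma Linf_measurable: "v \<in> Linf (sign_measure M ss) \<Longrightarrow> v \<in> borel_measurable (power_measure M (length ss))"
  unfolding Linf_def using measurable_cong_sets[OF sets_sign_measure refl] by blast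

lemma rep_kernel_measurable:
  assumes v: "v \<in> borel_measurable (power_measure lborel (length is))"
  shows "rep_kernel is v \<in> borel_measurable (power_measure (Z_measure :: (copy \<times> 'n::finite space) measure) (length is))"
  unfolding rep_kernel_def[abs_def]
proof (rule measurable_If)
  let ?N = "power_measure (Z_measure :: (copy \<times> 'n space) measure) (length is)"
  have "(\<lambda>p. \<lambda>j\<in>{..<length is}. fst (snd (p j))) \<in> ?N \<rightarrow>\<^sub>M power_measure lborel (length is)"
    by (intro measurable_restrict measurable_compose[OF _ first_coordinate_Z] measurable_component_singleton) auto
  from measurable_compose[OF this v]
  show "(\<lambda>p. v (\<lambda>j\<in>{..<length is}. fst (snd (p j)))) \<in> borel_measurable ?N" .
  have "{p \<in> space ?N. \<forall>j<length is. fst (p j) = is ! j} =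
    space ?N \<inter> (\<Inter>j\<in>{..<length is}. (\<lambda>p. fst (p j)) -` {is ! j} \<inter> space ?N)" by auto
  also have "\<dots> \<in> sets ?N"
  proof (cases "length is = 0")
    case False
    have "(\<lambda>p. fst (p j)) -` {is ! j} \<inter> space ?N \<in> sets ?N" if "j < length is" for j
      using that by (intro measurable_sets[where A="count_space UNIV"] measurable_compose[OF _ fst_Z] measurable_component_singleton) auto
    then show ?thesis using False by (intro sets.Int[OF sets.top sets.finite_INT]) auto
  qed simp
  finally show "{p \<in> space ?N. \<forall>j<length is. fst (p j) = is ! j} \<in> sets ?N" .
qed simp

text \<open>Let a partition be admissible for the represented signs. If every block stays in one
  copy, \<open>rep_sign\<close> flips both signs of a block or neither, so the partition is
  admissible for \<open>ss\<close> and the bound of \<open>v\<close> applies. If a block joins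
  positions assigned to different copies, the shared point cannot lie in both, and
  \<open>rep_kernel\<close> vanishes on the diagonal.\<close>

lemma rep_kernel_Linf:
  assumes len: "length is = length ss" and v: "v \<in> Linf (nu ss)"
  shows "rep_kernel is v \<in> Linf (sign_measure (Z_measure :: (copy \<times> 'n::finite space) measure) (map2 rep_sign is ss))"
proof -
  let ?Z = "Z_measure :: (copy \<times> 'n space) measure" and ?rs = "map2 rep_sign is ss"
  have lr: "length ?rs = length ss" using len by simp
  have rs: "?rs ! i = rep_sign (is ! i) (ss ! i)" if "i < length ss" for i using that len by simp
  have m: "rep_kernel is v \<in> borel_measurable (power_measure ?Z (length ss))"
    using rep_kernel_measurable[of v "is"] Linf_measurable[OF v] len by simp
  obtain C0 where C0: "AE s in nu ss. norm (v s) \<le> C0" using v by (auto simp: Linf_def)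
  \<comment> \<open>The bound also has to cover the value 0 taken outside the prescribed copies,
    hence the maximum with 0.\<close>
  define C1 where "C1 = max 0 C0"
  have C1: "AE s in nu ss. norm (v s) \<le> C1" "0 \<le> C1" using C0 by (auto simp: C1_def elim: eventually_mono)
  have "AE p in sign_measure ?Z ?rs. norm (rep_kernel is v p) \<le> C1"
  proof (rule AE_sign_measureI)
    show "{p \<in> space (power_measure ?Z (length ?rs)). norm (rep_kernel is v p) \<le> C1} \<in> sets (power_measure ?Z (length ?rs))"
      unfolding lr using m by measurable
  next
    fix \<theta> assume \<theta>: "\<theta> \<in> sign_partitions ?rs"
    note part = partition_on_sign_partitions[OF \<theta>, unfolded lr]
    have fin: "finite \<theta>" using finite_elements[OF _ part] by simp
    show "AE y in PiM \<theta> (\<lambda>_. ?Z). norm (rep_kernel is v (\<lambda>i\<in>{..<length ?rs}. y (block \<theta> i))) \<le> C1"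
    proof (cases "\<forall>i<length ss. \<forall>j<length ss. block \<theta> i = block \<theta> j \<longrightarrow> is ! i = is ! j")
      case True
      have "AE y in PiM \<theta> (\<lambda>_. ?Z). norm (v (\<lambda>i\<in>{..<length ss}. fst (snd (y (block \<theta> i))))) \<le> C1"
      proof (rule AE_sign_measure_pullback[OF sigma_finite_Z lborel.sigma_finite_measure_axioms first_coordinate_nonsingular
            first_coordinate_Z fin _ _ C1(1)])
        show "block \<theta> ` {..<length ss} \<subseteq> \<theta>" using block_in(1)[OF part] by auto
        fix i j assume ij: "i < length ss" "j < length ss" "i \<noteq> j" "block \<theta> i = block \<theta> j"
        have B: "block \<theta> i \<in> \<theta>" "{i, j} \<subseteq> block \<theta> i"
          using block_in[OF part, of i] block_in[OF part, of j] ij by auto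
        then have "card (block \<theta> i) \<le> 2" using \<theta> by (auto simp: sign_partitions_def)
        moreover have "block \<theta> i \<subseteq> {..<length ss}" using B(1) part by (auto simp: partition_on_def)
        then have "finite (block \<theta> i)" by (rule finite_subset) simp
        ultimately have "{i, j} = block \<theta> i" using ij(3) B(2) by (intro card_seteq) auto
        then have "{i, j} \<in> \<theta>" using B(1) by simp
        then have "?rs ! i \<noteq> ?rs ! j" using \<theta> ij(3) unfolding sign_partitions_def by blast
        then show "ss ! i \<noteq> ss ! j" using True ij rs by (metis)
      qed
      then show ?thesis
      proof eventually_elim
        case (elim y)
        have "(\<lambda>j\<in>{..<length is}. fst (snd ((\<lambda>i\<in>{..<length ?rs}. y (block \<theta> i)) j))) =
          (\<lambda>i\<in>{..<length ss}. fst (snd (y (block \<theta> i))))"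
          using len by (auto intro!: restrict_ext)
        then show ?case using elim C1(2) by (simp add: rep_kernel_def)
      qed
    next
      case False
      then obtain i j where ij: "i < length ss" "j < length ss" "block \<theta> i = block \<theta> j" "is ! i \<noteq> is ! j" by blast
      have "rep_kernel is v (\<lambda>i\<in>{..<length ?rs}. y (block \<theta> i)) = 0" for y :: "nat set \<Rightarrow> copy \<times> 'n space"
      proof -
        have "\<not> (\<forall>l<length is. fst ((\<lambda>i\<in>{..<length ?rs}. y (block \<theta> i)) l) = is ! l)"
        proof
          assume all: "\<forall>l<length is. fst ((\<lambda>i\<in>{..<length ?rs}. y (block \<theta> i)) l) = is ! l"
          have "fst (y (block \<theta> i)) = is ! i" "fst (y (block \<theta> j)) = is ! j"
            using all[rule_format, of i] all[rule_format, of j] ij(1,2) len by simp_all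
          then show False using ij(3,4) by simp
        qed
        then show ?thesis unfolding rep_kernel_def by (rule if_not_P)
      qed
      then show ?thesis using C1(2) by simp
    qed
  qed
  then show ?thesis
    unfolding Linf_def using m measurable_cong_sets[OF sets_sign_measure refl, of ?Z ?rs] lr by auto
qed

text \<open>Reversing positions and flipping all signs keeps opposite signs opposite, so the
  essential bound is carried over.\<close>

lemma Linf_reverse:
  assumes v: "v \<in> Linf (nu ss)"
  shows "(\<lambda>s. cnj (v (\<lambda>j\<in>{..<length ss}. s (length ss - Suc j)))) \<in> Linf (nu (flip_rev ss))"
proof -
  have lb: "sigma_finite_measure (lborel :: real measure)" by (rule lborel.sigma_finite_measure_axioms)
  obtain C0 where C0: "AE s in nu ss. norm (v s) \<le> C0" using v by (auto simp: Linf_def)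
  have "AE s in nu (flip_rev ss). norm (v (\<lambda>j\<in>{..<length ss}. s (length ss - Suc j))) \<le> C0"
  proof (rule AE_sign_measure_reindex[OF lb _ _ _ C0])
    show "inj_on (\<lambda>j. length ss - Suc j) {..<length ss}" by (rule inj_onI) auto
    fix i j assume ij: "i < length ss" "j < length ss" "flip_rev ss ! (length ss - Suc i) \<noteq> flip_rev ss ! (length ss - Suc j)"
    then show "ss ! i \<noteq> ss ! j" by (auto simp: rev_nth)
  qed auto
  moreover have "(\<lambda>s. \<lambda>j\<in>{..<length ss}. s (length ss - Suc j)) \<in> power_measure lborel (length ss) \<rightarrow>\<^sub>M power_measure lborel (length ss)"
    by (intro measurable_restrict measurable_component_singleton) auto
  from measurable_compose[OF this Linf_measurable[OF v]]
  have m: "(\<lambda>s. v (\<lambda>j\<in>{..<length ss}. s (length ss - Suc j))) \<in> borel_measurable (power_measure lborel (length (flip_rev ss)))" by simp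
  have "(\<lambda>s. cnj (v (\<lambda>j\<in>{..<length ss}. s (length ss - Suc j)))) \<in> borel_measurable (nu (flip_rev ss))"
    using measurable_compose[OF m borel_measurable_continuous_onI[OF continuous_on_cnj[OF continuous_on_id]]] measurable_cong_sets[OF sets_sign_measure refl, of lborel "flip_rev ss"]
    by auto
  ultimately show ?thesis by (auto simp: Linf_def)
qed

definition copy_op :: "(('n space \<Rightarrow> real) \<Rightarrow> 'n space \<Rightarrow> real) \<Rightarrow> (('n space \<Rightarrow> real) \<Rightarrow> 'n space \<Rightarrow> real) \<Rightarrow>
    copy \<Rightarrow> ('n space \<Rightarrow> real) \<Rightarrow> 'n space \<Rightarrow> real"
  where "copy_op K1 K2 i = (case i of Copy1 \<Rightarrow> K1 | Copy2 \<Rightarrow> K2)"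

locale qcr_rep = qcr Q \<eta> for Q \<eta> +
  fixes K1 K2 :: "('n::finite space \<Rightarrow> real) \<Rightarrow> 'n space \<Rightarrow> real"
  assumes K1: "L2_operator lborel K1" and K2: "L2_operator lborel K2"
begin

sublocale Z: fock_setup "Z_measure :: (copy \<times> 'n space) measure" "JQ Q" "max 1 \<bar>\<eta>\<bar>"
  by (rule fock_setup_JQ)

lemma copy_op_L2: "L2_operator lborel (copy_op K1 K2 i)"
  using K1 K2 by (cases i) (auto simp: copy_op_def)

lemma rep_fun_eq: "rep_fun K1 K2 i h = (\<lambda>p. if fst p = i then cext (copy_op K1 K2 i) h (snd p) else 0)"
  unfolding rep_fun_def[abs_def] copy_op_def ..

lemma rep_fun_L2: "h \<in> L2 lborel \<Longrightarrow> rep_fun K1 K2 i h \<in> L2 Z_measure"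
  unfolding rep_fun_eq by (intro copy_fun_L2 cext_L2 copy_op_L2)

lemma rep_fun_cnj:
  assumes h: "h \<in> L2 lborel"
  shows "AE p in Z_measure. rep_fun K1 K2 i (\<lambda>y. cnj (h y)) p = cnj (rep_fun K1 K2 i h p)"
proof (rule AE_Z)
  show "AE x in lborel. rep_fun K1 K2 i (\<lambda>y. cnj (h y)) (c, x) = cnj (rep_fun K1 K2 i h (c, x))" for c
    using cext_cnj[OF copy_op_L2 h, of i] by eventually_elim (simp add: rep_fun_eq)
  have [measurable]: "rep_fun K1 K2 i (\<lambda>y. cnj (h y)) \<in> borel_measurable (Z_measure :: (copy \<times> 'n space) measure)"
    "(\<lambda>p. cnj (rep_fun K1 K2 i h p)) \<in> borel_measurable (Z_measure :: (copy \<times> 'n space) measure)"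
    using L2_measurable[OF rep_fun_L2[OF L2_cnj[OF h]]] L2_measurable[OF L2_cnj[OF rep_fun_L2[OF h]]] by auto
  show "{p \<in> space Z_measure. rep_fun K1 K2 i (\<lambda>y. cnj (h y)) p = cnj (rep_fun K1 K2 i h p)} \<in> sets Z_measure"
    by measurable
qed

lemma rep_good_kernel:
  assumes "length hs = length ss" "set hs \<subseteq> L2 lborel" "v \<in> Linf (nu ss)" "length is = length ss"
  shows "Z.good_kernel (map2 rep_sign is ss) (map2 (rep_fun K1 K2) is hs) (rep_kernel is v)"
  unfolding Z.good_kernel_def
  using assms rep_kernel_Linf[OF assms(4,3)] by (auto intro!: rep_fun_L2 simp: subset_iff)

definition rep_term :: "sign list \<Rightarrow> ('n space \<Rightarrow> complex) list \<Rightarrow> ((nat \<Rightarrow> real) \<Rightarrow> complex) \<Rightarrow> copy list \<Rightarrow> (copy \<times> 'n space) fock_op"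
  where "rep_term ss hs v is = op_integral Z_measure (JQ Q) (map2 rep_sign is ss) (map2 (rep_fun K1 K2) is hs) (rep_kernel is v)"

lemma rep_integral_terms:
  "rep_integral Q K1 K2 ss hs v = (\<lambda>f n x. \<Sum>is | length is = length ss. rep_term ss hs v is f n x)"
  by (simp add: fun_eq_iff rep_integral_def rep_term_def)

lemma fock_operator_sum:
  assumes "finite I" "\<And>i. i \<in> I \<Longrightarrow> fock_operator Z_measure (JQ Q) (A i)"
  shows "fock_operator Z_measure (JQ Q) (\<lambda>(f :: (copy \<times> 'n space) fock) n x. \<Sum>i\<in>I. A i f n x)"
  using assms
proof (induction rule: finite_induct)
  case (insert i I)
  then show ?case using Z.fock_operator_add[of "A i" "\<lambda>f n x. \<Sum>i\<in>I. A i f n x"] by simp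
qed (simp add: Z.fock_operator_0)

lemma fock_adjoint_sum:
  assumes "finite I" "\<And>i. i \<in> I \<Longrightarrow> fock_operator Z_measure (JQ Q) (A i)" "\<And>i. i \<in> I \<Longrightarrow> fock_operator Z_measure (JQ Q) (B i)"
    "\<And>i. i \<in> I \<Longrightarrow> fock_adjoint Z_measure (JQ Q) (A i) (B i)"
  shows "fock_adjoint Z_measure (JQ Q) (\<lambda>(f :: (copy \<times> 'n space) fock) n x. \<Sum>i\<in>I. A i f n x) (\<lambda>f n x. \<Sum>i\<in>I. B i f n x)"
  using assms
proof (induction rule: finite_induct)
  case empty
  show ?case by (simp add: fock_adjoint_def fock_inner_def)
next
  case (insert i I)
  have "fock_adjoint Z_measure (JQ Q) (\<lambda>(f :: (copy \<times> 'n space) fock) n x. A i f n x + (\<Sum>i\<in>I. A i f n x))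
      (\<lambda>f n x. B i f n x + (\<Sum>i\<in>I. B i f n x))"
    using insert by (intro Z.fock_adjoint_add fock_operator_sum) auto
  then show ?case using insert by simp
qed

lemma rep_term_fock_operator:
  assumes "length hs = length ss" "set hs \<subseteq> L2 lborel" "v \<in> Linf (nu ss)" "length is = length ss"
  shows "fock_operator Z_measure (JQ Q) (rep_term ss hs v is)"
  unfolding rep_term_def by (rule Z.op_integral_fock_operator[OF rep_good_kernel[OF assms]])

lemma rep_integral_fock_operator:
  assumes "length hs = length ss" "set hs \<subseteq> L2 lborel" "v \<in> Linf (nu ss)"
  shows "fock_operator Z_measure (JQ Q) (rep_integral Q K1 K2 ss hs v)"
  unfolding rep_integral_terms
  using rep_term_fock_operator[OF assms] by (intro fock_operator_sum finite_copy_lists) auto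

text \<open>Flipping a sign commutes with the choice of copy, so the adjoint of the summand for
  \<open>is\<close> is again a summand, the one for the reversed list of copies.\<close>

lemma rep_term_adjoint:
  assumes hs: "length hs = length ss" "set hs \<subseteq> L2 lborel" and v: "v \<in> Linf (nu ss)" and len: "length is = length ss"
  shows "fock_adjoint Z_measure (JQ Q) (rep_term ss hs v is)
    (rep_term (flip_rev ss) (map (\<lambda>h y. cnj (h y)) (rev hs)) (\<lambda>s. cnj (v (\<lambda>j\<in>{..<length ss}. s (length ss - Suc j)))) (rev is))"
proof -
  let ?k = "length ss" and ?rs = "map2 rep_sign is ss" and ?gs = "map2 (rep_fun K1 K2) is hs"
  let ?v = "\<lambda>s. cnj (v (\<lambda>j\<in>{..<?k}. s (?k - Suc j)))" and ?hs = "map (\<lambda>h y. cnj (h y)) (rev hs)"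
  let ?gs2 = "map2 (rep_fun K1 K2) (rev is) ?hs"
  \<comment> \<open>The adjoint formula wants the exact conjugates \<open>gs'\<close>, while the
    representation produces \<open>?gs2\<close> from conjugated arguments. The two agree almost
    everywhere because the operators are real.\<close>
  define gs' where "gs' = map (\<lambda>g p. cnj (g p)) (rev ?gs)"
  have rs: "map2 rep_sign (rev is) (flip_rev ss) = flip_rev ?rs"
    by (rule nth_equalityI) (use len in \<open>auto simp: rev_nth rep_sign_flip\<close>)
  have hs2: "length ?hs = length (flip_rev ss)" "set ?hs \<subseteq> L2 lborel" "length (rev is) = length (flip_rev ss)"
    using hs len by (auto intro!: L2_cnj)
  note good = rep_good_kernel[OF hs v len]
  have good2: "Z.good_kernel (flip_rev ?rs) ?gs2 (rep_kernel (rev is) ?v)"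
    using rep_good_kernel[OF hs2(1,2) Linf_reverse[OF v] hs2(3)] unfolding rs .
  have g'n: "gs' ! j = (\<lambda>p. cnj ((?gs ! (?k - Suc j)) p))" if "j < ?k" for j
    using that len hs by (simp add: gs'_def rev_nth)
  have good': "Z.good_kernel (flip_rev ?rs) gs' (rep_kernel (rev is) ?v)"
    using good good2 g'n len hs by (auto simp: Z.good_kernel_def intro!: L2_cnj)
  have ker: "rep_kernel (rev is) ?v y = cnj (rep_kernel is v (\<lambda>j\<in>{..<length ?rs}. y (length ?rs - Suc j)))" for y :: "nat \<Rightarrow> copy \<times> 'n space"
  proof -
    have 1: "(\<forall>j<?k. fst (y j) = rev is ! j) \<longleftrightarrow> (\<forall>j<?k. fst (y (?k - Suc j)) = is ! j)"
    proof safe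
      fix j assume "\<forall>j<?k. fst (y j) = rev is ! j" "j < ?k"
      then show "fst (y (?k - Suc j)) = is ! j" using len by (auto simp: rev_nth)
    next
      fix j assume h: "\<forall>j<?k. fst (y (?k - Suc j)) = is ! j" and j: "j < ?k"
      from h[rule_format, of "?k - Suc j"] j show "fst (y j) = rev is ! j" using len by (simp add: rev_nth)
    qed
    have 2: "(\<lambda>j\<in>{..<?k}. (\<lambda>j\<in>{..<?k}. fst (snd (y j))) (?k - Suc j)) = (\<lambda>j\<in>{..<?k}. fst (snd ((\<lambda>j\<in>{..<?k}. y (?k - Suc j)) j)))"
      by (auto intro!: restrict_ext)
    have c: "(\<forall>j<length is. fst ((\<lambda>j\<in>{..<length ?rs}. y (length ?rs - Suc j)) j) = is ! j) \<longleftrightarrow> (\<forall>j<?k. fst (y (?k - Suc j)) = is ! j)"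
      using len by simp
    have l: "length (rev is) = ?k" "length is = ?k" "length ?rs = ?k" using len by simp_all
    show ?thesis
    proof (cases "\<forall>j<?k. fst (y j) = rev is ! j")
      case True
      show ?thesis unfolding rep_kernel_def c 1[symmetric] unfolding l if_P[OF True] 2 by (rule refl)
    next
      case False
      then show ?thesis unfolding rep_kernel_def c 1[symmetric] unfolding l if_not_P[OF False] by simp
    qed
  qed
  have adj: "fock_adjoint Z_measure (JQ Q) (op_integral Z_measure (JQ Q) ?rs ?gs (rep_kernel is v))
      (op_integral Z_measure (JQ Q) (flip_rev ?rs) gs' (rep_kernel (rev is) ?v))"
    using g'n len by (intro Z.op_integral_adjoint[OF good good' _ ker]) auto
  have eq: "fock_eq Z_measure (op_integral Z_measure (JQ Q) (flip_rev ?rs) gs' (rep_kernel (rev is) ?v) g)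
      (op_integral Z_measure (JQ Q) (flip_rev ?rs) ?gs2 (rep_kernel (rev is) ?v) g)"
    if g: "g \<in> fock_fin Z_measure (JQ Q)" for g :: "(copy \<times> 'n space) fock"
  proof (rule Z.op_integral_cong_AE[OF good' good2 _ g g fock_eq_refl])
    fix j assume "j < length (flip_rev ?rs)"
    then have j: "j < ?k" using len by simp
    have "hs ! (?k - Suc j) \<in> L2 lborel" using hs j by (auto simp: subset_iff)
    from rep_fun_cnj[OF this, of "is ! (?k - Suc j)"]
    show "AE y in Z_measure. (gs' ! j) y = (?gs2 ! j) y"
      unfolding g'n[OF j] using j len hs by (simp add: rev_nth eq_commute)
  qed
  show ?thesis
    unfolding fock_adjoint_def
  proof (intro ballI)
    fix f g :: "(copy \<times> 'n space) fock"
    assume f: "f \<in> fock_fin Z_measure (JQ Q)" and g: "g \<in> fock_fin Z_measure (JQ Q)"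
    have "fock_inner Z_measure (rep_term ss hs v is f) g = fock_inner Z_measure f (op_integral Z_measure (JQ Q) (flip_rev ?rs) gs' (rep_kernel (rev is) ?v) g)"
      using adj f g by (simp add: fock_adjoint_def rep_term_def)
    also have "\<dots> = fock_inner Z_measure f (op_integral Z_measure (JQ Q) (flip_rev ?rs) ?gs2 (rep_kernel (rev is) ?v) g)"
      using fock_operatorD(1)[OF Z.op_integral_fock_operator[OF good'] g] fock_operatorD(1)[OF Z.op_integral_fock_operator[OF good2] g]
      by (rule fock_inner_cong[OF f f fock_eq_refl _ _ eq[OF g]])
    finally show "fock_inner Z_measure (rep_term ss hs v is f) g =
      fock_inner Z_measure f (rep_term (flip_rev ss) ?hs ?v (rev is) g)"
      by (simp add: rep_term_def rs del: rev_map)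
  qed
qed

text \<open>The sum runs over all lists of copies, and reversing these lists permutes the
  summands.\<close>

lemma rep_integral_adjoint:
  assumes hs: "length hs = length ss" "set hs \<subseteq> L2 lborel" and v: "v \<in> Linf (nu ss)"
  shows "fock_adjoint Z_measure (JQ Q) (rep_integral Q K1 K2 ss hs v)
    (rep_integral Q K1 K2 (flip_rev ss) (map (\<lambda>h y. cnj (h y)) (rev hs))
      (\<lambda>s. cnj (v (\<lambda>j\<in>{..<length ss}. s (length ss - Suc j)))))"
proof -
  let ?v = "\<lambda>s. cnj (v (\<lambda>j\<in>{..<length ss}. s (length ss - Suc j)))" and ?hs = "map (\<lambda>h y. cnj (h y)) (rev hs)"
  have hs2: "length ?hs = length (flip_rev ss)" "set ?hs \<subseteq> L2 lborel"
    using hs by (auto intro!: L2_cnj)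
  have "rep_integral Q K1 K2 (flip_rev ss) ?hs ?v = (\<lambda>f n x. \<Sum>is | length is = length ss. rep_term (flip_rev ss) ?hs ?v (rev is) f n x)"
    unfolding rep_integral_terms fun_eq_iff
    by (intro allI sum.reindex_bij_witness[where i=rev and j=rev]) auto
  then show ?thesis
    unfolding rep_integral_terms[of ss]
    using rep_term_fock_operator[OF hs v] rep_term_fock_operator[OF hs2 Linf_reverse[OF v]] rep_term_adjoint[OF hs v]
    by (auto intro!: fock_adjoint_sum finite_copy_lists)
qed

lemma rep_algebra_fock_operator:
  assumes "a \<in> rep_algebra Q K1 K2"
  shows "fock_operator Z_measure (JQ Q) a"
  by (rule Z.generated_algebra_fock_operator[OF assms[unfolded rep_algebra_def]])
    (auto intro: rep_integral_fock_operator)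

lemma rep_state: "state_on Z_measure (JQ Q) (rep_algebra Q K1 K2) (vacuum_state Z_measure)"
  unfolding rep_algebra_def
proof (rule Z.vacuum_state_on)
  fix a assume "a \<in> {rep_integral Q K1 K2 ss hs v | ss hs v. length hs = length ss \<and> set hs \<subseteq> L2 lborel \<and> v \<in> Linf (nu ss)}"
  then obtain ss hs v where a: "a = rep_integral Q K1 K2 ss hs v" and h: "length hs = length ss" "set hs \<subseteq> L2 lborel" "v \<in> Linf (nu ss)"
    by blast
  show "fock_operator Z_measure (JQ Q) a" unfolding a by (rule rep_integral_fock_operator[OF h])
  let ?b = "rep_integral Q K1 K2 (flip_rev ss) (map (\<lambda>h y. cnj (h y)) (rev hs))
      (\<lambda>s. cnj (v (\<lambda>j\<in>{..<length ss}. s (length ss - Suc j))))"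
  have "length (map (\<lambda>h y. cnj (h y)) (rev hs)) = length (flip_rev ss)" "set (map (\<lambda>h y. cnj (h y)) (rev hs)) \<subseteq> L2 lborel"
    using h by (auto intro!: L2_cnj)
  then show "\<exists>b\<in>{rep_integral Q K1 K2 ss hs v | ss hs v. length hs = length ss \<and> set hs \<subseteq> L2 lborel \<and> v \<in> Linf (nu ss)}.
      fock_adjoint Z_measure (JQ Q) a b"
    unfolding a using rep_integral_adjoint[OF h] Linf_reverse[OF h(3)] by blast
qed

end

section \<open>The \<open>n\<close>-point functions\<close>

lemma count_list_replicate: "count_list (replicate n x) y = (if x = y then n else 0)"
  by (induction n) auto

context fock_setup
begin

text \<open>A vacuum expectation is the scalar product formula without outer signs, so the line is
  \<open>ss\<close> itself. If creations and annihilations do not balance, both sides vanish: a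
  diagram would be a bijection between finite sets of different size.\<close>

lemma vacuum_op_integral:
  assumes good: "good_kernel ss gs \<kappa>"
  shows "op_integral M R ss gs \<kappa> vacuum 0 (\<lambda>_. undefined) =
    (\<Sum>m\<in>line_diagrams ss. line_integral M R ss (kernel_fun gs \<kappa> (length ss)) m)"
proof -
  have zero: "op_term ss gs \<kappa> n (vacuum n) 0 x = 0" if "n \<noteq> 0" for n x
  proof -
    have e: "(\<lambda>x. 0 * vacuum n x) = (vacuum n :: (nat \<Rightarrow> 'y) \<Rightarrow> complex)"
      using that by (simp add: vacuum_def)
    from op_term_scale[of ss gs \<kappa> n 0 "vacuum n" 0 x] show ?thesis unfolding e by simp
  qed
  show ?thesis
  proof (cases "linked ss 0 0")
    case True
    have "op_integral M R ss gs \<kappa> vacuum 0 (\<lambda>_. undefined) = (\<Sum>n\<in>{0}. op_term ss gs \<kappa> n (vacuum n) 0 (\<lambda>_. undefined))"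
      unfolding op_integral_terms
      by (rule sum.mono_neutral_right[OF finite_linked(1)]) (use True zero in auto)
    also have "\<dots> = of_nat (fact 0) * (LINT x|power_measure M 0. op_term ss gs \<kappa> 0 (vacuum 0) 0 x * cnj (vacuum 0 x))"
      by (simp add: PiM_empty lebesgue_integral_count_space_finite vacuum_def)
    also have "\<dots> = (\<Sum>m\<in>line_diagrams (extended 0 ss 0). line_integral M R (extended 0 ss 0)
      (line_fun 0 (length ss) 0 (kernel_fun gs \<kappa> (length ss)) (vacuum 0) (vacuum 0)) m)"
      by (rule op_term_inner[OF True good fock_finD(2)[OF vacuum_fock_fin] fock_finD(2)[OF vacuum_fock_fin]])
    also have "\<dots> = (\<Sum>m\<in>line_diagrams ss. line_integral M R ss (kernel_fun gs \<kappa> (length ss)) m)"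
      unfolding line_integral_def by (simp add: line_fun_def vacuum_def cong: restrict_cong)
    finally show ?thesis .
  next
    case False
    have "line_diagrams ss = {}"
    proof (rule ccontr)
      assume "line_diagrams ss \<noteq> {}"
      then obtain m where "m \<in> line_diagrams ss" by auto
      then have "card (minuses ss) = card (pluses ss)" by (intro bij_betw_same_card line_diagramsD(2))
      then show False using False by (simp add: count_list_Plus[of ss 0] count_list_Minus[of ss 0])
    qed
    moreover have "op_integral M R ss gs \<kappa> vacuum 0 (\<lambda>_. undefined) = 0"
      unfolding op_integral_terms
    proof (rule sum.neutral, safe)
      fix n assume "linked ss n 0"
      then have "n \<noteq> 0" using False by auto
      then show "op_term ss gs \<kappa> n (vacuum n) 0 (\<lambda>_. undefined) = 0" by (rule zero)
    qed
    ultimately show ?thesis by simp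
  qed
qed

end

section \<open>Diagrams between two blocks of equal size\<close>

lemma minuses_pairs: "minuses (replicate n Minus @ replicate n Plus) = {..<n}"
  and pluses_pairs: "pluses (replicate n Minus @ replicate n Plus) = {n..<n + n}"
  by (auto simp: minus_set_def plus_set_def nth_append)

text \<open>The case of \<open>diagram_of\<close> with an empty list of inner signs, where
  \<open>New\<close> is the only pairing.\<close>

definition perm_diagram :: "nat \<Rightarrow> (nat \<Rightarrow> nat) \<Rightarrow> nat \<Rightarrow> nat"
  where "perm_diagram n \<pi> i = (if i < n then n + \<pi> (n - Suc i) else i)"

lemma pairs_Nil: "pairings n j [] m = {New}"
  by (auto simp: pairings_def)

lemma surv_Nil: "surv n [] New = map Arg [0..<n]"
  by (simp add: survivors_def)

lemma perm_diagram_eq: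
  assumes "\<pi> permutes {..<n}"
  shows "diagram_of n n [] \<pi> New = perm_diagram n \<pi>"
proof
  have lk: "n + count_list [] Plus = n + count_list [] Minus" by simp
  fix i
  have "\<pi> (n - Suc i) < n" if "i < n" using permutes_in_image[OF assms, of "n - Suc i"] that by simp
  then show "diagram_of n n [] \<pi> New i = perm_diagram n \<pi> i"
    by (simp add: diagram_of_def[OF lk] perm_diagram_def surv_Nil line_pos_def[OF lk])
qed

lemma bij_perm_diagram:
  "bij_betw (perm_diagram n) {\<pi>. \<pi> permutes {..<n}} (line_diagrams (replicate n Minus @ replicate n Plus))"
proof -
  have lk: "n + count_list [] Plus = n + count_list [] Minus" by simp
  have "bij_betw (\<lambda>(\<pi>, a). diagram_of n n [] \<pi> a) ({\<pi>. \<pi> permutes {..<n}} \<times> {New}) (line_diagrams (replicate n Minus @ replicate n Plus))"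
    using bij_diagram_of[OF lk] by (simp add: pairs_Nil)
  moreover have "bij_betw (\<lambda>\<pi>. (\<pi>, New)) {\<pi>. \<pi> permutes {..<n}} ({\<pi>. \<pi> permutes {..<n}} \<times> {New})"
    by (auto simp: bij_betw_def inj_on_def)
  ultimately have "bij_betw ((\<lambda>(\<pi>, a). diagram_of n n [] \<pi> a) \<circ> (\<lambda>\<pi>. (\<pi>, New))) {\<pi>. \<pi> permutes {..<n}} (line_diagrams (replicate n Minus @ replicate n Plus))"
    by (rule bij_betw_trans[rotated])
  then show ?thesis
    by (rule bij_betw_cong[THEN iffD1, rotated]) (simp add: perm_diagram_eq)
qed

lemma line_phase_perm_diagram:
  assumes \<pi>: "\<pi> permutes {..<n}"
  shows "line_phase R (replicate n Minus @ replicate n Plus) (perm_diagram n \<pi>) e = perm_phase R n \<pi> (\<lambda>i. e (n + \<pi> i))"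
proof -
  have lk: "n + count_list [] Plus = n + count_list [] Minus" by simp
  have "\<pi> i < n" if "i < n" for i using permutes_in_image[OF \<pi>, of i] that by simp
  then have "perm_phase R n \<pi> (\<lambda>p. e (line_pos n [] (surv n [] New ! \<pi> p))) = perm_phase R n \<pi> (\<lambda>i. e (n + \<pi> i))"
    by (intro perm_phase_cong) (simp add: surv_Nil line_pos_def[OF lk])
  then show ?thesis
    using line_phase_diagram_of[OF lk _ \<pi>, of New R e] by (simp add: perm_diagram_eq[OF \<pi>] pairs_Nil)
qed

text \<open>The point on the diagonal of \<open>\<pi>\<close>: for \<open>i < n\<close>, the
  positions \<open>n - Suc i\<close> and \<open>n + \<pi> i\<close> both receive
  \<open>x i\<close>.\<close>

definition layout :: "nat \<Rightarrow> (nat \<Rightarrow> nat) \<Rightarrow> (nat \<Rightarrow> 'x) \<Rightarrow> nat \<Rightarrow> 'x"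
  where "layout n \<pi> x = (\<lambda>j\<in>{..<2 * n}. if j < n then x (n - Suc j) else x (inv \<pi> (j - n)))"

text \<open>\<open>line_integral\<close> takes its variables at the right ends of the arcs.
  Numbering them by the left ends instead removes the shift by \<open>n\<close> and the permutation
  from the arguments of the phase.\<close>

lemma line_integral_perm_diagram:
  fixes M :: "'y measure"
  assumes M: "sigma_finite_measure M" and \<pi>: "\<pi> permutes {..<n}"
    and R: "(\<lambda>(x, y). R x y) \<in> borel_measurable (M \<Otimes>\<^sub>M M)"
    and \<Phi>: "\<Phi> \<in> borel_measurable (power_measure M (2 * n))"
  shows "line_integral M R (replicate n Minus @ replicate n Plus) \<Phi> (perm_diagram n \<pi>) =
    (LINT x|power_measure M n. \<Phi> (layout n \<pi> x) * perm_phase R n \<pi> x)"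
proof -
  let ?q = "\<lambda>l. inv \<pi> (l - n)"
  have inv: "inv \<pi> permutes {..<n}" by (rule permutes_inv[OF \<pi>])
  have \<pi>n: "\<pi> i < n" "inv \<pi> i < n" if "i < n" for i
    using permutes_in_image[OF \<pi>, of i] permutes_in_image[OF inv, of i] that by auto
  have ip: "inv \<pi> (\<pi> i) = i" "\<pi> (inv \<pi> i) = i" for i using permutes_inverses[OF \<pi>] by auto
  have q: "bij_betw ?q {n..<n + n} {..<n}"
    by (rule bij_betw_byWitness[where f'="\<lambda>i. n + \<pi> i"]) (auto simp: \<pi>n ip)
  define T where "T x = (\<lambda>l\<in>{n..<n + n}. x (?q l))" for x :: "nat \<Rightarrow> 'y"
  have Tm: "T \<in> power_measure M n \<rightarrow>\<^sub>M PiM {n..<n + n} (\<lambda>_. M)"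
    unfolding T_def[abs_def] using q by (intro measurable_restrict measurable_component_singleton) (auto simp: bij_betw_def)
  have Td: "distr (power_measure M n) (PiM {n..<n + n} (\<lambda>_. M)) T = PiM {n..<n + n} (\<lambda>_. M)"
    unfolding T_def[abs_def] by (rule distr_PiM_reindex_bij[OF M _ q]) simp
  have Rm: "(\<lambda>e. R (e i) (e j)) \<in> borel_measurable (PiM I (\<lambda>_. M))" if "i \<in> I" "j \<in> I" for i j :: nat and I
  proof -
    have "(\<lambda>e. (e i, e j)) \<in> PiM I (\<lambda>_. M) \<rightarrow>\<^sub>M M \<Otimes>\<^sub>M M"
      using that by (intro measurable_Pair measurable_component_singleton)
    from measurable_compose[OF this R] show ?thesis by simp
  qed
  have gm: "(\<lambda>e. \<Phi> (\<lambda>i\<in>{..<2 * n}. e (perm_diagram n \<pi> i)) * perm_phase R n \<pi> (\<lambda>i. e (n + \<pi> i)))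
      \<in> borel_measurable (PiM {n..<n + n} (\<lambda>_. M))"
  proof (intro borel_measurable_times)
    have "(\<lambda>e. \<lambda>i\<in>{..<2 * n}. e (perm_diagram n \<pi> i)) \<in> PiM {n..<n + n} (\<lambda>_. M) \<rightarrow>\<^sub>M power_measure M (2 * n)"
      by (intro measurable_restrict measurable_component_singleton) (auto simp: perm_diagram_def \<pi>n)
    from measurable_compose[OF this \<Phi>]
    show "(\<lambda>e. \<Phi> (\<lambda>i\<in>{..<2 * n}. e (perm_diagram n \<pi> i))) \<in> borel_measurable (PiM {n..<n + n} (\<lambda>_. M))" .
    show "(\<lambda>e. perm_phase R n \<pi> (\<lambda>i. e (n + \<pi> i))) \<in> borel_measurable (PiM {n..<n + n} (\<lambda>_. M))"
      unfolding perm_phase_def case_prod_beta by (intro borel_measurable_prod Rm) (auto simp: \<pi>n)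
  qed
  have "line_integral M R (replicate n Minus @ replicate n Plus) \<Phi> (perm_diagram n \<pi>) =
    (LINT e|PiM {n..<n + n} (\<lambda>_. M). \<Phi> (\<lambda>i\<in>{..<2 * n}. e (perm_diagram n \<pi> i)) * perm_phase R n \<pi> (\<lambda>i. e (n + \<pi> i)))"
    unfolding line_integral_def pluses_pairs line_phase_perm_diagram[OF \<pi>] by (simp add: mult_2)
  also have "\<dots> = (LINT x|power_measure M n. \<Phi> (\<lambda>i\<in>{..<2 * n}. T x (perm_diagram n \<pi> i)) * perm_phase R n \<pi> (\<lambda>i. T x (n + \<pi> i)))"
    by (subst Td[symmetric]) (rule integral_distr[OF Tm gm])
  also have "\<dots> = (LINT x|power_measure M n. \<Phi> (layout n \<pi> x) * perm_phase R n \<pi> x)"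
  proof (intro Bochner_Integration.integral_cong refl)
    fix x
    have "(\<lambda>i\<in>{..<2 * n}. T x (perm_diagram n \<pi> i)) = layout n \<pi> x"
      unfolding layout_def by (rule restrict_ext) (auto simp: T_def perm_diagram_def \<pi>n ip)
    moreover have "perm_phase R n \<pi> (\<lambda>i. T x (n + \<pi> i)) = perm_phase R n \<pi> x"
      by (rule perm_phase_cong) (simp add: T_def \<pi>n ip)
    ultimately show "\<Phi> (\<lambda>i\<in>{..<2 * n}. T x (perm_diagram n \<pi> i)) * perm_phase R n \<pi> (\<lambda>i. T x (n + \<pi> i)) =
      \<Phi> (layout n \<pi> x) * perm_phase R n \<pi> x" by simp
  qed
  finally show ?thesis .
qed

context qcr_rep
begin

text \<open>A position in \<open>Copy2\<close> keeps its sign: a creation among the first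
  \<open>k\<close>, an annihilation among the last \<open>n\<close>. Its partner lies to the left in
  the first case and to the right in the second, hence in the same group, where the required
  opposite sign can come only from \<open>Copy1\<close>. The shared letter would have to lie in both
  copies, so one of its two functions is zero there.\<close>

lemma kernel_fun_vanishes:
  assumes len: "length hs = k + n" "length is = k + n" and ne: "is \<noteq> replicate (k + n) Copy1"
    and ss: "ss = replicate k Plus @ replicate n Minus" and m: "m \<in> line_diagrams (map2 rep_sign is ss)"
  shows "Z.kernel_fun (map2 (rep_fun K1 K2) is hs) \<kappa> (k + n) (\<lambda>i\<in>{..<k + n}. e (m i)) = 0"
proof -
  let ?rs = "map2 rep_sign is ss"
  have lss: "length ss = k + n" by (simp add: ss)
  have rs: "?rs ! i = rep_sign (is ! i) (ss ! i)" if "i < k + n" for i using that len lss by simp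
  have lrs: "length ?rs = k + n" using len lss by simp
  have sP: "ss ! i = Plus \<longleftrightarrow> i < k" if "i < k + n" for i using that by (simp add: ss nth_append)
  have mi: "i < k + n \<and> ?rs ! i = Minus" if "i \<in> minuses ?rs" for i
    using that lrs by (auto simp: minus_set_def simp del: nth_map nth_zip)
  have pl: "i < k + n \<and> ?rs ! i = Plus" if "i \<in> pluses ?rs" for i
    using that lrs by (auto simp: plus_set_def simp del: nth_map nth_zip)
  obtain j where j: "j < k + n" "is ! j = Copy2"
  proof -
    have "\<exists>j<k + n. is ! j \<noteq> Copy1"
      using ne len by (metis (no_types, lifting) nth_equalityI length_replicate nth_replicate)
    then show ?thesis using that copy.exhaust by metis
  qed
  have "\<exists>j'<k + n. m j' = m j \<and> is ! j' = Copy1"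
  proof (cases "j \<in> minuses ?rs")
    case True
    then have jM: "?rs ! j = Minus" using mi by blast
    then have "ss ! j = Minus" using rs[OF j(1)] j(2) by (cases "ss ! j") auto
    then have jk: "k \<le> j" using sP[OF j(1)] by auto
    have i: "m j \<in> pluses ?rs" "j < m j" using line_diagramsD(3,5)[OF m True] by auto
    have iP: "m j < k + n" "?rs ! m j = Plus" using pl[OF i(1)] by auto
    have "ss ! m j = Minus" using sP[OF iP(1)] jk i(2) by (cases "ss ! m j") auto
    then have "is ! m j = Copy1" using rs[OF iP(1)] iP(2) by (cases "is ! m j") auto
    then show ?thesis using iP(1) line_diagrams_idem[OF m True] by blast
  next
    case False
    then have jm: "m j = j" by (rule line_diagramsD(1)[OF m])
    have "j \<in> pluses ?rs \<union> minuses ?rs" unfolding plus_minus_Un lrs using j(1) by simp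
    then have "j \<in> pluses ?rs" using False by simp
    then have jP: "?rs ! j = Plus" using pl by blast
    then have "ss ! j = Plus" using rs[OF j(1)] j(2) by (cases "ss ! j") auto
    then have jk: "j < k" using sP[OF j(1)] by auto
    obtain j' where j': "j' \<in> minuses ?rs" "m j' = j"
      using line_diagramsD(2)[OF m] \<open>j \<in> pluses ?rs\<close> unfolding bij_betw_def by (metis imageE)
    then have "j' < j" using line_diagramsD(3)[OF m j'(1)] by simp
    then have "ss ! j' = Plus" using sP[of j'] jk j(1) by simp
    moreover have "?rs ! j' = Minus" "j' < k + n" using mi[OF j'(1)] by auto
    ultimately have "is ! j' = Copy1" using rs[of j'] by (cases "is ! j'") auto
    then show ?thesis using jm j' \<open>j' < k + n\<close> by auto
  qed
  then obtain j' where j': "j' < k + n" "m j' = m j" "is ! j' = Copy1" by blast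
  have "fst (e (m j)) \<noteq> is ! j \<or> fst (e (m j')) \<noteq> is ! j'" using j j' by auto
  then have "\<exists>i<k + n. (map2 (rep_fun K1 K2) is hs ! i) (e (m i)) = 0"
  proof
    assume "fst (e (m j)) \<noteq> is ! j"
    then show ?thesis using j len by (intro exI[of _ j]) (simp add: rep_fun_eq)
  next
    assume "fst (e (m j')) \<noteq> is ! j'"
    then show ?thesis using j' len by (intro exI[of _ j']) (simp add: rep_fun_eq)
  qed
  then have "(\<Prod>i<k + n. (map2 (rep_fun K1 K2) is hs ! i) ((\<lambda>i\<in>{..<k + n}. e (m i)) i)) = 0"
    by (intro prod_zero) auto
  then show ?thesis by (simp add: Z.kernel_fun_def)
qed

lemma npoint_copy1:
  assumes len: "length hs = k + n" and hs: "set hs \<subseteq> L2 lborel"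
    and v: "v \<in> Linf (nu (replicate k Plus @ replicate n Minus))"
  shows "npoint (vacuum_state Z_measure) (rep_integral Q K1 K2) k n hs v =
    (\<Sum>m\<in>line_diagrams (replicate k Minus @ replicate n Plus).
      line_integral Z_measure (JQ Q) (replicate k Minus @ replicate n Plus)
        (Z.kernel_fun (map (rep_fun K1 K2 Copy1) hs) (rep_kernel (replicate (k + n) Copy1) v) (k + n)) m)"
proof -
  let ?ss = "replicate k Plus @ replicate n Minus" and ?I = "{is :: copy list. length is = length (replicate k Plus @ replicate n Minus)}"
  let ?u = "\<lambda>_::nat. undefined :: copy \<times> 'n space" and ?c = "replicate (k + n) Copy1"
  have len': "length hs = length ?ss" using len by simp
  have rs: "map2 rep_sign ?c ?ss = replicate k Minus @ replicate n Plus"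
    by (rule nth_equalityI) (auto simp: nth_append)
  have gs: "map2 (rep_fun K1 K2) ?c hs = map (rep_fun K1 K2 Copy1) hs"
    using len by (intro nth_equalityI) auto
  have t: "rep_term ?ss hs v is vacuum 0 ?u = (\<Sum>m\<in>line_diagrams (map2 rep_sign is ?ss).
      line_integral Z_measure (JQ Q) (map2 rep_sign is ?ss) (Z.kernel_fun (map2 (rep_fun K1 K2) is hs) (rep_kernel is v) (k + n)) m)"
    if "is \<in> ?I" for "is"
    unfolding rep_term_def using that Z.vacuum_op_integral[OF rep_good_kernel[OF len' hs v, of "is"]] by simp
  have "npoint (vacuum_state Z_measure) (rep_integral Q K1 K2) k n hs v = (\<Sum>is\<in>?I. rep_term ?ss hs v is vacuum 0 ?u)"
    by (simp add: npoint_def Z.vacuum_state_eq rep_integral_terms)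
  also have "\<dots> = (\<Sum>is\<in>{?c}. rep_term ?ss hs v is vacuum 0 ?u)"
  proof (rule sum.mono_neutral_right[OF finite_copy_lists])
    show "\<forall>is\<in>?I - {?c}. rep_term ?ss hs v is vacuum 0 ?u = 0"
    proof
      fix "is" assume i: "is \<in> ?I - {?c}"
      then have il: "length is = k + n" "is \<noteq> ?c" "length (map2 rep_sign is ?ss) = k + n" by auto
      have "line_integral Z_measure (JQ Q) (map2 rep_sign is ?ss) (Z.kernel_fun (map2 (rep_fun K1 K2) is hs) (rep_kernel is v) (k + n)) m = 0"
        if "m \<in> line_diagrams (map2 rep_sign is ?ss)" for m
        unfolding line_integral_def il(3) kernel_fun_vanishes[OF len il(1,2) refl that] by simp
      then show "rep_term ?ss hs v is vacuum 0 ?u = 0" using t[of "is"] i by simp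
    qed
  qed auto
  also have "\<dots> = (\<Sum>m\<in>line_diagrams (replicate k Minus @ replicate n Plus).
      line_integral Z_measure (JQ Q) (replicate k Minus @ replicate n Plus)
        (Z.kernel_fun (map (rep_fun K1 K2 Copy1) hs) (rep_kernel ?c v) (k + n)) m)"
    using t[of ?c] by (simp add: rs gs)
  finally show ?thesis .
qed

lemma npoint_unbalanced:
  assumes "k \<noteq> n" "length hs = k + n" "set hs \<subseteq> L2 lborel" "v \<in> Linf (nu (replicate k Plus @ replicate n Minus))"
  shows "npoint (vacuum_state Z_measure) (rep_integral Q K1 K2) k n hs v = 0"
proof -
  let ?rs = "replicate k Minus @ replicate n Plus"
  have "line_diagrams ?rs = {}"
  proof (rule ccontr)
    assume "line_diagrams ?rs \<noteq> {}"
    then obtain m where "m \<in> line_diagrams ?rs" by auto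
    from bij_betw_same_card[OF line_diagramsD(2)[OF this]]
    have "count_list ?rs Minus = count_list ?rs Plus"
      by (simp only: count_list_Minus[of _ 0] count_list_Plus[of _ 0])
    then show False using assms(1) by (simp add: count_list_append count_list_replicate)
  qed
  then show ?thesis by (simp add: npoint_copy1[OF assms(2-4)])
qed

end

section \<open>Pushing an integral forward to the first coordinates\<close>

lemma norm_mult_le: "norm w \<le> C \<Longrightarrow> norm (b * w) \<le> C * norm (b :: 'a::real_normed_div_algebra)"
  by (simp add: norm_mult mult.commute[of C] mult_left_mono)

lemma prod_insert_upd:
  "finite I \<Longrightarrow> l \<notin> I \<Longrightarrow> (\<Prod>i\<in>insert l I. F i ((x(l := z)) i)) = F l z * (\<Prod>i\<in>I. F i (x i) :: 'c::comm_monoid_mult)"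
  by (simp add: prod.insert) (intro arg_cong2[where f="(*)"] refl prod.cong, auto)

lemma restrict_fun_upd: "l \<notin> I \<Longrightarrow> (\<lambda>i\<in>insert l I. p ((x(l := z)) i)) = (\<lambda>i\<in>I. p (x i))(l := p z)"
  by (auto simp: fun_eq_iff)

text \<open>The variables are exchanged one at a time; \<open>\<psi>\<close> stands for \<open>W\<close> with the other variables frozen.\<close>

lemma integral_PiM_push:
  fixes G :: "'i \<Rightarrow> 'a \<Rightarrow> complex" and B :: "'i \<Rightarrow> 'b \<Rightarrow> complex" and W :: "('i \<Rightarrow> 'b) \<Rightarrow> complex"
  assumes M: "sigma_finite_measure M" and N: "sigma_finite_measure N" and p: "p \<in> M \<rightarrow>\<^sub>M N" and I: "finite I"
    and G: "\<And>i. i \<in> I \<Longrightarrow> integrable M (G i)" and B: "\<And>i. i \<in> I \<Longrightarrow> integrable N (B i)"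
    and GB: "\<And>i \<psi> C. i \<in> I \<Longrightarrow> \<psi> \<in> borel_measurable N \<Longrightarrow> (\<And>t. norm (\<psi> t) \<le> C) \<Longrightarrow>
      (LINT z|M. G i z * \<psi> (p z)) = (LINT t|N. B i t * \<psi> t)"
    and W: "W \<in> borel_measurable (PiM I (\<lambda>_. N))" "\<And>s. norm (W s) \<le> (C :: real)"
  shows "(LINT x|PiM I (\<lambda>_. M). (\<Prod>i\<in>I. G i (x i)) * W (\<lambda>i\<in>I. p (x i))) =
    (LINT s|PiM I (\<lambda>_. N). (\<Prod>i\<in>I. B i (s i)) * W s)"
  using I G B GB W
proof (induction I arbitrary: W C rule: finite_induct)
  case empty
  show ?case by (simp add: PiM_empty lebesgue_integral_count_space_finite restrict_def)
next
  case (insert l I)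
  interpret M: product_sigma_finite "\<lambda>_. M" by (rule product_sigma_finite_const[OF M])
  interpret N: product_sigma_finite "\<lambda>_. N" by (rule product_sigma_finite_const[OF N])
  note W = insert.prems(4,5)
  have C0: "0 \<le> C" using W(2)[of undefined] norm_ge_zero order_trans by blast
  have pm: "(\<lambda>x. \<lambda>i\<in>J. p (x i)) \<in> PiM J (\<lambda>_. M) \<rightarrow>\<^sub>M PiM J (\<lambda>_. N)" for J :: "'i set"
    by (intro measurable_restrict measurable_compose[OF _ p] measurable_component_singleton) auto
  \<comment> \<open>The exchanged variable is integrated out. What is left is again a bounded
    function of the other variables, with bound \<open>C\<close> times the L1 norm of
    \<open>B l\<close>, so the induction has to admit every bounded \<open>W\<close>.\<close>
  define W2 where "W2 s = (LINT t|N. B l t * W (s(l := t)))" for s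
  have Bl: "integrable N (B l)" using insert.prems(2) by simp
  have upd: "(\<lambda>(s, t). s(l := t)) \<in> PiM I (\<lambda>_. N) \<Otimes>\<^sub>M N \<rightarrow>\<^sub>M PiM (insert l I) (\<lambda>_. N)"
    by (rule measurable_add_dim)
  have W2m: "W2 \<in> borel_measurable (PiM I (\<lambda>_. N))"
    unfolding W2_def[abs_def]
  proof (rule sigma_finite_measure.borel_measurable_lebesgue_integral[OF N])
    have "(\<lambda>x. B l (snd x)) \<in> borel_measurable (PiM I (\<lambda>_. N) \<Otimes>\<^sub>M N)"
      using Bl by (intro measurable_compose[OF measurable_snd]) auto
    moreover have "(\<lambda>x. W ((fst x)(l := snd x))) \<in> borel_measurable (PiM I (\<lambda>_. N) \<Otimes>\<^sub>M N)"
      using measurable_compose[OF upd W(1)] unfolding case_prod_beta .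
    ultimately show "(\<lambda>(s, t). B l t * W (s(l := t))) \<in> borel_measurable (PiM I (\<lambda>_. N) \<Otimes>\<^sub>M N)"
      unfolding case_prod_beta by (rule borel_measurable_times)
  qed
  have W2b: "norm (W2 s) \<le> C * (LINT t|N. norm (B l t))" for s
  proof (cases "integrable N (\<lambda>t. B l t * W (s(l := t)))")
    case True
    have "norm (W2 s) \<le> (LINT t|N. norm (B l t * W (s(l := t))))"
      unfolding W2_def by (rule integral_norm_bound)
    also have "\<dots> \<le> (LINT t|N. C * norm (B l t))"
      using True Bl W(2) by (intro integral_mono integrable_norm integrable_mult_right norm_mult_le) auto
    finally show ?thesis by simp
  next
    case False
    then have "W2 s = 0" by (simp add: W2_def not_integrable_integral_eq)
    then show ?thesis using C0 by simp
  qed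
  have intM: "integrable (PiM (insert l I) (\<lambda>_. M)) (\<lambda>x. (\<Prod>i\<in>insert l I. G i (x i)) * W (\<lambda>i\<in>insert l I. p (x i)))"
  proof (rule Bochner_Integration.integrable_bound)
    have P: "integrable (PiM (insert l I) (\<lambda>_. M)) (\<lambda>x. \<Prod>i\<in>insert l I. G i (x i))"
      using insert by (intro M.product_integrable_prod) auto
    then show "integrable (PiM (insert l I) (\<lambda>_. M)) (\<lambda>x. C *\<^sub>R (\<Prod>i\<in>insert l I. G i (x i)))" by (rule integrable_scaleR_right)
    show "(\<lambda>x. (\<Prod>i\<in>insert l I. G i (x i)) * W (\<lambda>i\<in>insert l I. p (x i))) \<in> borel_measurable (PiM (insert l I) (\<lambda>_. M))"
      by (rule borel_measurable_times[OF borel_measurable_integrable[OF P] measurable_compose[OF pm W(1)]])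
  qed (use norm_mult_le[OF W(2)] C0 in \<open>simp del: prod.insert\<close>)
  have intN: "integrable (PiM (insert l I) (\<lambda>_. N)) (\<lambda>s. (\<Prod>i\<in>insert l I. B i (s i)) * W s)"
  proof (rule Bochner_Integration.integrable_bound)
    have P: "integrable (PiM (insert l I) (\<lambda>_. N)) (\<lambda>x. \<Prod>i\<in>insert l I. B i (x i))"
      using insert by (intro N.product_integrable_prod) auto
    then show "integrable (PiM (insert l I) (\<lambda>_. N)) (\<lambda>x. C *\<^sub>R (\<Prod>i\<in>insert l I. B i (x i)))" by (rule integrable_scaleR_right)
    show "(\<lambda>s. (\<Prod>i\<in>insert l I. B i (s i)) * W s) \<in> borel_measurable (PiM (insert l I) (\<lambda>_. N))"
      by (rule borel_measurable_times[OF borel_measurable_integrable[OF P] W(1)])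
  qed (use norm_mult_le[OF W(2)] C0 in \<open>simp del: prod.insert\<close>)
  note upd_prod = prod_insert_upd[OF insert(1,2)]
  have "(LINT x|PiM (insert l I) (\<lambda>_. M). (\<Prod>i\<in>insert l I. G i (x i)) * W (\<lambda>i\<in>insert l I. p (x i))) =
    (LINT x|PiM I (\<lambda>_. M). LINT z|M. (\<Prod>i\<in>insert l I. G i ((x(l := z)) i)) * W (\<lambda>i\<in>insert l I. p ((x(l := z)) i)))"
    by (rule M.product_integral_insert[OF insert(1,2) intM])
  also have "\<dots> = (LINT x|PiM I (\<lambda>_. M). (\<Prod>i\<in>I. G i (x i)) * W2 (\<lambda>i\<in>I. p (x i)))"
  proof (intro Bochner_Integration.integral_cong refl)
    fix x assume x: "x \<in> space (PiM I (\<lambda>_. M))"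
    let ?s = "\<lambda>i\<in>I. p (x i)"
    have s: "?s \<in> space (PiM I (\<lambda>_. N))" using measurable_space[OF pm x] .
    have "(\<lambda>t. W (?s(l := t))) \<in> borel_measurable N"
      by (rule measurable_compose[OF measurable_component_update[OF s insert(2)] W(1)])
    then have W2s: "W2 ?s = (LINT z|M. G l z * W (?s(l := p z)))"
      unfolding W2_def using insert.prems(3)[of l "\<lambda>t. W (?s(l := t))" C] W(2) by simp
    have "(LINT z|M. (\<Prod>i\<in>insert l I. G i ((x(l := z)) i)) * W (\<lambda>i\<in>insert l I. p ((x(l := z)) i))) =
      (LINT z|M. (\<Prod>i\<in>I. G i (x i)) * (G l z * W (?s(l := p z))))"
      unfolding upd_prod restrict_fun_upd[OF insert(2)] by (simp add: mult_ac)
    then show "(LINT z|M. (\<Prod>i\<in>insert l I. G i ((x(l := z)) i)) * W (\<lambda>i\<in>insert l I. p ((x(l := z)) i))) =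
      (\<Prod>i\<in>I. G i (x i)) * W2 ?s" by (simp add: W2s)
  qed
  also have "\<dots> = (LINT s|PiM I (\<lambda>_. N). (\<Prod>i\<in>I. B i (s i)) * W2 s)"
  proof (rule insert.IH[OF _ _ _ W2m W2b])
    show "(LINT z|M. G i z * \<psi> (p z)) = (LINT t|N. B i t * \<psi> t)"
      if "i \<in> I" "\<psi> \<in> borel_measurable N" "\<And>t. norm (\<psi> t) \<le> C" for i \<psi> C
      using insert.prems(3)[OF insertI2[OF that(1)] that(2,3)] .
  qed (use insert.prems in auto)
  also have "\<dots> = (LINT s|PiM I (\<lambda>_. N). LINT t|N. (\<Prod>i\<in>insert l I. B i ((s(l := t)) i)) * W (s(l := t)))"
  proof (intro Bochner_Integration.integral_cong refl)
    fix s
    have "(\<Prod>i\<in>I. B i (s i)) * W2 s = (LINT t|N. (\<Prod>i\<in>I. B i (s i)) * (B l t * W (s(l := t))))"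
      unfolding W2_def by (rule integral_mult_right_zero[symmetric])
    also have "\<dots> = (LINT t|N. (\<Prod>i\<in>insert l I. B i ((s(l := t)) i)) * W (s(l := t)))"
      unfolding upd_prod by (intro Bochner_Integration.integral_cong refl) (simp only: mult_ac)
    finally show "(\<Prod>i\<in>I. B i (s i)) * W2 s = \<dots>" .
  qed
  also have "\<dots> = (LINT s|PiM (insert l I) (\<lambda>_. N). (\<Prod>i\<in>insert l I. B i (s i)) * W s)"
    by (rule N.product_integral_insert[OF insert(1,2) intN, symmetric])
  finally show ?case .
qed

lemma integral_Z:
  fixes G :: "copy \<times> 'n::finite space \<Rightarrow> complex"
  assumes "integrable Z_measure G"
  shows "(LINT p|Z_measure. G p) = (LINT x|lborel. G (Copy1, x)) + (LINT x|lborel. G (Copy2, x))"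
proof -
  have U: "UNIV = {Copy1, Copy2}" using copy.exhaust by auto
  have fin: "finite (UNIV :: copy set)" by simp
  interpret P: pair_sigma_finite "count_space (UNIV :: copy set)" "lborel :: 'n space measure"
    unfolding pair_sigma_finite_def using lborel.sigma_finite_measure_axioms sigma_finite_measure_count_space_finite[OF fin] by blast
  have "(LINT p|Z_measure. G p) = (LINT c|count_space UNIV. LINT x|lborel. G (c, x))"
    unfolding Z_measure_def using P.integral_fst'[symmetric] assms by (simp add: Z_measure_def)
  also have "\<dots> = (LINT x|lborel. G (Copy1, x)) + (LINT x|lborel. G (Copy2, x))"
    by (subst lebesgue_integral_count_space_finite[OF fin]) (simp add: U)
  finally show ?thesis .
qed

section \<open>Bilinear pairings of complexified operators\<close>

definition complexify :: "('x \<Rightarrow> real) \<Rightarrow> ('x \<Rightarrow> real) \<Rightarrow> 'x \<Rightarrow> complex"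
  where "complexify a b x = of_real (a x) + \<i> * of_real (b x)"

lemma complexify_Re_Im: "complexify (\<lambda>y. Re (h y)) (\<lambda>y. Im (h y)) = h"
  by (simp add: complexify_def fun_eq_iff complex_eq_iff)

lemma cext_complexify: "cext K h = complexify (K (\<lambda>y. Re (h y))) (K (\<lambda>y. Im (h y)))"
  by (simp add: cext_eq complexify_def fun_eq_iff)

lemma integral_complexify:
  assumes "a \<in> L2 M" "b \<in> L2 M" "c \<in> L2 M" "d \<in> L2 M"
  shows "(LINT x|M. complexify a b x * complexify c d x) =
    of_real ((LINT x|M. a x * c x) - (LINT x|M. b x * d x)) + \<i> * of_real ((LINT x|M. a x * d x) + (LINT x|M. b x * c x))"
proof -
  note i = L2_integrable_mult[OF assms(1,3)] L2_integrable_mult[OF assms(2,4)] L2_integrable_mult[OF assms(1,4)] L2_integrable_mult[OF assms(2,3)]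
  have "(LINT x|M. complexify a b x * complexify c d x) =
    (LINT x|M. of_real (a x * c x - b x * d x) + \<i> * of_real (a x * d x + b x * c x))"
    by (intro Bochner_Integration.integral_cong refl) (simp add: complexify_def complex_eq_iff)
  also have "\<dots> = (LINT x|M. complex_of_real (a x * c x - b x * d x)) + (LINT x|M. \<i> * complex_of_real (a x * d x + b x * c x))"
    by (rule Bochner_Integration.integral_add)
      (intro integrable_of_real integrable_mult_right Bochner_Integration.integrable_diff Bochner_Integration.integrable_add i)+
  also have "\<dots> = of_real (LINT x|M. a x * c x - b x * d x) + \<i> * of_real (LINT x|M. a x * d x + b x * c x)"
    by (simp only: integral_mult_right_zero integral_complex_of_real)
  also have "\<dots> = of_real ((LINT x|M. a x * c x) - (LINT x|M. b x * d x)) + \<i> * of_real ((LINT x|M. a x * d x) + (LINT x|M. b x * c x))"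
    by (simp only: Bochner_Integration.integral_diff[OF i(1,2)] Bochner_Integration.integral_add[OF i(3,4)])
  finally show ?thesis .
qed

text \<open>The pairing is bilinear, without conjugation: the real adjoint acts as a transpose. The
  claim is four real adjoint relations, one for each choice of real and imaginary parts.\<close>

lemma cext_adjoint:
  assumes K: "L2_operator M K" and K': "L2_adjoint M K K'" and f: "f \<in> L2 M" and g: "g \<in> L2 M"
  shows "(LINT x|M. cext K f x * g x) = (LINT x|M. f x * cext K' g x)"
proof -
  have K'L: "L2_operator M K'" and adj: "\<And>f g. f \<in> L2 M \<Longrightarrow> g \<in> L2 M \<Longrightarrow> (LINT x|M. K f x * g x) = (LINT x|M. f x * K' g x)"
    using K' by (auto simp: L2_adjoint_def)
  note r = L2_Re[OF f] L2_Im[OF f] L2_Re[OF g] L2_Im[OF g]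
  have "(LINT x|M. cext K f x * g x) =
    (LINT x|M. complexify (K (\<lambda>y. Re (f y))) (K (\<lambda>y. Im (f y))) x * complexify (\<lambda>y. Re (g y)) (\<lambda>y. Im (g y)) x)"
    by (simp only: cext_complexify complexify_Re_Im)
  also have "\<dots> = (LINT x|M. complexify (\<lambda>y. Re (f y)) (\<lambda>y. Im (f y)) x * complexify (K' (\<lambda>y. Re (g y))) (K' (\<lambda>y. Im (g y))) x)"
    using L2_operatorD(1)[OF K r(1)] L2_operatorD(1)[OF K r(2)] L2_operatorD(1)[OF K'L r(3)] L2_operatorD(1)[OF K'L r(4)]
    by (simp only: integral_complexify r adj)
  finally show ?thesis by (simp only: cext_complexify complexify_Re_Im)
qed

lemma cext_linear:
  assumes K: "L2_operator M K" and f: "f \<in> L2 M"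
  shows "g \<in> L2 M \<Longrightarrow> AE x in M. cext K (\<lambda>y. f y + g y) x = cext K f x + cext K g x"
    and "AE x in M. cext K (\<lambda>y. c * f y) x = c * cext K f x"
proof -
  assume g: "g \<in> L2 M"
  show "AE x in M. cext K (\<lambda>y. f y + g y) x = cext K f x + cext K g x"
    using L2_operatorD(3)[OF K L2_Re[OF f] L2_Re[OF g]] L2_operatorD(3)[OF K L2_Im[OF f] L2_Im[OF g]]
    by eventually_elim (simp add: cext_def complex_eq_iff)
next
  note r = L2_Re[OF f] and i = L2_Im[OF f]
  have "AE x in M. K (\<lambda>y. Re c * Re (f y) + - Im c * Im (f y)) x = K (\<lambda>y. Re c * Re (f y)) x + K (\<lambda>y. - Im c * Im (f y)) x"
    "AE x in M. K (\<lambda>y. Re c * Im (f y) + Im c * Re (f y)) x = K (\<lambda>y. Re c * Im (f y)) x + K (\<lambda>y. Im c * Re (f y)) x"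
    by (intro L2_operatorD(3)[OF K] L2_scale r i)+
  then show "AE x in M. cext K (\<lambda>y. c * f y) x = c * cext K f x"
    using L2_operatorD(4)[OF K r, of "Re c"] L2_operatorD(4)[OF K i, of "- Im c"]
      L2_operatorD(4)[OF K i, of "Re c"] L2_operatorD(4)[OF K r, of "Im c"]
    by eventually_elim (simp add: cext_def complex_eq_iff)
qed

lemma cext_cong_AE:
  assumes K: "L2_operator M K" and f: "f \<in> L2 M" "g \<in> L2 M" and ae: "AE x in M. f x = g x"
  shows "AE x in M. cext K f x = cext K g x"
proof -
  have "AE x in M. Re (f x) = Re (g x)" "AE x in M. Im (f x) = Im (g x)"
    using ae by (auto elim: eventually_mono)
  from L2_operatorD(2)[OF K L2_Re[OF f(1)] L2_Re[OF f(2)] this(1)] L2_operatorD(2)[OF K L2_Im[OF f(1)] L2_Im[OF f(2)] this(2)]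
  show ?thesis by eventually_elim (simp add: cext_def)
qed

text \<open>A complex multiplier mixes real and imaginary parts. Each of the four real products that
  arise is covered by a real multiplier, with \<open>?i'\<close> absorbing the minus sign in the
  real part.\<close>

lemma cext_commute:
  fixes K :: "('n::finite space \<Rightarrow> real) \<Rightarrow> 'n space \<Rightarrow> real"
  assumes K: "L2_operator lborel K" and f: "f \<in> L2 lborel"
    and comm: "\<And>\<psi>::real \<Rightarrow> real. \<And>f. \<psi> \<in> borel_measurable borel \<Longrightarrow> bounded (range \<psi>) \<Longrightarrow> f \<in> L2 lborel \<Longrightarrow>
      AE x in lborel. K (\<lambda>y. \<psi> (fst y) * f y) x = \<psi> (fst x) * K f x"
    and \<psi>: "\<psi> \<in> borel_measurable borel" "\<And>t. norm (\<psi> t) \<le> C"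
  shows "AE x in lborel. cext K (\<lambda>y. \<psi> (fst y) * f y) x = \<psi> (fst x) * cext K f x"
proof -
  let ?r = "\<lambda>t. Re (\<psi> t)" and ?i = "\<lambda>t. Im (\<psi> t)" and ?i' = "\<lambda>t. - Im (\<psi> t)"
  have m: "?r \<in> borel_measurable borel" "?i \<in> borel_measurable borel" "?i' \<in> borel_measurable borel" using \<psi>(1) by auto
  have b: "bounded (range ?r)" "bounded (range ?i)" "bounded (range ?i')"
    using \<psi>(2) abs_Re_le_cmod abs_Im_le_cmod by (auto simp: bounded_iff intro!: exI[of _ C] intro: order_trans)
  have fstm: "fst \<in> (lborel :: 'n space measure) \<rightarrow>\<^sub>M borel"
    using measurable_fst[of "lborel :: real measure" "lborel :: (real ^ 'n) measure"] by (simp add: lborel_prod)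
  have L: "(\<lambda>y. \<phi> (fst y) * h y) \<in> L2 lborel"
    if "\<phi> \<in> borel_measurable borel" "\<And>t. \<bar>\<phi> t\<bar> \<le> C" "h \<in> L2 lborel" for \<phi> :: "real \<Rightarrow> real" and h :: "'n space \<Rightarrow> real"
    using that by (intro L2_mult_bounded[where C=C] measurable_compose[OF fstm]) auto
  have bd: "\<bar>?r t\<bar> \<le> C" "\<bar>?i t\<bar> \<le> C" "\<bar>?i' t\<bar> \<le> C" for t
    using \<psi>(2)[of t] abs_Re_le_cmod[of "\<psi> t"] abs_Im_le_cmod[of "\<psi> t"] by auto
  note re = L2_Re[OF f] and im = L2_Im[OF f]
  have "AE x in lborel. K (\<lambda>y. ?r (fst y) * Re (f y) + ?i' (fst y) * Im (f y)) x =
      K (\<lambda>y. ?r (fst y) * Re (f y)) x + K (\<lambda>y. ?i' (fst y) * Im (f y)) x"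
    "AE x in lborel. K (\<lambda>y. ?r (fst y) * Im (f y) + ?i (fst y) * Re (f y)) x =
      K (\<lambda>y. ?r (fst y) * Im (f y)) x + K (\<lambda>y. ?i (fst y) * Re (f y)) x"
    by (intro L2_operatorD(3)[OF K] L m bd re im)+
  then show ?thesis
    using comm[OF m(1) b(1) re] comm[OF m(3) b(3) im] comm[OF m(1) b(1) im] comm[OF m(2) b(2) re]
    by eventually_elim (simp add: cext_def complex_eq_iff)
qed

text \<open>The inner integral in the formula for the two-point density, before it is restricted to
  the diagonal.\<close>

definition fibre_density :: "(('n::finite space \<Rightarrow> complex) \<Rightarrow> 'n space \<Rightarrow> complex) \<Rightarrow> ('n space \<Rightarrow> complex) \<Rightarrow> ('n space \<Rightarrow> complex) \<Rightarrow> real \<Rightarrow> complex"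
  where "fibre_density T g h s = (LINT y|lborel. g (s, y) * T h (s, y))"

lemma fst_lborel [measurable]: "fst \<in> (lborel :: 'n::finite space measure) \<rightarrow>\<^sub>M borel"
  using measurable_fst[of "lborel :: real measure" "lborel :: (real ^ 'n) measure"] by (simp add: lborel_prod)

lemma fibre_density_integrable:
  assumes "g \<in> L2 lborel" "T h \<in> L2 lborel"
  shows "integrable lborel (fibre_density T g h)"
proof -
  have "integrable (lborel \<Otimes>\<^sub>M lborel) (\<lambda>x. g x * T h x)"
    using L2_integrable_mult[OF assms] by (simp add: lborel_prod)
  from lborel_pair.integrable_fst'[OF this] show ?thesis by (simp add: fibre_density_def[abs_def])
qed

lemma integral_fibre_density:
  assumes "integrable lborel (\<lambda>x. g x * T h x * \<psi> (fst x))"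
  shows "(LINT x|lborel. g x * T h x * \<psi> (fst x)) = (LINT s|lborel. fibre_density T g h s * \<psi> s)"
proof -
  have "integrable (lborel \<Otimes>\<^sub>M lborel) (\<lambda>x. g x * T h x * \<psi> (fst x))"
    using assms by (simp add: lborel_prod)
  from lborel_pair.integral_fst'[OF this] show ?thesis by (simp add: fibre_density_def lborel_prod)
qed

lemma prod_lessThan_add:
  fixes m n :: nat
  shows "(\<Prod>j<m + n. f j) = (\<Prod>j<m. f j) * (\<Prod>j<n. f (m + j) :: 'a::comm_monoid_mult)"
  by (induction n) (auto simp: mult_ac)

lemma layout_map: "\<pi> permutes {..<n} \<Longrightarrow> layout n \<pi> (\<lambda>i\<in>{..<n}. p (x i)) =
    (\<lambda>j\<in>{..<2 * n}. p (x (if j < n then n - Suc j else inv \<pi> (j - n))))"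
  unfolding layout_def
proof (rule restrict_ext)
  fix j assume \<pi>: "\<pi> permutes {..<n}" and j: "j \<in> {..<2 * n}"
  have "inv \<pi> (j - n) < n" if "\<not> j < n" using permutes_in_image[OF permutes_inv[OF \<pi>], of "j - n"] j that by auto
  then show "(if j < n then (\<lambda>i\<in>{..<n}. p (x i)) (n - Suc j) else (\<lambda>i\<in>{..<n}. p (x i)) (inv \<pi> (j - n))) =
    p (x (if j < n then n - Suc j else inv \<pi> (j - n)))" by auto
qed

text \<open>Two positions of \<open>layout\<close> receive the same variable only if they lie in
  different halves, where the signs are opposite. The diagonal of \<open>\<pi>\<close> is therefore
  one that \<open>nu2 n\<close> charges.\<close>

lemma AE_layout:
  assumes M: "sigma_finite_measure M" and N: "sigma_finite_measure N"
    and p: "absolutely_continuous N (distr M N p)" "p \<in> M \<rightarrow>\<^sub>M N" and \<pi>: "\<pi> permutes {..<n}"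
    and ae: "AE u in sign_measure N (replicate n Plus @ replicate n Minus). P u"
  shows "AE x in power_measure M n. P (layout n \<pi> (\<lambda>i\<in>{..<n}. p (x i)))"
proof -
  let ?ss = "replicate n Plus @ replicate n Minus"
  let ?a = "\<lambda>j. if j < n then n - Suc j else inv \<pi> (j - n)"
  note inv = permutes_inv[OF \<pi>]
  have "AE x in power_measure M n. P (\<lambda>j\<in>{..<length ?ss}. p (x (?a j)))"
  proof (rule AE_sign_measure_pullback[OF M N p _ _ _ ae])
    show "?a ` {..<length ?ss} \<subseteq> {..<n}"
    proof (rule image_subsetI)
      fix j assume j: "j \<in> {..<length ?ss}"
      have "inv \<pi> (j - n) < n" if "\<not> j < n" using permutes_in_image[OF inv, of "j - n"] j that by auto
      then show "?a j \<in> {..<n}" by auto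
    qed
    fix i j assume ij: "i < length ?ss" "j < length ?ss" "i \<noteq> j" "?a i = ?a j"
    have "(i < n) \<noteq> (j < n)"
    proof
      assume eq: "(i < n) = (j < n)"
      show False
      proof (cases "i < n")
        case True then show False using ij eq by auto
      next
        case False
        then have "inv \<pi> (i - n) = inv \<pi> (j - n)" using ij(4) eq by simp
        then have "i - n = j - n" using permutes_inj[OF inv] by (auto dest: injD)
        then show False using False eq ij(3) by simp
      qed
    qed
    then show "?ss ! i \<noteq> ?ss ! j" using ij by (auto simp: nth_append)
  qed simp
  then show ?thesis by (simp add: layout_map[OF \<pi>] mult_2)
qed

lemma measurable_layout:
  assumes "\<pi> permutes {..<n}"
  shows "layout n \<pi> \<in> power_measure M n \<rightarrow>\<^sub>M power_measure M (2 * n)"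
  unfolding layout_def[abs_def]
proof (rule measurable_restrict)
  fix j assume j: "j \<in> {..<2 * n}"
  have "inv \<pi> (j - n) < n" if "\<not> j < n" using permutes_in_image[OF permutes_inv[OF assms], of "j - n"] j that by auto
  then show "(\<lambda>x. if j < n then x (n - Suc j) else x (inv \<pi> (j - n))) \<in> power_measure M n \<rightarrow>\<^sub>M M"
    by (cases "j < n") (auto intro!: measurable_component_singleton)
qed

locale admissible_rep = qcr Q \<eta> for Q \<eta> +
  fixes K1 K1' K2 K2' :: "('n::finite space \<Rightarrow> real) \<Rightarrow> 'n space \<Rightarrow> real"
  assumes adm: "admissible_operators \<eta> K1 K1' K2 K2'"
begin

sublocale qcr_rep Q \<eta> K1 K2
  by unfold_locales (use adm in \<open>auto simp: admissible_operators_def\<close>)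

lemma K1': "L2_adjoint lborel K1 K1'" "L2_operator lborel K1'"
  using adm by (auto simp: admissible_operators_def L2_adjoint_def)

lemma K1_commute: "\<psi> \<in> borel_measurable borel \<Longrightarrow> bounded (range \<psi>) \<Longrightarrow> f \<in> L2 lborel \<Longrightarrow>
    AE x in lborel. K1 (\<lambda>y. \<psi> (fst y) * f y) x = \<psi> (fst x) * K1 f x"
  using adm unfolding admissible_operators_def by blast

definition T :: "('n space \<Rightarrow> complex) \<Rightarrow> 'n space \<Rightarrow> complex"
  where "T h = cext K1' (cext K1 h)"

lemma T_L2: "h \<in> L2 lborel \<Longrightarrow> T h \<in> L2 lborel"
  unfolding T_def by (intro cext_L2 K1 K1')

abbreviation fd :: "('n space \<Rightarrow> complex) \<Rightarrow> ('n space \<Rightarrow> complex) \<Rightarrow> real \<Rightarrow> complex"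
  where "fd \<equiv> fibre_density T"

text \<open>Commutation moves the multiplier inside \<open>K1\<close>, and transposition then moves
  \<open>K1\<close> to the other function, where \<open>T h\<close> appears. The arbitrary test
  function \<open>\<psi>\<close> of the first coordinate is what localizes the adjoint relation to
  fibres.\<close>

lemma copy1_push:
  assumes g: "g \<in> L2 lborel" and h: "h \<in> L2 lborel"
    and \<psi>: "\<psi> \<in> borel_measurable borel" "\<And>t. norm (\<psi> t) \<le> C"
  shows "(LINT z|Z_measure. rep_fun K1 K2 Copy1 g z * rep_fun K1 K2 Copy1 h z * \<psi> (fst (snd z))) =
    (LINT s|lborel. fd g h s * \<psi> s)"
proof -
  note K1g = cext_L2[OF K1 g] and K1h = cext_L2[OF K1 h]
  have \<psi>m: "(\<lambda>y::'n space. \<psi> (fst y)) \<in> borel_measurable lborel" by (rule measurable_compose[OF fst_lborel \<psi>(1)])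
  have \<psi>L: "(\<lambda>y. \<psi> (fst y) * f y) \<in> L2 lborel" if "f \<in> L2 lborel" for f :: "'n space \<Rightarrow> complex"
    by (rule L2_mult_bounded[OF that \<psi>m \<psi>(2)])
  have \<psi>Z: "(\<lambda>z::copy \<times> 'n space. \<psi> (fst (snd z))) \<in> borel_measurable Z_measure"
    using measurable_compose[OF first_coordinate_Z, of \<psi>] \<psi>(1) by simp
  have "integrable Z_measure (\<lambda>z. rep_fun K1 K2 Copy1 g z * (\<psi> (fst (snd z)) * rep_fun K1 K2 Copy1 h z))"
    by (intro L2_integrable_mult rep_fun_L2 g L2_mult_bounded[OF rep_fun_L2[OF h] \<psi>Z \<psi>(2)])
  then have "integrable Z_measure (\<lambda>z. rep_fun K1 K2 Copy1 g z * rep_fun K1 K2 Copy1 h z * \<psi> (fst (snd z)))"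
    by (simp add: mult_ac)
  then have "(LINT z|Z_measure. rep_fun K1 K2 Copy1 g z * rep_fun K1 K2 Copy1 h z * \<psi> (fst (snd z))) =
    (LINT x|lborel. cext K1 g x * cext K1 h x * \<psi> (fst x))"
    by (subst integral_Z) (simp_all add: rep_fun_eq copy_op_def)
  also have "\<dots> = (LINT x|lborel. cext K1 (\<lambda>y. \<psi> (fst y) * g y) x * cext K1 h x)"
  proof (rule integral_cong_AE)
    show "AE x in lborel. cext K1 g x * cext K1 h x * \<psi> (fst x) = cext K1 (\<lambda>y. \<psi> (fst y) * g y) x * cext K1 h x"
    proof -
      have "AE x in lborel. cext K1 (\<lambda>y. \<psi> (fst y) * g y) x = \<psi> (fst x) * cext K1 g x"
        by (rule cext_commute[OF K1 g _ \<psi>]) (rule K1_commute)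
      then show ?thesis by eventually_elim simp
    qed
    show "(\<lambda>x. cext K1 g x * cext K1 h x * \<psi> (fst x)) \<in> borel_measurable lborel"
      by (intro borel_measurable_times L2_measurable[OF K1g] L2_measurable[OF K1h] \<psi>m)
    show "(\<lambda>x. cext K1 (\<lambda>y. \<psi> (fst y) * g y) x * cext K1 h x) \<in> borel_measurable lborel"
      by (intro borel_measurable_times L2_measurable[OF K1h] L2_measurable[OF cext_L2[OF K1 \<psi>L[OF g]]])
  qed
  also have "\<dots> = (LINT x|lborel. \<psi> (fst x) * g x * T h x)"
    unfolding T_def by (rule cext_adjoint[OF K1 K1'(1) \<psi>L[OF g] K1h])
  also have "\<dots> = (LINT x|lborel. g x * T h x * \<psi> (fst x))" by (simp add: mult_ac)
  also have "\<dots> = (LINT s|lborel. fd g h s * \<psi> s)"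
  proof (rule integral_fibre_density)
    show "integrable lborel (\<lambda>x. g x * T h x * \<psi> (fst x))"
      using L2_integrable_mult[OF \<psi>L[OF g] T_L2[OF h]] by (simp add: mult_ac)
  qed
  finally show ?thesis .
qed

lemma perm_phase_Q_measurable: "perm_phase Q n \<pi> \<in> borel_measurable (power_measure lborel n)"
proof -
  define A where "A = {(i, j). i < j \<and> j < n \<and> \<pi> i > \<pi> j}"
  have eq: "perm_phase Q n \<pi> = (\<lambda>x. \<Prod>p\<in>A. Q (x (fst p)) (x (snd p)))"
    by (simp add: fun_eq_iff perm_phase_def A_def case_prod_beta)
  show ?thesis
    unfolding eq
  proof (intro borel_measurable_prod Q_measurable)
    fix p assume "p \<in> A"
    then have "fst p < n" "snd p < n" by (auto simp: A_def)
    then show "(\<lambda>x. x (fst p)) \<in> borel_measurable (power_measure lborel n)" "(\<lambda>x. x (snd p)) \<in> borel_measurable (power_measure lborel n)"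
      using measurable_component_singleton[of _ "{..<n}" "\<lambda>_. lborel :: real measure"] by auto
  qed
qed

lemma perm_phase_Q_bound: "norm (perm_phase Q n \<pi> s) \<le> (max 1 \<bar>\<eta>\<bar>) ^ card {(i, j). i < j \<and> j < n \<and> \<pi> i > \<pi> j}"
proof -
  let ?A = "{(i, j). i < j \<and> j < n \<and> \<pi> i > \<pi> j}"
  have "norm (perm_phase Q n \<pi> s) = (\<Prod>(i, j)\<in>?A. norm (Q (s i) (s j)))"
    unfolding perm_phase_def by (simp add: prod_norm[symmetric] case_prod_beta)
  also have "\<dots> \<le> (\<Prod>p\<in>?A. max 1 \<bar>\<eta>\<bar>)"
    by (intro prod_mono) (auto intro: Q_bound)
  finally show ?thesis by simp
qed

text \<open>In the term for \<open>\<pi>\<close> the functions \<open>gs ! i\<close> and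
  \<open>hs ! \<pi> i\<close> share one variable, and everything else depends on first coordinates
  only. The variables can therefore be pushed forward to the real line one by one.\<close>

lemma npoint_formula:
  assumes len: "length gs = n" "length hs = n" and L: "set gs \<subseteq> L2 lborel" "set hs \<subseteq> L2 lborel"
    and v: "v \<in> Linf (nu2 n)"
  shows "npoint (vacuum_state Z_measure) (rep_integral Q K1 K2) n n (rev gs @ hs) v =
    (\<Sum>\<pi> | \<pi> permutes {..<n}. LINT s|power_measure lborel n.
      (\<Prod>i<n. fd (gs ! i) (hs ! \<pi> i) (s i)) * (v (layout n \<pi> s) * perm_phase Q n \<pi> s))"
proof -
  let ?rf = "rep_fun K1 K2 Copy1" and ?c = "replicate (n + n) Copy1" and ?S = "replicate n Minus @ replicate n Plus"
  let ?\<Phi> = "Z.kernel_fun (map ?rf (rev gs @ hs)) (rep_kernel ?c v) (n + n)"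
  let ?Z = "Z_measure :: (copy \<times> 'n space) measure" and ?lb = "lborel :: real measure"
  have lb: "sigma_finite_measure ?lb" by (rule lborel.sigma_finite_measure_axioms)
  have vm: "v \<in> borel_measurable (power_measure lborel (2 * n))"
    using Linf_measurable[OF v] by (simp add: mult_2)
  have gL: "gs ! i \<in> L2 lborel" if "i < n" for i using L(1) that len by (auto simp: subset_iff)
  have hL: "hs ! i \<in> L2 lborel" if "i < n" for i using L(2) that len by (auto simp: subset_iff)
  have gh: "set (rev gs @ hs) \<subseteq> L2 lborel" "length (rev gs @ hs) = n + n" using L len by auto
  have "npoint (vacuum_state Z_measure) (rep_integral Q K1 K2) n n (rev gs @ hs) v =
    (\<Sum>m\<in>line_diagrams ?S. line_integral ?Z (JQ Q) ?S ?\<Phi> m)"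
    by (rule npoint_copy1[OF gh(2,1) v])
  also have "\<dots> = (\<Sum>\<pi> | \<pi> permutes {..<n}. line_integral ?Z (JQ Q) ?S ?\<Phi> (perm_diagram n \<pi>))"
    by (rule sum.reindex_bij_betw[OF bij_perm_diagram, symmetric])
  also have "\<dots> = (\<Sum>\<pi> | \<pi> permutes {..<n}. LINT s|power_measure lborel n.
      (\<Prod>i<n. fd (gs ! i) (hs ! \<pi> i) (s i)) * (v (layout n \<pi> s) * perm_phase Q n \<pi> s))"
  proof (rule sum.cong[OF refl], clarify)
    fix \<pi> assume \<pi>: "\<pi> permutes {..<n}"
    have \<pi>n: "\<pi> i < n" if "i < n" for i using permutes_in_image[OF \<pi>, of i] that by simp
    have kc: "rep_kernel ?c v \<in> borel_measurable (power_measure ?Z (2 * n))"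
      using rep_kernel_measurable[of v ?c] vm by (simp add: mult_2)
    have "(\<lambda>y. \<Prod>j<n + n. (map ?rf (rev gs @ hs) ! j) (y j)) \<in> borel_measurable (power_measure ?Z (2 * n))"
    proof (intro borel_measurable_prod measurable_compose[OF measurable_component_singleton])
      fix j assume "j \<in> {..<n + n}"
      moreover from this have "(rev gs @ hs) ! j \<in> set (rev gs @ hs)" using gh(2) by (intro nth_mem) simp
      then have "(rev gs @ hs) ! j \<in> L2 lborel" using gh(1) by blast
      moreover have "map ?rf (rev gs @ hs) ! j = ?rf ((rev gs @ hs) ! j)"
        using gh(2) \<open>j \<in> {..<n + n}\<close> by (intro nth_map) simp
      ultimately show "map ?rf (rev gs @ hs) ! j \<in> borel_measurable ?Z"
        using L2_measurable[OF rep_fun_L2] by (simp only:)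
    qed auto
    with kc have \<Phi>m: "?\<Phi> \<in> borel_measurable (power_measure ?Z (2 * n))"
      unfolding Z.kernel_fun_def[abs_def] by (rule borel_measurable_times[rotated])
    define G where "G i z = ?rf (gs ! i) z * ?rf (hs ! \<pi> i) z" for i z
    define W where "W s = v (layout n \<pi> s) * perm_phase Q n \<pi> s" for s
    have Wm: "W \<in> borel_measurable (power_measure lborel n)"
      unfolding W_def[abs_def]
      by (intro borel_measurable_times measurable_compose[OF measurable_layout[OF \<pi>] vm] perm_phase_Q_measurable)
    obtain C0 where C0: "AE u in nu2 n. norm (v u) \<le> C0" using v by (auto simp: Linf_def)
    define Cp where "Cp = (max 1 \<bar>\<eta>\<bar>) ^ card {(i, j). i < j \<and> j < n \<and> \<pi> i > \<pi> j}"
    define C1 where "C1 = \<bar>C0\<bar> * Cp"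
    have Cp: "0 \<le> Cp" by (simp add: Cp_def)
    \<comment> \<open>The push-forward needs a bound that holds everywhere, while \<open>v\<close>
      is bounded only almost everywhere for \<open>nu2 n\<close>. Cutting \<open>W\<close> off at
      \<open>C1\<close> changes both integrands on null sets only.\<close>
    define W' where "W' s = (if norm (W s) \<le> C1 then W s else 0)" for s
    have W'm: "W' \<in> borel_measurable (power_measure lborel n)"
      unfolding W'_def[abs_def] using Wm by measurable
    have W'b: "norm (W' s) \<le> C1" for s using Cp by (simp add: W'_def C1_def)
    have WW: "W s = W' s" if "norm (v (layout n \<pi> s)) \<le> C0" for s
    proof -
      have "norm (W s) \<le> \<bar>C0\<bar> * Cp"
        unfolding W_def norm_mult using that perm_phase_Q_bound[of n \<pi> s]
        by (intro mult_mono) (auto simp: Cp_def)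
      then show ?thesis by (simp add: W'_def C1_def)
    qed
    have Gint: "integrable ?Z (G i)" if "i < n" for i
      unfolding G_def using that by (intro L2_integrable_mult rep_fun_L2 gL hL \<pi>n)
    have Bint: "integrable lborel (fd (gs ! i) (hs ! \<pi> i))" if "i < n" for i
      using that by (intro fibre_density_integrable gL T_L2 hL \<pi>n)
    have pm: "(\<lambda>x. \<lambda>i\<in>{..<n}. fst (snd (x i))) \<in> power_measure ?Z n \<rightarrow>\<^sub>M power_measure lborel n"
      by (intro measurable_restrict measurable_compose[OF _ first_coordinate_Z] measurable_component_singleton) auto
    have Gm: "(\<lambda>x. \<Prod>i<n. G i (x i)) \<in> borel_measurable (power_measure ?Z n)"
      using Gint by (intro borel_measurable_prod measurable_compose[OF measurable_component_singleton]) auto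
    have Bm: "(\<lambda>s. \<Prod>i<n. fd (gs ! i) (hs ! \<pi> i) (s i)) \<in> borel_measurable (power_measure lborel n)"
      using Bint by (intro borel_measurable_prod measurable_compose[OF measurable_component_singleton]) auto
    have "line_integral ?Z (JQ Q) ?S ?\<Phi> (perm_diagram n \<pi>) =
      (LINT x|power_measure ?Z n. ?\<Phi> (layout n \<pi> x) * perm_phase (JQ Q) n \<pi> x)"
      by (rule line_integral_perm_diagram[OF sigma_finite_Z \<pi> JQ_meas \<Phi>m])
    also have "\<dots> = (LINT x|power_measure ?Z n. (\<Prod>i<n. G i (x i)) * W (\<lambda>i\<in>{..<n}. fst (snd (x i))))"
    proof (intro Bochner_Integration.integral_cong refl)
      fix x
      have "(\<Prod>j<n + n. (map ?rf (rev gs @ hs) ! j) (layout n \<pi> x j)) =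
        (\<Prod>j<n. ?rf (gs ! (n - Suc j)) (x (n - Suc j))) * (\<Prod>j<n. ?rf (hs ! j) (x (inv \<pi> j)))"
        unfolding prod_lessThan_add using len
        by (intro arg_cong2[where f="(*)"] prod.cong refl) (auto simp: layout_def nth_append rev_nth)
      also have "(\<Prod>j<n. ?rf (gs ! (n - Suc j)) (x (n - Suc j))) = (\<Prod>i<n. ?rf (gs ! i) (x i))"
        by (rule prod.nat_diff_reindex)
      also have "(\<Prod>j<n. ?rf (hs ! j) (x (inv \<pi> j))) = (\<Prod>i<n. ?rf (hs ! \<pi> i) (x i))"
        using prod.reindex_bij_betw[OF permutes_imp_bij[OF \<pi>], of "\<lambda>j. ?rf (hs ! j) (x (inv \<pi> j))"]
          permutes_inverses(2)[OF \<pi>] by simp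
      finally have P: "(\<Prod>j<n + n. (map ?rf (rev gs @ hs) ! j) (layout n \<pi> x j)) = (\<Prod>i<n. G i (x i))"
        by (simp add: G_def prod.distrib)
      show "?\<Phi> (layout n \<pi> x) * perm_phase (JQ Q) n \<pi> x = (\<Prod>i<n. G i (x i)) * W (\<lambda>i\<in>{..<n}. fst (snd (x i)))"
      \<comment> \<open>With all points in the first copy, \<open>rep_kernel\<close> and
        \<open>JQ\<close> reduce to \<open>v\<close> and \<open>Q\<close>. Otherwise the product of
        the functions contains a zero factor on both sides.\<close>
      proof (cases "\<forall>i<n. fst (x i) = Copy1")
        case True
        have ip: "inv \<pi> (j - n) < n" if "j < 2 * n" "\<not> j < n" for j
          using permutes_in_image[OF permutes_inv[OF \<pi>], of "j - n"] that by auto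
        have "\<forall>j<length ?c. fst (layout n \<pi> x j) = ?c ! j"
          using True ip by (auto simp: layout_def)
        moreover have "(\<lambda>j\<in>{..<length ?c}. fst (snd (layout n \<pi> x j))) = layout n \<pi> (\<lambda>i\<in>{..<n}. fst (snd (x i)))"
          using ip by (auto simp: layout_def mult_2 intro!: restrict_ext)
        ultimately have "rep_kernel ?c v (layout n \<pi> x) = v (layout n \<pi> (\<lambda>i\<in>{..<n}. fst (snd (x i))))"
          unfolding rep_kernel_def by simp
        moreover have "perm_phase (JQ Q) n \<pi> x = perm_phase Q n \<pi> (\<lambda>i\<in>{..<n}. fst (snd (x i)))"
          unfolding perm_phase_def using True by (intro prod.cong refl) (auto simp: JQ_def)
        ultimately show ?thesis unfolding Z.kernel_fun_def P W_def by simp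
      next
        case False
        then obtain i where "i < n" "fst (x i) \<noteq> Copy1" by blast
        then have "(\<Prod>i<n. G i (x i)) = 0" by (intro prod_zero) (auto simp: G_def rep_fun_eq)
        then show ?thesis unfolding Z.kernel_fun_def P by simp
      qed
    qed
    also have "\<dots> = (LINT x|power_measure ?Z n. (\<Prod>i<n. G i (x i)) * W' (\<lambda>i\<in>{..<n}. fst (snd (x i))))"
    proof (rule integral_cong_AE)
      show "AE x in power_measure ?Z n. (\<Prod>i<n. G i (x i)) * W (\<lambda>i\<in>{..<n}. fst (snd (x i))) = (\<Prod>i<n. G i (x i)) * W' (\<lambda>i\<in>{..<n}. fst (snd (x i)))"
        using AE_layout[OF sigma_finite_Z lb first_coordinate_nonsingular first_coordinate_Z \<pi> C0]
        by eventually_elim (simp add: WW)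
    qed (intro borel_measurable_times Gm measurable_compose[OF pm Wm] measurable_compose[OF pm W'm])+
    also have "\<dots> = (LINT s|power_measure lborel n. (\<Prod>i<n. fd (gs ! i) (hs ! \<pi> i) (s i)) * W' s)"
    proof (rule integral_PiM_push[OF sigma_finite_Z lb first_coordinate_Z _ _ _ _ W'm W'b])
      fix i and \<psi> :: "real \<Rightarrow> complex" and C :: real assume i: "i \<in> {..<n}" and \<psi>: "\<psi> \<in> borel_measurable ?lb" "\<And>t. norm (\<psi> t) \<le> C"
      have "\<psi> \<in> borel_measurable borel" using \<psi>(1) by simp
      moreover have "i < n" "\<pi> i < n" using i \<pi>n by auto
      ultimately show "(LINT z|?Z. G i z * \<psi> (fst (snd z))) = (LINT t|?lb. fd (gs ! i) (hs ! \<pi> i) t * \<psi> t)"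
        using copy1_push[OF gL hL _ \<psi>(2)] by (simp add: G_def)
    qed (use Gint Bint in auto)
    also have "\<dots> = (LINT s|power_measure lborel n. (\<Prod>i<n. fd (gs ! i) (hs ! \<pi> i) (s i)) * W s)"
    proof (rule integral_cong_AE)
      have "AE s in power_measure ?lb n. norm (v (layout n \<pi> (\<lambda>i\<in>{..<n}. s i))) \<le> C0"
        by (rule AE_layout[OF lb lb absolutely_continuous_id measurable_ident_sets[OF refl] \<pi> C0])
      then show "AE s in power_measure lborel n. (\<Prod>i<n. fd (gs ! i) (hs ! \<pi> i) (s i)) * W' s = (\<Prod>i<n. fd (gs ! i) (hs ! \<pi> i) (s i)) * W s"
        using AE_space
      proof eventually_elim
        case (elim s)
        have "(\<lambda>i\<in>{..<n}. s i) = s" using elim(2) by (auto simp: space_PiM)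
        then show ?case using elim(1) WW[of s] by simp
      qed
    qed (intro borel_measurable_times Bm Wm W'm)+
    finally show "line_integral ?Z (JQ Q) ?S ?\<Phi> (perm_diagram n \<pi>) = (LINT s|power_measure lborel n.
      (\<Prod>i<n. fd (gs ! i) (hs ! \<pi> i) (s i)) * (v (layout n \<pi> s) * perm_phase Q n \<pi> s))"
      unfolding W_def .
  qed
  finally show ?thesis .
qed

end

section \<open>Densities\<close>

text \<open>The sets where \<open>f\<close> is positive and where it is negative are themselves test
  sets.\<close>

lemma integral_indicator_zero_AE:
  fixes f :: "'a \<Rightarrow> real"
  assumes f: "integrable N f" and zero: "\<And>A. A \<in> sets N \<Longrightarrow> (LINT x|N. indicator A x * f x) = 0"
  shows "AE x in N. f x = 0"
proof -
  have [measurable]: "f \<in> borel_measurable N" using f by auto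
  have half: "AE x in N. \<not> g x > 0" if g: "integrable N g" and z: "\<And>A. A \<in> sets N \<Longrightarrow> (LINT x|N. indicator A x * g x) = 0" for g :: "'a \<Rightarrow> real"
  proof -
    have [measurable]: "g \<in> borel_measurable N" using g by auto
    let ?A = "{x \<in> space N. g x > 0}"
    have A: "?A \<in> sets N" by measurable
    have i: "integrable N (\<lambda>x. indicator ?A x * g x)"
      using integrable_mult_indicator[OF A g] by simp
    have "AE x in N. indicator ?A x * g x = 0"
      using z[OF A] integral_nonneg_eq_0_iff_AE[OF i] by (auto simp: indicator_def)
    then show ?thesis using AE_space by eventually_elim (auto simp: indicator_def split: if_splits)
  qed
  have "AE x in N. \<not> f x > 0" by (rule half[OF f zero])
  moreover have "AE x in N. \<not> - f x > 0"
    by (rule half) (use f zero in auto)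
  ultimately show ?thesis by eventually_elim simp
qed

lemma complex_density_unique:
  fixes \<rho> \<rho>' :: "'a \<Rightarrow> complex"
  assumes \<rho>: "integrable N \<rho>" "integrable N \<rho>'"
    and eq: "\<And>A. A \<in> sets N \<Longrightarrow> (LINT x|N. indicator A x *\<^sub>R \<rho> x) = (LINT x|N. indicator A x *\<^sub>R \<rho>' x)"
  shows "AE x in N. \<rho> x = \<rho>' x"
proof -
  have z: "(LINT x|N. indicator A x *\<^sub>R (\<rho> x - \<rho>' x)) = 0" if A: "A \<in> sets N" for A
    using Bochner_Integration.integral_diff[OF integrable_mult_indicator[OF A \<rho>(1)] integrable_mult_indicator[OF A \<rho>(2)]] eq[OF A]
    by (simp add: scaleR_diff_right)
  have i: "integrable N (\<lambda>x. indicator A x *\<^sub>R (\<rho> x - \<rho>' x))" if A: "A \<in> sets N" for A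
    by (intro integrable_mult_indicator A Bochner_Integration.integrable_diff \<rho>)
  have "AE x in N. Re (\<rho> x - \<rho>' x) = 0"
  proof (rule integral_indicator_zero_AE)
    show "integrable N (\<lambda>x. Re (\<rho> x - \<rho>' x))" by (intro integrable_Re Bochner_Integration.integrable_diff \<rho>)
    show "(LINT x|N. indicator A x * Re (\<rho> x - \<rho>' x)) = 0" if "A \<in> sets N" for A
      using integral_Re[OF i[OF that]] z[OF that] by simp
  qed
  moreover have "AE x in N. Im (\<rho> x - \<rho>' x) = 0"
  proof (rule integral_indicator_zero_AE)
    show "integrable N (\<lambda>x. Im (\<rho> x - \<rho>' x))" by (intro integrable_Im Bochner_Integration.integrable_diff \<rho>)
    show "(LINT x|N. indicator A x * Im (\<rho> x - \<rho>' x)) = 0" if "A \<in> sets N" for A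
      using integral_Im[OF i[OF that]] z[OF that] by simp
  qed
  ultimately show ?thesis by eventually_elim (simp add: complex_eq_iff)
qed

text \<open>The product enters through an equality of norms, so that the lemma serves both complex
  multiplication and scaling by a real density.\<close>

lemma integrable_Linf_mult:
  fixes \<rho> :: "'a \<Rightarrow> 'b::{real_normed_field, second_countable_topology, banach}"
    and c :: "'a \<Rightarrow> 'c::{second_countable_topology, banach}"
  assumes \<rho>: "integrable N \<rho>" and v: "v \<in> Linf N" and c: "c \<in> borel_measurable N"
    and eq: "\<And>x. norm (c x) = norm (v x) * norm (\<rho> x)"
  shows "integrable N c"
proof -
  obtain C where C: "AE x in N. norm (v x) \<le> C" using v by (auto simp: Linf_def)
  show ?thesis
  proof (rule Bochner_Integration.integrable_bound)
    show "integrable N (\<lambda>x. C *\<^sub>R \<rho> x)" using \<rho> by (rule integrable_scaleR_right)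
    show "AE x in N. norm (c x) \<le> norm (C *\<^sub>R \<rho> x)"
      using C
    proof eventually_elim
      case (elim x)
      have "0 \<le> C" using elim norm_ge_zero order_trans by blast
      then show ?case using elim by (simp add: eq mult_right_mono)
    qed
  qed (rule c)
qed

section \<open>Complex measures given by densities\<close>

lemma finite_density_part:
  fixes g :: "'a \<Rightarrow> real"
  assumes g: "integrable N g" "\<And>x. 0 \<le> g x"
  shows "finite_measure (density N g)" "A \<in> sets N \<Longrightarrow> measure (density N g) A = (LINT x|N. indicator A x * g x)"
    "v \<in> Linf N \<Longrightarrow> integrable (density N g) v" "v \<in> Linf N \<Longrightarrow> (LINT x|density N g. v x) = (LINT x|N. g x *\<^sub>R v x)"
proof -
  have gm[measurable]: "g \<in> borel_measurable N" using g by auto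
  have fin: "(\<integral>\<^sup>+x. ennreal (g x) \<partial>N) < \<infinity>" using g by (simp add: integrable_iff_bounded)
  have em: "emeasure (density N g) A = (\<integral>\<^sup>+x. ennreal (indicator A x * g x) \<partial>N)" if "A \<in> sets N" for A
    using that g(2) by (subst emeasure_density) (auto intro!: nn_integral_cong simp: indicator_def)
  have "emeasure (density N g) (space N) = (\<integral>\<^sup>+x. ennreal (g x) \<partial>N)"
    using em[OF sets.top] by (simp cong: nn_integral_cong)
  then show "finite_measure (density N g)" using fin by (intro finite_measureI) auto
  show "measure (density N g) A = (LINT x|N. indicator A x * g x)" if A: "A \<in> sets N"
  proof -
    have "emeasure (density N g) A = ennreal (LINT x|N. indicator A x * g x)"
      unfolding em[OF A] using integrable_mult_indicator[OF A g(1)] g(2)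
      by (intro nn_integral_eq_integral) auto
    then show ?thesis using g(2) by (simp add: measure_def Bochner_Integration.integral_nonneg)
  qed
  assume v: "v \<in> Linf N"
  then have vm: "v \<in> borel_measurable N" by (simp add: Linf_def)
  have "integrable N (\<lambda>x. g x *\<^sub>R v x)"
    using vm by (intro integrable_Linf_mult[OF g(1) v]) (auto simp: mult.commute)
  then show "integrable (density N g) v"
    using integrable_density[OF vm gm] g(2) by simp
  show "(LINT x|density N g. v x) = (LINT x|N. g x *\<^sub>R v x)"
    using integral_density[OF vm gm] g(2) by simp
qed

text \<open>The four finite measures of the decomposition have as densities the positive and
  negative parts of the real and of the imaginary part of \<open>\<rho>\<close>.\<close>

lemma density_cmeasure:
  fixes \<rho> :: "'a \<Rightarrow> complex"
  assumes \<rho>: "integrable N \<rho>"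
  defines "\<mu> \<equiv> \<lambda>A. if A \<in> sets N then LINT x|N. indicator A x *\<^sub>R \<rho> x else 0"
  shows "complex_measure N \<mu>" "cmeasure_abs_continuous N \<mu>" "cmeasure_density N \<mu> \<rho>"
    "v \<in> Linf N \<Longrightarrow> has_cmeasure_integral N \<mu> v (LINT x|N. v x * \<rho> x)"
proof -
  define g1 where "g1 x = max 0 (Re (\<rho> x))" for x
  define g2 where "g2 x = max 0 (- Re (\<rho> x))" for x
  define g3 where "g3 x = max 0 (Im (\<rho> x))" for x
  define g4 where "g4 x = max 0 (- Im (\<rho> x))" for x
  note Ri = integrable_Re[OF \<rho>] and Ii = integrable_Im[OF \<rho>]
  have gi: "integrable N g1" "integrable N g2" "integrable N g3" "integrable N g4"
    unfolding g1_def[abs_def] g2_def[abs_def] g3_def[abs_def] g4_def[abs_def]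
    using Ri Ii by (auto intro!: Bochner_Integration.integrable_max)
  have g0: "0 \<le> g1 x" "0 \<le> g2 x" "0 \<le> g3 x" "0 \<le> g4 x" for x by (simp_all add: g1_def g2_def g3_def g4_def)
  have gR: "Re (\<rho> x) = g1 x - g2 x" "Im (\<rho> x) = g3 x - g4 x" for x by (auto simp: g1_def g2_def g3_def g4_def)
  note p1 = finite_density_part[OF gi(1) g0(1)] and p2 = finite_density_part[OF gi(2) g0(2)]
    and p3 = finite_density_part[OF gi(3) g0(3)] and p4 = finite_density_part[OF gi(4) g0(4)]
  define P1 where "P1 = density N g1"
  define P2 where "P2 = density N g2"
  define P3 where "P3 = density N g3"
  define P4 where "P4 = density N g4"
  note P_def = P1_def P2_def P3_def P4_def
  have \<mu>: "\<mu> A = Complex (measure P1 A - measure P2 A) (measure P3 A - measure P4 A)" if A: "A \<in> sets N" for A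
  proof -
    note ii = integrable_mult_indicator[OF A gi(1)] integrable_mult_indicator[OF A gi(2)]
      integrable_mult_indicator[OF A gi(3)] integrable_mult_indicator[OF A gi(4)]
    have i: "integrable N (\<lambda>x. indicator A x *\<^sub>R \<rho> x)" by (intro integrable_mult_indicator A \<rho>)
    have "Re (\<mu> A) = (LINT x|N. indicator A x * g1 x - indicator A x * g2 x)"
      using A integral_Re[OF i] by (simp add: \<mu>_def gR right_diff_distrib)
    also have "\<dots> = measure P1 A - measure P2 A"
      using ii A by (simp add: Bochner_Integration.integral_diff P_def p1(2) p2(2))
    finally have 1: "Re (\<mu> A) = measure P1 A - measure P2 A" .
    have "Im (\<mu> A) = (LINT x|N. indicator A x * g3 x - indicator A x * g4 x)"
      using A integral_Im[OF i] by (simp add: \<mu>_def gR right_diff_distrib)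
    also have "\<dots> = measure P3 A - measure P4 A"
      using ii A by (simp add: Bochner_Integration.integral_diff P_def p3(2) p4(2))
    finally show ?thesis using 1 by (simp add: complex_eq_iff)
  qed
  interpret P1: finite_measure P1 unfolding P_def by (rule p1(1))
  interpret P2: finite_measure P2 unfolding P_def by (rule p2(1))
  interpret P3: finite_measure P3 unfolding P_def by (rule p3(1))
  interpret P4: finite_measure P4 unfolding P_def by (rule p4(1))
  have sets: "sets P1 = sets N" "sets P2 = sets N" "sets P3 = sets N" "sets P4 = sets N" by (simp_all add: P_def)
  show "complex_measure N \<mu>"
    unfolding complex_measure_def
  proof (intro conjI allI impI)
    show "\<mu> {} = 0" by (simp add: \<mu>_def)
    fix A :: "nat \<Rightarrow> 'a set" assume A: "range A \<subseteq> sets N" "disjoint_family A"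
    have U: "(\<Union>i. A i) \<in> sets N" using A(1) by auto
    have "(\<lambda>i. Complex (measure P1 (A i) - measure P2 (A i)) (measure P3 (A i) - measure P4 (A i))) sums
      Complex (measure P1 (\<Union>i. A i) - measure P2 (\<Union>i. A i)) (measure P3 (\<Union>i. A i) - measure P4 (\<Union>i. A i))"
      using A sets unfolding Complex_eq
      by (intro sums_add sums_mult sums_of_real sums_diff P1.finite_measure_UNION P2.finite_measure_UNION P3.finite_measure_UNION P4.finite_measure_UNION) auto
    moreover have "\<mu> (A i) = Complex (measure P1 (A i) - measure P2 (A i)) (measure P3 (A i) - measure P4 (A i))" for i
      using A(1) by (intro \<mu>) auto
    ultimately show "(\<lambda>i. \<mu> (A i)) sums \<mu> (\<Union>i. A i)" by (simp add: \<mu>[OF U])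
  qed
  show "cmeasure_abs_continuous N \<mu>"
    unfolding cmeasure_abs_continuous_def
  proof
    fix A assume A: "A \<in> null_sets N"
    have "(LINT x|N. indicator A x *\<^sub>R \<rho> x) = 0"
      by (rule integral_eq_zero_AE) (use AE_not_in[OF A] in eventually_elim, simp)
    then show "\<mu> A = 0" using A by (simp add: \<mu>_def null_sets_def)
  qed
  show "cmeasure_density N \<mu> \<rho>"
    using \<rho> by (simp add: cmeasure_density_def \<mu>_def set_lebesgue_integral_def)
  show "has_cmeasure_integral N \<mu> v (LINT x|N. v x * \<rho> x)" if v: "v \<in> Linf N"
    unfolding has_cmeasure_integral_def
  proof (intro exI conjI)
    show "\<forall>P\<in>{P1, P2, P3, P4}. finite_measure P \<and> sets P = sets N \<and> integrable P v"
      unfolding P_def using p1(1,3) p2(1,3) p3(1,3) p4(1,3) v by simp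
    show "\<forall>A\<in>sets N. \<mu> A = Complex (measure P1 A - measure P2 A) (measure P3 A - measure P4 A)" using \<mu> by blast
    have vm: "v \<in> borel_measurable N" using v by (simp add: Linf_def)
    have vi: "integrable N (\<lambda>x. g x *\<^sub>R v x)" if "integrable N g" for g :: "'a \<Rightarrow> real"
      using that vm by (intro integrable_Linf_mult[OF that v]) (auto simp: mult.commute)
    have "(LINT x|N. v x * \<rho> x) = (LINT x|N. (g1 x *\<^sub>R v x - g2 x *\<^sub>R v x) + \<i> * (g3 x *\<^sub>R v x - g4 x *\<^sub>R v x))"
    proof (intro Bochner_Integration.integral_cong refl)
      fix x
      have r: "\<rho> x = of_real (g1 x - g2 x) + \<i> * of_real (g3 x - g4 x)"
        by (rule complex_eqI) (simp_all add: gR)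
      show "v x * \<rho> x = (g1 x *\<^sub>R v x - g2 x *\<^sub>R v x) + \<i> * (g3 x *\<^sub>R v x - g4 x *\<^sub>R v x)"
        unfolding r by (simp add: scaleR_conv_of_real algebra_simps)
    qed
    also have "\<dots> = ((LINT x|N. g1 x *\<^sub>R v x) - (LINT x|N. g2 x *\<^sub>R v x)) + \<i> * ((LINT x|N. g3 x *\<^sub>R v x) - (LINT x|N. g4 x *\<^sub>R v x))"
      using vi[OF gi(1)] vi[OF gi(2)] vi[OF gi(3)] vi[OF gi(4)] by simp
    finally show "(LINT x|N. v x * \<rho> x) = (LINT x|P1. v x) - (LINT x|P2. v x) + \<i> * ((LINT x|P3. v x) - (LINT x|P4. v x))"
      unfolding P_def p1(4)[OF v] p2(4)[OF v] p3(4)[OF v] p4(4)[OF v] .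
  qed
qed

text \<open>Whatever decomposition witnesses the integral, on an indicator it returns the value of
  the measure; the functional thus determines the measure.\<close>

lemma has_cmeasure_integral_indicator:
  assumes "has_cmeasure_integral N \<mu> (\<lambda>x. indicator A x) I" and A: "A \<in> sets N"
  shows "I = \<mu> A"
proof -
  obtain P1 P2 P3 P4 where P: "\<forall>P\<in>{P1, P2, P3, P4}. finite_measure P \<and> sets P = sets N \<and> integrable P (\<lambda>x. indicator A x :: complex)"
    and \<mu>: "\<forall>A\<in>sets N. \<mu> A = Complex (measure P1 A - measure P2 A) (measure P3 A - measure P4 A)"
    and I: "I = (LINT x|P1. indicator A x) - (LINT x|P2. indicator A x) + \<i> * ((LINT x|P3. indicator A x) - (LINT x|P4. indicator A x))"
    using assms(1) unfolding has_cmeasure_integral_def by blast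
  have "(LINT x|P. indicator A x :: complex) = of_real (measure P A)" if "P \<in> {P1, P2, P3, P4}" for P
  proof -
    have "A \<in> sets P" using P that A by auto
    then have "A \<inter> space P = A" using sets.sets_into_space by blast
    have "(LINT x|P. indicator A x :: complex) = (LINT x|P. complex_of_real (indicator A x))"
      by (intro Bochner_Integration.integral_cong refl) (simp add: indicator_def)
    also have "\<dots> = of_real (measure P A)"
      using \<open>A \<inter> space P = A\<close> by (simp only: integral_complex_of_real) simp
    finally show ?thesis .
  qed
  then show ?thesis using \<mu> A I by (simp add: complex_eq_iff)
qed

lemma indicator_Linf: "A \<in> sets N \<Longrightarrow> (\<lambda>x. indicator A x) \<in> Linf N"
  by (auto simp: Linf_def indicator_def intro!: exI[of _ 1])

text \<open>Indicators are admissible kernels, so the \<open>n\<close>-point functional fixes the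
  measure of every set and with it the density.\<close>

lemma npoint_density_unique:
  assumes dens: "npoint_density \<tau> J n hs \<rho>" and \<rho>0: "integrable (nu2 n) \<rho>0"
    and rep: "\<And>v. v \<in> Linf (nu2 n) \<Longrightarrow> npoint \<tau> J n n hs v = (LINT u|nu2 n. v u * \<rho>0 u)"
  shows "AE u in nu2 n. \<rho> u = \<rho>0 u"
proof -
  from dens obtain \<mu> where \<mu>: "npoint_measure \<tau> J n hs \<mu>" "cmeasure_density (nu2 n) \<mu> \<rho>"
    by (auto simp: npoint_density_def)
  show ?thesis
  proof (rule complex_density_unique)
    show "integrable (nu2 n) \<rho>" using \<mu>(2) by (simp add: cmeasure_density_def)
    fix A assume A: "A \<in> sets (nu2 n)"
    have "has_cmeasure_integral (nu2 n) \<mu> (\<lambda>x. indicator A x) (npoint \<tau> J n n hs (\<lambda>x. indicator A x))"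
      using \<mu>(1) indicator_Linf[OF A] by (auto simp: npoint_measure_def)
    from has_cmeasure_integral_indicator[OF this A]
    have "(LINT u|nu2 n. indicator A u * \<rho>0 u) = \<mu> A"
      using rep[OF indicator_Linf[OF A]] by simp
    moreover have "(LINT u|nu2 n. indicator A u * \<rho>0 u) = (LINT u|nu2 n. indicator A u *\<^sub>R \<rho>0 u)"
      by (intro Bochner_Integration.integral_cong refl) (simp add: indicator_def)
    moreover have "\<mu> A = (LINT u|nu2 n. indicator A u *\<^sub>R \<rho> u)"
      using \<mu>(2) A by (simp add: cmeasure_density_def set_lebesgue_integral_def)
    ultimately show "(LINT u|nu2 n. indicator A u *\<^sub>R \<rho> u) = (LINT u|nu2 n. indicator A u *\<^sub>R \<rho>0 u)" by simp
  qed (rule \<rho>0)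
qed

lemma npoint_measure_exists:
  assumes \<rho>0: "integrable (nu2 n) \<rho>0"
    and rep: "\<And>v. v \<in> Linf (nu2 n) \<Longrightarrow> npoint \<tau> J n n hs v = (LINT u|nu2 n. v u * \<rho>0 u)"
  shows "\<exists>\<mu> \<rho>. npoint_measure \<tau> J n hs \<mu> \<and> cmeasure_density (nu2 n) \<mu> \<rho>"
  using density_cmeasure[OF \<rho>0] rep unfolding npoint_measure_def by auto

section \<open>The diagonals charged by \<open>nu2 n\<close>\<close>

lemma AE_PiM_distinct:
  assumes L: "finite L" "a \<in> L" "b \<in> L" "a \<noteq> b"
  shows "AE e in PiM L (\<lambda>_. lborel :: real measure). e a \<noteq> e b"
proof -
  have "AE e in PiM L (\<lambda>_. lborel :: real measure).
      (\<lambda>j\<in>{0, 1 :: nat}. e (if j = 0 then a else b)) 0 \<noteq> (\<lambda>j\<in>{0, 1 :: nat}. e (if j = 0 then a else b)) 1"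
    using L by (intro AE_PiM_pullback[OF lborel.sigma_finite_measure_axioms lborel.sigma_finite_measure_axioms
      absolutely_continuous_id measurable_ident_sets[OF refl] _ _ _ AE_lborel_distinct]) (auto simp: inj_on_def)
  then show ?thesis by simp
qed

lemma sets_eq_components:
  assumes "a < k" "b < k"
  shows "{u \<in> space (power_measure (lborel :: real measure) k). u a = u b} \<in> sets (power_measure lborel k)"
proof -
  have [measurable]: "(\<lambda>u. u a) \<in> borel_measurable (power_measure (lborel :: real measure) k)"
    "(\<lambda>u. u b) \<in> borel_measurable (power_measure (lborel :: real measure) k)"
    using measurable_component_singleton[of _ "{..<k}" "\<lambda>_. lborel :: real measure"] assms by auto
  show ?thesis by measurable
qed

lemma sets_neq_components:
  assumes "a < k" "b < k"
  shows "{u \<in> space (power_measure (lborel :: real measure) k). u a \<noteq> u b} \<in> sets (power_measure lborel k)"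
proof -
  have "{u \<in> space (power_measure (lborel :: real measure) k). u a \<noteq> u b} =
    space (power_measure lborel k) - {u \<in> space (power_measure lborel k). u a = u b}" by auto
  then show ?thesis using sets_eq_components[OF assms] by auto
qed

text \<open>Positions of equal sign never share a block, so on every charged diagonal they are
  separate Lebesgue coordinates.\<close>

lemma AE_nu_distinct:
  assumes ij: "i < length ss" "j < length ss" "i \<noteq> j" "ss ! i = ss ! j"
  shows "AE s in nu ss. s i \<noteq> s j"
proof (rule AE_sign_measureI)
  show "{s \<in> space (power_measure (lborel :: real measure) (length ss)). s i \<noteq> s j} \<in> sets (power_measure lborel (length ss))"
    using sets_neq_components[OF ij(1,2)] by simp
  fix \<theta> assume \<theta>: "\<theta> \<in> sign_partitions ss"
  note part = partition_on_sign_partitions[OF \<theta>]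
  have fin: "finite \<theta>" using finite_elements[OF _ part] by simp
  have "block \<theta> i \<noteq> block \<theta> j"
  proof
    assume eq: "block \<theta> i = block \<theta> j"
    have B: "block \<theta> i \<in> \<theta>" "{i, j} \<subseteq> block \<theta> i"
      using block_in[OF part, of i] block_in[OF part, of j] ij eq by auto
    then have "card (block \<theta> i) \<le> 2" using \<theta> by (auto simp: sign_partitions_def)
    moreover have "block \<theta> i \<subseteq> {..<length ss}" using B(1) part by (auto simp: partition_on_def)
    then have "finite (block \<theta> i)" by (rule finite_subset) simp
    ultimately have "{i, j} = block \<theta> i" using ij(3) B(2) by (intro card_seteq) auto
    then have "{i, j} \<in> \<theta>" using B(1) by simp
    then have "ss ! i \<noteq> ss ! j" using \<theta> ij(3) unfolding sign_partitions_def by blast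
    then show False using ij(4) by simp
  qed
  moreover have "block \<theta> i \<in> \<theta>" "block \<theta> j \<in> \<theta>" using block_in(1)[OF part] ij by auto
  ultimately show "AE y in PiM \<theta> (\<lambda>_. lborel :: real measure).
      (\<lambda>i\<in>{..<length ss}. y (block \<theta> i)) i \<noteq> (\<lambda>i\<in>{..<length ss}. y (block \<theta> i)) j"
    using AE_PiM_distinct[OF fin, of "block \<theta> i" "block \<theta> j"] ij by simp
qed

text \<open>The part of the diagonal belonging to \<open>\<pi>\<close> that no other pair partition charges.\<close>

definition matched :: "nat \<Rightarrow> (nat \<Rightarrow> nat) \<Rightarrow> (nat \<Rightarrow> real) set"
  where "matched n \<pi> = {u \<in> space (power_measure lborel (2 * n)).
    (\<forall>i\<in>{..<n}. u (n - Suc i) = u (n + \<pi> i)) \<and> (\<forall>i\<in>{..<n}. \<forall>j\<in>{..<n}. i \<noteq> j \<longrightarrow> u (n - Suc i) \<noteq> u (n - Suc j))}"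

context
  fixes n :: nat and \<pi> :: "nat \<Rightarrow> nat"
  assumes \<pi>: "\<pi> permutes {..<n}"
begin

lemma perm_less: "i < n \<Longrightarrow> \<pi> i < n" "i < n \<Longrightarrow> inv \<pi> i < n"
  using permutes_in_image[OF \<pi>, of i] permutes_in_image[OF permutes_inv[OF \<pi>], of i] by auto

lemma perm_inv: "inv \<pi> (\<pi> i) = i" "\<pi> (inv \<pi> i) = i"
  using permutes_inverses[OF \<pi>] by auto

lemma matched_sets: "matched n \<pi> \<in> sets (power_measure lborel (2 * n))"
proof -
  have neq: "{u \<in> space (power_measure (lborel :: real measure) (2 * n)). i \<noteq> j \<longrightarrow> u (n - Suc i) \<noteq> u (n - Suc j)} \<in> sets (power_measure lborel (2 * n))"
    if "i < n" "j < n" for i j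
    using sets_neq_components[of "n - Suc i" "2 * n" "n - Suc j"] that by (cases "i = j") auto
  have eq: "{u \<in> space (power_measure (lborel :: real measure) (2 * n)). u (n - Suc i) = u (n + \<pi> i)} \<in> sets (power_measure lborel (2 * n))"
    if "i < n" for i
    by (rule sets_eq_components) (use perm_less(1)[OF that] that in auto)
  have "{u \<in> space (power_measure (lborel :: real measure) (2 * n)). \<forall>i\<in>{..<n}. u (n - Suc i) = u (n + \<pi> i)} \<in> sets (power_measure lborel (2 * n))"
    by (rule sets.sets_Collect_finite_All[OF _ finite_lessThan], rule eq, simp)
  moreover have "{u \<in> space (power_measure (lborel :: real measure) (2 * n)). \<forall>i\<in>{..<n}. \<forall>j\<in>{..<n}. i \<noteq> j \<longrightarrow> u (n - Suc i) \<noteq> u (n - Suc j)} \<in> sets (power_measure lborel (2 * n))"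
    by (rule sets.sets_Collect_finite_All[OF _ finite_lessThan], rule sets.sets_Collect_finite_All[OF _ finite_lessThan], rule neq, simp_all)
  ultimately have "{u \<in> space (power_measure (lborel :: real measure) (2 * n)). \<forall>i\<in>{..<n}. u (n - Suc i) = u (n + \<pi> i)} \<inter>
    {u \<in> space (power_measure lborel (2 * n)). \<forall>i\<in>{..<n}. \<forall>j\<in>{..<n}. i \<noteq> j \<longrightarrow> u (n - Suc i) \<noteq> u (n - Suc j)} \<in> sets (power_measure lborel (2 * n))"
    by (rule sets.Int)
  then show ?thesis
    unfolding matched_def Collect_conj_eq[symmetric] by (rule back_subst[of "\<lambda>A. A \<in> sets _"]) blast
qed

definition pair_block :: "nat \<Rightarrow> nat set"
  where "pair_block i = {n - Suc i, n + \<pi> i}"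

definition pair_partition :: "nat set set"
  where "pair_partition = pair_block ` {..<n}"

lemma pair_block_index:
  assumes "j < 2 * n"
  shows "(if j < n then n - Suc j else inv \<pi> (j - n)) < n" "j \<in> pair_block (if j < n then n - Suc j else inv \<pi> (j - n))"
proof -
  have "inv \<pi> (j - n) < n" if "\<not> j < n" using perm_less(2)[of "j - n"] assms that by auto
  then show "(if j < n then n - Suc j else inv \<pi> (j - n)) < n" by auto
  show "j \<in> pair_block (if j < n then n - Suc j else inv \<pi> (j - n))"
    by (auto simp: pair_block_def perm_inv)
qed

lemma pair_block_disjoint:
  assumes "i < n" "i' < n" "j \<in> pair_block i" "j \<in> pair_block i'"
  shows "i = i'"
proof -
  note less = perm_less(1)[OF assms(1)] perm_less(1)[OF assms(2)]
  have "j = n - Suc i \<or> j = n + \<pi> i" "j = n - Suc i' \<or> j = n + \<pi> i'"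
    using assms(3,4) by (simp_all add: pair_block_def)
  then have "n - Suc i = n - Suc i' \<or> \<pi> i = \<pi> i'"
    using assms(1,2) less by linarith
  then show ?thesis
  proof
    assume "\<pi> i = \<pi> i'"
    then have "inv \<pi> (\<pi> i) = inv \<pi> (\<pi> i')" by (rule arg_cong)
    then show ?thesis unfolding perm_inv(1) .
  next
    assume "n - Suc i = n - Suc i'"
    then show ?thesis using assms(1,2) by linarith
  qed
qed

lemma pair_partition_on: "partition_on {..<2 * n} pair_partition"
  unfolding partition_on_def disjoint_def
proof (intro conjI ballI impI)
  show "\<Union> pair_partition = {..<2 * n}"
  proof (intro set_eqI iffI)
    fix j assume "j \<in> \<Union> pair_partition"
    then obtain i where "i < n" "j = n - Suc i \<or> j = n + \<pi> i" by (auto simp: pair_partition_def pair_block_def)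
    then show "j \<in> {..<2 * n}" using perm_less(1)[of i] by auto
  next
    fix j assume "j \<in> {..<2 * n}"
    then have "j < 2 * n" by simp
    from pair_block_index[OF this] show "j \<in> \<Union> pair_partition" unfolding pair_partition_def by (intro UnionI[OF imageI]) auto
  qed
  show "{} \<notin> pair_partition" by (auto simp: pair_partition_def pair_block_def)
  fix A B assume AB: "A \<in> pair_partition" "B \<in> pair_partition" "A \<noteq> B"
  then obtain i i' where i: "i < n" "i' < n" "A = pair_block i" "B = pair_block i'" by (auto simp: pair_partition_def)
  show "A \<inter> B = {}"
  proof (rule ccontr)
    assume "A \<inter> B \<noteq> {}"
    then obtain j where "j \<in> pair_block i" "j \<in> pair_block i'" using i by blast
    from pair_block_disjoint[OF i(1,2) this] show False using i AB(3) by simp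
  qed
qed

lemma pair_partition_signs: "pair_partition \<in> sign_partitions (replicate n Plus @ replicate n Minus)"
proof -
  have card: "card (pair_block i) \<le> 2" for i unfolding pair_block_def by (rule card_insert_le_m1) auto
  have "(replicate n Plus @ replicate n Minus) ! a \<noteq> (replicate n Plus @ replicate n Minus) ! b"
    if "a \<noteq> b" "{a, b} = pair_block i" "i < n" for a b i
  proof -
    have "(a = n - Suc i \<and> b = n + \<pi> i) \<or> (b = n - Suc i \<and> a = n + \<pi> i)"
      using that(1,2) by (auto simp: pair_block_def doubleton_eq_iff)
    then show ?thesis using that(3) perm_less(1)[OF that(3)] by (auto simp: nth_append)
  qed
  note signs = this
  have "partition_on {..<length (replicate n Plus @ replicate n Minus)} pair_partition"
    using pair_partition_on by (simp add: mult_2)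
  moreover have "\<forall>B\<in>pair_partition. card B \<le> 2" using card by (simp add: pair_partition_def)
  moreover have "\<forall>a b. a \<noteq> b \<longrightarrow> {a, b} \<in> pair_partition \<longrightarrow>
      (replicate n Plus @ replicate n Minus) ! a \<noteq> (replicate n Plus @ replicate n Minus) ! b"
  proof (intro allI impI)
    fix a b assume ab: "a \<noteq> b" "{a, b} \<in> pair_partition"
    then obtain i where "i < n" "{a, b} = pair_block i" unfolding pair_partition_def by (elim imageE) simp
    then show "(replicate n Plus @ replicate n Minus) ! a \<noteq> (replicate n Plus @ replicate n Minus) ! b"
      using signs[OF ab(1)] by blast
  qed
  ultimately show ?thesis unfolding sign_partitions_def by blast
qed

text \<open>Numbering the blocks by \<open>pair_block\<close> turns the parametrization of the
  diagonal by blocks into \<open>layout n \<pi>\<close>.\<close>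

lemma pair_partition_measure:
  "partition_measure lborel (2 * n) pair_partition =
    distr (power_measure (lborel :: real measure) n) (power_measure lborel (2 * n)) (layout n \<pi>)"
proof -
  have lb: "sigma_finite_measure (lborel :: real measure)" by (rule lborel.sigma_finite_measure_axioms)
  have fin: "finite pair_partition" by (simp add: pair_partition_def)
  have bij: "bij_betw pair_block {..<n} pair_partition"
    unfolding bij_betw_def pair_partition_def
  proof
    show "inj_on pair_block {..<n}"
    proof (rule inj_onI)
      fix i i' assume i: "i \<in> {..<n}" "i' \<in> {..<n}" "pair_block i = pair_block i'"
      have "n - Suc i \<in> pair_block i" by (simp add: pair_block_def)
      then show "i = i'" using i pair_block_disjoint[of i i' "n - Suc i"] by simp
    qed
  qed simp
  have m: "(\<lambda>y. \<lambda>i\<in>{..<n}. y (pair_block i)) \<in> PiM pair_partition (\<lambda>_. lborel :: real measure) \<rightarrow>\<^sub>M power_measure lborel n"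
    using bij by (intro measurable_restrict measurable_component_singleton) (auto simp: bij_betw_def)
  have "distr (power_measure (lborel :: real measure) n) (power_measure lborel (2 * n)) (layout n \<pi>) =
    distr (distr (PiM pair_partition (\<lambda>_. lborel)) (power_measure lborel n) (\<lambda>y. \<lambda>i\<in>{..<n}. y (pair_block i)))
      (power_measure lborel (2 * n)) (layout n \<pi>)"
    by (simp only: distr_PiM_reindex_bij[OF lb fin bij])
  also have "\<dots> = distr (PiM pair_partition (\<lambda>_. lborel)) (power_measure lborel (2 * n)) (layout n \<pi> \<circ> (\<lambda>y. \<lambda>i\<in>{..<n}. y (pair_block i)))"
    by (rule distr_distr[OF measurable_layout[OF \<pi>] m])
  also have "layout n \<pi> \<circ> (\<lambda>y. \<lambda>i\<in>{..<n}. y (pair_block i)) = (\<lambda>y. \<lambda>i\<in>{..<2 * n}. y (block pair_partition i) :: real)"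
  proof
    fix y :: "nat set \<Rightarrow> real"
    have "(layout n \<pi> \<circ> (\<lambda>y. \<lambda>i\<in>{..<n}. y (pair_block i))) y =
      (\<lambda>j\<in>{..<2 * n}. y (pair_block (if j < n then n - Suc j else inv \<pi> (j - n))))"
      using layout_map[OF \<pi>, of "\<lambda>B. y B" pair_block] by simp
    also have "\<dots> = (\<lambda>i\<in>{..<2 * n}. y (block pair_partition i))"
    proof (rule restrict_ext)
      fix j assume "j \<in> {..<2 * n}"
      then have "pair_block (if j < n then n - Suc j else inv \<pi> (j - n)) \<in> pair_partition"
        "j \<in> pair_block (if j < n then n - Suc j else inv \<pi> (j - n))"
        using pair_block_index[of j] unfolding pair_partition_def by blast+
      from block_eq[OF pair_partition_on this]
      show "y (pair_block (if j < n then n - Suc j else inv \<pi> (j - n))) = y (block pair_partition j)" by simp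
    qed
    finally show "(layout n \<pi> \<circ> (\<lambda>y. \<lambda>i\<in>{..<n}. y (pair_block i))) y = (\<lambda>i\<in>{..<2 * n}. y (block pair_partition i))" .
  qed
  finally show ?thesis unfolding partition_measure_def by (rule sym)
qed

text \<open>Tuples have pairwise distinct entries almost everywhere, so the image of
  \<open>layout\<close> avoids the smaller diagonals.\<close>

lemma layout_matched: "AE s in power_measure lborel n. layout n \<pi> s \<in> matched n \<pi>"
proof -
  have "AE s in power_measure (lborel :: real measure) n. \<forall>p\<in>{p \<in> {..<n} \<times> {..<n}. fst p \<noteq> snd p}. s (fst p) \<noteq> s (snd p)"
    by (intro AE_finite_allI) (auto intro!: AE_PiM_distinct)
  then show ?thesis using AE_space
  proof eventually_elim
    case (elim s)
    have "layout n \<pi> s \<in> space (power_measure lborel (2 * n))"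
      using measurable_space[OF measurable_layout[OF \<pi>] elim(2)] .
    moreover have "layout n \<pi> s (n - Suc i) = s i" "layout n \<pi> s (n + \<pi> i) = s i" if "i < n" for i
      using that perm_less(1)[OF that] by (auto simp: layout_def perm_inv)
    ultimately show ?case using elim(1) by (auto simp: matched_def)
  qed
qed

text \<open>Some pair joined by \<open>\<pi>\<close> is separated by \<open>\<theta>\<close>:
  otherwise each pair lies in a block, blocks have at most two elements, and \<open>\<theta>\<close>
  would be the partition of \<open>\<pi>\<close>. Separated coordinates differ almost
  everywhere.\<close>

lemma not_matched_other:
  assumes \<theta>: "\<theta> \<in> sign_partitions (replicate n Plus @ replicate n Minus)" "\<theta> \<noteq> pair_partition"
  shows "emeasure (partition_measure lborel (2 * n) \<theta>) (matched n \<pi>) = 0"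
proof -
  have part: "partition_on {..<2 * n} \<theta>" using partition_on_sign_partitions[OF \<theta>(1)] by (simp add: mult_2)
  have fin: "finite \<theta>" using finite_elements[OF _ part] by simp
  have "\<exists>i<n. block \<theta> (n - Suc i) \<noteq> block \<theta> (n + \<pi> i)"
  proof (rule ccontr)
    assume "\<not> ?thesis"
    then have eq: "block \<theta> (n - Suc i) = block \<theta> (n + \<pi> i)" if "i < n" for i using that by blast
    have pb: "pair_block i = block \<theta> (n - Suc i)" "pair_block i \<in> \<theta>" if i: "i < n" for i
    proof -
      have B: "block \<theta> (n - Suc i) \<in> \<theta>" "pair_block i \<subseteq> block \<theta> (n - Suc i)"
        using block_in[OF part, of "n - Suc i"] block_in[OF part, of "n + \<pi> i"] i perm_less(1)[OF i] eq[OF i]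
        by (auto simp: pair_block_def)
      then have "card (block \<theta> (n - Suc i)) \<le> 2" using \<theta>(1) by (auto simp: sign_partitions_def)
      moreover have "card (pair_block i) = 2" using i by (simp add: pair_block_def)
      moreover have "block \<theta> (n - Suc i) \<subseteq> {..<2 * n}" using B(1) part by (auto simp: partition_on_def)
      then have "finite (block \<theta> (n - Suc i))" by (rule finite_subset) simp
      ultimately show "pair_block i = block \<theta> (n - Suc i)" using B(2) by (intro card_seteq) auto
      then show "pair_block i \<in> \<theta>" using B(1) by simp
    qed
    have "\<theta> = pair_partition"
    proof (intro set_eqI iffI)
      fix B assume B: "B \<in> \<theta>"
      then have "B \<noteq> {}" "B \<subseteq> {..<2 * n}" using part by (auto simp: partition_on_def)
      then obtain j where j: "j \<in> B" "j < 2 * n" by blast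
      then have "B = block \<theta> j" using block_eq[OF part B] by simp
      moreover have "pair_block (if j < n then n - Suc j else inv \<pi> (j - n)) = block \<theta> j"
        using block_eq[OF part pb(2)[OF pair_block_index(1)[OF j(2)]] pair_block_index(2)[OF j(2)]] by (simp only:)
      ultimately show "B \<in> pair_partition"
        using imageI[of _ "{..<n}" pair_block, unfolded lessThan_iff, OF pair_block_index(1)[OF j(2)]]
        unfolding pair_partition_def by (simp only:)
    qed (use pb(2) in \<open>auto simp: pair_partition_def\<close>)
    then show False using \<theta>(2) by simp
  qed
  then obtain i where i: "i < n" "block \<theta> (n - Suc i) \<noteq> block \<theta> (n + \<pi> i)" by blast
  have "AE y in PiM \<theta> (\<lambda>_. lborel :: real measure). y (block \<theta> (n - Suc i)) \<noteq> y (block \<theta> (n + \<pi> i))"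
    using block_in(1)[OF part] i perm_less(1)[OF i(1)] by (intro AE_PiM_distinct[OF fin]) auto
  then have "AE y in PiM \<theta> (\<lambda>_. lborel :: real measure). (\<lambda>i\<in>{..<2 * n}. y (block \<theta> i)) \<notin> matched n \<pi>"
  proof eventually_elim
    case (elim y)
    then show ?case using i perm_less(1)[OF i(1)] by (auto simp: matched_def)
  qed
  then have "AE u in partition_measure lborel (2 * n) \<theta>. u \<notin> matched n \<pi>"
    unfolding partition_measure_def using matched_sets
    by (subst AE_distr_iff[OF measurable_partition_map[OF part]]) (auto simp: sets.sets_Collect_neg)
  then show ?thesis
    using matched_sets sets.sets_into_space[OF matched_sets]
    by (subst (asm) AE_iff_measurable[of "matched n \<pi>"]) (auto simp: sets_partition_measure partition_measure_def)
qed

text \<open>On the matched set the sum over partitions keeps only the summand of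
  \<open>\<pi>\<close>, and that summand is carried by the set. An integral over \<open>n\<close>
  variables can so be rewritten as one over \<open>nu2 n\<close> with an indicator, which is the
  form a density requires.\<close>

lemma density_matched:
  "density (nu2 n) (\<lambda>u. ennreal (indicator (matched n \<pi>) u)) =
    distr (power_measure lborel n) (power_measure lborel (2 * n)) (layout n \<pi>)"
proof (rule measure_eqI)
  let ?ss = "replicate n Plus @ replicate n Minus"
  have sets: "sets (nu2 n) = sets (power_measure lborel (2 * n))" by (simp add: sets_sign_measure mult_2)
  then show "sets (density (nu2 n) (\<lambda>u. ennreal (indicator (matched n \<pi>) u))) =
    sets (distr (power_measure lborel n) (power_measure lborel (2 * n)) (layout n \<pi>))" by simp
  fix A assume "A \<in> sets (density (nu2 n) (\<lambda>u. ennreal (indicator (matched n \<pi>) u)))"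
  then have A: "A \<in> sets (power_measure lborel (2 * n))" using sets by simp
  have mA: "matched n \<pi> \<inter> A \<in> sets (power_measure lborel (2 * n))" using A matched_sets by auto
  have mm: "matched n \<pi> \<in> sets (nu2 n)" unfolding sets by (rule matched_sets)
  have "(\<lambda>u. ennreal (indicator (matched n \<pi>) u)) \<in> borel_measurable (nu2 n)"
    by (intro measurable_compose[OF borel_measurable_indicator[OF mm] measurable_ennreal])
  then have "emeasure (density (nu2 n) (\<lambda>u. ennreal (indicator (matched n \<pi>) u))) A =
    (\<integral>\<^sup>+u. ennreal (indicator (matched n \<pi>) u) * indicator A u \<partial>nu2 n)"
    by (rule emeasure_density) (use A sets in simp)
  also have "\<dots> = (\<integral>\<^sup>+u. indicator (matched n \<pi> \<inter> A) u \<partial>nu2 n)"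
    by (rule nn_integral_cong) (simp add: indicator_def)
  also have "\<dots> = emeasure (nu2 n) (matched n \<pi> \<inter> A)" using mA sets by simp
  also have "\<dots> = (\<Sum>\<theta>\<in>sign_partitions ?ss. emeasure (partition_measure lborel (2 * n) \<theta>) (matched n \<pi> \<inter> A))"
    using emeasure_sign_measure[of "matched n \<pi> \<inter> A" ?ss lborel] mA by (simp add: mult_2)
  also have "\<dots> = (\<Sum>\<theta>\<in>{pair_partition}. emeasure (partition_measure lborel (2 * n) \<theta>) (matched n \<pi> \<inter> A))"
  proof (rule sum.mono_neutral_right[OF finite_sign_partitions])
    show "\<forall>\<theta>\<in>sign_partitions ?ss - {pair_partition}. emeasure (partition_measure lborel (2 * n) \<theta>) (matched n \<pi> \<inter> A) = 0"
    proof
      fix \<theta> assume "\<theta> \<in> sign_partitions ?ss - {pair_partition}"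
      then have "emeasure (partition_measure lborel (2 * n) \<theta>) (matched n \<pi>) = 0" by (intro not_matched_other) auto
      moreover have "emeasure (partition_measure lborel (2 * n) \<theta>) (matched n \<pi> \<inter> A) \<le> emeasure (partition_measure lborel (2 * n) \<theta>) (matched n \<pi>)"
        using matched_sets by (intro emeasure_mono) (auto simp: sets_partition_measure)
      ultimately show "emeasure (partition_measure lborel (2 * n) \<theta>) (matched n \<pi> \<inter> A) = 0" by simp
    qed
  qed (use pair_partition_signs in auto)
  also have "\<dots> = emeasure (distr (power_measure lborel n) (power_measure lborel (2 * n)) (layout n \<pi>)) (matched n \<pi> \<inter> A)"
    by (simp add: pair_partition_measure)
  also have "\<dots> = emeasure (distr (power_measure lborel n) (power_measure lborel (2 * n)) (layout n \<pi>)) A"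
  proof (rule emeasure_eq_AE)
    have "AE u in distr (power_measure lborel n) (power_measure lborel (2 * n)) (layout n \<pi>). u \<in> matched n \<pi>"
      using layout_matched matched_sets
      by (subst AE_distr_iff[OF measurable_layout[OF \<pi>]]) auto
    then show "AE u in distr (power_measure lborel n) (power_measure lborel (2 * n)) (layout n \<pi>). (u \<in> matched n \<pi> \<inter> A) = (u \<in> A)"
      by eventually_elim auto
  qed (use A mA in auto)
  finally show "emeasure (density (nu2 n) (\<lambda>u. ennreal (indicator (matched n \<pi>) u))) A =
    emeasure (distr (power_measure lborel n) (power_measure lborel (2 * n)) (layout n \<pi>)) A" .
qed

end

lemma layout_nth:
  "i < n \<Longrightarrow> layout n \<pi> s (n - Suc i) = s i"
  by (auto simp: layout_def)

section \<open>Densities of the n-point functions\<close>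

context admissible_rep
begin

text \<open>The variables are read off the left half, position \<open>n - Suc i\<close> for the
  variable \<open>i\<close>; on the matched set the right half repeats them.\<close>

definition pairing_density ::
  "('n space \<Rightarrow> complex) list \<Rightarrow> ('n space \<Rightarrow> complex) list \<Rightarrow> nat \<Rightarrow> (nat \<Rightarrow> nat) \<Rightarrow> (nat \<Rightarrow> real) \<Rightarrow> complex"
  where "pairing_density gs hs n \<pi> u = indicator (matched n \<pi>) u *\<^sub>R
    ((\<Prod>i<n. fd (gs ! i) (hs ! \<pi> i) (u (n - Suc i))) * perm_phase Q n \<pi> (\<lambda>i\<in>{..<n}. u (n - Suc i)))"

context
  fixes gs hs :: "('n space \<Rightarrow> complex) list" and n :: nat
  assumes len: "length gs = n" "length hs = n" and L: "set gs \<subseteq> L2 lborel" "set hs \<subseteq> L2 lborel"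
begin

lemma nth_L2: "i < n \<Longrightarrow> gs ! i \<in> L2 lborel" "i < n \<Longrightarrow> hs ! i \<in> L2 lborel"
  using L len by (auto simp: subset_iff)

text \<open>By \<open>density_matched\<close> the measure \<open>nu2 n\<close> cut down to the
  matched set is the image of Lebesgue measure under \<open>layout n \<pi>\<close>, so both claims
  are changes of variables.\<close>

lemma pairing_density_integral:
  assumes \<pi>: "\<pi> permutes {..<n}"
  shows "integrable (nu2 n) (pairing_density gs hs n \<pi>)"
    and "v \<in> Linf (nu2 n) \<Longrightarrow> (LINT u|nu2 n. v u * pairing_density gs hs n \<pi> u) =
      (LINT s|power_measure lborel n. (\<Prod>i<n. fd (gs ! i) (hs ! \<pi> i) (s i)) * (v (layout n \<pi> s) * perm_phase Q n \<pi> s))"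
proof -
  define D where "D u = (\<Prod>i<n. fd (gs ! i) (hs ! \<pi> i) (u (n - Suc i))) * perm_phase Q n \<pi> (\<lambda>i\<in>{..<n}. u (n - Suc i))"
    for u :: "nat \<Rightarrow> real"
  define F where "F s = (\<Prod>i<n. fd (gs ! i) (hs ! \<pi> i) (s i)) * perm_phase Q n \<pi> s" for s :: "nat \<Rightarrow> real"
  have dens: "pairing_density gs hs n \<pi> = (\<lambda>u. indicator (matched n \<pi>) u *\<^sub>R D u)"
    by (simp add: pairing_density_def[abs_def] D_def)
  interpret P: product_sigma_finite "\<lambda>_. lborel :: real measure"
    by (rule product_sigma_finite_const[OF lborel.sigma_finite_measure_axioms])
  have fdi: "integrable lborel (fd (gs ! i) (hs ! \<pi> i))" if i: "i < n" for i
    by (rule fibre_density_integrable[where T = T, OF nth_L2(1)[OF i] T_L2[OF nth_L2(2)[OF perm_less(1)[OF \<pi> i]]]])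
  have fdm: "fd (gs ! i) (hs ! \<pi> i) \<in> borel_measurable lborel" if i: "i < n" for i
    using fdi[OF i] by (rule borel_measurable_integrable)
  have sets: "sets (nu2 n) = sets (power_measure (lborel :: real measure) (2 * n))" by (simp add: sets_sign_measure mult_2)
  have comp: "(\<lambda>u. u (n - Suc i)) \<in> power_measure (lborel :: real measure) (2 * n) \<rightarrow>\<^sub>M lborel" if "i < n" for i
    by (rule measurable_component_singleton) (use that in auto)
  have comp1: "(\<lambda>s. s i) \<in> power_measure (lborel :: real measure) n \<rightarrow>\<^sub>M lborel" if "i < n" for i
    by (rule measurable_component_singleton) (use that in auto)
  have restr: "(\<lambda>u. \<lambda>i\<in>{..<n}. u (n - Suc i)) \<in> power_measure (lborel :: real measure) (2 * n) \<rightarrow>\<^sub>M power_measure lborel n"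
    by (rule measurable_restrict) (rule comp, simp)
  have Dm: "D \<in> borel_measurable (power_measure lborel (2 * n))"
    unfolding D_def[abs_def]
    by (intro borel_measurable_times borel_measurable_prod measurable_compose[OF comp fdm]
      measurable_compose[OF restr perm_phase_Q_measurable]) auto
  then have Dm': "D \<in> borel_measurable (nu2 n)" using measurable_cong_sets[OF sets refl] by blast
  have F: "integrable (power_measure lborel n) F"
  proof (rule Bochner_Integration.integrable_bound)
    let ?C = "max 1 \<bar>\<eta>\<bar> ^ card {(i, j). i < j \<and> j < n \<and> \<pi> i > \<pi> j}"
    have "integrable (power_measure lborel n) (\<lambda>s. \<Prod>i<n. fd (gs ! i) (hs ! \<pi> i) (s i))"
      by (rule P.product_integrable_prod) (auto intro: fdi)
    then show "integrable (power_measure lborel n) (\<lambda>s. ?C *\<^sub>R (\<Prod>i<n. fd (gs ! i) (hs ! \<pi> i) (s i)))"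
      by (rule integrable_scaleR_right)
    show "F \<in> borel_measurable (power_measure lborel n)"
      unfolding F_def[abs_def]
      by (intro borel_measurable_times borel_measurable_prod perm_phase_Q_measurable
        measurable_compose[OF comp1 fdm]) auto
    show "AE s in power_measure lborel n. norm (F s) \<le> norm (?C *\<^sub>R (\<Prod>i<n. fd (gs ! i) (hs ! \<pi> i) (s i)))"
    proof (rule AE_I2)
      fix s
      have "0 \<le> ?C" by simp
      then show "norm (F s) \<le> norm (?C *\<^sub>R (\<Prod>i<n. fd (gs ! i) (hs ! \<pi> i) (s i)))"
        using norm_mult_le[OF perm_phase_Q_bound[of n \<pi> s]] unfolding F_def norm_scaleR by (simp only: abs_of_nonneg)
    qed
  qed
  have DF: "D (layout n \<pi> s) = F s" if "s \<in> space (power_measure lborel n)" for s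
  proof -
    have "s \<in> extensional {..<n}" using that by (simp add: space_PiM PiE_def)
    then have "(\<lambda>i\<in>{..<n}. layout n \<pi> s (n - Suc i)) = s"
      by (intro extensionalityI[of _ "{..<n}"]) (auto simp: layout_nth)
    moreover have "(\<Prod>i<n. fd (gs ! i) (hs ! \<pi> i) (layout n \<pi> s (n - Suc i))) = (\<Prod>i<n. fd (gs ! i) (hs ! \<pi> i) (s i))"
      by (intro prod.cong refl) (simp add: layout_nth)
    ultimately show ?thesis by (simp add: D_def F_def)
  qed
  have ind: "(indicator (matched n \<pi>) :: _ \<Rightarrow> real) \<in> borel_measurable (nu2 n)"
    by (rule borel_measurable_indicator) (simp only: sets matched_sets[OF \<pi>])
  have "integrable (power_measure lborel n) (\<lambda>s. D (layout n \<pi> s))"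
    using F by (rule Bochner_Integration.integrable_cong[THEN iffD1, rotated -1]) (simp_all add: DF)
  then have "integrable (distr (power_measure lborel n) (power_measure lborel (2 * n)) (layout n \<pi>)) D"
    by (rule integrable_distr_eq[OF measurable_layout[OF \<pi>] Dm, THEN iffD2])
  then have "integrable (density (nu2 n) (\<lambda>u. ennreal (indicator (matched n \<pi>) u))) D"
    by (simp only: density_matched[OF \<pi>])
  then have "integrable (nu2 n) (\<lambda>u. indicator (matched n \<pi>) u *\<^sub>R D u)"
    by (rule integrable_density[OF Dm' ind, THEN iffD1, rotated]) simp
  then show "integrable (nu2 n) (pairing_density gs hs n \<pi>)" unfolding dens .
  assume v: "v \<in> Linf (nu2 n)"
  have vm': "v \<in> borel_measurable (nu2 n)" using v by (simp add: Linf_def)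
  have vm: "v \<in> borel_measurable (power_measure lborel (2 * n))"
    using Linf_measurable[OF v] by (simp add: mult_2)
  have "(LINT u|nu2 n. v u * pairing_density gs hs n \<pi> u) = (LINT u|nu2 n. indicator (matched n \<pi>) u *\<^sub>R (v u * D u))"
    unfolding dens by simp
  also have "\<dots> = (LINT u|density (nu2 n) (\<lambda>u. ennreal (indicator (matched n \<pi>) u)). v u * D u)"
    by (rule integral_density[OF borel_measurable_times[OF vm' Dm'] ind, symmetric]) simp
  also have "\<dots> = (LINT s|power_measure lborel n. v (layout n \<pi> s) * D (layout n \<pi> s))"
    unfolding density_matched[OF \<pi>]
    by (rule integral_distr[OF measurable_layout[OF \<pi>]]) (intro borel_measurable_times vm Dm)
  also have "\<dots> = (LINT s|power_measure lborel n. (\<Prod>i<n. fd (gs ! i) (hs ! \<pi> i) (s i)) * (v (layout n \<pi> s) * perm_phase Q n \<pi> s))"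
    by (intro Bochner_Integration.integral_cong refl) (simp add: DF F_def mult_ac)
  finally show "(LINT u|nu2 n. v u * pairing_density gs hs n \<pi> u) =
      (LINT s|power_measure lborel n. (\<Prod>i<n. fd (gs ! i) (hs ! \<pi> i) (s i)) * (v (layout n \<pi> s) * perm_phase Q n \<pi> s))" .
qed

lemma integrable_pairing_sum: "integrable (nu2 n) (\<lambda>u. \<Sum>\<pi> | \<pi> permutes {..<n}. pairing_density gs hs n \<pi> u)"
  by (rule Bochner_Integration.integrable_sum) (simp add: pairing_density_integral(1))

lemma npoint_pairing:
  assumes v: "v \<in> Linf (nu2 n)"
  shows "npoint (vacuum_state Z_measure) (rep_integral Q K1 K2) n n (rev gs @ hs) v =
    (LINT u|nu2 n. v u * (\<Sum>\<pi> | \<pi> permutes {..<n}. pairing_density gs hs n \<pi> u))"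
proof -
  have vm: "v \<in> borel_measurable (nu2 n)" using v by (simp add: Linf_def)
  have i: "integrable (nu2 n) (\<lambda>u. v u * pairing_density gs hs n \<pi> u)" if "\<pi> permutes {..<n}" for \<pi>
    using vm borel_measurable_integrable[OF pairing_density_integral(1)[OF that]]
    by (intro integrable_Linf_mult[OF pairing_density_integral(1)[OF that] v] borel_measurable_times norm_mult)
  have "(LINT u|nu2 n. v u * (\<Sum>\<pi> | \<pi> permutes {..<n}. pairing_density gs hs n \<pi> u)) =
    (\<Sum>\<pi> | \<pi> permutes {..<n}. LINT u|nu2 n. v u * pairing_density gs hs n \<pi> u)"
    unfolding sum_distrib_left by (rule Bochner_Integration.integral_sum) (use i in simp)
  then show ?thesis
    unfolding npoint_formula[OF len L v] by (simp add: pairing_density_integral(2)[OF _ v])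
qed

end

lemma npoint_density_AE:
  assumes len: "length gs = n" "length hs = n" and L: "set gs \<subseteq> L2 lborel" "set hs \<subseteq> L2 lborel"
    and \<rho>: "npoint_density (vacuum_state Z_measure) (rep_integral Q K1 K2) n (rev gs @ hs) \<rho>"
  shows "AE u in nu2 n. \<rho> u = (\<Sum>\<pi> | \<pi> permutes {..<n}. pairing_density gs hs n \<pi> u)"
  by (rule npoint_density_unique[OF \<rho> integrable_pairing_sum[OF len L] npoint_pairing[OF len L]])

text \<open>A single variable leaves only the identity, which has no inversions, and makes the
  distinctness condition in \<open>matched\<close> vacuous.\<close>

lemma pairing_density_one:
  "(\<Sum>\<pi> | \<pi> permutes {..<1}. pairing_density [g] [h] 1 \<pi> u) =
    (if u \<in> space (power_measure lborel 2) \<and> u 0 = u 1 then 1 else 0) * fd g h (u 0)"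
proof -
  have p: "{\<pi>. \<pi> permutes {..<1::nat}} = {id}" by (auto simp: lessThan_Suc)
  have "perm_phase Q 1 id w = 1" for w unfolding perm_phase_def by (rule prod.neutral) auto
  moreover have "u \<in> matched 1 id \<longleftrightarrow> u \<in> space (power_measure lborel 2) \<and> u 0 = u 1"
    by (simp add: matched_def lessThan_Suc)
  moreover have "(\<Sum>\<pi> | \<pi> permutes {..<1}. pairing_density [g] [h] 1 \<pi> u) = pairing_density [g] [h] 1 id u"
    unfolding p by (subst sum.insert) simp_all
  ultimately show ?thesis by (simp add: pairing_density_def indicator_def)
qed

lemma two_point_density:
  assumes g: "g \<in> L2 lborel" and h: "h \<in> L2 lborel"
    and \<sigma>: "npoint_density (vacuum_state Z_measure) (rep_integral Q K1 K2) 1 [g, h] \<sigma>"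
  shows "AE u in nu [Plus, Minus]. \<sigma> u = (if u 0 = u 1 then 1 else 0) * fd g h (u 0)"
proof -
  have "AE u in nu2 1. \<sigma> u = (\<Sum>\<pi> | \<pi> permutes {..<1}. pairing_density [g] [h] 1 \<pi> u)"
    by (rule npoint_density_AE) (use g h \<sigma> in auto)
  then have "AE u in nu2 1. \<sigma> u = (if u 0 = u 1 then 1 else 0) * fd g h (u 0)"
    using AE_space
  proof eventually_elim
    case (elim u)
    have "u \<in> space (power_measure lborel 2)"
      using elim(2) sets_eq_imp_space_eq[OF sets_sign_measure[of "lborel :: real measure" "replicate 1 Plus @ replicate 1 Minus"]]
      by (simp add: numeral_2_eq_2)
    then show ?case using elim(1) unfolding pairing_density_one by simp
  qed
  moreover have "replicate 1 Plus @ replicate 1 Minus = [Plus, Minus]" by simp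
  ultimately show ?thesis by (simp only:)
qed

text \<open>When the first \<open>n\<close> coordinates are distinct, being matched amounts to
  \<open>n\<close> separate equalities. The one indicator then distributes over the factors, as the
  product of two-point densities demands.\<close>

lemma pairing_density_reordered:
  fixes s :: "nat \<Rightarrow> real"
  assumes \<pi>: "\<pi> permutes {..<n}" and inj: "\<And>i j. i < n \<Longrightarrow> j < n \<Longrightarrow> i \<noteq> j \<Longrightarrow> s i \<noteq> s j"
  shows "pairing_density gs hs n \<pi> (\<lambda>i\<in>{..<2 * n}. if i < n then s (n - 1 - i) else s i) =
    (\<Prod>i<n. (if s i = s (n + \<pi> i) then 1 else 0) * fd (gs ! i) (hs ! \<pi> i) (s i)) * perm_phase Q n \<pi> s"
    (is "pairing_density gs hs n \<pi> ?u = _")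
proof -
  have u: "?u (n - Suc i) = s i" "?u (n + \<pi> i) = s (n + \<pi> i)" if "i < n" for i
    using that perm_less(1)[OF \<pi> that] by auto
  have sp: "?u \<in> space (power_measure (lborel :: real measure) (2 * n))"
    by (simp add: space_PiM PiE_def)
  have "?u \<in> matched n \<pi> \<longleftrightarrow> (\<forall>i\<in>{..<n}. ?u (n - Suc i) = ?u (n + \<pi> i)) \<and>
      (\<forall>i\<in>{..<n}. \<forall>j\<in>{..<n}. i \<noteq> j \<longrightarrow> ?u (n - Suc i) \<noteq> ?u (n - Suc j))"
    using sp unfolding matched_def by blast
  also have "\<dots> \<longleftrightarrow> (\<forall>i\<in>{..<n}. s i = s (n + \<pi> i)) \<and> (\<forall>i\<in>{..<n}. \<forall>j\<in>{..<n}. i \<noteq> j \<longrightarrow> s i \<noteq> s j)"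
    by (intro arg_cong2[where f="(\<and>)"] ball_cong refl) (simp_all only: u lessThan_iff)
  finally have m: "?u \<in> matched n \<pi> \<longleftrightarrow> (\<forall>i\<in>{..<n}. s i = s (n + \<pi> i))" using inj by blast
  have F: "(\<Prod>i<n. fd (gs ! i) (hs ! \<pi> i) (?u (n - Suc i))) = (\<Prod>i<n. fd (gs ! i) (hs ! \<pi> i) (s i))"
    by (intro prod.cong refl) (simp only: u lessThan_iff)
  have P: "perm_phase Q n \<pi> (\<lambda>i\<in>{..<n}. ?u (n - Suc i)) = perm_phase Q n \<pi> s"
    by (rule perm_phase_cong) auto
  show ?thesis
  proof (cases "\<forall>i\<in>{..<n}. s i = s (n + \<pi> i)")
    case True
    have "(\<Prod>i<n. (if s i = s (n + \<pi> i) then 1 else 0) * fd (gs ! i) (hs ! \<pi> i) (s i)) = (\<Prod>i<n. fd (gs ! i) (hs ! \<pi> i) (s i))"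
      by (intro prod.cong refl) (use True in simp)
    moreover have "indicator (matched n \<pi>) ?u = (1::real)" using m True by (simp only: indicator_simps)
    ultimately show ?thesis unfolding pairing_density_def F P by simp
  next
    case False
    then obtain i where "i < n" "s i \<noteq> s (n + \<pi> i)" by auto
    then have "(\<Prod>i<n. (if s i = s (n + \<pi> i) then 1 else 0) * fd (gs ! i) (hs ! \<pi> i) (s i)) = 0"
      by (intro prod_zero) auto
    moreover have "?u \<notin> matched n \<pi>" using m False by blast
    then have "indicator (matched n \<pi>) ?u = (0::real)" by (rule indicator_simps(2))
    ultimately show ?thesis unfolding pairing_density_def F P by simp
  qed
qed

text \<open>Three almost-everywhere facts meet: the density at the reordered point, all two-point
  densities at pairs of coordinates, and distinctness within the first half. The first two are
  transported by \<open>AE_sign_measure_reindex\<close>, since reordering the first half and picking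
  one coordinate from each half keep opposite signs opposite.\<close>

lemma npoint_densities_factorize:
  assumes len: "length gs = n" "length hs = n" and L: "set gs \<subseteq> L2 lborel" "set hs \<subseteq> L2 lborel"
    and \<rho>: "npoint_density (vacuum_state Z_measure) (rep_integral Q K1 K2) n (rev gs @ hs) \<rho>"
    and \<sigma>: "\<And>i j. i < n \<Longrightarrow> j < n \<Longrightarrow> npoint_density (vacuum_state Z_measure) (rep_integral Q K1 K2) 1 [gs ! i, hs ! j] (\<sigma> i j)"
  shows "AE s in nu2 n. \<rho> (\<lambda>i\<in>{..<2 * n}. if i < n then s (n - 1 - i) else s i) =
    (\<Sum>\<pi> | \<pi> permutes {..<n}. (\<Prod>i<n. \<sigma> i (\<pi> i) (pair_point (s i) (s (n + \<pi> i)))) * perm_phase Q n \<pi> s)"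
proof -
  let ?ss = "replicate n Plus @ replicate n Minus"
  have lb: "sigma_finite_measure (lborel :: real measure)" by (rule lborel.sigma_finite_measure_axioms)
  have lss: "length ?ss = 2 * n" by simp
  have nth: "?ss ! i = (if i < n then Plus else Minus)" if "i < 2 * n" for i
    using that by (auto simp: nth_append)
  have "AE s in nu2 n. \<rho> (\<lambda>i\<in>{..<length ?ss}. s (if i < n then n - 1 - i else i)) =
      (\<Sum>\<pi> | \<pi> permutes {..<n}. pairing_density gs hs n \<pi> (\<lambda>i\<in>{..<length ?ss}. s (if i < n then n - 1 - i else i)))"
  proof (rule AE_sign_measure_reindex[OF lb])
    show "inj_on (\<lambda>i. if i < n then n - 1 - i else i) {..<length ?ss}" by (auto simp: inj_on_def)
    show "AE u in nu2 n. \<rho> u = (\<Sum>\<pi> | \<pi> permutes {..<n}. pairing_density gs hs n \<pi> u)"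
      by (rule npoint_density_AE[OF len L \<rho>])
  qed (auto simp: nth_append split: if_splits)
  moreover have "(\<lambda>i\<in>{..<length ?ss}. s (if i < n then n - 1 - i else i)) =
      (\<lambda>i\<in>{..<2 * n}. if i < n then s (n - 1 - i) else s i)" for s :: "nat \<Rightarrow> real"
    unfolding lss by (rule restrict_ext) simp
  ultimately have 1: "AE s in nu2 n. \<rho> (\<lambda>i\<in>{..<2 * n}. if i < n then s (n - 1 - i) else s i) =
      (\<Sum>\<pi> | \<pi> permutes {..<n}. pairing_density gs hs n \<pi> (\<lambda>i\<in>{..<2 * n}. if i < n then s (n - 1 - i) else s i))"
    by (simp only:)
  have 2: "AE s in nu2 n. \<forall>i\<in>{..<n}. \<forall>j\<in>{..<n}. \<sigma> i j (pair_point (s i) (s (n + j))) =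
      (if s i = s (n + j) then 1 else 0) * fd (gs ! i) (hs ! j) (s i)"
  proof (intro AE_finite_allI finite_lessThan)
    fix i j assume "i \<in> {..<n}" "j \<in> {..<n}"
    then have ij: "i < n" "j < n" by auto
    let ?ss' = "[Plus, Minus]" and ?\<tau> = "\<lambda>k. if k = 0 then i else n + j"
    have "AE s in nu2 n. \<sigma> i j (\<lambda>k\<in>{..<length ?ss'}. s (?\<tau> k)) =
      (if (\<lambda>k\<in>{..<length ?ss'}. s (?\<tau> k)) 0 = (\<lambda>k\<in>{..<length ?ss'}. s (?\<tau> k)) 1 then 1 else 0) *
        fd (gs ! i) (hs ! j) ((\<lambda>k\<in>{..<length ?ss'}. s (?\<tau> k)) 0)"
    proof (rule AE_sign_measure_reindex[OF lb])
      show "AE u in nu ?ss'. \<sigma> i j u = (if u 0 = u 1 then 1 else 0) * fd (gs ! i) (hs ! j) (u 0)"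
        by (rule two_point_density[OF nth_L2(1)[OF len L ij(1)] nth_L2(2)[OF len L ij(2)] \<sigma>[OF ij]])
      show "inj_on ?\<tau> {..<length ?ss'}" using ij by (auto simp: inj_on_def)
    next
      fix k assume "k < length ?ss'"
      then show "?\<tau> k < length ?ss" using ij by auto
    next
      fix k l assume "k < length ?ss'" "l < length ?ss'" "?ss ! ?\<tau> k \<noteq> ?ss ! ?\<tau> l"
      then have "k \<noteq> l" "k = 0 \<or> k = 1" "l = 0 \<or> l = 1" by auto
      then show "?ss' ! k \<noteq> ?ss' ! l" by auto
    qed
    moreover have "(\<lambda>k\<in>{..<length ?ss'}. s (?\<tau> k)) = pair_point (s i) (s (n + j))" for s :: "nat \<Rightarrow> real"
      by (auto simp: pair_point_def fun_eq_iff restrict_def)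
    ultimately show "AE s in nu2 n. \<sigma> i j (pair_point (s i) (s (n + j))) =
      (if s i = s (n + j) then 1 else 0) * fd (gs ! i) (hs ! j) (s i)"
      by (simp add: pair_point_def)
  qed
  have 3: "AE s in nu2 n. \<forall>p\<in>{p \<in> {..<n} \<times> {..<n}. fst p \<noteq> snd p}. s (fst p) \<noteq> s (snd p)"
  proof (rule AE_finite_allI)
    fix p assume "p \<in> {p \<in> {..<n} \<times> {..<n}. fst p \<noteq> snd p}"
    then show "AE s in nu2 n. s (fst p) \<noteq> s (snd p)"
      by (intro AE_nu_distinct) (auto simp: nth_append)
  qed simp
  from 1 2 3 show ?thesis
  proof eventually_elim
    case (elim s)
    have inj: "s i \<noteq> s j" if "i < n" "j < n" "i \<noteq> j" for i j
      using bspec[OF elim(3), of "(i, j)"] that by simp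
    show ?case
      unfolding elim(1)
    proof (rule sum.cong[OF refl])
      fix \<pi> assume "\<pi> \<in> {\<pi>. \<pi> permutes {..<n}}"
      then have \<pi>: "\<pi> permutes {..<n}" by simp
      have reord: "pairing_density gs hs n \<pi> (\<lambda>i\<in>{..<2 * n}. if i < n then s (n - 1 - i) else s i) =
        (\<Prod>i<n. (if s i = s (n + \<pi> i) then 1 else 0) * fd (gs ! i) (hs ! \<pi> i) (s i)) * perm_phase Q n \<pi> s"
        by (rule pairing_density_reordered[OF \<pi> inj])
      have "(\<Prod>i<n. (if s i = s (n + \<pi> i) then 1 else 0) * fd (gs ! i) (hs ! \<pi> i) (s i)) =
        (\<Prod>i<n. \<sigma> i (\<pi> i) (pair_point (s i) (s (n + \<pi> i))))"
        using elim(2) perm_less(1)[OF \<pi>] by (intro prod.cong refl) simp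
      then show "pairing_density gs hs n \<pi> (\<lambda>i\<in>{..<2 * n}. if i < n then s (n - 1 - i) else s i) =
        (\<Prod>i<n. \<sigma> i (\<pi> i) (pair_point (s i) (s (n + \<pi> i)))) * perm_phase Q n \<pi> s"
        by (simp only: reord)
    qed
  qed
qed

lemma gauge_invariant_quasi_free_vacuum:
  "gauge_invariant_quasi_free Q lborel (vacuum_state Z_measure) (rep_integral Q K1 K2)"
  unfolding gauge_invariant_quasi_free_def
proof (intro conjI allI impI)
  fix k n :: nat and hs :: "('n space \<Rightarrow> complex) list" and v
  assume "k \<noteq> n" "length hs = k + n" "set hs \<subseteq> L2 lborel" "v \<in> Linf (nu (replicate k Plus @ replicate n Minus))"
  then show "npoint (vacuum_state Z_measure) (rep_integral Q K1 K2) k n hs v = 0" by (rule npoint_unbalanced)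
next
  fix n :: nat and hs :: "('n space \<Rightarrow> complex) list"
  assume hs: "length hs = 2 * n" "set hs \<subseteq> L2 lborel"
  \<comment> \<open>The formulas are stated for lists of the form \<open>rev gs @ hs\<close>;
    reversing the first half brings an arbitrary list into this form.\<close>
  define gs where "gs = rev (take n hs)"
  have eq: "rev gs @ drop n hs = hs" by (simp add: gs_def)
  have len: "length gs = n" "length (drop n hs) = n" using hs by (auto simp: gs_def)
  have L: "set gs \<subseteq> L2 lborel" "set (drop n hs) \<subseteq> L2 lborel"
    using hs(2) set_take_subset[of n hs] set_drop_subset[of n hs] by (auto simp: gs_def)
  show "\<exists>\<mu> \<rho>. npoint_measure (vacuum_state Z_measure) (rep_integral Q K1 K2) n hs \<mu> \<and> cmeasure_density (nu2 n) \<mu> \<rho>"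
    by (rule npoint_measure_exists[OF integrable_pairing_sum[OF len L]])
      (rule npoint_pairing[OF len L, unfolded eq])
next
  fix n gs hs \<rho> and \<sigma> :: "nat \<Rightarrow> nat \<Rightarrow> (nat \<Rightarrow> real) \<Rightarrow> complex"
  assume len: "length gs = n" "length hs = n" and L: "set gs \<subseteq> L2 lborel" "set hs \<subseteq> L2 lborel"
    and \<rho>: "npoint_density (vacuum_state Z_measure) (rep_integral Q K1 K2) n (rev gs @ hs) \<rho>"
    and \<sigma>: "\<forall>i<n. \<forall>j<n. npoint_density (vacuum_state Z_measure) (rep_integral Q K1 K2) 1 [gs ! i, hs ! j] (\<sigma> i j)"
  show "AE s in nu2 n. \<rho> (\<lambda>i\<in>{..<2 * n}. if i < n then s (n - 1 - i) else s i) =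
    (\<Sum>\<pi> | \<pi> permutes {..<n}. (\<Prod>i<n. \<sigma> i (\<pi> i) (pair_point (s i) (s (n + \<pi> i)))) * perm_phase Q n \<pi> s)"
    by (rule npoint_densities_factorize[OF len L \<rho>]) (use \<sigma> in blast)
qed

end

section \<open>The operator \<open>T\<close>\<close>

lemma L2_norm_sq:
  fixes f :: "'a \<Rightarrow> complex"
  assumes "f \<in> L2 M"
  shows "(LINT x|M. (norm (f x))\<^sup>2) = (LINT x|M. (norm (Re (f x)))\<^sup>2) + (LINT x|M. (norm (Im (f x)))\<^sup>2)"
proof -
  have "integrable M (\<lambda>x. Re (f x) * Re (f x))" "integrable M (\<lambda>x. Im (f x) * Im (f x))"
    by (intro L2_integrable_mult L2_Re L2_Im assms)+
  then have "(LINT x|M. Re (f x) * Re (f x) + Im (f x) * Im (f x)) =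
      (LINT x|M. Re (f x) * Re (f x)) + (LINT x|M. Im (f x) * Im (f x))"
    by (rule Bochner_Integration.integral_add)
  then show ?thesis unfolding cmod_power2 real_norm_def power2_abs unfolding power2_eq_square .
qed

text \<open>Real and imaginary parts are acted on separately and their squared norms add, so the
  constant of \<open>K\<close> serves for its extension.\<close>

lemma cext_bounded:
  fixes K :: "('a \<Rightarrow> real) \<Rightarrow> 'a \<Rightarrow> real"
  assumes K: "L2_operator M K"
  shows "\<exists>C\<ge>0. \<forall>f\<in>L2 M. sqrt (LINT x|M. (norm (cext K f x))\<^sup>2) \<le> C * sqrt (LINT x|M. (norm (f x))\<^sup>2)"
proof -
  obtain C where C: "0 \<le> C" "\<And>f. f \<in> L2 M \<Longrightarrow> sqrt (LINT x|M. (norm (K f x))\<^sup>2) \<le> C * sqrt (LINT x|M. (norm (f x))\<^sup>2)"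
    using K unfolding L2_operator_def by blast
  have sq: "(LINT x|M. (norm (K f x))\<^sup>2) \<le> C\<^sup>2 * (LINT x|M. (norm (f x))\<^sup>2)" if "f \<in> L2 M" for f
  proof -
    have "(sqrt (LINT x|M. (norm (K f x))\<^sup>2))\<^sup>2 \<le> (C * sqrt (LINT x|M. (norm (f x))\<^sup>2))\<^sup>2"
      by (rule power_mono[OF C(2)[OF that]]) simp
    then show ?thesis by (simp add: power_mult_distrib)
  qed
  show ?thesis
  proof (intro exI[of _ C] conjI ballI C(1))
    fix f :: "'a \<Rightarrow> complex" assume f: "f \<in> L2 M"
    have "(LINT x|M. (norm (cext K f x))\<^sup>2) =
      (LINT x|M. (norm (K (\<lambda>y. Re (f y)) x))\<^sup>2) + (LINT x|M. (norm (K (\<lambda>y. Im (f y)) x))\<^sup>2)"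
      using L2_norm_sq[OF cext_L2[OF K f]] by (simp add: cext_def)
    also have "\<dots> \<le> C\<^sup>2 * (LINT x|M. (norm (Re (f x)))\<^sup>2) + C\<^sup>2 * (LINT x|M. (norm (Im (f x)))\<^sup>2)"
      by (intro add_mono sq L2_Re L2_Im f)
    also have "\<dots> = C\<^sup>2 * (LINT x|M. (norm (f x))\<^sup>2)"
      unfolding L2_norm_sq[OF f] by (simp add: distrib_left)
    finally have "sqrt (LINT x|M. (norm (cext K f x))\<^sup>2) \<le> sqrt (C\<^sup>2 * (LINT x|M. (norm (f x))\<^sup>2))"
      by (rule real_sqrt_le_mono)
    then show "sqrt (LINT x|M. (norm (cext K f x))\<^sup>2) \<le> C * sqrt (LINT x|M. (norm (f x))\<^sup>2)"
      using C(1) by (simp add: real_sqrt_mult)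
  qed
qed

lemma L2_operator_cext:
  assumes K: "L2_operator M K"
  shows "L2_operator M (cext K)"
  unfolding L2_operator_def
proof (intro conjI ballI allI impI)
  show "\<exists>C\<ge>0. \<forall>f\<in>L2 M. sqrt (LINT x|M. (norm (cext K f x))\<^sup>2) \<le> C * sqrt (LINT x|M. (norm (f x))\<^sup>2)"
    by (rule cext_bounded[OF K])
qed (rule cext_L2[OF K] cext_cong_AE[OF K] cext_linear[OF K]; assumption)+

lemma L2_operator_comp:
  fixes A B :: "('a \<Rightarrow> 'b::{real_normed_field, second_countable_topology, banach}) \<Rightarrow> 'a \<Rightarrow> 'b"
  assumes A: "L2_operator M A" and B: "L2_operator M B"
  shows "L2_operator M (\<lambda>f. A (B f))"
proof -
  obtain C where C: "0 \<le> C" "\<And>f. f \<in> L2 M \<Longrightarrow> sqrt (LINT x|M. (norm (A f x))\<^sup>2) \<le> C * sqrt (LINT x|M. (norm (f x))\<^sup>2)"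
    using A unfolding L2_operator_def by blast
  obtain D where D: "0 \<le> D" "\<And>f. f \<in> L2 M \<Longrightarrow> sqrt (LINT x|M. (norm (B f x))\<^sup>2) \<le> D * sqrt (LINT x|M. (norm (f x))\<^sup>2)"
    using B unfolding L2_operator_def by blast
  note a = L2_operatorD[OF A] and b = L2_operatorD[OF B]
  show ?thesis
    unfolding L2_operator_def
  proof (intro conjI ballI allI impI)
    show "A (B f) \<in> L2 M" if "f \<in> L2 M" for f by (intro a(1) b(1) that)
    show "AE x in M. A (B f) x = A (B g) x" if "f \<in> L2 M" "g \<in> L2 M" "AE x in M. f x = g x" for f g
      by (intro a(2) b(1) b(2) that)
    show "AE x in M. A (B (\<lambda>y. f y + g y)) x = A (B f) x + A (B g) x" if f: "f \<in> L2 M" and g: "g \<in> L2 M" for f g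
    proof -
      have "AE x in M. A (B (\<lambda>y. f y + g y)) x = A (\<lambda>y. B f y + B g y) x"
        by (intro a(2) b(1) b(3) L2_add f g)
      moreover have "AE x in M. A (\<lambda>y. B f y + B g y) x = A (B f) x + A (B g) x" by (intro a(3) b(1) f g)
      ultimately show ?thesis by eventually_elim simp
    qed
    show "AE x in M. A (B (\<lambda>y. c * f y)) x = c * A (B f) x" if f: "f \<in> L2 M" for c f
    proof -
      have "AE x in M. A (B (\<lambda>y. c * f y)) x = A (\<lambda>y. c * B f y) x"
        by (intro a(2) b(1) b(4) L2_scale f)
      moreover have "AE x in M. A (\<lambda>y. c * B f y) x = c * A (B f) x" by (intro a(4) b(1) f)
      ultimately show ?thesis by eventually_elim simp
    qed
    show "\<exists>C\<ge>0. \<forall>f\<in>L2 M. sqrt (LINT x|M. (norm (A (B f) x))\<^sup>2) \<le> C * sqrt (LINT x|M. (norm (f x))\<^sup>2)"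
    proof (intro exI[of _ "C * D"] conjI ballI)
      fix f :: "'a \<Rightarrow> 'b" assume f: "f \<in> L2 M"
      have "sqrt (LINT x|M. (norm (A (B f) x))\<^sup>2) \<le> C * sqrt (LINT x|M. (norm (B f x))\<^sup>2)" by (rule C(2)[OF b(1)[OF f]])
      also have "\<dots> \<le> C * (D * sqrt (LINT x|M. (norm (f x))\<^sup>2))" by (rule mult_left_mono[OF D(2)[OF f] C(1)])
      finally show "sqrt (LINT x|M. (norm (A (B f) x))\<^sup>2) \<le> C * D * sqrt (LINT x|M. (norm (f x))\<^sup>2)" by simp
    qed (use C(1) D(1) in simp)
  qed
qed

text \<open>The bilinear transposition becomes a sesquilinear identity because a real operator
  commutes with conjugation almost everywhere.\<close>

lemma cext_adjoint_cnj:
  assumes K: "L2_operator M K" and K': "L2_adjoint M K K'" and f: "f \<in> L2 M" and g: "g \<in> L2 M"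
  shows "(LINT x|M. cext K' (cext K f) x * cnj (g x)) = (LINT x|M. cext K f x * cnj (cext K g x))"
proof -
  have K'L: "L2_operator M K'" using K' by (simp add: L2_adjoint_def)
  have "(LINT x|M. cext K' (cext K f) x * cnj (g x)) = (LINT x|M. cext K (\<lambda>y. cnj (g y)) x * cext K f x)"
    unfolding cext_adjoint[OF K K' L2_cnj[OF g] cext_L2[OF K f]] by (simp only: mult.commute)
  also have "\<dots> = (LINT x|M. cnj (cext K g x) * cext K f x)"
  proof (rule integral_cong_AE)
    show "AE x in M. cext K (\<lambda>y. cnj (g y)) x * cext K f x = cnj (cext K g x) * cext K f x"
      using cext_cnj[OF K g] by eventually_elim simp
  qed (intro borel_measurable_integrable L2_integrable_mult cext_L2[OF K] L2_cnj f g)+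
  finally show ?thesis by (simp only: mult.commute)
qed

text \<open>Symmetry and positivity are both read off from the scalar product of
  \<open>cext K f\<close> with \<open>cext K g\<close>.\<close>

lemma L2_selfadjoint_positive_adjoint_comp:
  assumes K: "L2_operator M K" and K': "L2_adjoint M K K'"
  shows "L2_selfadjoint_positive M (\<lambda>h. cext K' (cext K h))"
  unfolding L2_selfadjoint_positive_def
proof (intro conjI ballI)
  have K'L: "L2_operator M K'" using K' by (simp add: L2_adjoint_def)
  show "L2_operator M (\<lambda>h. cext K' (cext K h))"
    by (rule L2_operator_comp[OF L2_operator_cext[OF K'L] L2_operator_cext[OF K]])
  show "(LINT x|M. cext K' (cext K f) x * cnj (g x)) = (LINT x|M. f x * cnj (cext K' (cext K g) x))"
    if f: "f \<in> L2 M" and g: "g \<in> L2 M" for f g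
  proof -
    have "(LINT x|M. f x * cnj (cext K' (cext K g) x)) = cnj (LINT x|M. cext K' (cext K g) x * cnj (f x))"
      by (subst Bochner_Integration.integral_cnj[symmetric]) (simp add: mult.commute)
    also have "\<dots> = (LINT x|M. cnj (cext K g x * cnj (cext K f x)))"
      unfolding cext_adjoint_cnj[OF K K' g f] by (rule Bochner_Integration.integral_cnj[symmetric])
    also have "\<dots> = (LINT x|M. cext K f x * cnj (cext K g x))"
      by (simp add: mult.commute)
    finally show ?thesis by (simp only: cext_adjoint_cnj[OF K K' f g])
  qed
  show "(LINT x|M. cext K' (cext K f) x * cnj (f x)) \<in> \<real>\<^sub>\<ge>\<^sub>0" if f: "f \<in> L2 M" for f
  proof -
    have "(LINT x|M. cext K' (cext K f) x * cnj (f x)) = (LINT x|M. complex_of_real ((norm (cext K f x))\<^sup>2))"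
      unfolding cext_adjoint_cnj[OF K K' f f] by (simp only: complex_norm_square)
    also have "\<dots> = complex_of_real (LINT x|M. (norm (cext K f x))\<^sup>2)" by (rule integral_complex_of_real)
    finally show ?thesis by (simp only: nonneg_Reals_of_real_iff) simp
  qed
qed

section \<open>The two-point function and the dependence on \<open>T\<close>\<close>

context admissible_rep
begin

lemma two_point_formula:
  assumes g: "g \<in> L2 lborel" and h: "h \<in> L2 lborel" and v: "v \<in> Linf (nu [Plus, Minus])"
  shows "npoint (vacuum_state Z_measure) (rep_integral Q K1 K2) 1 1 [g, h] v =
    (LINT x|lborel. g x * T h x * v (pair_point (fst x) (fst x)))"
proof -
  let ?lb = "lborel :: real measure"
  interpret P: product_sigma_finite "\<lambda>_. ?lb"
    by (rule product_sigma_finite_const[OF lborel.sigma_finite_measure_axioms])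
  have l1: "{..<1::nat} = {0}" by auto
  have list: "replicate 1 Plus @ replicate 1 Minus = [Plus, Minus]" by simp
  have v': "v \<in> Linf (nu2 1)" using v by simp
  have vm: "v \<in> borel_measurable (power_measure ?lb 2)"
    using Linf_measurable[OF v] by (simp add: numeral_2_eq_2)
  have pp: "pair_point s s = (\<lambda>i\<in>{..<2}. s)" for s :: real
    by (auto simp: pair_point_def restrict_def fun_eq_iff)
  have ppm: "(\<lambda>s::real. pair_point s s) \<in> borel \<rightarrow>\<^sub>M power_measure ?lb 2"
    unfolding pp by (rule measurable_restrict) simp
  have lay: "layout 1 id s = pair_point (s 0) (s 0)" for s :: "nat \<Rightarrow> real"
    by (auto simp: layout_def pair_point_def restrict_def fun_eq_iff)
  have p: "{\<pi>. \<pi> permutes {..<1::nat}} = {id}" by (auto simp: lessThan_Suc)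
  have ph: "perm_phase Q 1 id w = 1" for w unfolding perm_phase_def by (rule prod.neutral) auto
  have vpm: "(\<lambda>s. v (pair_point s s)) \<in> borel_measurable borel" by (rule measurable_compose[OF ppm vm])
  have fdm: "fd g h \<in> borel_measurable lborel"
    by (rule borel_measurable_integrable[OF fibre_density_integrable[where T = T, OF g T_L2[OF h]]])
  have len: "length [g] = 1" "length [h] = 1" and L: "set [g] \<subseteq> L2 lborel" "set [h] \<subseteq> L2 lborel" using g h by auto
  have "npoint (vacuum_state Z_measure) (rep_integral Q K1 K2) 1 1 (rev [g] @ [h]) v =
    (LINT s|power_measure ?lb 1. (\<Prod>i<1. fd ([g] ! i) ([h] ! id i) (s i)) * (v (layout 1 id s) * perm_phase Q 1 id s))"
    unfolding npoint_formula[OF len L v'] p by (subst sum.insert) simp_all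
  also have "\<dots> = (LINT s|power_measure ?lb 1. fd g h (s 0) * v (pair_point (s 0) (s 0)))"
    by (simp only: lay ph) simp
  also have "\<dots> = (LINT s|PiM {0::nat} (\<lambda>_. ?lb). fd g h (s 0) * v (pair_point (s 0) (s 0)))"
    by (simp add: lessThan_Suc)
  also have "\<dots> = (LINT s|?lb. fd g h s * v (pair_point s s))"
    by (rule P.product_integral_singleton) (use fdm vpm in simp)
  also have "\<dots> = (LINT x|lborel. g x * T h x * v (pair_point (fst x) (fst x)))"
  proof (rule integral_fibre_density[symmetric])
    \<comment> \<open>The bound of \<open>v\<close> for \<open>nu [Plus, Minus]\<close> covers
      almost every point of the diagonal. This gives the integrability needed to undo the fibre
      integration.\<close>
    obtain C where C: "AE u in nu [Plus, Minus]. norm (v u) \<le> C" using v by (auto simp: Linf_def)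
    have "AE x in power_measure ?lb 1. norm (v (layout 1 id (\<lambda>i\<in>{..<1}. x i))) \<le> C"
      by (rule AE_layout[OF lborel.sigma_finite_measure_axioms lborel.sigma_finite_measure_axioms
        absolutely_continuous_id measurable_ident_sets[OF refl] permutes_id]) (use C in \<open>simp only: list\<close>)
    then have "AE x in PiM {0::nat} (\<lambda>_. ?lb). norm (v (pair_point (x 0) (x 0))) \<le> C"
      unfolding lay l1 by simp
    then have "AE s in distr (PiM {0::nat} (\<lambda>_. ?lb)) ?lb (\<lambda>x. x 0). norm (v (pair_point s s)) \<le> C"
      by (subst AE_distr_iff) (use vpm in auto)
    then have "AE s in ?lb. norm (v (pair_point s s)) \<le> C" by (simp only: P.distr_singleton)
    then have "AE x in ?lb \<Otimes>\<^sub>M (lborel :: (real ^ 'n) measure). norm (v (pair_point (fst x) (fst x))) \<le> C"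
    proof (intro lborel_pair.AE_pair_measure)
      have "(\<lambda>x. v (pair_point (fst x) (fst x))) \<in> borel_measurable (?lb \<Otimes>\<^sub>M (lborel :: (real ^ 'n) measure))"
        by (rule measurable_compose[OF measurable_fst]) (use vpm in simp)
      then show "{x \<in> space (?lb \<Otimes>\<^sub>M (lborel :: (real ^ 'n) measure)). norm (v (pair_point (fst x) (fst x))) \<le> C} \<in> sets (?lb \<Otimes>\<^sub>M lborel)"
        by (intro borel_measurable_le measurable_compose[OF _ borel_measurable_norm] borel_measurable_const)
    qed (auto)
    then have ae: "AE x in (lborel :: 'n space measure). norm (v (pair_point (fst x) (fst x))) \<le> C"
      by (simp only: lborel_prod)
    have m: "(\<lambda>x. v (pair_point (fst x) (fst x))) \<in> borel_measurable (lborel :: 'n space measure)"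
      by (rule measurable_compose[OF fst_lborel vpm])
    have i: "integrable lborel (\<lambda>x. g x * T h x)" by (rule L2_integrable_mult[OF g T_L2[OF h]])
    show "integrable lborel (\<lambda>x. g x * T h x * v (pair_point (fst x) (fst x)))"
    proof (rule integrable_Linf_mult[OF i, where v = "\<lambda>x. v (pair_point (fst x) (fst x))"])
      show "(\<lambda>x. v (pair_point (fst x) (fst x))) \<in> Linf (lborel :: 'n space measure)"
        using m ae by (auto simp: Linf_def)
      show "(\<lambda>x. g x * T h x * v (pair_point (fst x) (fst x))) \<in> borel_measurable lborel"
        by (rule borel_measurable_times[OF borel_measurable_integrable[OF i] m])
    qed (simp add: norm_mult mult_ac)
  qed
  finally show ?thesis by simp
qed

end

text \<open>In \<open>npoint_formula\<close> the operators enter only through the fibre densities.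
  These agree almost everywhere when the two versions of \<open>T\<close> do, and each factor has
  its own variable, so the products agree almost everywhere as well.\<close>

lemma npoint_determined_by_T:
  fixes K1 K3 :: "('n::finite space \<Rightarrow> real) \<Rightarrow> 'n space \<Rightarrow> real"
  assumes "admissible_rep Q \<eta> K1 K1' K2 K2'" "admissible_rep Q \<eta> K3 K3' K4 K4'"
    and T: "\<And>h. h \<in> L2 lborel \<Longrightarrow> AE x in lborel. cext K3' (cext K3 h) x = cext K1' (cext K1 h) x"
    and hs: "length hs = k + n" "set hs \<subseteq> L2 lborel" "v \<in> Linf (nu (replicate k Plus @ replicate n Minus))"
  shows "npoint (vacuum_state Z_measure) (rep_integral Q K3 K4) k n hs v =
    npoint (vacuum_state Z_measure) (rep_integral Q K1 K2) k n hs v"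
proof -
  interpret A: admissible_rep Q \<eta> K1 K1' K2 K2' by (rule assms(1))
  interpret B: admissible_rep Q \<eta> K3 K3' K4 K4' by (rule assms(2))
  show ?thesis
  proof (cases "k = n")
    case False
    then show ?thesis using A.npoint_unbalanced[OF False hs] B.npoint_unbalanced[OF False hs] by simp
  next
    case True
    define gs where "gs = rev (take n hs)"
    define fs where "fs = drop n hs"
    have eq: "rev gs @ fs = hs" by (simp add: gs_def fs_def)
    have len: "length gs = n" "length fs = n" using hs True by (auto simp: gs_def fs_def)
    have L: "set gs \<subseteq> L2 lborel" "set fs \<subseteq> L2 lborel"
      using hs(2) set_take_subset[of n hs] set_drop_subset[of n hs] by (auto simp: gs_def fs_def)
    have v: "v \<in> Linf (nu2 n)" using hs(3) True by simp
    have vm: "v \<in> borel_measurable (power_measure lborel (2 * n))"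
      using Linf_measurable[OF v] by (simp add: mult_2)
    \<comment> \<open>By Fubini almost every fibre meets the set where the two versions of
      \<open>T h\<close> differ in a null set.\<close>
    have fd: "AE s in lborel. B.fd g h s = A.fd g h s" if g: "g \<in> L2 lborel" and h: "h \<in> L2 lborel" for g h
    proof -
      have "AE x in (lborel :: real measure) \<Otimes>\<^sub>M (lborel :: (real ^ 'n) measure). B.T h x = A.T h x"
        unfolding lborel_prod B.T_def A.T_def by (rule T[OF h])
      from lborel_pair.AE_pair[OF this]
      have "AE s in (lborel :: real measure). AE y in (lborel :: (real ^ 'n) measure). B.T h (s, y) = A.T h (s, y)" .
      moreover have m: "(\<lambda>x. g x * U x) \<in> borel_measurable (lborel \<Otimes>\<^sub>M lborel)" if "U \<in> L2 lborel" for U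
        unfolding lborel_prod by (rule borel_measurable_integrable[OF L2_integrable_mult[OF g that]])
      ultimately show ?thesis
      proof (elim eventually_mono)
        fix s assume ae: "AE y in (lborel :: (real ^ 'n) measure). B.T h (s, y) = A.T h (s, y)"
        show "B.fd g h s = A.fd g h s"
          unfolding fibre_density_def
        proof (rule integral_cong_AE)
          show "(\<lambda>y. g (s, y) * B.T h (s, y)) \<in> borel_measurable lborel"
            by (rule measurable_compose[OF measurable_Pair1' m[OF B.T_L2[OF h]]]) simp
          show "(\<lambda>y. g (s, y) * A.T h (s, y)) \<in> borel_measurable lborel"
            by (rule measurable_compose[OF measurable_Pair1' m[OF A.T_L2[OF h]]]) simp
          show "AE y in lborel. g (s, y) * B.T h (s, y) = g (s, y) * A.T h (s, y)"
            using ae by eventually_elim simp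
        qed
      qed
    qed
    have gL: "gs ! i \<in> L2 lborel" if "i < n" for i using L(1) that len by (auto simp: subset_iff)
    have fL: "fs ! i \<in> L2 lborel" if "i < n" for i using L(2) that len by (auto simp: subset_iff)
    have "npoint (vacuum_state Z_measure) (rep_integral Q K3 K4) n n (rev gs @ fs) v =
      npoint (vacuum_state Z_measure) (rep_integral Q K1 K2) n n (rev gs @ fs) v"
      unfolding A.npoint_formula[OF len L v] B.npoint_formula[OF len L v]
    proof (rule sum.cong[OF refl], rule integral_cong_AE)
      fix \<pi> assume "\<pi> \<in> {\<pi>. \<pi> permutes {..<n}}"
      then have \<pi>: "\<pi> permutes {..<n}" by simp
      note vp = measurable_compose[OF measurable_layout[OF \<pi>] vm]
      have comp1: "(\<lambda>s. s i) \<in> power_measure (lborel :: real measure) n \<rightarrow>\<^sub>M lborel" if "i < n" for i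
        by (rule measurable_component_singleton) (use that in auto)
      have meas: "(\<lambda>s. (\<Prod>i<n. F i (s i)) * (v (layout n \<pi> s) * perm_phase Q n \<pi> s)) \<in> borel_measurable (power_measure lborel n)"
        if "\<And>i. i < n \<Longrightarrow> F i \<in> borel_measurable lborel" for F :: "nat \<Rightarrow> real \<Rightarrow> complex"
        by (intro borel_measurable_times borel_measurable_prod A.perm_phase_Q_measurable vp
          measurable_compose[OF comp1 that]) auto
      show "(\<lambda>s. (\<Prod>i<n. B.fd (gs ! i) (fs ! \<pi> i) (s i)) * (v (layout n \<pi> s) * perm_phase Q n \<pi> s)) \<in> borel_measurable (power_measure lborel n)"
        by (rule meas, rule borel_measurable_integrable, rule fibre_density_integrable, erule gL,
          rule B.T_L2, rule fL, erule perm_less(1)[OF \<pi>])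
      show "(\<lambda>s. (\<Prod>i<n. A.fd (gs ! i) (fs ! \<pi> i) (s i)) * (v (layout n \<pi> s) * perm_phase Q n \<pi> s)) \<in> borel_measurable (power_measure lborel n)"
        by (rule meas, rule borel_measurable_integrable, rule fibre_density_integrable, erule gL,
          rule A.T_L2, rule fL, erule perm_less(1)[OF \<pi>])
      have "AE s in power_measure lborel n. \<forall>i\<in>{..<n}. B.fd (gs ! i) (fs ! \<pi> i) (s i) = A.fd (gs ! i) (fs ! \<pi> i) (s i)"
      proof (intro AE_finite_allI finite_lessThan)
        fix i assume i: "i \<in> {..<n}"
        show "AE s in power_measure lborel n. B.fd (gs ! i) (fs ! \<pi> i) (s i) = A.fd (gs ! i) (fs ! \<pi> i) (s i)"
          by (rule AE_PiM_coordinate[OF lborel.sigma_finite_measure_axioms finite_lessThan i], rule fd, rule gL)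
            (use i in simp, rule fL, rule perm_less(1)[OF \<pi>], use i in simp)
      qed
      then show "AE s in power_measure lborel n. (\<Prod>i<n. B.fd (gs ! i) (fs ! \<pi> i) (s i)) * (v (layout n \<pi> s) * perm_phase Q n \<pi> s) =
        (\<Prod>i<n. A.fd (gs ! i) (fs ! \<pi> i) (s i)) * (v (layout n \<pi> s) * perm_phase Q n \<pi> s)"
      proof eventually_elim
        case (elim s)
        have "(\<Prod>i<n. B.fd (gs ! i) (fs ! \<pi> i) (s i)) = (\<Prod>i<n. A.fd (gs ! i) (fs ! \<pi> i) (s i))"
          by (rule prod.cong[OF refl]) (use elim in blast)
        then show ?case by (simp only:)
      qed
    qed
    then show ?thesis by (simp only: eq True)
  qed
qed

theorem theorem22:
  fixes Q :: "real \<Rightarrow> real \<Rightarrow> complex"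
    and \<eta> :: real
    and K1 K1' K2 K2' :: "('n::finite space \<Rightarrow> real) \<Rightarrow> 'n space \<Rightarrow> real"
  assumes "(\<lambda>(s, t). Q s t) \<in> borel_measurable borel"
    and "\<And>s t. s \<noteq> t \<Longrightarrow> norm (Q s t) = 1"
    and "\<And>s t. s \<noteq> t \<Longrightarrow> Q s t = cnj (Q t s)"
    and "\<And>s. Q s s = complex_of_real \<eta>"
    and "admissible_operators \<eta> K1 K1' K2 K2'"
  shows
    "(\<forall>a\<in>rep_algebra Q K1 K2. fock_operator Z_measure (JQ Q) a) \<and>
     state_on Z_measure (JQ Q) (rep_algebra Q K1 K2) (vacuum_state Z_measure) \<and>
     gauge_invariant_quasi_free Q lborel (vacuum_state Z_measure) (rep_integral Q K1 K2) \<and>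
     L2_selfadjoint_positive lborel (\<lambda>h. cext K1' (cext K1 h)) \<and>
     (\<forall>K3 K3' K4 K4'. admissible_operators \<eta> K3 K3' K4 K4' \<longrightarrow>
       (\<forall>h\<in>L2 lborel. AE x in lborel. cext K3' (cext K3 h) x = cext K1' (cext K1 h) x) \<longrightarrow>
       (\<forall>k n hs v. length hs = k + n \<longrightarrow> set hs \<subseteq> L2 lborel \<longrightarrow>
         v \<in> Linf (nu (replicate k Plus @ replicate n Minus)) \<longrightarrow>
         npoint (vacuum_state Z_measure) (rep_integral Q K3 K4) k n hs v =
         npoint (vacuum_state Z_measure) (rep_integral Q K1 K2) k n hs v)) \<and>
     (\<forall>g\<in>L2 lborel. \<forall>h\<in>L2 lborel. \<forall>v\<in>Linf (nu [Plus, Minus]).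
       npoint (vacuum_state Z_measure) (rep_integral Q K1 K2) 1 1 [g, h] v =
       (LINT x|lborel. g x * cext K1' (cext K1 h) x * v (pair_point (fst x) (fst x)))) \<and>
     (\<forall>g\<in>L2 lborel. \<forall>h\<in>L2 lborel. \<forall>\<rho>.
       npoint_density (vacuum_state Z_measure) (rep_integral Q K1 K2) 1 [g, h] \<rho> \<longrightarrow>
       (AE s in nu [Plus, Minus].
         \<rho> s = (if s 0 = s 1 then 1 else 0) *
           (LINT y|lborel. g (s 0, y) * cext K1' (cext K1 h) (s 0, y))))"
proof -
  have qcr: "qcr Q \<eta>" by (rule qcr.intro[OF assms(1-4)])
  have rep: "admissible_rep Q \<eta> A A' B B'" if "admissible_operators \<eta> A A' B B'"
    for A A' B B' :: "('n space \<Rightarrow> real) \<Rightarrow> 'n space \<Rightarrow> real"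
    by (rule admissible_rep.intro[OF qcr admissible_rep_axioms.intro[OF that]])
  interpret admissible_rep Q \<eta> K1 K1' K2 K2' by (rule rep[OF assms(5)])
  show ?thesis
  proof (intro conjI)
    show "\<forall>a\<in>rep_algebra Q K1 K2. fock_operator Z_measure (JQ Q) a"
      by (rule ballI) (rule rep_algebra_fock_operator)
    show "state_on Z_measure (JQ Q) (rep_algebra Q K1 K2) (vacuum_state Z_measure)" by (rule rep_state)
    show "gauge_invariant_quasi_free Q lborel (vacuum_state Z_measure) (rep_integral Q K1 K2)"
      by (rule gauge_invariant_quasi_free_vacuum)
    show "L2_selfadjoint_positive lborel (\<lambda>h. cext K1' (cext K1 h))"
      by (rule L2_selfadjoint_positive_adjoint_comp[OF K1 K1'(1)])
    show "\<forall>K3 K3' K4 K4'. admissible_operators \<eta> K3 K3' K4 K4' \<longrightarrow>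
       (\<forall>h\<in>L2 lborel. AE x in lborel. cext K3' (cext K3 h) x = cext K1' (cext K1 h) x) \<longrightarrow>
       (\<forall>k n hs v. length hs = k + n \<longrightarrow> set hs \<subseteq> L2 lborel \<longrightarrow>
         v \<in> Linf (nu (replicate k Plus @ replicate n Minus)) \<longrightarrow>
         npoint (vacuum_state Z_measure) (rep_integral Q K3 K4) k n hs v =
         npoint (vacuum_state Z_measure) (rep_integral Q K1 K2) k n hs v)"
    proof (intro allI impI)
      fix K3 K3' K4 K4' :: "('n space \<Rightarrow> real) \<Rightarrow> 'n space \<Rightarrow> real" and k n v
        and hs :: "('n space \<Rightarrow> complex) list"
      assume adm': "admissible_operators \<eta> K3 K3' K4 K4'"
        and T': "\<forall>h\<in>L2 lborel. AE x in lborel. cext K3' (cext K3 h) x = cext K1' (cext K1 h) x"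
        and hs: "length hs = k + n" "set hs \<subseteq> L2 lborel" "v \<in> Linf (nu (replicate k Plus @ replicate n Minus))"
      show "npoint (vacuum_state Z_measure) (rep_integral Q K3 K4) k n hs v =
         npoint (vacuum_state Z_measure) (rep_integral Q K1 K2) k n hs v"
        by (rule npoint_determined_by_T[OF rep[OF assms(5)] rep[OF adm'] bspec[OF T'] hs])
    qed
    show "\<forall>g\<in>L2 lborel. \<forall>h\<in>L2 lborel. \<forall>v\<in>Linf (nu [Plus, Minus]).
       npoint (vacuum_state Z_measure) (rep_integral Q K1 K2) 1 1 [g, h] v =
       (LINT x|lborel. g x * cext K1' (cext K1 h) x * v (pair_point (fst x) (fst x)))"
      by (intro ballI) (rule two_point_formula[unfolded T_def])
    show "\<forall>g\<in>L2 lborel. \<forall>h\<in>L2 lborel. \<forall>\<rho>.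
       npoint_density (vacuum_state Z_measure) (rep_integral Q K1 K2) 1 [g, h] \<rho> \<longrightarrow>
       (AE s in nu [Plus, Minus].
         \<rho> s = (if s 0 = s 1 then 1 else 0) *
           (LINT y|lborel. g (s 0, y) * cext K1' (cext K1 h) (s 0, y)))"
    proof (intro ballI allI impI)
      fix g h \<rho> assume "g \<in> L2 lborel" "h \<in> L2 lborel"
        "npoint_density (vacuum_state Z_measure) (rep_integral Q K1 K2) 1 [g, h] \<rho>"
      from two_point_density[OF this]
      show "AE s in nu [Plus, Minus]. \<rho> s = (if s 0 = s 1 then 1 else 0) *
           (LINT y|lborel. g (s 0, y) * cext K1' (cext K1 h) (s 0, y))"
        unfolding fibre_density_def T_def .
    qed
  qed
qed

end
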